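(* Let $\mathbf{G}$ be an irreducible solvable $\mathbb{Q}$-defined linear algebraic group with associated $\mathbb{Q}$-defined Lie algebra $\mathfrak{g}_{\mathbb{Q}}$, written $\mathbf{G}=\mathbf{U}\rtimes\mathbf{T}$ with $\mathbf{U}$ its unipotent radical and $\mathbf{T}$ its $\mathbb{Q}$-split maximal torus. Let $\Gamma\leq\mathbf{G}(\mathbb{Q})$ be a Zariski dense subgroup such that $\Gamma\cap\mathbf{T}(\mathbb{Q})$ is discrete in $\mathbf{T}(\mathbb{R})$ for the Euclidean (Lie group) topology. Then for every finite dimensional rational $\mathbf{G}$-module $M$ and every finite index subgroup $\Delta\leq\Gamma$, $H^*(\Delta,M)$ is isomorphic to $H^*(\Gamma,M)$ as cohomology rings.
   Context: Irreducible means connected in the Zariski topology. Convention: an irreducible solvable $\mathbb{Q}$-defined linear algebraic group $\mathbf{G}$ is written as $\mathbf{G}=\mathbf{U}\rtimes\mathbf{T}$, where $\mathbf{U}$ is the $\mathbb{Q}$-defined unipotent radical and $\mathbf{T}$ is a fixed $\mathbb{Q}$-split maximal torus ($\mathbf{T}\cong\mathbf{G}_m^{r}$ over $\mathbb{Q}$). A finite dimensional rational $\mathbf{G}$-module is a finite dimensional $\mathbb{Q}$-vector space $M$ with a homomorphism $\mathbf{G}\to\mathrm{GL}(M)$ of algebraic groups over $\mathbb{Q}$; subgroups of $\mathbf{G}(\mathbb{Q})$ act on $M$ by restriction. $H^*(\Gamma,M)$ is ordinary group cohomology. Isomorphic as cohomology rings: there are graded $\mathbb{Q}$-linear isomorphisms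 $\Psi_M$ (coefficients in $M$) and $\Psi_{\mathbb{Q}}$ (trivial coefficients $\mathbb{Q}$, a graded ring isomorphism) compatible with the cup products $H^i(-,M)\otimes H^j(-,\mathbb{Q})\to H^{i+j}(-,M)$, that is, $\Psi_M(x\cup a)=\Psi_M(x)\cup\Psi_{\mathbb{Q}}(a)$. *)

theory Defs
  imports "HOL-Analysis.Analysis" "HOL-Algebra.Algebra"
begin

section \<open>Linear algebraic groups over the rationals\<close>

text \<open>
  A linear algebraic group is identified with its group of complex points, a Zariski closed
  subgroup of \<open>GL\<^sub>n(\<complex>)\<close>, where \<open>n\<close> is the cardinality of the index type.  The field of
  definition is tracked by restricting the coefficients of the polynomials involved.
\<close>

text \<open>
  The \<open>K\<close>-algebra of functions generated by a set of functions \<open>F\<close>, for \<open>K\<close> a subfield of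
  \<open>\<complex>\<close>.
\<close>

inductive_set alg_gen :: "complex set \<Rightarrow> ('x \<Rightarrow> complex) set \<Rightarrow> ('x \<Rightarrow> complex) set"
  for K :: "complex set" and F :: "('x \<Rightarrow> complex) set" where
  const: "c \<in> K \<Longrightarrow> (\<lambda>_. c) \<in> alg_gen K F"
| gen: "f \<in> F \<Longrightarrow> f \<in> alg_gen K F"
| add: "f \<in> alg_gen K F \<Longrightarrow> g \<in> alg_gen K F \<Longrightarrow> (\<lambda>x. f x + g x) \<in> alg_gen K F"
| mult: "f \<in> alg_gen K F \<Longrightarrow> g \<in> alg_gen K F \<Longrightarrow> (\<lambda>x. f x * g x) \<in> alg_gen K F"

definition entries :: "(complex^'n^'n \<Rightarrow> complex) set" where
  "entries = {\<lambda>A. A $ i $ j | i j. True}"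

definition poly_fun :: "complex set \<Rightarrow> (complex^'n^'n \<Rightarrow> complex) set" where
  "poly_fun K = alg_gen K entries"

text \<open>The coordinate ring of \<open>GL\<^sub>n\<close> over \<open>K\<close>.\<close>

definition regular_GL :: "complex set \<Rightarrow> (complex^'n^'n \<Rightarrow> complex) set" where
  "regular_GL K = alg_gen K (insert (\<lambda>A. inverse (det A)) entries)"

definition GL :: "(complex^'n^'n) monoid" where
  "GL = \<lparr>carrier = {A. invertible A}, monoid.mult = (**), one = mat 1\<rparr>"

abbreviation GL_sub :: "(complex^'n^'n) set \<Rightarrow> (complex^'n^'n) monoid" where
  "GL_sub S \<equiv> GL\<lparr>carrier := S\<rparr>"

lemma group_GL: "group (GL :: (complex^'n^'n) monoid)"
proof (rule groupI)
  fix x y :: "complex^'n^'n"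
  show "\<one>\<^bsub>GL\<^esub> \<in> carrier (GL :: (complex^'n^'n) monoid)"
    unfolding GL_def invertible_def by (simp add: exI[where x = "mat 1"])
  assume x: "x \<in> carrier GL"
  then show "\<exists>y\<in>carrier GL. y \<otimes>\<^bsub>GL\<^esub> x = \<one>\<^bsub>GL\<^esub>"
    unfolding GL_def invertible_def by auto
  assume "y \<in> carrier GL"
  then show "x \<otimes>\<^bsub>GL\<^esub> y \<in> carrier GL"
    using x by (simp add: GL_def invertible_mult)
qed (simp_all add: GL_def matrix_mul_assoc)

text \<open>
  Zero sets in \<open>GL\<^sub>n(\<complex>)\<close> of polynomials with coefficients in \<open>K\<close>.  In characteristic 0 this
  is the same as the vanishing ideal being generated by polynomials over \<open>K\<close>.
\<close>

definition defined_over :: "complex set \<Rightarrow> (complex^'n^'n) set \<Rightarrow> bool" where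
  "defined_over K S \<longleftrightarrow> (\<exists>P \<subseteq> poly_fun K. S = {A. invertible A \<and> (\<forall>p\<in>P. p A = 0)})"

definition algebraic_group :: "complex set \<Rightarrow> (complex^'n^'n) set \<Rightarrow> bool" where
  "algebraic_group K G \<longleftrightarrow> subgroup G GL \<and> defined_over K G"

definition rational_points :: "(complex^'n^'n) set \<Rightarrow> (complex^'n^'n) set" where
  "rational_points G = {A \<in> G. \<forall>i j. A $ i $ j \<in> \<rat>}"

definition zariski :: "(complex^'n^'n) topology" where
  "zariski = topology_generated_by {{A. invertible A \<and> p A \<noteq> 0} | p. p \<in> poly_fun UNIV}"

lemma closedin_zariski_iff: "closedin zariski (S :: (complex^'n^'n) set) \<longleftrightarrow> defined_over UNIV S"
proof -
  let ?B = "{{A :: complex^'n^'n. invertible A \<and> p A \<noteq> 0} | p. p \<in> poly_fun UNIV}"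
  have one: "(\<lambda>_. 1) \<in> poly_fun UNIV" unfolding poly_fun_def by (rule alg_gen.const) simp
  have ts: "topspace zariski = {A :: complex^'n^'n. invertible A}"
  proof (unfold zariski_def topology_generated_by_topspace, intro equalityI Union_least subsetI)
    fix V and A :: "complex^'n^'n" assume "V \<in> ?B" "A \<in> V"
    then show "A \<in> {A. invertible A}" by blast
  next
    fix A :: "complex^'n^'n" assume "A \<in> {A. invertible A}"
    then have "A \<in> {A. invertible A \<and> (\<lambda>_. 1::complex) A \<noteq> 0}" by simp
    moreover have "{A :: complex^'n^'n. invertible A \<and> (\<lambda>_. 1::complex) A \<noteq> 0} \<in> ?B"
      by (intro CollectI exI[of _ "\<lambda>_. 1"] conjI refl one)
    ultimately show "A \<in> \<Union>?B" by (rule UnionI[rotated])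
  qed
  have gen: "generate_topology_on ?B U \<Longrightarrow> \<exists>P\<subseteq>poly_fun UNIV. U = {A. invertible A \<and> (\<exists>p\<in>P. p A \<noteq> 0)}" for U
  proof (induction rule: generate_topology_on.induct)
    case Empty then show ?case by (intro exI[of _ "{}"]) auto
  next
    case (Int a b)
    from Int.IH(1) obtain P where P: "P\<subseteq>poly_fun UNIV" "a = {A. invertible A \<and> (\<exists>p\<in>P. p A \<noteq> 0)}"
      by (elim exE conjE)
    from Int.IH(2) obtain Q where Q: "Q\<subseteq>poly_fun UNIV" "b = {A. invertible A \<and> (\<exists>p\<in>Q. p A \<noteq> 0)}"
      by (elim exE conjE)
    have "(\<lambda>A. p A * q A) \<in> poly_fun UNIV" if "p \<in> P" "q \<in> Q" for p q
      unfolding poly_fun_def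
      by (rule alg_gen.mult) (use that P(1) Q(1) in \<open>auto simp: poly_fun_def\<close>)
    then have sub: "{\<lambda>A. p A * q A | p q. p \<in> P \<and> q \<in> Q} \<subseteq> poly_fun UNIV" by blast
    have eq: "A \<in> a \<inter> b \<longleftrightarrow>
        A \<in> {A. invertible A \<and> (\<exists>r\<in>{\<lambda>A. p A * q A | p q. p \<in> P \<and> q \<in> Q}. r A \<noteq> 0)}" for A
    proof
      assume "A \<in> a \<inter> b"
      then obtain p q where "invertible A" "p \<in> P" "q \<in> Q" "p A \<noteq> 0" "q A \<noteq> 0"
        unfolding P(2) Q(2) by blast
      then show "A \<in> {A. invertible A \<and> (\<exists>r\<in>{\<lambda>A. p A * q A | p q. p \<in> P \<and> q \<in> Q}. r A \<noteq> 0)}"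
        by (intro CollectI conjI bexI[of _ "\<lambda>A. p A * q A"]) auto
    next
      assume "A \<in> {A. invertible A \<and> (\<exists>r\<in>{\<lambda>A. p A * q A | p q. p \<in> P \<and> q \<in> Q}. r A \<noteq> 0)}"
      then obtain p q where "invertible A" "p \<in> P" "q \<in> Q" "p A * q A \<noteq> 0" by blast
      then show "A \<in> a \<inter> b" unfolding P(2) Q(2) by auto
    qed
    have "a \<inter> b = {A. invertible A \<and> (\<exists>r\<in>{\<lambda>A. p A * q A | p q. p \<in> P \<and> q \<in> Q}. r A \<noteq> 0)}"
      by (rule Set.set_eqI) (rule eq)
    with sub show ?case by (intro exI conjI)
  next
    case (UN K)
    have "\<forall>k\<in>K. \<exists>P. P \<subseteq> poly_fun UNIV \<and> k = {A. invertible A \<and> (\<exists>p\<in>P. p A \<noteq> 0)}"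
      by (intro ballI UN.IH)
    from bchoice[OF this] obtain F where
      F: "\<forall>k\<in>K. F k \<subseteq> poly_fun UNIV \<and> k = {A. invertible A \<and> (\<exists>p\<in>F k. p A \<noteq> 0)}" by blast
    have "\<Union>K = \<Union>((\<lambda>k. k) ` K)" by simp
    also have "\<dots> = (\<Union>k\<in>K. {A. invertible A \<and> (\<exists>p\<in>F k. p A \<noteq> 0)})"
    proof (rule SUP_cong)
      fix k assume "k \<in> K"
      from bspec[OF F this] show "k = {A. invertible A \<and> (\<exists>p\<in>F k. p A \<noteq> 0)}" by (rule conjunct2)
    qed simp
    also have "\<dots> = {A. invertible A \<and> (\<exists>p\<in>\<Union>(F ` K). p A \<noteq> 0)}" by auto
    finally have eq: "\<Union>K = {A. invertible A \<and> (\<exists>p\<in>\<Union>(F ` K). p A \<noteq> 0)}" .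
    have "\<Union>(F ` K) \<subseteq> poly_fun UNIV" by (rule UN_least) (use F in blast)
    then show ?case using eq by blast
  next
    case (Basis s)
    then obtain p where "p \<in> poly_fun UNIV" "s = {A. invertible A \<and> p A \<noteq> 0}" by blast
    then show ?case by (intro exI[of _ "{p}"]) simp
  qed
  show ?thesis
  proof
    assume "closedin zariski S"
    then have S: "S \<subseteq> {A. invertible A}" "openin zariski ({A. invertible A} - S)"
      by (auto simp: closedin_def ts)
    then obtain P where P: "P\<subseteq>poly_fun UNIV" "{A. invertible A} - S = {A. invertible A \<and> (\<exists>p\<in>P. p A \<noteq> 0)}"
      using gen[OF S(2)[unfolded zariski_def openin_topology_generated_by_iff]] by blast
    then have "S = {A. invertible A \<and> (\<forall>p\<in>P. p A = 0)}" using S by blast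
    then show "defined_over UNIV S" unfolding defined_over_def using P by blast
  next
    assume "defined_over UNIV S"
    then obtain P where P: "P\<subseteq>poly_fun UNIV" "S = {A. invertible A \<and> (\<forall>p\<in>P. p A = 0)}"
      unfolding defined_over_def by auto
    have "{A. invertible A} - S = (\<Union>p\<in>P. {A. invertible A \<and> p A \<noteq> 0})" using P by auto
    moreover have "openin zariski (\<Union>p\<in>P. {A. invertible A \<and> p A \<noteq> 0})"
    proof (intro openin_Union ballI)
      fix V assume "V \<in> (\<lambda>p. {A. invertible A \<and> p A \<noteq> 0}) ` P"
      then have "V \<in> ?B" using P(1) by blast
      then show "openin zariski V" unfolding zariski_def by (rule topology_generated_by_Basis)
    qed
    ultimately show "closedin zariski S" using P by (auto simp: closedin_def ts)
  qed
qed

text \<open>Matrix powers are written as iterates since \<open>^\<close> is componentwise on vectors.\<close>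

definition unipotent :: "complex^'n^'n \<Rightarrow> bool" where
  "unipotent A \<longleftrightarrow> (\<exists>k. (((**) (A - mat 1)) ^^ k) (mat 1) = 0)"

definition connected_normal_unipotent :: "(complex^'n^'n) set \<Rightarrow> (complex^'n^'n) set \<Rightarrow> bool" where
  "connected_normal_unipotent U G \<longleftrightarrow>
     U \<lhd> GL_sub G \<and> closedin zariski U \<and> connectedin zariski U \<and> (\<forall>A\<in>U. unipotent A)"

definition unipotent_radical :: "(complex^'n^'n) set \<Rightarrow> (complex^'n^'n) set \<Rightarrow> bool" where
  "unipotent_radical U G \<longleftrightarrow>
     connected_normal_unipotent U G \<and> (\<forall>V. connected_normal_unipotent V G \<longrightarrow> V \<subseteq> U)"

definition Gm :: "complex monoid" where
  "Gm = \<lparr>carrier = - {0}, monoid.mult = (*), one = 1\<rparr>"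

definition Gm_power :: "nat \<Rightarrow> (nat \<Rightarrow> complex) monoid" where
  "Gm_power r = product_group {..<r} (\<lambda>_. Gm)"

text \<open>The coordinate ring of \<open>G\<^sub>m\<^sup>r\<close> over \<open>K\<close>: Laurent polynomials.\<close>

definition regular_Gm :: "complex set \<Rightarrow> nat \<Rightarrow> ((nat \<Rightarrow> complex) \<Rightarrow> complex) set" where
  "regular_Gm K r = alg_gen K ({\<lambda>x. x i | i. i < r} \<union> {\<lambda>x. inverse (x i) | i. i < r})"

text \<open>
  \<open>T\<close> is \<open>K\<close>-isomorphic, as an algebraic group, to some \<open>G\<^sub>m\<^sup>r\<close>.  For \<open>K = \<complex>\<close> this is the
  notion of a torus, for \<open>K = \<rat>\<close> that of a \<open>\<rat>\<close>-split torus.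
\<close>

definition split_torus :: "complex set \<Rightarrow> (complex^'n^'n) set \<Rightarrow> bool" where
  "split_torus K T \<longleftrightarrow> algebraic_group K T \<and>
     (\<exists>r. \<exists>\<phi> \<in> iso (GL_sub T) (Gm_power r).
        (\<forall>i<r. \<exists>p\<in>regular_GL K. \<forall>A\<in>T. \<phi> A i = p A) \<and>
        (\<forall>i j. \<exists>q\<in>regular_Gm K r. \<forall>x\<in>carrier (Gm_power r). inv_into T \<phi> x $ i $ j = q x))"

definition maximal_torus :: "(complex^'n^'n) set \<Rightarrow> (complex^'n^'n) set \<Rightarrow> bool" where
  "maximal_torus T G \<longleftrightarrow> split_torus UNIV T \<and> T \<subseteq> G \<and>
     (\<forall>S. split_torus UNIV S \<and> T \<subseteq> S \<and> S \<subseteq> G \<longrightarrow> S = T)"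

text \<open>
  A finite dimensional rational \<open>G\<close>-module: the \<open>\<rat>\<close>-vector space is the whole type \<open>'m\<close> with
  scalar multiplication \<open>s\<close>.  The homomorphism \<open>G \<rightarrow> GL(M)\<close> over \<open>\<rat>\<close> is given in a basis \<open>B\<close> by
  its matrix coefficients \<open>R\<close>, which are functions on all complex points of \<open>G\<close>; \<open>\<rho>\<close> is the
  resulting action of \<open>G(\<rat>)\<close> on \<open>M\<close>.
\<close>

definition rational_module ::
  "(complex^'n^'n) set \<Rightarrow> (rat \<Rightarrow> 'm \<Rightarrow> 'm) \<Rightarrow> (complex^'n^'n \<Rightarrow> 'm \<Rightarrow> 'm::ab_group_add) \<Rightarrow> bool"
where
  "rational_module G s \<rho> \<longleftrightarrow>
     (\<exists>B R. finite_dimensional_vector_space s B \<and>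
        (\<forall>b\<in>B. \<forall>c\<in>B. (\<lambda>g. R g b c) \<in> regular_GL \<rat>) \<and>
        (\<forall>b\<in>B. \<forall>c\<in>B. R (mat 1) b c = (if b = c then 1 else 0)) \<and>
        (\<forall>g\<in>G. \<forall>h\<in>G. \<forall>b\<in>B. \<forall>c\<in>B. R (g ** h) b c = (\<Sum>d\<in>B. R g b d * R h d c)) \<and>
        (\<forall>g\<in>rational_points G. Vector_Spaces.linear s s (\<rho> g) \<and>
           (\<forall>b\<in>B. \<forall>c\<in>B. R g b c = of_rat (module.representation s B (\<rho> g c) b))))"

section \<open>Group cohomology with rational coefficients\<close>

text \<open>
  Cohomology of a group \<open>\<Gamma>\<close> acting by \<open>\<rho>\<close> on a \<open>\<rat>\<close>-vector space with scalar multiplication \<open>s\<close>,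
  by inhomogeneous cochains.  A \<open>k\<close>-cochain is a function on lists, normalised to be zero away
  from lists of length \<open>k\<close> over \<open>\<Gamma>\<close>.
\<close>

definition tuples :: "('g, 'x) monoid_scheme \<Rightarrow> nat \<Rightarrow> 'g list set" where
  "tuples \<Gamma> k = {xs. length xs = k \<and> set xs \<subseteq> carrier \<Gamma>}"

definition cochains :: "('g, 'x) monoid_scheme \<Rightarrow> nat \<Rightarrow> ('g list \<Rightarrow> 'm::ab_group_add) set" where
  "cochains \<Gamma> k = {f. \<forall>xs. xs \<notin> tuples \<Gamma> k \<longrightarrow> f xs = 0}"

definition coboundary ::
  "('g, 'x) monoid_scheme \<Rightarrow> (rat \<Rightarrow> 'm \<Rightarrow> 'm) \<Rightarrow> ('g \<Rightarrow> 'm \<Rightarrow> 'm) \<Rightarrow> nat \<Rightarrow>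
   ('g list \<Rightarrow> 'm::ab_group_add) \<Rightarrow> 'g list \<Rightarrow> 'm"
where
  "coboundary \<Gamma> s \<rho> k f = (\<lambda>xs. if xs \<in> tuples \<Gamma> (Suc k) then
     \<rho> (hd xs) (f (tl xs))
     + (\<Sum>i<k. s ((-1) ^ Suc i) (f (take i xs @ [xs ! i \<otimes>\<^bsub>\<Gamma>\<^esub> xs ! Suc i] @ drop (Suc (Suc i)) xs)))
     + s ((-1) ^ Suc k) (f (butlast xs))
   else 0)"

definition cocycle_group ::
  "('g, 'x) monoid_scheme \<Rightarrow> (rat \<Rightarrow> 'm \<Rightarrow> 'm) \<Rightarrow> ('g \<Rightarrow> 'm \<Rightarrow> 'm) \<Rightarrow> nat \<Rightarrow>
   ('g list \<Rightarrow> 'm::ab_group_add) monoid"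
where
  "cocycle_group \<Gamma> s \<rho> k =
     \<lparr>carrier = {f \<in> cochains \<Gamma> k. coboundary \<Gamma> s \<rho> k f = (\<lambda>_. 0)},
      monoid.mult = (\<lambda>f g xs. f xs + g xs), one = (\<lambda>_. 0)\<rparr>"

definition coboundaries ::
  "('g, 'x) monoid_scheme \<Rightarrow> (rat \<Rightarrow> 'm \<Rightarrow> 'm) \<Rightarrow> ('g \<Rightarrow> 'm \<Rightarrow> 'm) \<Rightarrow> nat \<Rightarrow>
   ('g list \<Rightarrow> 'm::ab_group_add) set"
where
  "coboundaries \<Gamma> s \<rho> k =
     (case k of 0 \<Rightarrow> {\<lambda>_. 0} | Suc j \<Rightarrow> coboundary \<Gamma> s \<rho> j ` cochains \<Gamma> j)"

definition cohomology ::
  "('g, 'x) monoid_scheme \<Rightarrow> (rat \<Rightarrow> 'm \<Rightarrow> 'm) \<Rightarrow> ('g \<Rightarrow> 'm \<Rightarrow> 'm) \<Rightarrow> nat \<Rightarrow>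
   ('g list \<Rightarrow> 'm::ab_group_add) set monoid"
where
  "cohomology \<Gamma> s \<rho> k = cocycle_group \<Gamma> s \<rho> k Mod coboundaries \<Gamma> s \<rho> k"

definition coh_class ::
  "('g, 'x) monoid_scheme \<Rightarrow> (rat \<Rightarrow> 'm \<Rightarrow> 'm) \<Rightarrow> ('g \<Rightarrow> 'm \<Rightarrow> 'm) \<Rightarrow> nat \<Rightarrow>
   ('g list \<Rightarrow> 'm::ab_group_add) \<Rightarrow> ('g list \<Rightarrow> 'm) set"
where
  "coh_class \<Gamma> s \<rho> k f = coboundaries \<Gamma> s \<rho> k #>\<^bsub>cocycle_group \<Gamma> s \<rho> k\<^esub> f"

text \<open>
  Operations on classes are unions over representatives; all members of these unions are the
  same class.
\<close>

definition coh_scale ::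
  "('g, 'x) monoid_scheme \<Rightarrow> (rat \<Rightarrow> 'm \<Rightarrow> 'm) \<Rightarrow> ('g \<Rightarrow> 'm \<Rightarrow> 'm) \<Rightarrow> nat \<Rightarrow>
   rat \<Rightarrow> ('g list \<Rightarrow> 'm::ab_group_add) set \<Rightarrow> ('g list \<Rightarrow> 'm) set"
where
  "coh_scale \<Gamma> s \<rho> k c x = (\<Union>f\<in>x. coh_class \<Gamma> s \<rho> k (\<lambda>xs. s c (f xs)))"

text \<open>
  The cup product \<open>H\<^sup>i(\<Gamma>, M) \<otimes> H\<^sup>j(\<Gamma>, \<rat>) \<rightarrow> H\<^sup>i\<^sup>+\<^sup>j(\<Gamma>, M)\<close>.  The coefficients of the second factor
  are trivial, so no action appears in the formula.
\<close>

definition cup ::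
  "('g, 'x) monoid_scheme \<Rightarrow> (rat \<Rightarrow> 'm \<Rightarrow> 'm) \<Rightarrow> ('g \<Rightarrow> 'm \<Rightarrow> 'm) \<Rightarrow> nat \<Rightarrow> nat \<Rightarrow>
   ('g list \<Rightarrow> 'm::ab_group_add) set \<Rightarrow> ('g list \<Rightarrow> rat) set \<Rightarrow> ('g list \<Rightarrow> 'm) set"
where
  "cup \<Gamma> s \<rho> i j x y =
     (\<Union>f\<in>x. \<Union>a\<in>y. coh_class \<Gamma> s \<rho> (i + j) (\<lambda>xs. s (a (drop i xs)) (f (take i xs))))"

abbreviation trivial_action :: "'g \<Rightarrow> rat \<Rightarrow> rat" where
  "trivial_action \<equiv> (\<lambda>_ q. q)"

definition coh_unit :: "('g, 'x) monoid_scheme \<Rightarrow> ('g list \<Rightarrow> rat) set" where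
  "coh_unit \<Gamma> = coh_class \<Gamma> (*) trivial_action 0 (\<lambda>xs. if xs = [] then 1 else 0)"

definition graded_linear_iso ::
  "('g, 'x) monoid_scheme \<Rightarrow> ('h, 'y) monoid_scheme \<Rightarrow> (rat \<Rightarrow> 'm \<Rightarrow> 'm) \<Rightarrow> ('g \<Rightarrow> 'm \<Rightarrow> 'm) \<Rightarrow>
   ('h \<Rightarrow> 'm \<Rightarrow> 'm) \<Rightarrow> (nat \<Rightarrow> ('g list \<Rightarrow> 'm::ab_group_add) set \<Rightarrow> ('h list \<Rightarrow> 'm) set) \<Rightarrow> bool"
where
  "graded_linear_iso \<Delta> \<Gamma> s \<rho> \<rho>' \<Psi> \<longleftrightarrow>
     (\<forall>k. \<Psi> k \<in> iso (cohomology \<Delta> s \<rho> k) (cohomology \<Gamma> s \<rho>' k) \<and>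
       (\<forall>c. \<forall>x \<in> carrier (cohomology \<Delta> s \<rho> k).
          \<Psi> k (coh_scale \<Delta> s \<rho> k c x) = coh_scale \<Gamma> s \<rho>' k c (\<Psi> k x)))"

definition isomorphic_as_cohomology_rings ::
  "('g, 'x) monoid_scheme \<Rightarrow> ('h, 'y) monoid_scheme \<Rightarrow> (rat \<Rightarrow> 'm \<Rightarrow> 'm) \<Rightarrow> ('g \<Rightarrow> 'm \<Rightarrow> 'm) \<Rightarrow>
   ('h \<Rightarrow> 'm \<Rightarrow> 'm::ab_group_add) \<Rightarrow> bool"
where
  "isomorphic_as_cohomology_rings \<Delta> \<Gamma> s \<rho> \<rho>' \<longleftrightarrow>
     (\<exists>\<Psi>\<^sub>M \<Psi>\<^sub>Q.
        graded_linear_iso \<Delta> \<Gamma> s \<rho> \<rho>' \<Psi>\<^sub>M \<and>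
        graded_linear_iso \<Delta> \<Gamma> (*) trivial_action trivial_action \<Psi>\<^sub>Q \<and>
        \<Psi>\<^sub>Q 0 (coh_unit \<Delta>) = coh_unit \<Gamma> \<and>
        (\<forall>i j. \<forall>x \<in> carrier (cohomology \<Delta> (*) trivial_action i).
               \<forall>a \<in> carrier (cohomology \<Delta> (*) trivial_action j).
           \<Psi>\<^sub>Q (i + j) (cup \<Delta> (*) trivial_action i j x a)
           = cup \<Gamma> (*) trivial_action i j (\<Psi>\<^sub>Q i x) (\<Psi>\<^sub>Q j a)) \<and>
        (\<forall>i j. \<forall>x \<in> carrier (cohomology \<Delta> s \<rho> i).
               \<forall>a \<in> carrier (cohomology \<Delta> (*) trivial_action j).
           \<Psi>\<^sub>M (i + j) (cup \<Delta> s \<rho> i j x a) = cup \<Gamma> s \<rho>' i j (\<Psi>\<^sub>M i x) (\<Psi>\<^sub>Q j a)))"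

end

(*
  Restriction to the finite index subgroup is an isomorphism, and its inverse is the required one.
  Since \<Gamma> is solvable, \<Delta> and \<Gamma> are both joined to a normal core by chains of cyclic extensions
  K < S, and decomposing cochains over \<complex> into eigenvectors of a generator of S/K reduces the claim
  for one step to the vanishing of H^*(S, M \<otimes> \<sigma>) for nontrivial characters \<sigma> of the finite group
  S/K.  By the theorem of Lie and Kolchin M has a flag whose quotients are algebraic characters \<theta>
  of the ambient group, and \<sigma>\<theta> is nontrivial on S: otherwise a power of \<theta> is trivial on the
  dense group \<Gamma>, so \<theta> has finite image and is trivial by connectedness.  That H^*(S, \<psi>) = 0 for
  \<psi> = \<sigma>\<theta> is shown along a central series of the unipotent part of S, whose factors embed into
  the rational numbers and are scaled by quotients of diagonal characters; splitness of the torus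
  makes these rational.  Such a factor is locally cyclic, so its cohomology lives in degrees 0 and 1
  and only shifts \<psi> by another algebraic character, until the group acting is abelian, where a
  central element with \<psi> \<noteq> 1 kills everything.  A retraction of \<complex> onto the rational numbers
  transfers the result to the rational module.
*)
theory Submission
  imports Defs "HOL-Library.Function_Algebras" "HOL-Computational_Algebra.Fundamental_Theorem_Algebra"
begin

section \<open>Homogeneous cochains\<close>

text \<open>The group acting need not be finitely generated, so the factors of the series are
  subgroups of the rationals such as the dyadic fractions, whose cohomology is a limit over cyclic
  subgroups. A linear functional that extends the eventual value replaces this limit. Spectral
  sequences are avoided by joins: a cochain takes one vertex list for G/N and one for G/K. Its
  columns are exact because a vertex of the second list can serve as cone point for the first, so
  acyclicity for G/N passes to G/K once the rows are controlled. Eigenvectors force complex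
  coefficients, while the one-step argument needs rational factors. The two meet as follows: a
  triangular coordinate of a rational matrix lies in a finite dimensional rational vector space of
  complex numbers, and finitely many rational functionals split it into rational pieces. These
  functionals have kernels stable under conjugation only if the diagonal entries are rational, and
  those are found as traces against the weight projections of the torus. Each piece contributes H^0
  and H^1, which involve two different characters. Hence nontriviality is demanded for all algebraic
  characters at once.\<close>

text \<open>
  A homogeneous cochain is a function on lists of vertices; \<open>cobd\<close> is the alternating sum over
  the omitted vertex, so the complex is augmented by the value at the empty list.
\<close>

fun cobd :: "('g list \<Rightarrow> 'v::ab_group_add) \<Rightarrow> 'g list \<Rightarrow> 'v" where
  "cobd f [] = 0"
| "cobd f (x # xs) = f xs - cobd (\<lambda>ys. f (x # ys)) xs"

fun prism :: "('g \<Rightarrow> 'g) \<Rightarrow> ('g list \<Rightarrow> 'v::ab_group_add) \<Rightarrow> 'g list \<Rightarrow> 'v" where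
  "prism t f [] = 0"
| "prism t f (x # xs) = f (t x # x # xs) - prism t (\<lambda>ys. f (t x # ys)) xs"

text \<open>Related lists have related faces. With \<open>r\<close> an equality, a translation or a
  translation modulo a subgroup, and \<open>A\<close> the identity, an action or a scalar, this
  single induction yields congruence, equivariance and coset invariance of
  \<open>cobd\<close>.\<close>

lemma cobd_additive_rel:
  assumes "Modules.additive A" and "list_all2 r xs ys"
    and "\<And>us vs. list_all2 r us vs \<Longrightarrow> Suc (length us) = length xs \<Longrightarrow> f vs = A (g us)"
  shows "cobd f ys = A (cobd g xs)"
  using assms(2,3)
proof (induction xs arbitrary: ys f g)
  case Nil
  then show ?case by (simp add: Modules.additive.zero[OF assms(1)])
next
  case (Cons x xs)
  from Cons.prems(1) obtain y ys' where y: "ys = y # ys'" "r x y" "list_all2 r xs ys'"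
    unfolding list_all2_Cons1 by (elim exE conjE)
  have "cobd (\<lambda>us. f (y # us)) ys' = A (cobd (\<lambda>us. g (x # us)) xs)"
    by (rule Cons.IH[OF y(3)]) (use y Cons.prems(2) in auto)
  with y Cons.prems(2)[OF y(3)] show ?case
    by (simp add: Modules.additive.diff[OF assms(1)])
qed

lemma prism_additive_rel:
  assumes "Modules.additive A" and "list_all2 r xs ys" and "\<And>x y. r x y \<Longrightarrow> r (t x) (t' y)"
    and "\<And>us vs. list_all2 r us vs \<Longrightarrow> length us = Suc (length xs) \<Longrightarrow> f vs = A (g us)"
  shows "prism t' f ys = A (prism t g xs)"
  using assms(2,4)
proof (induction xs arbitrary: ys f g)
  case Nil
  then show ?case by (simp add: Modules.additive.zero[OF assms(1)])
next
  case (Cons x xs)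
  from Cons.prems(1) obtain y ys' where y: "ys = y # ys'" "r x y" "list_all2 r xs ys'"
    unfolding list_all2_Cons1 by (elim exE conjE)
  have "prism t' (\<lambda>us. f (t' y # us)) ys' = A (prism t (\<lambda>us. g (t x # us)) xs)"
    by (rule Cons.IH[OF y(3)]) (use y Cons.prems(2) assms(3) in auto)
  moreover have "f (t' y # y # ys') = A (g (t x # x # xs))"
    by (rule Cons.prems(2)) (use y assms(3) in auto)
  ultimately show ?case
    using y by (simp add: Modules.additive.diff[OF assms(1)])
qed

lemma additive_id: "Modules.additive (\<lambda>x. x)"
  by unfold_locales simp

lemma additive_mult_left: "Modules.additive (\<lambda>x. (c::'a::ring) * x)"
  by unfold_locales (simp add: distrib_left)

lemma list_all2_eq_in_iff: "list_all2 (\<lambda>x y. x \<in> S \<and> y = x) xs ys \<longleftrightarrow> ys = xs \<and> set xs \<subseteq> S"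
  by (induction xs arbitrary: ys) (auto simp: list_all2_Cons1)

lemma list_all2_map_in_iff:
  "list_all2 (\<lambda>x y. x \<in> S \<and> y = h x) xs ys \<longleftrightarrow> ys = map h xs \<and> set xs \<subseteq> S"
  by (induction xs arbitrary: ys) (auto simp: list_all2_Cons1)

lemma cobd_additive:
  assumes "Modules.additive A"
  shows "cobd (\<lambda>ys. A (f ys)) xs = A (cobd f xs)"
  by (rule cobd_additive_rel[OF assms, where r = "(=)"]) (auto simp: list.rel_eq)

lemma cobd_cong:
  assumes "\<And>ys. set ys \<subseteq> set xs \<Longrightarrow> Suc (length ys) = length xs \<Longrightarrow> f ys = g ys"
  shows "cobd f xs = cobd g xs"
  by (rule cobd_additive_rel[OF additive_id, where r = "\<lambda>x y. x \<in> set xs \<and> y = x"])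
    (use assms in \<open>auto simp: list_all2_eq_in_iff\<close>)

lemma cobd_add: "cobd (\<lambda>ys. f ys + g ys) xs = cobd f xs + cobd g xs"
  by (induction xs arbitrary: f g) auto

lemma cobd_diff: "cobd (\<lambda>ys. f ys - g ys) xs = cobd f xs - cobd g xs"
  by (induction xs arbitrary: f g) auto

lemma cobd_zero: "cobd (\<lambda>_. 0) xs = 0"
  by (induction xs) auto

lemma cobd_sum: "cobd (\<lambda>ys. \<Sum>i\<in>I. f i ys) xs = (\<Sum>i\<in>I. cobd (f i) xs)"
  by (induction I rule: infinite_finite_induct) (auto simp: cobd_zero cobd_add)

lemma cobd_cmult: "cobd (\<lambda>ys. (c::'a::ring) * f ys) xs = c * cobd f xs"
  by (rule cobd_additive[OF additive_mult_left])

lemma cobd_map: "cobd f (map t xs) = cobd (\<lambda>ys. f (map t ys)) xs"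
  by (induction xs arbitrary: f) auto

lemma cobd_cobd: "cobd (cobd f) xs = 0"
proof (induction xs arbitrary: f)
  case (Cons x xs)
  have "cobd (cobd f) (x # xs) = cobd f xs - cobd (\<lambda>ys. f ys - cobd (\<lambda>zs. f (x # zs)) ys) xs"
    by simp
  also have "\<dots> = 0" unfolding cobd_diff using Cons.IH[of "\<lambda>zs. f (x # zs)"] by simp
  finally show ?case .
qed simp

text \<open>The two alternating sums run over different lists, so no sign arises and the double
  complex used later has commuting differentials.\<close>

lemma cobd_swap:
  "cobd (\<lambda>zs. cobd (f zs) ys) xs = cobd (\<lambda>ws. cobd (\<lambda>zs. f zs ws) xs) ys"
  by (induction xs arbitrary: f) (simp_all add: cobd_zero cobd_diff)

lemma prism_diff: "prism t (\<lambda>ys. f ys - g ys) xs = prism t f xs - prism t g xs"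
  by (induction xs arbitrary: f g) auto

text \<open>The classical prism operator between the identity and the vertex map \<open>t\<close>.
  The augmentation needs no exception, since on the empty list both sides are 0.\<close>

lemma prism_homotopy:
  "cobd (prism t f) xs + prism t (cobd f) xs = f xs - f (map t xs)"
proof (induction xs arbitrary: f)
  case (Cons x xs)
  have IH: "cobd (prism t (\<lambda>ys. f (t x # ys))) xs + prism t (cobd (\<lambda>ys. f (t x # ys))) xs
      = f (t x # xs) - f (t x # map t xs)"
    by (rule Cons.IH)
  have "cobd (prism t f) (x # xs) = prism t f xs
      - (cobd (\<lambda>ys. f (t x # x # ys)) xs - cobd (prism t (\<lambda>ys. f (t x # ys))) xs)"
    by (simp add: cobd_diff)
  moreover have "prism t (cobd f) (x # xs) =
      f (x # xs) - (f (t x # xs) - cobd (\<lambda>ys. f (t x # x # ys)) xs)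
      - (prism t f xs - prism t (cobd (\<lambda>ys. f (t x # ys))) xs)"
    by (simp add: prism_diff)
  ultimately show ?case using IH by (simp add: algebra_simps)
qed simp

lemma prism_zero:
  assumes "\<And>us. set us \<subseteq> set xs \<union> t ` set xs \<Longrightarrow> length us = Suc (length xs) \<Longrightarrow> f us = 0"
  shows "prism t f xs = 0"
  using assms
proof (induction xs arbitrary: f)
  case (Cons x xs)
  have "prism t (\<lambda>ys. f (t x # ys)) xs = 0"
  proof (rule Cons.IH)
    fix us assume "set us \<subseteq> set xs \<union> t ` set xs" "length us = Suc (length xs)"
    then show "f (t x # us) = 0" by (intro Cons.prems) auto
  qed
  moreover have "f (t x # x # xs) = 0" by (rule Cons.prems) auto
  ultimately show ?case by simp
qed simp

text \<open>
  If \<open>f(a, b, \<dots>)\<close> can be replaced by a function that is additive in the edge \<open>(a, b)\<close>, then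
  \<open>f\<close> is a coboundary: this is what kills the cohomology of \<open>\<int>\<close> in degrees at least 2.
\<close>

lemma cobd_exact_if_additive_edge:
  assumes add: "\<And>a b c. T a b ws + T b c ws = T a c (ws :: 'g list)"
    and T: "cobd (T y0 y1) (y1 # ws) = f (y0 # y1 # ws) - f (y1 # y1 # ws)"
    and closed: "cobd f (y0 # y0 # y1 # ws) = 0" and ne: "ws \<noteq> []"
  shows "f (y0 # y1 # ws) = cobd (\<lambda>zs. f (hd zs # zs) - T (hd zs) (hd (tl zs)) (tl zs)) (y0 # y1 # ws)"
proof -
  have "cobd (\<lambda>zs. f (hd zs # zs)) (y0 # y1 # ws) =
      f (y1 # y1 # ws) - cobd (\<lambda>zs. f (y0 # y0 # zs)) (y1 # ws)"
    by simp
  \<comment> \<open>In the boundary of the degenerate simplex that repeats \<open>y0\<close>, the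
    first two faces coincide and cancel; what remains is this sum.\<close>
  moreover have "cobd (\<lambda>zs. f (y0 # y0 # zs)) (y1 # ws) = 0" using closed by simp
  moreover have "cobd (\<lambda>zs. T (hd zs) (hd (tl zs)) (tl zs)) (y0 # y1 # ws) =
      T y1 (hd ws) ws - (T y0 (hd ws) ws - cobd (\<lambda>zs. T y0 y1 (y1 # zs)) ws)"
    by simp
  moreover have "T y0 (hd ws) ws = f (y0 # y1 # ws) - f (y1 # y1 # ws)
      + cobd (\<lambda>zs. T y0 y1 (y1 # zs)) ws + T y1 (hd ws) ws"
    unfolding add[of y0 y1 "hd ws", symmetric] using T by (simp add: diff_eq_eq)
  ultimately show ?thesis
    by (simp add: cobd_diff)
qed

section \<open>Characters without cohomology and normal subgroups\<close>

text \<open>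
  \<open>cochain1 G N \<psi>\<close> are the homogeneous cochains of \<open>G/N\<close> with values in the one-dimensional
  module given by the character \<open>\<psi>\<close>, as functions on lists over \<open>G\<close>.  In \<open>cochain2 G N N' \<psi>\<close>
  a list over \<open>G/N\<close> is joined to a list over \<open>G/N'\<close>.
\<close>

definition grel :: "('g, 'x) monoid_scheme \<Rightarrow> 'g set \<Rightarrow> 'g \<Rightarrow> 'g \<Rightarrow> 'g \<Rightarrow> bool" where
  "grel G N g x y \<longleftrightarrow> x \<in> carrier G \<and> (\<exists>n\<in>N. y = g \<otimes>\<^bsub>G\<^esub> x \<otimes>\<^bsub>G\<^esub> n)"

definition cochain1 ::
  "('g, 'x) monoid_scheme \<Rightarrow> 'g set \<Rightarrow> ('g \<Rightarrow> complex) \<Rightarrow> nat \<Rightarrow> ('g list \<Rightarrow> complex) \<Rightarrow> bool"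
where
  "cochain1 G N \<psi> q f \<longleftrightarrow> (\<forall>g\<in>carrier G. \<forall>xs ys. length xs = q \<longrightarrow>
     list_all2 (grel G N g) xs ys \<longrightarrow> f ys = \<psi> g * f xs)"

definition cochain2 ::
  "('g, 'x) monoid_scheme \<Rightarrow> 'g set \<Rightarrow> 'g set \<Rightarrow> ('g \<Rightarrow> complex) \<Rightarrow> nat \<Rightarrow> nat \<Rightarrow>
   ('g list \<Rightarrow> 'g list \<Rightarrow> complex) \<Rightarrow> bool"
where
  "cochain2 G N N' \<psi> p q f \<longleftrightarrow> (\<forall>g\<in>carrier G. \<forall>xs xs' ys ys'. length xs = p \<longrightarrow> length ys = q \<longrightarrow>
     list_all2 (grel G N g) xs xs' \<longrightarrow> list_all2 (grel G N' g) ys ys' \<longrightarrow> f xs' ys' = \<psi> g * f xs ys)"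

text \<open>Exactness of the augmented complex; lists of length \<open>q\<close> are degree q - 1.
  At length 1 the primitive is a number \<open>h []\<close> with
  \<open>h [] = \<psi> g * h []\<close>, hence 0 when \<psi> is nontrivial, so for such \<psi> this
  is vanishing of all cohomology, H^0 included.\<close>

definition acyclic_char :: "('g, 'x) monoid_scheme \<Rightarrow> 'g set \<Rightarrow> ('g \<Rightarrow> complex) \<Rightarrow> bool" where
  "acyclic_char G N \<psi> \<longleftrightarrow> (\<forall>q f. cochain1 G N \<psi> q f \<longrightarrow> (\<forall>xs\<in>tuples G (Suc q). cobd f xs = 0) \<longrightarrow>
     (\<exists>h. cochain1 G N \<psi> (q - 1) h \<and> (\<forall>xs\<in>tuples G q. f xs = cobd h xs)))"

lemma tuples_0 [simp]: "xs \<in> tuples G 0 \<longleftrightarrow> xs = []"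
  by (auto simp: tuples_def)

lemma Cons_in_tuples [simp]: "x # xs \<in> tuples G (Suc q) \<longleftrightarrow> x \<in> carrier G \<and> xs \<in> tuples G q"
  by (auto simp: tuples_def)

lemma tuples_Suc_iff: "xs \<in> tuples G (Suc q) \<longleftrightarrow>
    (\<exists>y ys. xs = y # ys \<and> y \<in> carrier G \<and> ys \<in> tuples G q)"
  by (cases xs) (auto simp: tuples_def)

lemma cobd_cong_tuples:
  assumes "xs \<in> tuples G (Suc q)" and "\<And>ys. ys \<in> tuples G q \<Longrightarrow> f ys = g ys"
  shows "cobd f xs = cobd g xs"
  by (rule cobd_cong) (use assms in \<open>auto simp: tuples_def\<close>)

lemma cobd_eq_0_tuples:
  assumes "xs \<in> tuples G (Suc q)" and "\<And>ys. ys \<in> tuples G q \<Longrightarrow> f ys = 0"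
  shows "cobd f xs = 0"
  using cobd_cong_tuples[OF assms(1), of f "\<lambda>_. 0"] assms(2) by (simp add: cobd_zero)

lemma cochain2_cobd_left:
  assumes "cochain2 G N N' \<psi> p q f"
  shows "cochain2 G N N' \<psi> (Suc p) q (\<lambda>xs ys. cobd (\<lambda>zs. f zs ys) xs)"
  unfolding cochain2_def
proof (intro ballI allI impI)
  fix g xs xs' ys ys'
  assume g: "g \<in> carrier G" "length xs = Suc p" "length ys = q"
    and xs: "list_all2 (grel G N g) xs xs'" and ys: "list_all2 (grel G N' g) ys ys'"
  show "cobd (\<lambda>zs. f zs ys') xs' = \<psi> g * cobd (\<lambda>zs. f zs ys) xs"
    by (rule cobd_additive_rel[OF additive_mult_left xs])
      (use assms g ys in \<open>auto simp: cochain2_def\<close>)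
qed

lemma cochain2_cobd_right:
  assumes "cochain2 G N N' \<psi> p q f"
  shows "cochain2 G N N' \<psi> p (Suc q) (\<lambda>xs. cobd (f xs))"
  unfolding cochain2_def
proof (intro ballI allI impI)
  fix g xs xs' ys ys'
  assume g: "g \<in> carrier G" "length xs = p" "length ys = Suc q"
    and xs: "list_all2 (grel G N g) xs xs'" and ys: "list_all2 (grel G N' g) ys ys'"
  show "cobd (f xs') ys' = \<psi> g * cobd (f xs) ys"
    by (rule cobd_additive_rel[OF additive_mult_left ys])
      (use assms g xs in \<open>auto simp: cochain2_def\<close>)
qed

lemma cochain2_add:
  "cochain2 G N N' \<psi> p q f \<Longrightarrow> cochain2 G N N' \<psi> p q h \<Longrightarrow>
    cochain2 G N N' \<psi> p q (\<lambda>xs ys. f xs ys + h xs ys)"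
  unfolding cochain2_def by (simp add: distrib_left)

lemma cochain2_diff:
  "cochain2 G N N' \<psi> p q f \<Longrightarrow> cochain2 G N N' \<psi> p q h \<Longrightarrow>
    cochain2 G N N' \<psi> p q (\<lambda>xs ys. f xs ys - h xs ys)"
  unfolding cochain2_def by (simp add: right_diff_distrib)

lemma cochain2_zero: "cochain2 G N N' \<psi> p q (\<lambda>xs ys. 0)"
  unfolding cochain2_def by simp

lemma grel_mono: "grel G N' g x y \<Longrightarrow> N' \<subseteq> N \<Longrightarrow> grel G N g x y"
  unfolding grel_def by blast

section \<open>The double complex of joins of lists over G/N and G/N'\<close>

locale join_complex =
  fixes G :: "('g, 'x) monoid_scheme" and N N' :: "'g set" and \<psi> :: "'g \<Rightarrow> complex"
  assumes N'_subset: "N' \<subseteq> N" and base: "acyclic_char G N \<psi>" and carrier_ne: "carrier G \<noteq> {}"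
begin

abbreviation "C2 \<equiv> cochain2 G N N' \<psi>"

text \<open>If the second list is empty, this is acyclicity of G/N. Otherwise its first vertex is a
  cone point for the first list; this respects cosets because N' is contained in N.\<close>

lemma left_exact:
  assumes f: "C2 (Suc p) q f"
    and closed: "\<And>xs ys. xs \<in> tuples G (Suc (Suc p)) \<Longrightarrow> ys \<in> tuples G q \<Longrightarrow> cobd (\<lambda>zs. f zs ys) xs = 0"
  obtains h where "C2 p q h"
    and "\<And>xs ys. xs \<in> tuples G (Suc p) \<Longrightarrow> ys \<in> tuples G q \<Longrightarrow> f xs ys = cobd (\<lambda>zs. h zs ys) xs"
proof (cases q)
  case 0
  have "cochain1 G N \<psi> (Suc p) (\<lambda>xs. f xs [])"
    unfolding cochain1_def using f by (auto simp: cochain2_def 0)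
  moreover have "\<forall>xs\<in>tuples G (Suc (Suc p)). cobd (\<lambda>xs. f xs []) xs = 0"
    using closed by (simp add: 0)
  ultimately obtain h where h: "cochain1 G N \<psi> p h" "\<forall>xs\<in>tuples G (Suc p). f xs [] = cobd h xs"
    using base unfolding acyclic_char_def by fastforce
  show thesis
  proof (rule that[of "\<lambda>xs ys. h xs"])
    show "C2 p q (\<lambda>xs ys. h xs)"
      using h(1) unfolding cochain1_def cochain2_def by blast
  qed (use h(2) 0 in auto)
next
  case (Suc r)
  show thesis
  proof (rule that[of "\<lambda>xs ys. f (hd ys # xs) ys"])
    show "C2 p q (\<lambda>xs ys. f (hd ys # xs) ys)"
      unfolding cochain2_def
    proof (intro ballI allI impI)
      fix g xs xs' ys ys'
      assume *: "g \<in> carrier G" "length xs = p" "length ys = q"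
        "list_all2 (grel G N g) xs xs'" "list_all2 (grel G N' g) ys ys'"
      then obtain y us y' us' where "ys = y # us" "ys' = y' # us'" "grel G N' g y y'"
        by (cases ys; cases ys') (auto simp: Suc)
      with * have "list_all2 (grel G N g) (hd ys # xs) (hd ys' # xs')"
        by (auto intro: grel_mono[OF _ N'_subset])
      moreover have "length (hd ys # xs) = Suc p" using * by simp
      ultimately show "f (hd ys' # xs') ys' = \<psi> g * f (hd ys # xs) ys"
        using f * unfolding cochain2_def by blast
    qed
  next
    fix xs ys assume *: "xs \<in> tuples G (Suc p)" "ys \<in> tuples G q"
    then have "hd ys # xs \<in> tuples G (Suc (Suc p))" by (auto simp: Suc tuples_Suc_iff)
    from closed[OF this *(2)] show "f xs ys = cobd (\<lambda>zs. f (hd ys # zs) ys) xs" by simp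
  qed
qed

text \<open>
  The argument of the double complex spectral sequence: the columns are exact, and the rows
  \<open>p \<ge> 1\<close> are exact up to classes that are boundaries in the horizontal direction.
\<close>

lemma biclosed_exact:
  assumes row: "\<And>p q g. C2 (Suc p) (Suc q) g \<Longrightarrow>
      (\<And>xs ys. xs \<in> tuples G (Suc p) \<Longrightarrow> ys \<in> tuples G (Suc (Suc q)) \<Longrightarrow> cobd (g xs) ys = 0) \<Longrightarrow>
      (\<And>xs ys. xs \<in> tuples G (Suc (Suc p)) \<Longrightarrow> ys \<in> tuples G (Suc q) \<Longrightarrow> cobd (\<lambda>zs. g zs ys) xs = 0) \<Longrightarrow>
      \<exists>e h. C2 p (Suc q) e \<and> C2 (Suc p) q h \<and>
        (\<forall>xs\<in>tuples G p. \<forall>ys\<in>tuples G (Suc (Suc q)). cobd (e xs) ys = 0) \<and>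
        (p = 0 \<longrightarrow> e = (\<lambda>_ _. 0)) \<and>
        (\<forall>xs\<in>tuples G (Suc p). \<forall>ys\<in>tuples G (Suc q). g xs ys = cobd (\<lambda>zs. e zs ys) xs + cobd (h xs) ys)"
  assumes "C2 (Suc p) q g"
    and "\<And>xs ys. xs \<in> tuples G (Suc p) \<Longrightarrow> ys \<in> tuples G (Suc q) \<Longrightarrow> cobd (g xs) ys = 0"
    and "\<And>xs ys. xs \<in> tuples G (Suc (Suc p)) \<Longrightarrow> ys \<in> tuples G q \<Longrightarrow> cobd (\<lambda>zs. g zs ys) xs = 0"
  shows "\<exists>h. C2 p q h \<and> (\<forall>xs\<in>tuples G p. \<forall>ys\<in>tuples G (Suc q). cobd (h xs) ys = 0) \<and>
    (\<forall>xs\<in>tuples G (Suc p). \<forall>ys\<in>tuples G q. g xs ys = cobd (\<lambda>zs. h zs ys) xs) \<and>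
    (p = 0 \<longrightarrow> (\<exists>k. C2 0 (q - 1) k \<and> (\<forall>ys\<in>tuples G q. h [] ys = cobd (k []) ys)))"
  using assms(2-)
proof (induction q arbitrary: p g)
  case 0
  obtain y where "y \<in> carrier G" using carrier_ne by blast
  then have "[y] \<in> tuples G (Suc 0)" by simp
  from 0(2)[OF _ this] have "g xs [] = 0" if "xs \<in> tuples G (Suc p)" for xs using that by simp
  then show ?case
    by (intro exI[of _ "\<lambda>_ _. 0"]) (auto simp: cochain2_zero cobd_zero intro!: exI[of _ "\<lambda>_ _. 0"])
next
  case (Suc q)
  obtain e h where e: "C2 p (Suc q) e" and h: "C2 (Suc p) q h"
    and e0: "\<And>xs ys. xs \<in> tuples G p \<Longrightarrow> ys \<in> tuples G (Suc (Suc q)) \<Longrightarrow> cobd (e xs) ys = 0"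
    and p0: "p = 0 \<Longrightarrow> e = (\<lambda>_ _. 0)"
    and g: "\<And>xs ys. xs \<in> tuples G (Suc p) \<Longrightarrow> ys \<in> tuples G (Suc q) \<Longrightarrow>
        g xs ys = cobd (\<lambda>zs. e zs ys) xs + cobd (h xs) ys"
    using row[OF Suc.prems] by blast
  \<comment> \<open>The horizontal boundary of the leftover \<open>h\<close> is closed in both
    directions, with one more vertex on the left and one fewer on the right. By induction it is the
    horizontal boundary of a vertically closed \<open>w\<close>; then \<open>h - w\<close> is
    horizontally closed, and its primitive \<open>k\<close> supplies the correction
    \<open>cobd (k xs)\<close> to \<open>e\<close>.\<close>
  let ?d = "\<lambda>xs ys. cobd (\<lambda>zs. h zs ys) xs"
  have "C2 (Suc (Suc p)) q ?d" by (rule cochain2_cobd_left[OF h])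
  moreover have "cobd (?d xs) ys = 0" if "xs \<in> tuples G (Suc (Suc p))" "ys \<in> tuples G (Suc q)" for xs ys
  proof -
    have "cobd (?d xs) ys = cobd (\<lambda>zs. cobd (h zs) ys) xs" by (simp add: cobd_swap[of h])
    also have "\<dots> = cobd (\<lambda>zs. g zs ys - cobd (\<lambda>us. e us ys) zs) xs"
      by (rule cobd_cong_tuples[OF that(1)]) (simp add: g that(2))
    also have "\<dots> = 0" using Suc.prems(3)[OF that] by (simp add: cobd_diff cobd_cobd)
    finally show ?thesis .
  qed
  ultimately obtain w where w: "C2 (Suc p) q w"
    and w0: "\<And>xs ys. xs \<in> tuples G (Suc p) \<Longrightarrow> ys \<in> tuples G (Suc q) \<Longrightarrow> cobd (w xs) ys = 0"
    and dw: "\<And>xs ys. xs \<in> tuples G (Suc (Suc p)) \<Longrightarrow> ys \<in> tuples G q \<Longrightarrow> ?d xs ys = cobd (\<lambda>zs. w zs ys) xs"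
    using Suc.IH[of "Suc p" ?d] by (auto simp: cobd_cobd)
  obtain k where k: "C2 p q k"
    and dk: "\<And>xs ys. xs \<in> tuples G (Suc p) \<Longrightarrow> ys \<in> tuples G q \<Longrightarrow> h xs ys - w xs ys = cobd (\<lambda>zs. k zs ys) xs"
  proof (rule left_exact[OF cochain2_diff[OF h w]])
    show "cobd (\<lambda>zs. h zs ys - w zs ys) xs = 0"
      if "xs \<in> tuples G (Suc (Suc p))" "ys \<in> tuples G q" for xs ys
      using dw[OF that] by (simp add: cobd_diff)
  qed blast
  let ?h = "\<lambda>xs ys. e xs ys + cobd (k xs) ys"
  show ?case
  proof (rule exI[of _ ?h], intro conjI ballI impI)
    show "C2 p (Suc q) ?h" by (intro cochain2_add e cochain2_cobd_right k)
    show "cobd (?h xs) ys = 0" if "xs \<in> tuples G p" "ys \<in> tuples G (Suc (Suc q))" for xs ys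
      using e0[OF that] by (simp add: cobd_add cobd_cobd)
    show "g xs ys = cobd (\<lambda>zs. ?h zs ys) xs" if xs: "xs \<in> tuples G (Suc p)" and ys: "ys \<in> tuples G (Suc q)" for xs ys
    proof -
      have "cobd (h xs) ys = cobd (\<lambda>us. w xs us + cobd (\<lambda>zs. k zs us) xs) ys"
        by (rule cobd_cong_tuples[OF ys]) (use dk[OF xs] in \<open>simp add: algebra_simps\<close>)
      also have "\<dots> = cobd (\<lambda>zs. cobd (k zs) ys) xs"
        by (simp add: cobd_add w0[OF xs ys] cobd_swap[of k])
      finally show ?thesis by (simp add: g[OF xs ys] cobd_add)
    qed
    show "\<exists>k. C2 0 (Suc q - 1) k \<and> (\<forall>ys\<in>tuples G (Suc q). ?h [] ys = cobd (k []) ys)" if "p = 0"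
      using k p0[OF that] that by (intro exI[of _ k]) simp
  qed
qed

text \<open>A cochain of G/N' is placed in the double complex as constant in a single left vertex.
  The value at the empty left list of the resulting horizontal primitive is the cochain itself, and
  it is a vertical boundary there.\<close>

lemma acyclic_if_rows:
  assumes row: "\<And>p q g. C2 (Suc p) (Suc q) g \<Longrightarrow>
      (\<And>xs ys. xs \<in> tuples G (Suc p) \<Longrightarrow> ys \<in> tuples G (Suc (Suc q)) \<Longrightarrow> cobd (g xs) ys = 0) \<Longrightarrow>
      (\<And>xs ys. xs \<in> tuples G (Suc (Suc p)) \<Longrightarrow> ys \<in> tuples G (Suc q) \<Longrightarrow> cobd (\<lambda>zs. g zs ys) xs = 0) \<Longrightarrow>
      \<exists>e h. C2 p (Suc q) e \<and> C2 (Suc p) q h \<and>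
        (\<forall>xs\<in>tuples G p. \<forall>ys\<in>tuples G (Suc (Suc q)). cobd (e xs) ys = 0) \<and>
        (p = 0 \<longrightarrow> e = (\<lambda>_ _. 0)) \<and>
        (\<forall>xs\<in>tuples G (Suc p). \<forall>ys\<in>tuples G (Suc q). g xs ys = cobd (\<lambda>zs. e zs ys) xs + cobd (h xs) ys)"
  shows "acyclic_char G N' \<psi>"
  unfolding acyclic_char_def
proof (intro allI impI)
  fix q f assume f: "cochain1 G N' \<psi> q f" and closed: "\<forall>xs\<in>tuples G (Suc q). cobd f xs = 0"
  have "C2 (Suc 0) q (\<lambda>xs. f)" using f unfolding cochain1_def cochain2_def by blast
  moreover have "cobd (\<lambda>zs. f ys) xs = 0" if "xs \<in> tuples G (Suc (Suc 0))" for xs ys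
    using that by (auto simp: tuples_Suc_iff)
  ultimately obtain h where h: "\<forall>xs\<in>tuples G (Suc 0). \<forall>ys\<in>tuples G q. f ys = cobd (\<lambda>zs. h zs ys) xs"
    "\<exists>k. C2 0 (q - 1) k \<and> (\<forall>ys\<in>tuples G q. h [] ys = cobd (k []) ys)"
    using biclosed_exact[OF row, of 0 q "\<lambda>xs. f"] closed by blast
  then obtain k where k: "C2 0 (q - 1) k" "\<forall>ys\<in>tuples G q. h [] ys = cobd (k []) ys" by blast
  obtain y where "[y] \<in> tuples G (Suc 0)" using carrier_ne by auto
  with h(1) have "f ys = h [] ys" if "ys \<in> tuples G q" for ys using that by fastforce
  moreover have "cochain1 G N' \<psi> (q - 1) (k [])"
    using k(1) unfolding cochain1_def cochain2_def by auto
  ultimately show "\<exists>h. cochain1 G N' \<psi> (q - 1) h \<and> (\<forall>xs\<in>tuples G q. f xs = cobd h xs)"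
    using k(2) by auto
qed

end

section \<open>Linear functionals\<close>

lemma (in vector_space) exists_functional:
  assumes W: "subspace W" and v: "v \<notin> W"
  shows "\<exists>L. Vector_Spaces.linear scale (*) L \<and> (\<forall>w\<in>W. L w = 0) \<and> L v = 1"
proof -
  interpret field_vs: vector_space "(*) :: 'a \<Rightarrow> 'a \<Rightarrow> 'a"
    by unfold_locales (simp_all add: algebra_simps)
  interpret pair: vector_space_pair scale "(*) :: 'a \<Rightarrow> 'a \<Rightarrow> 'a" by unfold_locales
  obtain B where B: "B \<subseteq> W" "independent B" "W \<subseteq> span B"
    by (rule basis_exists[of W])
  have sp: "span B = W" using B W by (metis span_subspace)
  have ind: "independent (insert v B)" using B(2) v sp by (simp add: independent_insert)
  have vB: "v \<notin> B" using v B(1) by blast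
  obtain L where L: "Vector_Spaces.linear scale (*) L" "\<forall>x\<in>insert v B. L x = (if x = v then 1 else 0)"
    using pair.linear_independent_extend[OF ind, of "\<lambda>x. if x = v then 1 else 0"] by blast
  have "L w = 0" if "w \<in> W" for w
  proof -
    have "\<forall>x\<in>B. L x = 0" using L(2) vB by auto
    moreover have "w \<in> span B" using sp that by simp
    ultimately show ?thesis using pair.linear_eq_0_on_span[OF L(1), of B w] by blast
  qed
  then show ?thesis using L by auto
qed

interpretation fun_vs: vector_space "\<lambda>(c::complex) f b. c * f b"
  by unfold_locales (auto simp: algebra_simps)

interpretation rat_vs: vector_space "\<lambda>(q::rat) (z::complex). of_rat q * z"
  by unfold_locales (auto simp: algebra_simps of_rat_add of_rat_mult)

abbreviation "fun_linear \<equiv> Vector_Spaces.linear (\<lambda>(c::complex) f b. c * f b) (*)"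

lemma sum_apply: "sum F I x = (\<Sum>i\<in>I. (F i x :: 'a::comm_monoid_add))"
  by (induction I rule: infinite_finite_induct) auto

lemma fun_linearD:
  assumes "fun_linear L"
  shows "L (\<lambda>b. f b + g b) = L f + L g" and "L (\<lambda>b. c * f b) = c * L f"
    and "L (\<lambda>b. f b - g b) = L f - L g" and "L (\<lambda>b. 0) = 0"
    and "L (\<lambda>b. \<Sum>i\<in>I. F i b) = (\<Sum>i\<in>I. L (F i))"
proof -
  interpret L: Vector_Spaces.linear "\<lambda>(c::complex) f b. c * f b" "(*)" L by fact
  have f: "(\<lambda>b. f b + g b) = f + g" "(\<lambda>b. f b - g b) = f - g" "(\<lambda>b. 0) = (0 :: 'a \<Rightarrow> complex)"
    "(\<lambda>b. \<Sum>i\<in>I. F i b) = (\<Sum>i\<in>I. F i)"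
    by (auto simp: fun_eq_iff sum_apply)
  show "L (\<lambda>b. f b + g b) = L f + L g" "L (\<lambda>b. c * f b) = c * L f"
    "L (\<lambda>b. f b - g b) = L f - L g" "L (\<lambda>b. 0) = 0" "L (\<lambda>b. \<Sum>i\<in>I. F i b) = (\<Sum>i\<in>I. L (F i))"
    unfolding f by (rule L.add L.scale L.diff L.zero L.sum)+
qed

section \<open>Locally cyclic groups\<close>

definition rat_subgroup :: "rat set \<Rightarrow> bool" where
  "rat_subgroup A \<longleftrightarrow> 0 \<in> A \<and> (\<forall>a\<in>A. \<forall>b\<in>A. a + b \<in> A) \<and> (\<forall>a\<in>A. - a \<in> A)"

definition int_multiple :: "rat \<Rightarrow> rat \<Rightarrow> bool" where
  "int_multiple e a \<longleftrightarrow> (\<exists>j::int. a = of_int j * e)"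

lemma rat_subgroup_int_mult:
  assumes "rat_subgroup A" "a \<in> A"
  shows "of_int j * a \<in> A"
proof (induction j rule: int_induct[where k = 0])
  case base
  then show ?case using assms by (simp add: rat_subgroup_def)
next
  case (step1 i)
  then show ?case using assms by (simp add: rat_subgroup_def distrib_right)
next
  case (step2 i)
  have "of_int (i - 1) * a = of_int i * a + - a" by (simp add: algebra_simps)
  then show ?case using assms step2 by (metis rat_subgroup_def)
qed

lemma int_multiple_trans: "int_multiple e d \<Longrightarrow> int_multiple d a \<Longrightarrow> int_multiple e a"
  unfolding int_multiple_def by (metis (no_types, opaque_lifting) mult.assoc of_int_mult)

lemma rat_subgroup_pair_cyclic:
  assumes A: "rat_subgroup A" and a: "a \<in> A" "a \<noteq> 0" and b: "b \<in> A"
  obtains e where "e \<in> A" "e \<noteq> 0" "int_multiple e a" "int_multiple e b"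
proof -
  obtain p d where p: "a = of_int p / of_int d" "d \<noteq> 0"
  proof -
    obtain i j where "quotient_of a = (i, j)" by force
    then show thesis using that quotient_of_div quotient_of_denom_pos by fastforce
  qed
  obtain q d' where q: "b = of_int q / of_int d'" "d' \<noteq> 0"
  proof -
    obtain i j where "quotient_of b = (i, j)" by force
    then show thesis using that quotient_of_div quotient_of_denom_pos by fastforce
  qed
  \<comment> \<open>Over the common denominator \<open>d * d'\<close> the two numbers have
    numerators \<open>p * d'\<close> and \<open>q * d\<close>; Bezout puts the quotient of their gcd
    by this denominator into the subgroup.\<close>
  define g where "g = gcd (p * d') (q * d)"
  obtain u v where uv: "u * (p * d') + v * (q * d) = g" unfolding g_def using bezout_int by blast
  define e where "e = (of_int g / of_int (d * d') :: rat)"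
  have "p \<noteq> 0" using p a by auto
  then have g0: "g \<noteq> 0" using q(2) by (simp add: g_def)
  have "e = of_int u * a + of_int v * b"
  proof -
    have "e = (of_int u * of_int p * of_int d' + of_int v * of_int q * of_int d) / (of_int d * of_int d')"
      unfolding e_def uv[symmetric] by (simp add: mult.assoc)
    then show ?thesis using p(2) q(2) by (simp add: p(1) q(1) field_simps)
  qed
  then have "e \<in> A" using A a b rat_subgroup_int_mult[OF A] by (auto simp: rat_subgroup_def)
  moreover have "e \<noteq> 0" using g0 p q by (simp add: e_def)
  moreover have "int_multiple e a"
  proof -
    obtain k where k: "p * d' = g * k" unfolding g_def by (meson gcd_dvd1 dvdE)
    have "(of_int p * of_int d' :: rat) = of_int g * of_int k" using k by (metis of_int_mult)
    then have "a = of_int k * e" using p(2) q(2) by (simp add: p(1) e_def field_simps)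
    then show ?thesis by (auto simp: int_multiple_def)
  qed
  moreover have "int_multiple e b"
  proof -
    obtain k where k: "q * d = g * k" unfolding g_def by (meson gcd_dvd2 dvdE)
    have "(of_int q * of_int d :: rat) = of_int g * of_int k" using k by (metis of_int_mult)
    then have "b = of_int k * e" using p(2) q(2) by (simp add: q(1) e_def field_simps)
    then show ?thesis by (auto simp: int_multiple_def)
  qed
  ultimately show thesis by (rule that)
qed

lemma rat_subgroup_finite_cyclic:
  assumes A: "rat_subgroup A" and a: "a \<in> A" "a \<noteq> 0" and F: "finite F" "F \<subseteq> A"
  obtains e where "e \<in> A" "e \<noteq> 0" "\<forall>b\<in>F. int_multiple e b"
proof -
  have "\<exists>e\<in>A. e \<noteq> 0 \<and> (\<forall>b\<in>F. int_multiple e b)"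
    using F
  proof (induction F rule: finite_induct)
    case empty
    then show ?case using a by auto
  next
    case (insert b F)
    then obtain e where e: "e \<in> A" "e \<noteq> 0" "\<forall>b\<in>F. int_multiple e b" by auto
    obtain e' where "e' \<in> A" "e' \<noteq> 0" "int_multiple e' e" "int_multiple e' b"
      using rat_subgroup_pair_cyclic[OF A e(1,2), of b] insert by auto
    then show ?case using e(3) int_multiple_trans by blast
  qed
  then show thesis using that by blast
qed

text \<open>
  A linear functional that computes the eventual value along the cyclic subgroups of \<open>A\<close>,
  directed by inclusion.  It turns compatible-up-to-coboundary solutions on the cyclic
  subgroups into a solution on \<open>A\<close>, so no \<open>lim\<^sup>1\<close> term arises.
\<close>

definition eventually_cyclic :: "rat set \<Rightarrow> (rat \<Rightarrow> bool) \<Rightarrow> bool" where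
  "eventually_cyclic A P \<longleftrightarrow> (\<exists>F. finite F \<and> F \<subseteq> A \<and>
     (\<forall>e\<in>A. e \<noteq> 0 \<longrightarrow> (\<forall>b\<in>F. int_multiple e b) \<longrightarrow> P e))"

lemma eventually_cyclic_conj:
  assumes "eventually_cyclic A P" "eventually_cyclic A Q" "\<And>e. P e \<Longrightarrow> Q e \<Longrightarrow> R e"
  shows "eventually_cyclic A R"
proof -
  obtain F where F: "finite F \<and> F \<subseteq> A \<and> (\<forall>e\<in>A. e \<noteq> 0 \<longrightarrow> (\<forall>b\<in>F. int_multiple e b) \<longrightarrow> P e)"
    using assms(1)[unfolded eventually_cyclic_def] by (elim exE)
  obtain F' where F': "finite F' \<and> F' \<subseteq> A \<and> (\<forall>e\<in>A. e \<noteq> 0 \<longrightarrow> (\<forall>b\<in>F'. int_multiple e b) \<longrightarrow> Q e)"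
    using assms(2)[unfolded eventually_cyclic_def] by (elim exE)
  show ?thesis unfolding eventually_cyclic_def
    by (rule exI[of _ "F \<union> F'"]) (use F F' assms(3) in auto)
qed

text \<open>Functions that are eventually 0 form a subspace. It does not contain the constant 1,
  because every finite subset of \<open>A\<close> lies in a cyclic subgroup; so a functional exists
  that kills it and sends 1 to 1.\<close>

lemma eventual_value_functional:
  assumes A: "rat_subgroup A" and a: "a \<in> A" "a \<noteq> 0"
  obtains L where "fun_linear L" and "\<And>u c. eventually_cyclic A (\<lambda>e. u e = c) \<Longrightarrow> L u = c"
proof -
  let ?W = "{u :: rat \<Rightarrow> complex. eventually_cyclic A (\<lambda>e. u e = 0)}"
  have sub: "fun_vs.subspace ?W"
  proof (rule fun_vs.subspaceI)
    show "0 \<in> ?W" by (auto simp: eventually_cyclic_def)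
    show "x + y \<in> ?W" if "x \<in> ?W" "y \<in> ?W" for x y
      by (rule CollectI, rule eventually_cyclic_conj[OF that[THEN CollectD]]) simp
    show "(\<lambda>b. c * x b) \<in> ?W" if "x \<in> ?W" for c x
      by (rule CollectI, rule eventually_cyclic_conj[OF that[THEN CollectD] that[THEN CollectD]]) simp
  qed
  have one: "(\<lambda>_. 1) \<notin> ?W"
  proof
    assume "(\<lambda>_. 1) \<in> ?W"
    from this[unfolded mem_Collect_eq eventually_cyclic_def] obtain F where F: "finite F" "F \<subseteq> A"
      "\<forall>e\<in>A. e \<noteq> 0 \<longrightarrow> (\<forall>b\<in>F. int_multiple e b) \<longrightarrow> (1::complex) = 0"
      by (elim exE conjE)
    obtain e where "e \<in> A" "e \<noteq> 0" "\<forall>b\<in>F. int_multiple e b"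
      by (rule rat_subgroup_finite_cyclic[OF A a F(1,2)])
    with F(3) have "(1::complex) = 0" by meson
    then show False by simp
  qed
  from fun_vs.exists_functional[OF sub one]
  obtain L where L: "fun_linear L" "\<forall>w\<in>?W. L w = 0" "L (\<lambda>_. 1) = 1"
    by (elim exE conjE)
  show thesis
  proof (rule that[OF L(1)])
    fix u :: "rat \<Rightarrow> complex" and c assume "eventually_cyclic A (\<lambda>e. u e = c)"
    then have "(\<lambda>e. u e - c * 1) \<in> ?W" by simp
    then have "L (\<lambda>e. u e - c * 1) = 0" using L(2) by blast
    moreover have "L (\<lambda>e. u e - c * 1) = L u - c * L (\<lambda>_. 1)"
      by (simp only: fun_linearD[OF L(1)])
    ultimately show "L u = c" using L(3) by simp
  qed
qed

text \<open>The discrete antiderivative on the integers with value 0 at 0; for each \<open>j\<close>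
  one of the two sums is empty.\<close>

definition int_primitive :: "(int \<Rightarrow> 'v::ab_group_add) \<Rightarrow> int \<Rightarrow> 'v" where
  "int_primitive u j = (\<Sum>i\<in>{0..<j}. u i) - (\<Sum>i\<in>{j..<0}. u i)"

lemma int_primitive_0 [simp]: "int_primitive u 0 = 0"
  by (simp add: int_primitive_def)

lemma int_primitive_step: "int_primitive u (j + 1) = int_primitive u j + u j"
proof (cases "j \<ge> 0")
  case True
  then have "{0..<j + 1} = insert j {0..<j}" by (auto simp: set_eq_iff)
  then show ?thesis using True by (simp add: int_primitive_def)
next
  case False
  then have "x \<in> {j..<0} \<longleftrightarrow> x \<in> insert j {j + 1..<0}" for x
    by (simp only: atLeastLessThan_iff insert_iff) presburger
  then have "{j..<0} = insert j {j + 1..<0}" by (rule Set.set_eqI)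
  then show ?thesis using False by (simp add: int_primitive_def)
qed

lemma int_primitive_unique:
  assumes "\<And>j. F (j + 1) = F j + u j"
  shows "F j = F 0 + int_primitive u j"
proof (induction j rule: int_induct[where k = 0])
  case (step1 i)
  then show ?case by (simp add: assms int_primitive_step add.assoc)
next
  case (step2 i)
  have "F (i - 1) + u (i - 1) = F 0 + int_primitive u (i - 1) + u (i - 1)"
    using assms[of "i - 1"] int_primitive_step[of u "i - 1"] step2 by (simp add: add.assoc)
  then show ?case by simp
qed simp

lemma int_primitive_shift:
  "int_primitive u (j + m) - int_primitive u (l + m) =
    int_primitive (\<lambda>i. u (i + m)) j - int_primitive (\<lambda>i. u (i + m)) l"
proof -
  have "int_primitive u (j + m) = int_primitive u m + int_primitive (\<lambda>i. u (i + m)) j" for j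
    using int_primitive_unique[of "\<lambda>j. int_primitive u (j + m)" "\<lambda>i. u (i + m)" j]
      int_primitive_step[of u "_ + m"] by (simp add: algebra_simps)
  then show ?thesis by simp
qed


text \<open>
  On the cyclic subgroup generated by \<open>e\<close>, the edge \<open>(a, b)\<close> is replaced by the path from \<open>a\<close> to
  \<open>b\<close> with steps \<open>e\<close>.
\<close>

definition path_sum :: "rat \<Rightarrow> (rat list \<Rightarrow> complex) \<Rightarrow> rat \<Rightarrow> rat \<Rightarrow> rat list \<Rightarrow> complex" where
  "path_sum e f a b ys =
     int_primitive (\<lambda>i. f (of_int i * e # of_int (i + 1) * e # ys)) \<lfloor>b / e\<rfloor> -
     int_primitive (\<lambda>i. f (of_int i * e # of_int (i + 1) * e # ys)) \<lfloor>a / e\<rfloor>"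

lemma path_sum_trans: "path_sum e f a b ys + path_sum e f b c ys = path_sum e f a c ys"
  by (simp add: path_sum_def)

text \<open>Closedness of \<open>f\<close> on a step (ke, (k+1)e, ys) expresses the coboundary of
  that step as a difference of neighbouring values of \<open>f\<close>, and the path
  telescopes.\<close>

lemma cobd_path_sum:
  assumes e: "e \<noteq> 0" "int_multiple e a" "int_multiple e b" "\<And>y. y \<in> set ys \<Longrightarrow> int_multiple e y"
    and closed: "\<And>zs. length zs = Suc (Suc (length ys)) \<Longrightarrow> (\<And>z. z \<in> set zs \<Longrightarrow> int_multiple e z) \<Longrightarrow>
      cobd f zs = 0"
  shows "cobd (path_sum e f a b) ys = f (a # ys) - f (b # ys)"
proof -
  let ?u = "\<lambda>ys i. f (of_int i * e # of_int (i + 1) * e # ys)"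
  obtain i j where ij: "a = of_int i * e" "b = of_int j * e"
    using e by (auto simp: int_multiple_def)
  have step: "cobd (\<lambda>zs. ?u zs k) ys = f (of_int k * e # ys) - f (of_int (k + 1) * e # ys)" for k
  proof -
    have "int_multiple e (of_int l * e)" for l by (auto simp: int_multiple_def)
    from this[of k] this[of "k + 1"] have "cobd f (of_int k * e # of_int (k + 1) * e # ys) = 0"
      by (intro closed) (use e(4) in auto)
    then show ?thesis by (simp add: algebra_simps)
  qed
  have prim: "cobd (\<lambda>zs. int_primitive (?u zs) k) ys = f (0 # ys) - f (of_int k * e # ys)" for k
  proof -
    have "cobd (\<lambda>zs. int_primitive (?u zs) (l + 1)) ys =
        cobd (\<lambda>zs. int_primitive (?u zs) l) ys + (f (of_int l * e # ys) - f (of_int (l + 1) * e # ys))" for l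
      unfolding int_primitive_step cobd_add step ..
    then have "cobd (\<lambda>zs. int_primitive (?u zs) (l + 1)) ys + f (of_int (l + 1) * e # ys) =
        cobd (\<lambda>zs. int_primitive (?u zs) l) ys + f (of_int l * e # ys) + 0" for l
      by simp
    from int_primitive_unique[of "\<lambda>l. cobd (\<lambda>zs. int_primitive (?u zs) l) ys + f (of_int l * e # ys)" "\<lambda>_. 0" k,
        OF this]
    show ?thesis by (simp add: cobd_zero int_primitive_def algebra_simps)
  qed
  have fl: "\<lfloor>a / e\<rfloor> = i" "\<lfloor>b / e\<rfloor> = j" using ij e(1) by simp_all
  have "cobd (path_sum e f a b) ys = cobd (\<lambda>zs. int_primitive (?u zs) j - int_primitive (?u zs) i) ys"
    by (simp add: path_sum_def[abs_def] fl)
  then show ?thesis unfolding cobd_diff prim ij by simp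
qed

lemma path_sum_translate:
  assumes e: "e \<noteq> 0" "int_multiple e a" "int_multiple e b" "int_multiple e c"
    and inv: "\<And>zs. length zs = Suc (Suc (length ys)) \<Longrightarrow> set zs \<subseteq> A \<Longrightarrow> f (map ((+) c) zs) = f zs"
    and A: "\<And>i. of_int i * e \<in> A" "set ys \<subseteq> A"
  shows "path_sum e f (c + a) (c + b) (map ((+) c) ys) = path_sum e f a b ys"
proof -
  let ?u = "\<lambda>ys i. f (of_int i * e # of_int (i + 1) * e # ys)"
  obtain i j m where ij: "a = of_int i * e" "b = of_int j * e" "c = of_int m * e"
    using e by (auto simp: int_multiple_def)
  have fl: "\<lfloor>a / e\<rfloor> = i" "\<lfloor>b / e\<rfloor> = j" "\<lfloor>(c + a) / e\<rfloor> = i + m" "\<lfloor>(c + b) / e\<rfloor> = j + m"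
    using ij e(1) by (simp_all add: add_divide_distrib flip: of_int_add)
  have "?u (map ((+) c) ys) (k + m) = ?u ys k" for k
  proof -
    have "?u (map ((+) c) ys) (k + m) = f (map ((+) c) (of_int k * e # of_int (k + 1) * e # ys))"
      by (simp add: ij algebra_simps)
    also have "\<dots> = ?u ys k" by (rule inv) (use A(1)[of k] A(1)[of "k + 1"] A(2) in auto)
    finally show ?thesis .
  qed
  then show ?thesis
    unfolding path_sum_def fl int_primitive_shift[of _ j m i] by simp
qed

text \<open>Lists of three or more vertices are degrees at least 2. For each generator
  \<open>e\<close> the path sums solve the equation on the cyclic group of \<open>e\<close>; the
  functional applied in the variable \<open>e\<close> merges these solutions, and both required
  identities survive since they hold for all sufficiently fine \<open>e\<close>.\<close>

theorem locally_cyclic_acyclic: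
  fixes f :: "rat list \<Rightarrow> complex"
  assumes A: "rat_subgroup A" "a \<in> A" "a \<noteq> 0"
    and inv: "\<And>c ys. c \<in> A \<Longrightarrow> set ys \<subseteq> A \<Longrightarrow> length ys = Suc (Suc (Suc q)) \<Longrightarrow> f (map ((+) c) ys) = f ys"
    and closed: "\<And>ys. set ys \<subseteq> A \<Longrightarrow> length ys = Suc (Suc (Suc (Suc q))) \<Longrightarrow> cobd f ys = 0"
  obtains h where "\<And>c ys. c \<in> A \<Longrightarrow> set ys \<subseteq> A \<Longrightarrow> length ys = Suc (Suc q) \<Longrightarrow> h (map ((+) c) ys) = h ys"
    and "\<And>ys. set ys \<subseteq> A \<Longrightarrow> length ys = Suc (Suc (Suc q)) \<Longrightarrow> f ys = cobd h ys"
proof -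
  obtain L where L: "fun_linear L" "\<And>u c. eventually_cyclic A (\<lambda>e. u e = c) \<Longrightarrow> L u = c"
    using eventual_value_functional[OF A] by blast
  have Leq: "L u = L v" if "eventually_cyclic A (\<lambda>e. u e = v e)" for u v
  proof -
    have "L (\<lambda>e. u e - v e) = 0" using that by (intro L(2)) simp
    then show ?thesis by (simp add: fun_linearD(3)[OF L(1)])
  qed
  let ?h = "\<lambda>e zs. f (hd zs # zs) - path_sum e f (hd zs) (hd (tl zs)) (tl zs)"
  show thesis
  proof (rule that[of "\<lambda>zs. L (\<lambda>e. ?h e zs)"])
    fix c ys assume *: "c \<in> A" "set ys \<subseteq> A" "length ys = Suc (Suc q)"
    then obtain y0 y1 us where ys: "ys = y0 # y1 # us" by (metis length_Suc_conv)
    show "L (\<lambda>e. ?h e (map ((+) c) ys)) = L (\<lambda>e. ?h e ys)"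
    proof (rule Leq, unfold eventually_cyclic_def, intro exI[of _ "insert c (set ys)"] conjI ballI impI)
      fix e assume e: "e \<in> A" "e \<noteq> 0" and m: "\<forall>b\<in>insert c (set ys). int_multiple e b"
      have "f (map ((+) c) (y0 # ys)) = f (y0 # ys)" by (rule inv) (use * ys in auto)
      moreover have "path_sum e f (c + y0) (c + y1) (map ((+) c) (y1 # us)) = path_sum e f y0 y1 (y1 # us)"
        by (rule path_sum_translate[where A = A])
          (use e m ys * inv[of c] rat_subgroup_int_mult[OF A(1)] in auto)
      ultimately show "?h e (map ((+) c) ys) = ?h e ys" by (simp add: ys)
    qed (use * in auto)
  next
    fix ys assume *: "set ys \<subseteq> A" "length ys = Suc (Suc (Suc q))"
    then obtain y0 y1 us where ys: "ys = y0 # y1 # us" "us \<noteq> []" by (metis length_Suc_conv list.distinct(1))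
    have add: "Modules.additive L"
      by unfold_locales (use fun_linearD(1)[OF L(1)] in \<open>simp add: plus_fun_def\<close>)
    have cb: "cobd (\<lambda>zs e. ?h e zs) ys = (\<lambda>e. cobd (?h e) ys)"
    proof
      fix e
      have "Modules.additive (\<lambda>u::rat \<Rightarrow> complex. u e)" by unfold_locales simp
      from cobd_additive[OF this, of "\<lambda>zs e. ?h e zs" ys]
      show "cobd (\<lambda>zs e. ?h e zs) ys e = cobd (?h e) ys" by simp
    qed
    have "cobd (\<lambda>zs. L (\<lambda>e. ?h e zs)) ys = L (\<lambda>e. cobd (?h e) ys)"
      unfolding cb[symmetric] by (rule cobd_additive[OF add])
    also have "\<dots> = f ys"
    proof (rule L(2), unfold eventually_cyclic_def, intro exI[of _ "set ys"] conjI ballI impI)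
      fix e assume e: "e \<in> A" "e \<noteq> 0" and m: "\<forall>b\<in>set ys. int_multiple e b"
      have mA: "z \<in> A" if "int_multiple e z" for z
        using that rat_subgroup_int_mult[OF A(1) e(1)] by (auto simp: int_multiple_def)
      have "f (y0 # y1 # us) = cobd (?h e) (y0 # y1 # us)"
      proof (rule cobd_exact_if_additive_edge[where T = "path_sum e f"])
        show "cobd (path_sum e f y0 y1) (y1 # us) = f (y0 # y1 # us) - f (y1 # y1 # us)"
          by (rule cobd_path_sum) (use e m ys * in \<open>auto intro!: closed subsetI mA\<close>)
        show "cobd f (y0 # y0 # y1 # us) = 0" by (rule closed) (use * ys in auto)
      qed (simp_all add: path_sum_trans ys)
      then show "cobd (?h e) ys = f ys" by (simp only: ys)
    qed (use * in auto)
    finally show "f ys = cobd (\<lambda>zs. L (\<lambda>e. ?h e zs)) ys" by simp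
  qed
qed

section \<open>Extension by a group of rational numbers\<close>

text \<open>Clearing denominators shows that an additive map on a subgroup of the rationals is
  proportional to the inclusion. The cross-multiplied form avoids dividing by zero. It makes H^1 of
  a locally cyclic factor one-dimensional.\<close>

lemma additive_on_rat_subgroup_linear:
  fixes \<eta> :: "rat \<Rightarrow> complex"
  assumes A: "rat_subgroup A" and add: "\<And>a b. a \<in> A \<Longrightarrow> b \<in> A \<Longrightarrow> \<eta> (a + b) = \<eta> a + \<eta> b"
    and ab: "a \<in> A" "b \<in> A"
  shows "\<eta> a * of_rat b = \<eta> b * of_rat a"
proof -
  have 0: "\<eta> 0 = 0" using add[of 0 0] A by (simp add: rat_subgroup_def)
  have mult: "\<eta> (of_int j * x) = of_int j * \<eta> x" if "x \<in> A" for j x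
  proof (induction j rule: int_induct[where k = 0])
    case base
    then show ?case using 0 by simp
  next
    case (step1 i)
    have "\<eta> (of_int i * x + x) = \<eta> (of_int i * x) + \<eta> x"
      by (rule add[OF rat_subgroup_int_mult[OF A that] that])
    then show ?case using step1 by (simp add: algebra_simps)
  next
    case (step2 i)
    have "\<eta> (of_int (i - 1) * x + x) = \<eta> (of_int (i - 1) * x) + \<eta> x"
      by (rule add[OF rat_subgroup_int_mult[OF A that] that])
    then show ?case using step2 by (simp add: algebra_simps)
  qed
  obtain p d where p: "a = of_int p / of_int d" "d \<noteq> 0"
  proof -
    obtain i j where "quotient_of a = (i, j)" by force
    then show thesis using that quotient_of_div quotient_of_denom_pos by fastforce
  qed
  obtain q e where q: "b = of_int q / of_int e" "e \<noteq> 0"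
  proof -
    obtain i j where "quotient_of b = (i, j)" by force
    then show thesis using that quotient_of_div quotient_of_denom_pos by fastforce
  qed
  have "of_int (q * d) * a = of_int (p * e) * b" using p(2) q(2) by (simp add: p(1) q(1))
  then have "of_int (q * d) * \<eta> a = of_int (p * e) * \<eta> b" using mult ab by metis
  then show ?thesis using p(2) q(2) by (simp add: p(1) q(1) of_rat_divide field_simps)
qed

context group
begin

lemma inv_cancel_left [simp]:
  "x \<in> carrier G \<Longrightarrow> y \<in> carrier G \<Longrightarrow> inv x \<otimes> (x \<otimes> y) = y"
  "x \<in> carrier G \<Longrightarrow> y \<in> carrier G \<Longrightarrow> x \<otimes> (inv x \<otimes> y) = y"
  by (simp_all flip: m_assoc)

lemmas group_word_simps = m_assoc inv_mult_group

lemma grelI: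
  assumes "g \<in> carrier G" "x \<in> carrier G" "y \<in> carrier G" "inv x \<otimes> (inv g \<otimes> y) \<in> N"
  shows "grel G N g x y"
  unfolding grel_def
proof (intro conjI bexI)
  show "y = g \<otimes> x \<otimes> (inv x \<otimes> (inv g \<otimes> y))" using assms by (simp add: m_assoc)
qed (use assms in auto)

end

text \<open>With K the kernel of \<alpha>, the quotient N/K is a subgroup of the rationals on which
  conjugation by G is multiplication by \<kappa>, and \<psi> is a character of G/K.\<close>

locale char_extension = group G for G (structure) +
  fixes N :: "'a set" and \<alpha> :: "'a \<Rightarrow> rat" and \<kappa> \<psi> :: "'a \<Rightarrow> complex"
  assumes normal: "N \<lhd> G"
    and \<alpha>_mult: "m \<in> N \<Longrightarrow> n \<in> N \<Longrightarrow> \<alpha> (m \<otimes> n) = \<alpha> m + \<alpha> n"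
    and \<alpha>_conj: "g \<in> carrier G \<Longrightarrow> n \<in> N \<Longrightarrow> of_rat (\<alpha> (g \<otimes> n \<otimes> inv g)) = \<kappa> g * of_rat (\<alpha> n)"
    and \<kappa>_mult: "g \<in> carrier G \<Longrightarrow> h \<in> carrier G \<Longrightarrow> \<kappa> (g \<otimes> h) = \<kappa> g * \<kappa> h"
    and \<kappa>_nz: "g \<in> carrier G \<Longrightarrow> \<kappa> g \<noteq> 0"
    and \<psi>_mult: "g \<in> carrier G \<Longrightarrow> h \<in> carrier G \<Longrightarrow> \<psi> (g \<otimes> h) = \<psi> g * \<psi> h"
    and \<psi>_nz: "g \<in> carrier G \<Longrightarrow> \<psi> g \<noteq> 0"
    and \<psi>_ker: "n \<in> N \<Longrightarrow> \<alpha> n = 0 \<Longrightarrow> \<psi> n = 1"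
begin

abbreviation "K \<equiv> {n \<in> N. \<alpha> n = 0}"

lemma N_subgroup: "subgroup N G" using normal by (rule normal_imp_subgroup)

lemma N_carrier [simp]: "n \<in> N \<Longrightarrow> n \<in> carrier G"
  using subgroup.mem_carrier[OF N_subgroup] .

lemma N_mult [simp]: "m \<in> N \<Longrightarrow> n \<in> N \<Longrightarrow> m \<otimes> n \<in> N"
  using subgroup.m_closed[OF N_subgroup] .

lemma N_inv [simp]: "n \<in> N \<Longrightarrow> inv n \<in> N"
  using subgroup.m_inv_closed[OF N_subgroup] .

lemma N_one [simp]: "\<one> \<in> N"
  using subgroup.one_closed[OF N_subgroup] .

lemma N_conj: "g \<in> carrier G \<Longrightarrow> n \<in> N \<Longrightarrow> g \<otimes> (n \<otimes> inv g) \<in> N"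
  using normal.inv_op_closed2[OF normal] by (simp add: m_assoc)

lemma N_conj': "g \<in> carrier G \<Longrightarrow> n \<in> N \<Longrightarrow> inv g \<otimes> (n \<otimes> g) \<in> N"
  using normal.inv_op_closed1[OF normal] by (simp add: m_assoc)

lemma \<alpha>_one [simp]: "\<alpha> \<one> = 0"
  using \<alpha>_mult[of \<one> \<one>] by simp

lemma \<alpha>_inv [simp]: "n \<in> N \<Longrightarrow> \<alpha> (inv n) = - \<alpha> n"
  using \<alpha>_mult[of n "inv n"] by simp

lemma \<alpha>_conj_assoc: "g \<in> carrier G \<Longrightarrow> n \<in> N \<Longrightarrow> of_rat (\<alpha> (g \<otimes> (n \<otimes> inv g))) = \<kappa> g * of_rat (\<alpha> n)"
  using \<alpha>_conj[of g n] by (simp add: m_assoc)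

lemma \<alpha>_conj_inv: "g \<in> carrier G \<Longrightarrow> n \<in> N \<Longrightarrow> \<kappa> g * of_rat (\<alpha> (inv g \<otimes> (n \<otimes> g))) = of_rat (\<alpha> n)"
  using \<alpha>_conj_assoc[of g "inv g \<otimes> (n \<otimes> g)"] by (simp add: N_conj' m_assoc)

lemma \<psi>_one [simp]: "\<psi> \<one> = 1"
  using \<psi>_mult[of \<one> \<one>] \<psi>_nz[of \<one>] by simp

lemma \<psi>_conj: "g \<in> carrier G \<Longrightarrow> h \<in> carrier G \<Longrightarrow> \<psi> (g \<otimes> (h \<otimes> inv g)) = \<psi> h"
  using \<psi>_mult[of g "inv g"] by (simp add: \<psi>_mult)

lemma rat_subgroup_image: "rat_subgroup (\<alpha> ` N)"
proof -
  have "\<alpha> m + \<alpha> n \<in> \<alpha> ` N" if "m \<in> N" "n \<in> N" for m n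
    using that by (intro image_eqI[of _ _ "m \<otimes> n"]) (simp_all add: \<alpha>_mult)
  moreover have "- \<alpha> n \<in> \<alpha> ` N" if "n \<in> N" for n
    using that by (intro image_eqI[of _ _ "inv n"]) simp_all
  moreover have "0 \<in> \<alpha> ` N" by (intro image_eqI[of _ _ \<one>]) simp_all
  ultimately show ?thesis by (auto simp: rat_subgroup_def)
qed

lemma grelE:
  assumes "grel G M g x y" "M \<subseteq> N"
  obtains n where "n \<in> M" "n \<in> N" "y = g \<otimes> x \<otimes> n" "x \<in> carrier G"
  using assms unfolding grel_def by blast

lemma grel_carrier:
  assumes "grel G M g x y" "M \<subseteq> N" "g \<in> carrier G"
  shows "x \<in> carrier G" "y \<in> carrier G"
  using assms by (auto elim!: grelE)

lemma grel_tuples: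
  assumes "list_all2 (grel G M g) xs ys" "M \<subseteq> N" "g \<in> carrier G" "length xs = p"
  shows "xs \<in> tuples G p" "ys \<in> tuples G p"
proof -
  have "set xs \<subseteq> carrier G \<and> set ys \<subseteq> carrier G"
    using assms(1) by (induction rule: list_all2_induct) (use grel_carrier[OF _ assms(2,3)] in auto)
  then show "xs \<in> tuples G p" "ys \<in> tuples G p"
    using assms(4) list_all2_lengthD[OF assms(1)] by (auto simp: tuples_def)
qed

lemma grel_N_self:
  assumes "b \<in> N" "x \<in> carrier G"
  shows "grel G N b x x"
  by (rule grelI) (use assms N_conj'[of x "inv b"] in auto)

lemma cochain2_apply:
  assumes "cochain2 G N M \<psi> p q f" "g \<in> carrier G" "length xs = p" "length ys = q"
    "list_all2 (grel G N g) xs xs'" "list_all2 (grel G M g) ys ys'"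
  shows "f xs' ys' = \<psi> g * f xs ys"
  using assms unfolding cochain2_def by blast

lemma list_all2_grel_N_self:
  assumes "b \<in> N" "xs \<in> tuples G p"
  shows "list_all2 (grel G N b) xs xs"
  using assms by (auto simp: list_all2_same tuples_def intro!: grel_N_self)

lemma grel_K_left: "g \<in> carrier G \<Longrightarrow> y \<in> carrier G \<Longrightarrow> grel G K g y (g \<otimes> y)"
  by (rule grelI) simp_all

lemma list_all2_grel_K_left:
  "g \<in> carrier G \<Longrightarrow> set ys \<subseteq> carrier G \<Longrightarrow> list_all2 (grel G K g) ys (map ((\<otimes>) g) ys)"
  by (auto simp: list_all2_map2 list_all2_same intro!: grel_K_left)

text \<open>An element of N fixes every coset of N but multiplies values by \<psi>, so cochains of
  G/N vanish. The rows are killed by the same element through a translation homotopy, since N/K is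
  abelian.\<close>

lemma acyclic_of_nontrivial:
  assumes a: "a \<in> N" "\<psi> a \<noteq> 1"
  shows "acyclic_char G K \<psi>"
proof -
  have acyN: "acyclic_char G N \<psi>"
    unfolding acyclic_char_def
  proof (intro allI impI)
    fix q f assume f: "cochain1 G N \<psi> q f"
    have "f xs = 0" if "xs \<in> tuples G q" for xs
    proof -
      have "f xs = \<psi> a * f xs"
        using f[unfolded cochain1_def, rule_format, of a xs xs]
          list_all2_grel_N_self[OF a(1) that] that a(1) by (simp add: tuples_def)
      then show ?thesis using a(2) by simp
    qed
    then show "\<exists>h. cochain1 G N \<psi> (q - 1) h \<and> (\<forall>xs\<in>tuples G q. f xs = cobd h xs)"
      by (intro exI[of _ "\<lambda>_. 0"]) (simp add: cochain1_def cobd_zero)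
  qed
  interpret join_complex G N K \<psi>
    by unfold_locales (use acyN in auto)
  show ?thesis
  proof (rule acyclic_if_rows)
    fix p q g
    assume g: "C2 (Suc p) (Suc q) g"
      and closed: "\<And>xs ys. xs \<in> tuples G (Suc p) \<Longrightarrow> ys \<in> tuples G (Suc (Suc q)) \<Longrightarrow> cobd (g xs) ys = 0"
    \<comment> \<open>Left translation by the conjugate of \<open>a\<close> by the first left vertex
      \<open>x\<close>. The conjugation makes the family of maps compatible with left translations
      by G, and \<psi> takes on the conjugate the same value as on \<open>a\<close>.\<close>
    define t where "t x y = x \<otimes> (a \<otimes> (inv x \<otimes> y))" for x y
    define h where "h xs ys = prism (t (hd xs)) (g xs) ys / (1 - \<psi> a)" for xs ys
    have h: "C2 (Suc p) q h"
      unfolding cochain2_def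
    proof (intro ballI allI impI)
      fix \<gamma> xs xs' ys ys'
      assume *: "\<gamma> \<in> carrier G" "length xs = Suc p" "length ys = q"
        "list_all2 (grel G N \<gamma>) xs xs'" "list_all2 (grel G K \<gamma>) ys ys'"
      then obtain x us x' us' where x: "xs = x # us" "xs' = x' # us'" "grel G N \<gamma> x x'"
        by (cases xs; cases xs') auto
      obtain m where m: "m \<in> N" "x' = \<gamma> \<otimes> x \<otimes> m" "x \<in> carrier G"
        using x(3) by (rule grelE) simp_all
      have "prism (t (hd xs')) (g xs') ys' = \<psi> \<gamma> * prism (t (hd xs)) (g xs) ys"
      proof (rule prism_additive_rel[OF additive_mult_left *(5)])
        fix y y' assume "grel G K \<gamma> y y'"
        then obtain n where n: "n \<in> K" "y' = \<gamma> \<otimes> y \<otimes> n" "y \<in> carrier G"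
          by (rule grelE) auto
        \<comment> \<open>Passing from \<open>x\<close> to \<gamma> x m changes the translation by a
          commutator of \<open>m\<close> and \<open>a\<close>, which \<alpha> kills; hence
          \<open>t\<close> respects cosets of K.\<close>
        let ?c = "inv a \<otimes> m \<otimes> a \<otimes> inv m"
        have c: "?c \<in> N" "\<alpha> ?c = 0" using m a by (simp_all add: \<alpha>_mult)
        let ?z = "inv x \<otimes> y"
        have z: "?z \<in> carrier G" using m n by simp
        have "inv ?z \<otimes> (?c \<otimes> ?z) \<otimes> n \<in> N" using N_conj'[OF z c(1)] n by simp
        moreover have "\<alpha> (inv ?z \<otimes> (?c \<otimes> ?z) \<otimes> n) = 0"
          using N_conj'[OF z c(1)] \<alpha>_conj_inv[OF z c(1)] c \<kappa>_nz[OF z] n by (simp add: \<alpha>_mult)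
        moreover have "inv (t x y) \<otimes> (inv \<gamma> \<otimes> t x' y') = inv ?z \<otimes> (?c \<otimes> ?z) \<otimes> n"
          using m n a *(1) by (simp add: t_def group_word_simps)
        ultimately show "grel G K \<gamma> (t (hd xs) y) (t (hd xs') y')"
          using x m n a *(1) by (intro grelI) (simp_all add: t_def)
      next
        fix us vs assume "list_all2 (grel G K \<gamma>) us vs" "length us = Suc (length ys)"
        then show "g xs' vs = \<psi> \<gamma> * g xs us" by (intro cochain2_apply[OF g]) (use * in auto)
      qed
      then show "h xs' ys' = \<psi> \<gamma> * h xs ys" by (simp add: h_def)
    qed
    have "g xs ys = cobd (h xs) ys" if xs: "xs \<in> tuples G (Suc p)" and ys: "ys \<in> tuples G (Suc q)" for xs ys
    proof -
      obtain x us where x: "xs = x # us" "x \<in> carrier G" using xs by (auto simp: tuples_Suc_iff)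
      let ?b = "x \<otimes> (a \<otimes> inv x)"
      have b: "?b \<in> N" using N_conj x a by simp
      have "map (t x) ys = map ((\<otimes>) ?b) ys"
        using ys x a by (auto simp: t_def tuples_def m_assoc)
      then have "g xs (map (t x) ys) = g xs (map ((\<otimes>) ?b) ys)" by (simp only:)
      also have "\<dots> = \<psi> ?b * g xs ys"
        by (rule cochain2_apply[OF g])
          (use xs ys b list_all2_grel_N_self[OF b xs] list_all2_grel_K_left in \<open>auto simp: tuples_def\<close>)
      also have "\<psi> ?b = \<psi> a" using \<psi>_conj x a by simp
      finally have "(1 - \<psi> a) * g xs ys = cobd (prism (t x) (g xs)) ys + prism (t x) (cobd (g xs)) ys"
        unfolding prism_homotopy by (simp add: algebra_simps)
      also have "prism (t x) (cobd (g xs)) ys = 0"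
      proof (rule prism_zero)
        fix us assume "set us \<subseteq> set ys \<union> t x ` set ys" "length us = Suc (length ys)"
        moreover have "set ys \<union> t x ` set ys \<subseteq> carrier G"
          using ys x a by (auto simp: tuples_def t_def)
        ultimately show "cobd (g xs) us = 0"
          using closed[OF xs, of us] ys unfolding tuples_def by auto
      qed
      finally have "g xs ys = cobd (prism (t x) (g xs)) ys / (1 - \<psi> a)"
        using a(2) by (simp add: field_simps)
      also have "\<dots> = cobd (h xs) ys"
        using cobd_cmult[of "1 / (1 - \<psi> a)" "prism (t x) (g xs)" ys] by (simp add: h_def[abs_def] x)
      finally show ?thesis .
    qed
    then show "\<exists>e h. C2 p (Suc q) e \<and> C2 (Suc p) q h \<and>
        (\<forall>xs\<in>tuples G p. \<forall>ys\<in>tuples G (Suc (Suc q)). cobd (e xs) ys = 0) \<and>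
        (p = 0 \<longrightarrow> e = (\<lambda>_ _. 0)) \<and>
        (\<forall>xs\<in>tuples G (Suc p). \<forall>ys\<in>tuples G (Suc q). g xs ys = cobd (\<lambda>zs. e zs ys) xs + cobd (h xs) ys)"
      using h cochain2_zero by (intro exI[of _ "\<lambda>_ _. 0"] exI[of _ h]) (simp add: cobd_zero)
  qed
qed

text \<open>A representative chosen for each coset of N trivialises that coset: \<open>k\<close>
  measures by \<alpha> the displacement from it. The representative depends on the coset alone, so
  left translation by N adds to \<open>k\<close>.\<close>

lemma exists_fibre_coordinate:
  obtains k where "\<And>y. y \<in> carrier G \<Longrightarrow> k y \<in> \<alpha> ` N"
    and "\<And>b y. b \<in> N \<Longrightarrow> y \<in> carrier G \<Longrightarrow> k (b \<otimes> y) = \<alpha> b + k y"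
proof -
  define rep where "rep y = (SOME z. z \<in> N #> y)" for y
  have rep: "rep y \<in> N #> y" if "y \<in> carrier G" for y
    unfolding rep_def by (rule someI[of _ y]) (rule rcos_self[OF that N_subgroup])
  have rep': "y \<otimes> inv (rep y) \<in> N \<and> rep y \<in> carrier G" if y: "y \<in> carrier G" for y
  proof -
    obtain n where n: "n \<in> N" "rep y = n \<otimes> y" using rep[OF y] by (auto simp: r_coset_def)
    then have "y \<otimes> inv (rep y) = inv n" using y by (simp add: group_word_simps)
    then show ?thesis using n y by simp
  qed
  show thesis
  proof (rule that[of "\<lambda>y. \<alpha> (y \<otimes> inv (rep y))"])
    fix b y assume b: "b \<in> N" and y: "y \<in> carrier G"
    have "N #> (b \<otimes> y) = N #> y"
      using b y coset_mult_assoc[of N b y] coset_join2[OF _ N_subgroup b] subgroup.subset[OF N_subgroup] by simp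
    then have "rep (b \<otimes> y) = rep y" by (simp add: rep_def)
    then have "b \<otimes> y \<otimes> inv (rep (b \<otimes> y)) = b \<otimes> (y \<otimes> inv (rep y))"
      using rep'[OF y] b y by (simp add: m_assoc)
    then show "\<alpha> (b \<otimes> y \<otimes> inv (rep (b \<otimes> y))) = \<alpha> b + \<alpha> (y \<otimes> inv (rep y))"
      using rep'[OF y] b by (simp add: \<alpha>_mult)
  qed (use rep' in blast)
qed

end

section \<open>Rows of the join complex when \<psi> is trivial on N\<close>

context char_extension
begin

context
  assumes triv: "\<And>n. n \<in> N \<Longrightarrow> \<psi> n = 1"
    and nz: "\<exists>n\<in>N. \<alpha> n \<noteq> 0"
begin

lemma rat_subgroup_add: "rat_subgroup A \<Longrightarrow> a \<in> A \<Longrightarrow> b \<in> A \<Longrightarrow> a + b \<in> A"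
  by (simp add: rat_subgroup_def)

text \<open>Values of \<alpha> are invariant under conjugation by N because the rationals are
  abelian; one nonzero value then forces \<kappa> = 1.\<close>

lemma \<kappa>_N: "n \<in> N \<Longrightarrow> \<kappa> n = 1"
proof -
  assume n: "n \<in> N"
  obtain b where b: "b \<in> N" "\<alpha> b \<noteq> 0" using nz by blast
  have "of_rat (\<alpha> (n \<otimes> (b \<otimes> inv n))) = (of_rat (\<alpha> b) :: complex)" using n b by (simp add: \<alpha>_mult)
  then show "\<kappa> n = 1" using \<alpha>_conj_assoc[of n b] n b by simp
qed

lemma cochain2_N_invariant:
  assumes f: "cochain2 G N K \<psi> p q f" and "b \<in> N" "xs \<in> tuples G p" "ys \<in> tuples G q"
  shows "f xs (map ((\<otimes>) b) ys) = f xs ys"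
  using cochain2_apply[where g = b, OF f _ _ _ list_all2_grel_N_self list_all2_grel_K_left, where ys = ys] assms triv
  by (simp add: tuples_def)

text \<open>On one vertex closedness means constant, and the constant is a cochain with empty second
  list: the augmentation absorbs H^0 of N/K.\<close>

lemma row_exact_1:
  assumes g: "cochain2 G N K \<psi> p (Suc 0) g"
    and closed: "\<And>xs ys. xs \<in> tuples G p \<Longrightarrow> ys \<in> tuples G (Suc (Suc 0)) \<Longrightarrow> cobd (g xs) ys = 0"
  shows "\<exists>h. cochain2 G N K \<psi> p 0 h \<and> (\<forall>xs\<in>tuples G p. \<forall>ys\<in>tuples G (Suc 0). g xs ys = cobd (h xs) ys)"
proof -
  have const: "g xs [u] = g xs [v]" if "xs \<in> tuples G p" "u \<in> carrier G" "v \<in> carrier G" for xs u v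
    using closed[of xs "[u, v]"] that by simp
  have "cochain2 G N K \<psi> p 0 (\<lambda>xs ys. g xs [\<one>])"
    unfolding cochain2_def
  proof (intro ballI allI impI)
    fix \<gamma> xs xs' ys ys'
    assume *: "\<gamma> \<in> carrier G" "length xs = p" "list_all2 (grel G N \<gamma>) xs xs'"
    have "g xs' [\<gamma>] = \<psi> \<gamma> * g xs [\<one>]"
      by (rule cochain2_apply[OF g]) (use * grel_K_left[of \<gamma> \<one>] in auto)
    moreover have "g xs' [\<one>] = g xs' [\<gamma>]"
      using * grel_tuples[OF *(3)] by (intro const) auto
    ultimately show "g xs' [\<one>] = \<psi> \<gamma> * g xs [\<one>]" by simp
  qed
  moreover have "g xs ys = cobd (\<lambda>_. g xs [\<one>]) ys" if xs: "xs \<in> tuples G p" and ys: "ys \<in> tuples G (Suc 0)" for xs ys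
  proof -
    obtain y where "ys = [y]" "y \<in> carrier G" using ys by (auto simp: tuples_Suc_iff)
    then show ?thesis using const[OF xs, of y \<one>] by simp
  qed
  ultimately show ?thesis by (intro exI[of _ "\<lambda>xs ys. g xs [\<one>]"] conjI ballI)
qed

text \<open>For fixed \<open>xs\<close> the second vertices can be pushed into the coset of N
  through the first left vertex, which modulo K is a copy of the image of \<alpha>. There
  \<open>locally_cyclic_acyclic\<close> applies, and a prism accounts for the pushing.\<close>

lemma row_exact_higher:
  assumes g: "cochain2 G N K \<psi> (Suc p) (Suc (Suc (Suc q))) g"
    and closed: "\<And>xs ys. xs \<in> tuples G (Suc p) \<Longrightarrow> ys \<in> tuples G (Suc (Suc (Suc (Suc q)))) \<Longrightarrow> cobd (g xs) ys = 0"
  shows "\<exists>h. cochain2 G N K \<psi> (Suc p) (Suc (Suc q)) h \<and>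
    (\<forall>xs\<in>tuples G (Suc p). \<forall>ys\<in>tuples G (Suc (Suc (Suc q))). g xs ys = cobd (h xs) ys)"
proof -
  let ?A = "\<alpha> ` N"
  obtain k where k: "\<And>y. y \<in> carrier G \<Longrightarrow> k y \<in> ?A"
    "\<And>b y. b \<in> N \<Longrightarrow> y \<in> carrier G \<Longrightarrow> k (b \<otimes> y) = \<alpha> b + k y"
    using exists_fibre_coordinate by blast
  have "\<forall>a\<in>?A. \<exists>n. n \<in> N \<and> \<alpha> n = a" by blast
  then obtain \<beta> where \<beta>: "\<And>a. a \<in> ?A \<Longrightarrow> \<beta> a \<in> N" "\<And>a. a \<in> ?A \<Longrightarrow> \<alpha> (\<beta> a) = a"
    using bchoice[of ?A "\<lambda>a n. n \<in> N \<and> \<alpha> n = a"] by blast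
  define crd where "crd x y = k (inv x \<otimes> y)" for x y
  have crdA: "crd x y \<in> ?A" if "x \<in> carrier G" "y \<in> carrier G" for x y
    using that by (simp add: crd_def k(1))
  have kK: "k (y \<otimes> n) = k y" if "n \<in> K" "y \<in> carrier G" for y n
  proof -
    have "y \<otimes> n = (y \<otimes> (n \<otimes> inv y)) \<otimes> y" using that by (simp add: m_assoc)
    then have "k (y \<otimes> n) = \<alpha> (y \<otimes> (n \<otimes> inv y)) + k y" using k(2)[OF N_conj] that by simp
    moreover have "\<alpha> (y \<otimes> (n \<otimes> inv y)) = 0" using \<alpha>_conj_assoc[of y n] that by simp
    ultimately show ?thesis by simp
  qed
  have crd_rel: "crd x' y' = crd x y - \<alpha> m"
    if "\<gamma> \<in> carrier G" "x \<in> carrier G" "m \<in> N" "x' = \<gamma> \<otimes> x \<otimes> m" and yy: "grel G K \<gamma> y y'" for \<gamma> x x' m y y'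
  proof -
    obtain n where n: "n \<in> K" "y' = \<gamma> \<otimes> y \<otimes> n" "y \<in> carrier G" using yy by (rule grelE) auto
    have "inv x' \<otimes> y' = inv m \<otimes> (inv x \<otimes> y) \<otimes> n" using that n by (simp add: group_word_simps)
    then show ?thesis using kK[OF n(1), of "inv m \<otimes> (inv x \<otimes> y)"] k(2)[of "inv m" "inv x \<otimes> y"] that n
      by (simp add: crd_def)
  qed
  \<comment> \<open>Restriction of the row to the fibre through the first left vertex, written in
    the rational coordinate. Division by \<psi> makes it invariant under G; the value 0 elsewhere
    turns agreement on the relevant lists into equality of functions.\<close>
  define \<phi> where "\<phi> xs as = (if set as \<subseteq> ?A \<and> length as = Suc (Suc (Suc q)) then g xs (map (\<lambda>a. hd xs \<otimes> \<beta> a) as) / \<psi> (hd xs) else 0)" for xs as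
  have fibre: "map (\<lambda>a. x \<otimes> \<beta> a) as \<in> tuples G r" if "x \<in> carrier G" "set as \<subseteq> ?A" "length as = r" for x as r
    using that \<beta>(1) by (auto simp: tuples_def)
  have \<beta>_rel: "grel G K \<gamma> (x \<otimes> \<beta> (a + \<alpha> m)) (\<gamma> \<otimes> x \<otimes> m \<otimes> \<beta> a)"
    if "\<gamma> \<in> carrier G" "x \<in> carrier G" "m \<in> N" "a \<in> ?A" for \<gamma> x m a
  proof -
    have s: "a + \<alpha> m \<in> ?A" using that by (intro rat_subgroup_add rat_subgroup_image) auto
    have "inv (\<beta> (a + \<alpha> m)) \<otimes> m \<otimes> \<beta> a \<in> K" using \<beta>[OF s] \<beta>[OF that(4)] that by (simp add: \<alpha>_mult)
    moreover have "inv (x \<otimes> \<beta> (a + \<alpha> m)) \<otimes> (inv \<gamma> \<otimes> (\<gamma> \<otimes> x \<otimes> m \<otimes> \<beta> a)) = inv (\<beta> (a + \<alpha> m)) \<otimes> m \<otimes> \<beta> a"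
      using \<beta>(1)[OF s] \<beta>(1)[OF that(4)] that by (simp add: group_word_simps)
    ultimately show ?thesis using \<beta>(1)[OF s] \<beta>(1)[OF that(4)] that by (intro grelI) simp_all
  qed
  have \<phi>_inv: "\<phi> xs (map ((+) c) as) = \<phi> xs as"
    if xs: "xs \<in> tuples G (Suc p)" and c: "c \<in> ?A" and "set as \<subseteq> ?A" "length as = Suc (Suc (Suc q))" for xs c as
  proof -
    obtain x us where x: "xs = x # us" "x \<in> carrier G" using xs by (auto simp: tuples_Suc_iff)
    obtain b where b: "b \<in> N" "c = \<alpha> b" using c by blast
    let ?\<gamma> = "x \<otimes> (inv b \<otimes> inv x)"
    have \<gamma>: "?\<gamma> \<in> N" using N_conj x b by simp
    have sA: "set (map ((+) c) as) \<subseteq> ?A" using that rat_subgroup_add[OF rat_subgroup_image c] by auto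
    have eq: "?\<gamma> \<otimes> x \<otimes> b \<otimes> \<beta> a = x \<otimes> \<beta> a" if "a \<in> ?A" for a
      using \<beta>(1)[OF that] x b by (simp add: m_assoc)
    have "list_all2 (grel G K ?\<gamma>) (map (\<lambda>a. x \<otimes> \<beta> a) (map ((+) c) as)) (map (\<lambda>a. x \<otimes> \<beta> a) as)"
    proof -
      have "grel G K ?\<gamma> (x \<otimes> \<beta> (c + a)) (x \<otimes> \<beta> a)" if "a \<in> set as" for a
        using \<beta>_rel[of ?\<gamma> x b a] eq[of a] that \<open>set as \<subseteq> ?A\<close> x b by (auto simp: add.commute)
      then show ?thesis by (auto simp: list_all2_map1 list_all2_map2 list_all2_same)
    qed
    then have "g xs (map (\<lambda>a. x \<otimes> \<beta> a) as) = \<psi> ?\<gamma> * g xs (map (\<lambda>a. x \<otimes> \<beta> a) (map ((+) c) as))"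
      by (intro cochain2_apply[OF g]) (use that \<gamma> list_all2_grel_N_self[OF \<gamma> that(1)] in \<open>auto simp: tuples_def\<close>)
    then have "g xs (map (\<lambda>a. x \<otimes> \<beta> a) (map ((+) c) as)) = g xs (map (\<lambda>a. x \<otimes> \<beta> a) as)"
      using triv[OF \<gamma>] by simp
    then show ?thesis using that(3) sA x(1) unfolding \<phi>_def by simp
  qed
  have \<phi>_closed: "cobd (\<phi> xs) as = 0"
    if "xs \<in> tuples G (Suc p)" "set as \<subseteq> ?A" "length as = Suc (Suc (Suc (Suc q)))" for xs as
  proof -
    have x: "hd xs \<in> carrier G" using that(1) by (auto simp: tuples_Suc_iff)
    have "cobd (\<phi> xs) as = cobd (\<lambda>us. (1 / \<psi> (hd xs)) * g xs (map (\<lambda>a. hd xs \<otimes> \<beta> a) us)) as"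
      by (rule cobd_cong) (use that in \<open>auto simp: \<phi>_def\<close>)
    also have "\<dots> = (1 / \<psi> (hd xs)) * cobd (g xs) (map (\<lambda>a. hd xs \<otimes> \<beta> a) as)"
      unfolding cobd_cmult cobd_map ..
    also have "\<dots> = 0" using closed[OF that(1) fibre[OF x that(2,3)]] by simp
    finally show ?thesis .
  qed
  define sol where "sol f = (SOME h. (\<forall>c\<in>?A. \<forall>as. set as \<subseteq> ?A \<longrightarrow> length as = Suc (Suc q) \<longrightarrow>
      h (map ((+) c) as) = h as) \<and>
      (\<forall>as. set as \<subseteq> ?A \<longrightarrow> length as = Suc (Suc (Suc q)) \<longrightarrow> f as = cobd h as))"
    for f :: "rat list \<Rightarrow> complex"
  have sol: "(\<forall>c\<in>?A. \<forall>as. set as \<subseteq> ?A \<longrightarrow> length as = Suc (Suc q) \<longrightarrow>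
      sol (\<phi> xs) (map ((+) c) as) = sol (\<phi> xs) as) \<and>
      (\<forall>as. set as \<subseteq> ?A \<longrightarrow> length as = Suc (Suc (Suc q)) \<longrightarrow> \<phi> xs as = cobd (sol (\<phi> xs)) as)"
    if xs: "xs \<in> tuples G (Suc p)" for xs
  proof -
    obtain a where a: "a \<in> ?A" "a \<noteq> 0" using nz by blast
    show ?thesis
    proof (rule locally_cyclic_acyclic[OF rat_subgroup_image a \<phi>_inv[OF xs] \<phi>_closed[OF xs]])
      fix h assume h: "\<And>c as. c \<in> ?A \<Longrightarrow> set as \<subseteq> ?A \<Longrightarrow> length as = Suc (Suc q) \<Longrightarrow> h (map ((+) c) as) = h as"
        "\<And>as. set as \<subseteq> ?A \<Longrightarrow> length as = Suc (Suc (Suc q)) \<Longrightarrow> \<phi> xs as = cobd h as"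
      show ?thesis unfolding sol_def by (rule someI[of _ h]) (use h in auto)
    qed
  qed
  \<comment> \<open>The retraction of G/K onto the fibre through \<open>x\<close>, at the point with
    the same coordinate.\<close>
  define t where "t x y = x \<otimes> \<beta> (crd x y)" for x y
  define h where "h xs ys = \<psi> (hd xs) * sol (\<phi> xs) (map (crd (hd xs)) ys) + prism (t (hd xs)) (g xs) ys" for xs ys
  have "cochain2 G N K \<psi> (Suc p) (Suc (Suc q)) h"
    unfolding cochain2_def
  proof (intro ballI allI impI)
    fix \<gamma> xs xs' ys ys'
    assume *: "\<gamma> \<in> carrier G" "length xs = Suc p" "length ys = Suc (Suc q)"
      "list_all2 (grel G N \<gamma>) xs xs'" "list_all2 (grel G K \<gamma>) ys ys'"
    then obtain x us x' us' where x: "xs = x # us" "xs' = x' # us'" "grel G N \<gamma> x x'"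
      by (cases xs; cases xs') auto
    obtain m where m: "m \<in> N" "x' = \<gamma> \<otimes> x \<otimes> m" "x \<in> carrier G"
      using x(3) by (rule grelE) simp_all
    note tup = grel_tuples[OF *(4) subset_refl *(1,2)]
    have tupy: "ys \<in> tuples G (Suc (Suc q))" by (rule grel_tuples[OF *(5) _ *(1,3)]) auto
    have \<psi>x: "\<psi> x' = \<psi> \<gamma> * \<psi> x" using m *(1) by (simp add: \<psi>_mult triv)
    have "\<phi> xs' as = \<phi> xs as" for as
    proof (cases "set as \<subseteq> ?A \<and> length as = Suc (Suc (Suc q))")
      case True
      have sA: "set (map ((+) (\<alpha> m)) as) \<subseteq> ?A" using True rat_subgroup_add[OF rat_subgroup_image imageI[OF m(1)]] by auto
      have "grel G K \<gamma> (x \<otimes> \<beta> (\<alpha> m + a)) (x' \<otimes> \<beta> a)" if "a \<in> set as" for a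
        using \<beta>_rel[OF *(1) m(3,1), of a] True that m(2) by (auto simp: add.commute)
      then have "list_all2 (grel G K \<gamma>) (map (\<lambda>a. x \<otimes> \<beta> a) (map ((+) (\<alpha> m)) as)) (map (\<lambda>a. x' \<otimes> \<beta> a) as)"
        by (auto simp: list_all2_map1 list_all2_map2 list_all2_same)
      then have "g xs' (map (\<lambda>a. x' \<otimes> \<beta> a) as) = \<psi> \<gamma> * g xs (map (\<lambda>a. x \<otimes> \<beta> a) (map ((+) (\<alpha> m)) as))"
        by (intro cochain2_apply[OF g]) (use * True in auto)
      then have "\<phi> xs' as = \<phi> xs (map ((+) (\<alpha> m)) as)"
        using sA True x(1,2) \<psi>_nz[OF *(1)] unfolding \<phi>_def by (simp add: \<psi>x)
      then show ?thesis using \<phi>_inv[OF tup(1), of "\<alpha> m" as] True m by simp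
    next
      case False
      then show ?thesis by (simp only: \<phi>_def if_False)
    qed
    then have \<phi>eq: "\<phi> xs' = \<phi> xs" by (rule ext)
    have crds: "crd x' y' = - \<alpha> m + crd x y" if "grel G K \<gamma> y y'" for y y'
      using crd_rel[OF *(1) m(3,1,2) that] by simp
    have "map (crd x') ys' = map ((+) (- \<alpha> m)) (map (crd x) ys)"
      using *(5) by (induction rule: list_all2_induct) (simp_all add: crds)
    moreover have "set (map (crd x) ys) \<subseteq> ?A" using tupy crdA[OF m(3)] by (auto simp: tuples_def)
    moreover have "- \<alpha> m \<in> ?A" using imageI[of "inv m" N \<alpha>] m(1) by simp
    ultimately have "sol (\<phi> xs) (map (crd x') ys') = sol (\<phi> xs) (map (crd x) ys)"
      using sol[OF tup(1)] *(3) by (metis length_map)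
    moreover have "prism (t (hd xs')) (g xs') ys' = \<psi> \<gamma> * prism (t (hd xs)) (g xs) ys"
    proof (rule prism_additive_rel[OF additive_mult_left *(5)])
      fix y y' assume y: "grel G K \<gamma> y y'"
      have yc: "y \<in> carrier G" "y' \<in> carrier G" using grel_carrier[OF y _ *(1)] by auto
      have xc: "x' \<in> carrier G" using m *(1) by simp
      have "crd x y = crd x' y' + \<alpha> m" using crds[OF y] by simp
      then show "grel G K \<gamma> (t (hd xs) y) (t (hd xs') y')"
        using \<beta>_rel[OF *(1) m(3,1) crdA[OF xc yc(2)]] x m(2) by (simp add: t_def)
    next
      fix us vs assume "list_all2 (grel G K \<gamma>) us vs" "length us = Suc (length ys)"
      then show "g xs' vs = \<psi> \<gamma> * g xs us" by (intro cochain2_apply[OF g]) (use * in auto)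
    qed
    ultimately show "h xs' ys' = \<psi> \<gamma> * h xs ys"
      unfolding h_def \<phi>eq using x(1,2) by (simp add: \<psi>x distrib_left)
  qed
  moreover have "g xs ys = cobd (h xs) ys"
    if xs: "xs \<in> tuples G (Suc p)" and ys: "ys \<in> tuples G (Suc (Suc (Suc q)))" for xs ys
  proof -
    obtain x us where x: "xs = x # us" "x \<in> carrier G" using xs by (auto simp: tuples_Suc_iff)
    have cA: "set (map (crd x) ys) \<subseteq> ?A" using ys crdA[OF x(2)] by (auto simp: tuples_def)
    have tc: "t x y \<in> carrier G" if "y \<in> carrier G" for y
      using that x(2) \<beta>(1) crdA[OF x(2) that] by (simp add: t_def)
    have "g xs (map (t x) ys) = \<psi> x * \<phi> xs (map (crd x) ys)"
    proof -
      have "map (t x) ys = map (\<lambda>a. x \<otimes> \<beta> a) (map (crd x) ys)" by (simp add: t_def)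
      then show ?thesis using cA x \<psi>_nz ys by (simp add: \<phi>_def tuples_def del: map_map)
    qed
    also have "\<phi> xs (map (crd x) ys) = cobd (sol (\<phi> xs)) (map (crd x) ys)"
      using sol[OF xs] cA ys by (simp add: tuples_def)
    also have "\<psi> x * \<dots> = cobd (\<lambda>us. \<psi> x * sol (\<phi> xs) (map (crd x) us)) ys"
      by (simp only: cobd_cmult cobd_map)
    finally have "g xs ys = cobd (\<lambda>us. \<psi> x * sol (\<phi> xs) (map (crd x) us)) ys +
        (cobd (prism (t x) (g xs)) ys + prism (t x) (cobd (g xs)) ys)"
      unfolding prism_homotopy by simp
    also have "prism (t x) (cobd (g xs)) ys = 0"
    proof (rule prism_zero)
      fix us assume "set us \<subseteq> set ys \<union> t x ` set ys" "length us = Suc (length ys)"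
      moreover have "set ys \<union> t x ` set ys \<subseteq> carrier G"
        using ys tc by (auto simp: tuples_def)
      ultimately show "cobd (g xs) us = 0"
        using closed[OF xs, of us] ys unfolding tuples_def by auto
    qed
    finally show ?thesis by (simp add: h_def[abs_def] x(1) cobd_add)
  qed
  ultimately show ?thesis by (intro exI[of _ h] conjI ballI)
qed


text \<open>
  The cohomology of \<open>N/K\<close> in degree 1 is one-dimensional and spanned by \<open>\<alpha>\<close>, on which \<open>G\<close> acts
  through the inverse of \<open>\<kappa>\<close>.
\<close>

lemma row_exact_2:
  assumes base: "acyclic_char G N (\<lambda>x. \<psi> x / \<kappa> x)" and ne: "\<gamma>0 \<in> carrier G" "\<psi> \<gamma>0 \<noteq> \<kappa> \<gamma>0"
    and g: "cochain2 G N K \<psi> (Suc p) (Suc (Suc 0)) g"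
    and closed: "\<And>xs ys. xs \<in> tuples G (Suc p) \<Longrightarrow> ys \<in> tuples G (Suc (Suc (Suc 0))) \<Longrightarrow> cobd (g xs) ys = 0"
    and closed': "\<And>xs ys. xs \<in> tuples G (Suc (Suc p)) \<Longrightarrow> ys \<in> tuples G (Suc (Suc 0)) \<Longrightarrow> cobd (\<lambda>zs. g zs ys) xs = 0"
  shows "\<exists>e h. cochain2 G N K \<psi> p (Suc (Suc 0)) e \<and> cochain2 G N K \<psi> (Suc p) (Suc 0) h \<and>
    (\<forall>xs\<in>tuples G p. \<forall>ys\<in>tuples G (Suc (Suc (Suc 0))). cobd (e xs) ys = 0) \<and>
    (p = 0 \<longrightarrow> e = (\<lambda>_ _. 0)) \<and>
    (\<forall>xs\<in>tuples G (Suc p). \<forall>ys\<in>tuples G (Suc (Suc 0)). g xs ys = cobd (\<lambda>zs. e zs ys) xs + cobd (h xs) ys)"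
proof -
  \<comment> \<open>The value on a pair inside one coset of N represents the class in H^1 of N/K. If
    it vanishes, integrating from the first left vertex is independent of the representative of that
    vertex and gives a primitive.\<close>
  have exact_if_class_0: "\<exists>h. cochain2 G N K \<psi> (Suc p) (Suc 0) h \<and>
      (\<forall>xs\<in>tuples G (Suc p). \<forall>ys\<in>tuples G (Suc (Suc 0)). f xs ys = cobd (h xs) ys)"
    if f: "cochain2 G N K \<psi> (Suc p) (Suc (Suc 0)) f"
      and f_closed: "\<And>xs ys. xs \<in> tuples G (Suc p) \<Longrightarrow> ys \<in> tuples G (Suc (Suc (Suc 0))) \<Longrightarrow> cobd (f xs) ys = 0"
      and cls: "\<And>xs b y. xs \<in> tuples G (Suc p) \<Longrightarrow> b \<in> N \<Longrightarrow> y \<in> carrier G \<Longrightarrow> f xs [y, b \<otimes> y] = 0" for f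
  proof -
    have add: "f xs [u, w] = f xs [u, v] + f xs [v, w]"
      if "xs \<in> tuples G (Suc p)" "u \<in> carrier G" "v \<in> carrier G" "w \<in> carrier G" for xs u v w
      using f_closed[of xs "[u, v, w]"] that by (simp add: algebra_simps)
    let ?h = "\<lambda>xs ys. f xs [hd xs, hd ys]"
    have "cochain2 G N K \<psi> (Suc p) (Suc 0) ?h"
      unfolding cochain2_def
    proof (intro ballI allI impI)
      fix \<gamma> xs xs' ys ys'
      assume *: "\<gamma> \<in> carrier G" "length xs = Suc p" "length ys = Suc 0"
        "list_all2 (grel G N \<gamma>) xs xs'" "list_all2 (grel G K \<gamma>) ys ys'"
      then obtain x us x' us' where x: "xs = x # us" "xs' = x' # us'" "grel G N \<gamma> x x'"
        by (cases xs; cases xs') auto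
      obtain y y' where y: "ys = [y]" "ys' = [y']" "grel G K \<gamma> y y'"
        using *(3,5) by (cases ys; cases ys') auto
      obtain m where m: "m \<in> N" "x' = \<gamma> \<otimes> x \<otimes> m" "x \<in> carrier G"
        using x(3) by (rule grelE) simp_all
      have yc: "y \<in> carrier G" "y' \<in> carrier G" using grel_carrier[OF y(3) _ *(1)] by auto
      note tup = grel_tuples[OF *(4) subset_refl *(1,2)]
      have gx: "\<gamma> \<otimes> x \<in> carrier G" using *(1) m by simp
      have c: "(\<gamma> \<otimes> x) \<otimes> (m \<otimes> inv (\<gamma> \<otimes> x)) \<in> N" by (rule N_conj[OF gx m(1)])
      have x': "x' = ((\<gamma> \<otimes> x) \<otimes> (m \<otimes> inv (\<gamma> \<otimes> x))) \<otimes> (\<gamma> \<otimes> x)"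
        using gx m by (simp add: m_assoc del: inv_mult_group)
      have "f xs' [\<gamma> \<otimes> x, y'] = f xs' [\<gamma> \<otimes> x, x'] + f xs' [x', y']"
        by (rule add[OF tup(2)]) (use gx m yc *(1) in simp_all)
      moreover have "f xs' [\<gamma> \<otimes> x, x'] = 0"
        unfolding x' by (rule cls[OF tup(2) c gx])
      moreover have "f xs' [\<gamma> \<otimes> x, y'] = \<psi> \<gamma> * f xs [x, y]"
        by (rule cochain2_apply[OF f]) (use * y m grel_K_left in auto)
      ultimately show "?h xs' ys' = \<psi> \<gamma> * ?h xs ys" by (simp add: x y)
    qed
    moreover have "f xs ys = cobd (?h xs) ys" if xs: "xs \<in> tuples G (Suc p)" and ys: "ys \<in> tuples G (Suc (Suc 0))" for xs ys
    proof -
      obtain y0 y1 where y: "ys = [y0, y1]" "y0 \<in> carrier G" "y1 \<in> carrier G"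
        using ys by (auto simp: tuples_Suc_iff)
      have "hd xs \<in> carrier G" using xs by (auto simp: tuples_Suc_iff)
      then show ?thesis using add[OF xs _ y(2,3), of "hd xs"] y by simp
    qed
    ultimately show ?thesis by (intro exI[of _ ?h] conjI ballI)
  qed
  have left_inv: "g xs (map ((\<otimes>) b) ys) = g xs ys"
    if "b \<in> N" "xs \<in> tuples G (Suc p)" "ys \<in> tuples G (Suc (Suc 0))" for b xs ys
    by (rule cochain2_N_invariant[OF g that])
  have add: "g xs [u, w] = g xs [u, v] + g xs [v, w]"
    if "xs \<in> tuples G (Suc p)" "u \<in> carrier G" "v \<in> carrier G" "w \<in> carrier G" for xs u v w
    using closed[of xs "[u, v, w]"] that by (simp add: algebra_simps)
  have gself: "g xs [u, u] = 0" if "xs \<in> tuples G (Suc p)" "u \<in> carrier G" for xs u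
    using add[OF that that(2,2)] by simp
  have g_base: "g xs [y, b \<otimes> y] = g xs [\<one>, b]"
    if "xs \<in> tuples G (Suc p)" "b \<in> N" "y \<in> carrier G" for xs b y
  proof -
    have "g xs [y, b \<otimes> y] = g xs [y, \<one>] + (g xs [\<one>, b] + g xs [b, b \<otimes> y])"
      using add[of xs y \<one> "b \<otimes> y"] add[of xs \<one> b "b \<otimes> y"] that by simp
    moreover have "g xs [b, b \<otimes> y] = g xs [\<one>, y]"
      using left_inv[of b xs "[\<one>, y]"] that by simp
    moreover have "g xs [y, \<one>] + g xs [\<one>, y] = 0"
      using add[of xs y \<one> y] gself[of xs y] that by simp
    ultimately show ?thesis by simp
  qed
  have g_hom: "g xs [\<one>, b \<otimes> b'] = g xs [\<one>, b] + g xs [\<one>, b']" if "xs \<in> tuples G (Suc p)" "b \<in> N" "b' \<in> N" for xs b b'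
    using add[of xs \<one> b' "b \<otimes> b'"] g_base[of xs b b'] that by simp
  have g_K: "g xs [\<one>, b] = 0" if "xs \<in> tuples G (Suc p)" "b \<in> K" for xs b
  proof -
    have "grel G K \<one> \<one> b" "grel G K \<one> \<one> \<one>" by (rule grelI; use that in simp)+
    then have "g xs [\<one>, b] = \<psi> \<one> * g xs [\<one>, \<one>]"
      by (intro cochain2_apply[OF g]) (use that list_all2_grel_N_self[OF N_one that(1)] in \<open>auto simp: tuples_def\<close>)
    then show ?thesis using gself[OF that(1) one_closed] by simp
  qed
  obtain b0 where b0: "b0 \<in> N" "\<alpha> b0 \<noteq> 0" using nz by blast
  \<comment> \<open>The coefficient of the H^1 class of the row with respect to \<alpha>, read off
    at one element with nonzero \<alpha>. Conjugation rescales \<alpha> by \<kappa>, so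
    \<open>c\<close> belongs to the character \<psi>/\<kappa>.\<close>
  define c where "c xs = g xs [\<one>, b0] / of_rat (\<alpha> b0)" for xs
  have g_c: "g xs [\<one>, b] = of_rat (\<alpha> b) * c xs" if xs: "xs \<in> tuples G (Suc p)" and b: "b \<in> N" for xs b
  proof -
    have "\<forall>a\<in>\<alpha> ` N. \<exists>n. n \<in> N \<and> \<alpha> n = a" by blast
    then obtain \<beta> where \<beta>: "\<And>a. a \<in> \<alpha> ` N \<Longrightarrow> \<beta> a \<in> N" "\<And>a. a \<in> \<alpha> ` N \<Longrightarrow> \<alpha> (\<beta> a) = a"
      using bchoice[of "\<alpha> ` N" "\<lambda>a n. n \<in> N \<and> \<alpha> n = a"] by blast
    have g\<alpha>: "g xs [\<one>, m] = g xs [\<one>, n]" if "m \<in> N" "n \<in> N" "\<alpha> m = \<alpha> n" for m n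
      using g_hom[OF xs, of "m \<otimes> inv n" n] g_K[OF xs, of "m \<otimes> inv n"] that
      by (simp add: m_assoc \<alpha>_mult)
    have "g xs [\<one>, \<beta> (x + y)] = g xs [\<one>, \<beta> x] + g xs [\<one>, \<beta> y]" if "x \<in> \<alpha> ` N" "y \<in> \<alpha> ` N" for x y
    proof -
      have s: "x + y \<in> \<alpha> ` N" by (rule rat_subgroup_add[OF rat_subgroup_image that])
      have "g xs [\<one>, \<beta> (x + y)] = g xs [\<one>, \<beta> x \<otimes> \<beta> y]"
        by (rule g\<alpha>) (use that s in \<open>simp_all only: \<beta> N_mult \<alpha>_mult\<close>)
      then show ?thesis using g_hom[OF xs \<beta>(1)[OF that(1)] \<beta>(1)[OF that(2)]] by simp
    qed
    from additive_on_rat_subgroup_linear[OF rat_subgroup_image, of "\<lambda>a. g xs [\<one>, \<beta> a]", OF this imageI[OF b] imageI[OF b0(1)]]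
    have "g xs [\<one>, \<beta> (\<alpha> b)] * of_rat (\<alpha> b0) = g xs [\<one>, \<beta> (\<alpha> b0)] * of_rat (\<alpha> b)" .
    moreover have "g xs [\<one>, \<beta> (\<alpha> n)] = g xs [\<one>, n]" if "n \<in> N" for n
      by (rule g\<alpha>) (use that \<beta> in auto)
    ultimately show ?thesis using b b0 by (simp add: c_def field_simps)
  qed
  have c: "cochain1 G N (\<lambda>x. \<psi> x / \<kappa> x) (Suc p) c"
    unfolding cochain1_def
  proof (intro ballI allI impI)
    fix \<gamma> xs xs' assume *: "\<gamma> \<in> carrier G" "length xs = Suc p" "list_all2 (grel G N \<gamma>) xs xs'"
    note tup = grel_tuples[OF *(3) subset_refl *(1,2)]
    let ?b = "inv \<gamma> \<otimes> (b0 \<otimes> \<gamma>)"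
    have b: "?b \<in> N" using N_conj'[OF *(1) b0(1)] .
    have "g xs' (map ((\<otimes>) \<gamma>) [\<one>, ?b]) = \<psi> \<gamma> * g xs [\<one>, ?b]"
      by (rule cochain2_apply[OF g]) (use * b list_all2_grel_K_left[of \<gamma> "[\<one>, ?b]"] in auto)
    then have "g xs' [\<gamma>, b0 \<otimes> \<gamma>] = \<psi> \<gamma> * (of_rat (\<alpha> ?b) * c xs)"
      using * b b0 g_c[OF tup(1) b] by simp
    moreover have "g xs' [\<gamma>, b0 \<otimes> \<gamma>] = of_rat (\<alpha> b0) * c xs'"
      using g_base[OF tup(2) b0(1) *(1)] g_c[OF tup(2) b0(1)] by simp
    moreover have "of_rat (\<alpha> b0) = \<kappa> \<gamma> * of_rat (\<alpha> ?b)" using \<alpha>_conj_inv[OF *(1) b0(1)] by simp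
    moreover have "of_rat (\<alpha> b0) \<noteq> (0::complex)" using b0 by simp
    ultimately show "c xs' = \<psi> \<gamma> / \<kappa> \<gamma> * c xs"
      using \<kappa>_nz[OF *(1)] by (simp add: field_simps)
  qed
  have "cobd c xs = 0" if xs: "xs \<in> tuples G (Suc (Suc p))" for xs
  proof -
    have "cobd c xs = cobd (\<lambda>zs. (1 / of_rat (\<alpha> b0)) * g zs [\<one>, b0]) xs" by (simp add: c_def[abs_def])
    also have "\<dots> = (1 / of_rat (\<alpha> b0)) * cobd (\<lambda>zs. g zs [\<one>, b0]) xs" by (rule cobd_cmult)
    also have "\<dots> = 0" using closed'[OF xs, of "[\<one>, b0]"] b0 by simp
    finally show ?thesis .
  qed
  then obtain d where d: "cochain1 G N (\<lambda>x. \<psi> x / \<kappa> x) p d" "\<And>xs. xs \<in> tuples G (Suc p) \<Longrightarrow> c xs = cobd d xs"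
    using base[unfolded acyclic_char_def, rule_format, OF c] by auto
  show ?thesis
  proof (cases p)
    case 0
    \<comment> \<open>A value on the empty list is fixed by the character \<psi>/\<kappa>, and
      \<open>\<gamma>0\<close> witnesses that this character is nontrivial. This removes the class
      that the augmentation would otherwise leave at the edge.\<close>
    have "d [] = \<psi> \<gamma>0 / \<kappa> \<gamma>0 * d []"
      using d(1)[unfolded cochain1_def, rule_format, OF ne(1), of "[]" "[]"] 0 by simp
    then have "d [] = 0" using ne \<kappa>_nz[OF ne(1)] by (auto simp: field_simps)
    then have "c xs = 0" if "xs \<in> tuples G (Suc p)" for xs
      using d(2)[OF that] that 0 by (auto simp: tuples_Suc_iff)
    then have cls: "g xs [y, b \<otimes> y] = 0" if "xs \<in> tuples G (Suc p)" "b \<in> N" "y \<in> carrier G" for xs b y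
      using g_base[OF that] g_c[OF that(1,2)] that(1) by simp
    have "\<exists>h. cochain2 G N K \<psi> (Suc p) (Suc 0) h \<and>
        (\<forall>xs\<in>tuples G (Suc p). \<forall>ys\<in>tuples G (Suc (Suc 0)). g xs ys = cobd (h xs) ys)"
      by (rule exact_if_class_0) fact+
    then obtain h where "cochain2 G N K \<psi> (Suc p) (Suc 0) h"
      "\<forall>xs\<in>tuples G (Suc p). \<forall>ys\<in>tuples G (Suc (Suc 0)). g xs ys = cobd (h xs) ys"
      by (elim exE conjE)
    then show ?thesis
      using cochain2_zero by (intro exI[of _ "\<lambda>_ _. 0"] exI[of _ h]) (simp add: cobd_zero)
  next
    case (Suc r)
    obtain k where k: "\<And>y. y \<in> carrier G \<Longrightarrow> k y \<in> \<alpha> ` N"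
      "\<And>b y. b \<in> N \<Longrightarrow> y \<in> carrier G \<Longrightarrow> k (b \<otimes> y) = \<alpha> b + k y"
      using exists_fibre_coordinate by blast
    have kK: "k (y \<otimes> n) = k y" if "n \<in> K" "y \<in> carrier G" for y n
    proof -
      have "y \<otimes> n = (y \<otimes> (n \<otimes> inv y)) \<otimes> y" using that by (simp add: m_assoc)
      then have "k (y \<otimes> n) = \<alpha> (y \<otimes> (n \<otimes> inv y)) + k y" using k(2)[OF N_conj] that by simp
      moreover have "\<alpha> (y \<otimes> (n \<otimes> inv y)) = 0" using \<alpha>_conj_assoc[of y n] that by simp
      ultimately show ?thesis by simp
    qed
    have crd_rel: "k (inv x' \<otimes> y') = k (inv x \<otimes> y) - \<alpha> m"
      if "\<gamma> \<in> carrier G" "x \<in> carrier G" "m \<in> N" "x' = \<gamma> \<otimes> x \<otimes> m" and yy: "grel G K \<gamma> y y'" for \<gamma> x x' m y y'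
    proof -
      obtain n where n: "n \<in> K" "y' = \<gamma> \<otimes> y \<otimes> n" "y \<in> carrier G" using yy by (rule grelE) auto
      have "inv x' \<otimes> y' = inv m \<otimes> (inv x \<otimes> y) \<otimes> n" using that n by (simp add: group_word_simps)
      then show ?thesis using kK[OF n(1), of "inv m \<otimes> (inv x \<otimes> y)"] k(2)[of "inv m" "inv x \<otimes> y"] that n
        by simp
    qed
    \<comment> \<open>A row cochain whose H^1 class is \<open>d\<close>: a difference of coordinates
      seen from the first left vertex, multiplied by \<kappa> of that vertex to undo the
      conjugation. Its horizontal boundary has class \<open>cobd d\<close>, which is
      \<open>c\<close>.\<close>
    define e where "e xs ys = d xs * \<kappa> (hd xs) * of_rat (k (inv (hd xs) \<otimes> ys ! 1) - k (inv (hd xs) \<otimes> ys ! 0))"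
      for xs ys
    have e: "cochain2 G N K \<psi> p (Suc (Suc 0)) e"
      unfolding cochain2_def
    proof (intro ballI allI impI)
      fix \<gamma> xs xs' ys ys'
      assume *: "\<gamma> \<in> carrier G" "length xs = p" "length ys = Suc (Suc 0)"
        "list_all2 (grel G N \<gamma>) xs xs'" "list_all2 (grel G K \<gamma>) ys ys'"
      then obtain x us x' us' where x: "xs = x # us" "xs' = x' # us'" "grel G N \<gamma> x x'"
        using Suc by (cases xs; cases xs') auto
      obtain m where m: "m \<in> N" "x' = \<gamma> \<otimes> x \<otimes> m" "x \<in> carrier G"
        using x(3) by (rule grelE) simp_all
      have "grel G K \<gamma> (ys ! 0) (ys' ! 0)" "grel G K \<gamma> (ys ! 1) (ys' ! 1)"
        using list_all2_nthD[OF *(5)] *(3) by auto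
      note r = this[THEN crd_rel[OF *(1) m(3,1,2)]]
      have "d xs' = \<psi> \<gamma> / \<kappa> \<gamma> * d xs" using d(1) * unfolding cochain1_def by simp
      moreover have "\<kappa> x' = \<kappa> \<gamma> * \<kappa> x" using m *(1) by (simp add: \<kappa>_mult \<kappa>_N)
      ultimately show "e xs' ys' = \<psi> \<gamma> * e xs ys"
        using \<kappa>_nz[OF *(1)] unfolding e_def x(1,2) list.sel r by simp
    qed
    have e_closed: "cobd (e xs) ys = 0" if "xs \<in> tuples G p" "ys \<in> tuples G (Suc (Suc (Suc 0)))" for xs ys
      using that(2) by (auto simp: tuples_Suc_iff e_def of_rat_diff algebra_simps)
    have e_class: "e xs [y, b \<otimes> y] = d xs * of_rat (\<alpha> b)" if "xs \<in> tuples G p" "b \<in> N" "y \<in> carrier G" for xs b y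
    proof -
      have x: "hd xs \<in> carrier G" using that(1) Suc by (auto simp: tuples_Suc_iff)
      let ?x = "hd xs"
      have "inv ?x \<otimes> (b \<otimes> y) = (inv ?x \<otimes> (b \<otimes> ?x)) \<otimes> (inv ?x \<otimes> y)" using x that by (simp add: m_assoc)
      then have "k (inv ?x \<otimes> (b \<otimes> y)) = \<alpha> (inv ?x \<otimes> (b \<otimes> ?x)) + k (inv ?x \<otimes> y)"
        using k(2)[OF N_conj'[OF x that(2)], of "inv ?x \<otimes> y"] x that by simp
      then have "e xs [y, b \<otimes> y] = d xs * (\<kappa> ?x * of_rat (\<alpha> (inv ?x \<otimes> (b \<otimes> ?x))))"
        by (simp add: e_def mult.assoc)
      then show ?thesis using \<alpha>_conj_inv[OF x that(2)] by simp
    qed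
    let ?f = "\<lambda>xs ys. g xs ys - cobd (\<lambda>zs. e zs ys) xs"
    have f: "cochain2 G N K \<psi> (Suc p) (Suc (Suc 0)) ?f"
      by (intro cochain2_diff g cochain2_cobd_left e)
    have f_closed: "cobd (?f xs) ys = 0" if "xs \<in> tuples G (Suc p)" "ys \<in> tuples G (Suc (Suc (Suc 0)))" for xs ys
    proof -
      have "cobd (\<lambda>ws. cobd (\<lambda>zs. e zs ws) xs) ys = cobd (\<lambda>zs. cobd (e zs) ys) xs"
        by (rule cobd_swap[symmetric])
      also have "\<dots> = 0" by (rule cobd_eq_0_tuples[OF that(1)]) (rule e_closed[OF _ that(2)])
      finally show ?thesis using closed[OF that] by (simp add: cobd_diff)
    qed
    have f_class: "?f xs [y, b \<otimes> y] = 0" if "xs \<in> tuples G (Suc p)" "b \<in> N" "y \<in> carrier G" for xs b y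
    proof -
      have "cobd (\<lambda>zs. e zs [y, b \<otimes> y]) xs = cobd (\<lambda>zs. of_rat (\<alpha> b) * d zs) xs"
        by (rule cobd_cong_tuples[OF that(1)]) (simp add: e_class that)
      also have "\<dots> = of_rat (\<alpha> b) * c xs" unfolding cobd_cmult d(2)[OF that(1)] ..
      finally show ?thesis using g_base[OF that] g_c[OF that(1,2)] by simp
    qed
    have "\<exists>h. cochain2 G N K \<psi> (Suc p) (Suc 0) h \<and>
        (\<forall>xs\<in>tuples G (Suc p). \<forall>ys\<in>tuples G (Suc (Suc 0)). ?f xs ys = cobd (h xs) ys)"
      by (rule exact_if_class_0) fact+
    then obtain h where h: "cochain2 G N K \<psi> (Suc p) (Suc 0) h"
      "\<forall>xs\<in>tuples G (Suc p). \<forall>ys\<in>tuples G (Suc (Suc 0)). ?f xs ys = cobd (h xs) ys"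
      by (elim exE conjE)
    then have "\<forall>xs\<in>tuples G (Suc p). \<forall>ys\<in>tuples G (Suc (Suc 0)). g xs ys = cobd (\<lambda>zs. e zs ys) xs + cobd (h xs) ys"
      by (simp add: diff_eq_eq add.commute)
    then show ?thesis using e h(1) e_closed Suc by (intro exI[of _ e] exI[of _ h]) simp
  qed
qed

end

text \<open>H^0 of N/K contributes the character \<psi> of G/N and H^1 contributes \<psi>/\<kappa>,
  which is why both must be acyclic below. The hypotheses are conditional because they only make
  sense when \<psi> is trivial on N; otherwise \<open>acyclic_of_nontrivial\<close> takes
  over.\<close>

theorem acyclic_extension:
  assumes base: "(\<And>n. n \<in> N \<Longrightarrow> \<psi> n = 1) \<Longrightarrow> acyclic_char G N \<psi>"
    and base': "(\<And>n. n \<in> N \<Longrightarrow> \<psi> n = 1) \<Longrightarrow> acyclic_char G N (\<lambda>x. \<psi> x / \<kappa> x)"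
    and ne: "\<gamma>0 \<in> carrier G" "\<psi> \<gamma>0 \<noteq> \<kappa> \<gamma>0"
  shows "acyclic_char G K \<psi>"
proof (cases "\<exists>a\<in>N. \<psi> a \<noteq> 1")
  case True
  then show ?thesis using acyclic_of_nontrivial by blast
next
  case False
  then have triv: "\<And>n. n \<in> N \<Longrightarrow> \<psi> n = 1" by blast
  show ?thesis
  proof (cases "\<exists>n\<in>N. \<alpha> n \<noteq> 0")
    case False
    then have "K = N" by blast
    then show ?thesis using base[OF triv] by simp
  next
    case nz: True
    interpret join_complex G N K \<psi>
      by unfold_locales (use base[OF triv] in auto)
    show ?thesis
    proof (rule acyclic_if_rows)
      fix p q g
      assume g: "C2 (Suc p) (Suc q) g"
        and closed: "\<And>xs ys. xs \<in> tuples G (Suc p) \<Longrightarrow> ys \<in> tuples G (Suc (Suc q)) \<Longrightarrow> cobd (g xs) ys = 0"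
        and closed': "\<And>xs ys. xs \<in> tuples G (Suc (Suc p)) \<Longrightarrow> ys \<in> tuples G (Suc q) \<Longrightarrow> cobd (\<lambda>zs. g zs ys) xs = 0"
      show "\<exists>e h. C2 p (Suc q) e \<and> C2 (Suc p) q h \<and>
          (\<forall>xs\<in>tuples G p. \<forall>ys\<in>tuples G (Suc (Suc q)). cobd (e xs) ys = 0) \<and>
          (p = 0 \<longrightarrow> e = (\<lambda>_ _. 0)) \<and>
          (\<forall>xs\<in>tuples G (Suc p). \<forall>ys\<in>tuples G (Suc q). g xs ys = cobd (\<lambda>zs. e zs ys) xs + cobd (h xs) ys)"
      \<comment> \<open>Two right vertices are degree 1, the one degree where N/K has cohomology
        besides the part absorbed by the augmentation.\<close>
      proof (cases "q = 1")
        case True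
        then show ?thesis
          using row_exact_2[OF triv nz base'[OF triv] ne, of p g] g closed closed' by simp
      next
        case False
        have "\<exists>h. C2 (Suc p) q h \<and> (\<forall>xs\<in>tuples G (Suc p). \<forall>ys\<in>tuples G (Suc q). g xs ys = cobd (h xs) ys)"
        proof (cases q)
          case 0
          then show ?thesis using row_exact_1[OF triv nz, of "Suc p" g] g closed by simp
        next
          case (Suc r)
          with False obtain r' where "q = Suc (Suc r')" by (cases r) auto
          then show ?thesis using row_exact_higher[OF triv nz, of p r' g] g closed by simp
        qed
        then obtain h where "C2 (Suc p) q h"
          "\<forall>xs\<in>tuples G (Suc p). \<forall>ys\<in>tuples G (Suc q). g xs ys = cobd (h xs) ys" by (elim exE conjE)
        then show ?thesis
          using cochain2_zero by (intro exI[of _ "\<lambda>_ _. 0"] exI[of _ h]) (simp add: cobd_zero)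
      qed
    qed
  qed
qed

end

section \<open>Restriction to subgroups of finite index\<close>

definition lists_of :: "'g set \<Rightarrow> nat \<Rightarrow> 'g list set" where
  "lists_of S q = {xs. set xs \<subseteq> S \<and> length xs = q}"

text \<open>The acting set \<open>S\<close> and the vertex set \<open>T\<close> are separate because
  cochains of a subgroup will also be evaluated on lists over the larger group. Values lie in
  \<open>V\<close> on every list, so sums and prisms stay in \<open>V\<close> without side
  conditions.\<close>

definition equivariant ::
  "('g, 'x) monoid_scheme \<Rightarrow> ('g \<Rightarrow> 'v \<Rightarrow> 'v) \<Rightarrow> 'v set \<Rightarrow> 'g set \<Rightarrow> 'g set \<Rightarrow> nat \<Rightarrow>
    ('g list \<Rightarrow> 'v::ab_group_add) \<Rightarrow> bool"
where
  "equivariant G act V S T q f \<longleftrightarrow> (\<forall>xs. f xs \<in> V) \<and>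
     (\<forall>g\<in>S. \<forall>xs\<in>lists_of T q. f (map ((\<otimes>\<^bsub>G\<^esub>) g) xs) = act g (f xs))"

definition cocycle ::
  "('g, 'x) monoid_scheme \<Rightarrow> ('g \<Rightarrow> 'v \<Rightarrow> 'v) \<Rightarrow> 'v set \<Rightarrow> 'g set \<Rightarrow> nat \<Rightarrow>
    ('g list \<Rightarrow> 'v::ab_group_add) \<Rightarrow> bool"
where
  "cocycle G act V S q f \<longleftrightarrow> equivariant G act V S S q f \<and> (\<forall>xs\<in>lists_of S (Suc q). cobd f xs = 0)"

text \<open>
  The condition at \<open>q = 1\<close> removes the augmentation: only zero bounds in cohomological degree 0.
\<close>

definition bounds ::
  "('g, 'x) monoid_scheme \<Rightarrow> ('g \<Rightarrow> 'v \<Rightarrow> 'v) \<Rightarrow> 'v set \<Rightarrow> 'g set \<Rightarrow> nat \<Rightarrow>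
    ('g list \<Rightarrow> 'v::ab_group_add) \<Rightarrow> bool"
where
  "bounds G act V S q f \<longleftrightarrow> (\<exists>h. equivariant G act V S S (q - 1) h \<and> (q = 1 \<longrightarrow> h [] = 0) \<and>
     (\<forall>xs\<in>lists_of S q. f xs = cobd h xs))"

text \<open>Surjectivity and injectivity of restriction in cohomology, stated on cochains;
  \<open>V\<close> is carried as a set, so submodules need no type of their own.\<close>

definition restriction_iso ::
  "('g, 'x) monoid_scheme \<Rightarrow> ('g \<Rightarrow> 'v \<Rightarrow> 'v) \<Rightarrow> 'v::ab_group_add set \<Rightarrow> 'g set \<Rightarrow> 'g set \<Rightarrow> bool"
where
  "restriction_iso G act V S T \<longleftrightarrow>
     (\<forall>q f. cocycle G act V T q f \<longrightarrow>
       (\<exists>F. cocycle G act V S q F \<and> bounds G act V T q (\<lambda>xs. f xs - F xs))) \<and>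
     (\<forall>q F. cocycle G act V S q F \<longrightarrow> bounds G act V T q F \<longrightarrow> bounds G act V S q F)"

lemma lists_of_Suc_iff: "xs \<in> lists_of S (Suc q) \<longleftrightarrow> (\<exists>y ys. xs = y # ys \<and> y \<in> S \<and> ys \<in> lists_of S q)"
  by (cases xs) (auto simp: lists_of_def)

lemma lists_of_mono: "T \<subseteq> S \<Longrightarrow> lists_of T q \<subseteq> lists_of S q"
  by (auto simp: lists_of_def)

lemma cobd_cong_lists_of:
  assumes "xs \<in> lists_of S q" and "\<And>ys. ys \<in> lists_of S (q - 1) \<Longrightarrow> f ys = g ys"
  shows "cobd f xs = cobd g xs"
  by (rule cobd_cong) (use assms in \<open>auto simp: lists_of_def\<close>)

lemma equivariant_mono:
  "equivariant G act V S T q f \<Longrightarrow> S' \<subseteq> S \<Longrightarrow> T' \<subseteq> T \<Longrightarrow> equivariant G act V S' T' q f"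
  unfolding equivariant_def using lists_of_mono[of T' T q] by blast

lemma cocycle_mono: "cocycle G act V S q f \<Longrightarrow> T \<subseteq> S \<Longrightarrow> cocycle G act V T q f"
  unfolding cocycle_def using equivariant_mono lists_of_mono[of T S "Suc q"] by blast

lemma bounds_mono:
  assumes "bounds G act V S q f" "T \<subseteq> S"
  shows "bounds G act V T q f"
proof -
  obtain h where h: "equivariant G act V S S (q - 1) h" "q = 1 \<longrightarrow> h [] = 0"
    "\<forall>xs\<in>lists_of S q. f xs = cobd h xs"
    using assms(1) unfolding bounds_def by (elim exE conjE)
  show ?thesis unfolding bounds_def
    using equivariant_mono[OF h(1) assms(2,2)] h(2,3) lists_of_mono[OF assms(2), of q]
    by (intro exI[of _ h] conjI) auto
qed

locale equivariant_module =
  fixes G :: "('g, 'x) monoid_scheme" and act :: "'g \<Rightarrow> 'v \<Rightarrow> 'v::ab_group_add" and V :: "'v set"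
    and S :: "'g set"
  assumes act_add: "\<And>g. g \<in> S \<Longrightarrow> Modules.additive (act g)"
    and V_zero: "0 \<in> V" and V_diff: "\<And>u v. u \<in> V \<Longrightarrow> v \<in> V \<Longrightarrow> u - v \<in> V"
begin

lemma V_add: "u \<in> V \<Longrightarrow> v \<in> V \<Longrightarrow> u + v \<in> V"
  using V_diff[of u "0 - v"] V_diff[of 0 v] V_zero by simp

lemma V_cobd: "(\<And>ys. f ys \<in> V) \<Longrightarrow> cobd f xs \<in> V"
  by (induction xs arbitrary: f) (auto simp: V_zero V_diff)

lemma V_prism: "(\<And>ys. f ys \<in> V) \<Longrightarrow> prism t f xs \<in> V"
  by (induction xs arbitrary: f) (auto simp: V_zero V_diff)

lemma equivariant_zero: "S' \<subseteq> S \<Longrightarrow> equivariant G act V S' T q (\<lambda>_. 0)"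
  unfolding equivariant_def using Modules.additive.zero[OF act_add] V_zero by auto

lemma equivariant_add:
  assumes "S' \<subseteq> S" "equivariant G act V S' T q f" "equivariant G act V S' T q g"
  shows "equivariant G act V S' T q (\<lambda>xs. f xs + g xs)"
  using assms Modules.additive.add[OF act_add] V_add unfolding equivariant_def by auto

lemma equivariant_diff:
  assumes "S' \<subseteq> S" "equivariant G act V S' T q f" "equivariant G act V S' T q g"
  shows "equivariant G act V S' T q (\<lambda>xs. f xs - g xs)"
  using assms Modules.additive.diff[OF act_add] V_diff unfolding equivariant_def by auto

lemma equivariant_cobd:
  assumes "S' \<subseteq> S" "equivariant G act V S' T q f"
  shows "equivariant G act V S' T (Suc q) (cobd f)"
  unfolding equivariant_def
proof (intro conjI allI ballI)
  fix xs show "cobd f xs \<in> V" using assms(2) by (intro V_cobd) (auto simp: equivariant_def)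
next
  fix g xs assume g: "g \<in> S'" "xs \<in> lists_of T (Suc q)"
  have "cobd f (map ((\<otimes>\<^bsub>G\<^esub>) g) xs) = cobd (\<lambda>ys. act g (f ys)) xs"
    unfolding cobd_map
    by (rule cobd_cong_lists_of[OF g(2)]) (use assms(2) g(1) in \<open>simp add: equivariant_def\<close>)
  also have "\<dots> = act g (cobd f xs)" by (rule cobd_additive[OF act_add]) (use assms g in auto)
  finally show "cobd f (map ((\<otimes>\<^bsub>G\<^esub>) g) xs) = act g (cobd f xs)" .
qed

lemma bounds_add:
  assumes "S' \<subseteq> S" "bounds G act V S' q f" "bounds G act V S' q g"
  shows "bounds G act V S' q (\<lambda>xs. f xs + g xs)"
proof -
  obtain h where h: "equivariant G act V S' S' (q - 1) h" "q = 1 \<longrightarrow> h [] = 0"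
    "\<forall>xs\<in>lists_of S' q. f xs = cobd h xs"
    using assms(2) unfolding bounds_def by (elim exE conjE)
  obtain k where k: "equivariant G act V S' S' (q - 1) k" "q = 1 \<longrightarrow> k [] = 0"
    "\<forall>xs\<in>lists_of S' q. g xs = cobd k xs"
    using assms(3) unfolding bounds_def by (elim exE conjE)
  show ?thesis unfolding bounds_def
    using equivariant_add[OF assms(1) h(1) k(1)] h k
    by (intro exI[of _ "\<lambda>xs. h xs + k xs"] conjI) (auto simp: cobd_add)
qed

lemma bounds_cong:
  "(\<And>xs. xs \<in> lists_of S' q \<Longrightarrow> f xs = g xs) \<Longrightarrow> bounds G act V S' q f = bounds G act V S' q g"
  unfolding bounds_def by simp

lemma cocycle_diff:
  assumes "S' \<subseteq> S" "cocycle G act V S' q f" "cocycle G act V S' q g"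
  shows "cocycle G act V S' q (\<lambda>xs. f xs - g xs)"
  using assms equivariant_diff unfolding cocycle_def by (simp add: cobd_diff)

lemma restriction_iso_refl: "T \<subseteq> S \<Longrightarrow> restriction_iso G act V T T"
  unfolding restriction_iso_def
proof (intro conjI allI impI)
  fix q f assume T: "T \<subseteq> S" and f: "cocycle G act V T q f"
  have "bounds G act V T q (\<lambda>xs. f xs - f xs)"
    unfolding bounds_def using equivariant_zero[OF T] by (intro exI[of _ "\<lambda>_. 0"]) (simp add: cobd_zero)
  then show "\<exists>F. cocycle G act V T q F \<and> bounds G act V T q (\<lambda>xs. f xs - F xs)"
    using f by (intro exI[of _ f] conjI)
qed

lemma restriction_iso_trans:
  assumes "S1 \<subseteq> S" "S2 \<subseteq> S1" "S3 \<subseteq> S2" "restriction_iso G act V S1 S2" "restriction_iso G act V S2 S3"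
  shows "restriction_iso G act V S1 S3"
  unfolding restriction_iso_def
proof (intro conjI allI impI)
  fix q f assume "cocycle G act V S3 q f"
  then obtain F where F: "cocycle G act V S2 q F" "bounds G act V S3 q (\<lambda>xs. f xs - F xs)"
    using assms(5) unfolding restriction_iso_def by blast
  then obtain E where E: "cocycle G act V S1 q E" "bounds G act V S2 q (\<lambda>xs. F xs - E xs)"
    using assms(4) unfolding restriction_iso_def by blast
  have "bounds G act V S3 q (\<lambda>xs. (f xs - F xs) + (F xs - E xs))"
    by (rule bounds_add) (use assms F bounds_mono[OF E(2)] in auto)
  then show "\<exists>F. cocycle G act V S1 q F \<and> bounds G act V S3 q (\<lambda>xs. f xs - F xs)"
    using E(1) by (intro exI[of _ E]) simp
next
  fix q F assume "cocycle G act V S1 q F" "bounds G act V S3 q F"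
  then show "bounds G act V S1 q F"
    using assms cocycle_mono unfolding restriction_iso_def by metis
qed

text \<open>Two of three: a chain of normal steps reaches only a normal core from each of the two
  groups of interest, and this recovers the restriction between them.\<close>

lemma restriction_iso_cancel:
  assumes "S1 \<subseteq> S" "S2 \<subseteq> S1" "S3 \<subseteq> S2" "restriction_iso G act V S1 S3" "restriction_iso G act V S2 S3"
  shows "restriction_iso G act V S1 S2"
  unfolding restriction_iso_def
proof (intro conjI allI impI)
  fix q f assume f: "cocycle G act V S2 q f"
  then have "cocycle G act V S3 q f" using cocycle_mono assms by blast
  then obtain F where F: "cocycle G act V S1 q F" "bounds G act V S3 q (\<lambda>xs. f xs - F xs)"
    using assms(4) unfolding restriction_iso_def by blast
  have "cocycle G act V S2 q (\<lambda>xs. f xs - F xs)"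
    by (rule cocycle_diff) (use assms f cocycle_mono[OF F(1)] in auto)
  then have "bounds G act V S2 q (\<lambda>xs. f xs - F xs)"
    using F(2) assms(5) unfolding restriction_iso_def by blast
  then show "\<exists>F. cocycle G act V S1 q F \<and> bounds G act V S2 q (\<lambda>xs. f xs - F xs)"
    using F(1) by (intro exI[of _ F]) simp
next
  fix q F assume F: "cocycle G act V S1 q F" "bounds G act V S2 q F"
  then have "bounds G act V S3 q F" using bounds_mono assms(3) by blast
  then show "bounds G act V S1 q F" using F(1) assms(4) unfolding restriction_iso_def by blast
qed

end

definition twist :: "('g \<Rightarrow> complex) \<Rightarrow> ('g \<Rightarrow> ('b \<Rightarrow> complex) \<Rightarrow> 'b \<Rightarrow> complex) \<Rightarrow> 'g \<Rightarrow> ('b \<Rightarrow> complex) \<Rightarrow> 'b \<Rightarrow> complex"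
  where "twist \<sigma> act g v = (\<lambda>b. \<sigma> g * act g v b)"

lemma sum_shift_periodic:
  fixes u :: "nat \<Rightarrow> 'c::ab_group_add"
  shows "u m = u 0 \<Longrightarrow> (\<Sum>i<m. u i) = (\<Sum>i<m. u (Suc i))"
  using sum.lessThan_Suc_shift[of u m] by (simp add: add.commute)

text \<open>
  \<open>S\<close> is generated by \<open>K\<close> and an element \<open>h\<close> normalizing it, and \<open>m\<close> is the order of \<open>h\<close> modulo
  \<open>K\<close>.  A cochain is decomposed into eigenvectors of the action of \<open>h\<close>.
\<close>

locale cyclic_extension = group G for G :: "('a, 'x) monoid_scheme" (structure) +
  fixes act :: "'a \<Rightarrow> ('b \<Rightarrow> complex) \<Rightarrow> 'b \<Rightarrow> complex" and V :: "('b \<Rightarrow> complex) set"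
    and S K :: "'a set" and h :: 'a and m :: nat
  assumes S: "subgroup S G" and K: "subgroup K G" and KS: "K \<subseteq> S" and hS: "h \<in> S"
    and normalizes: "\<And>k. k \<in> K \<Longrightarrow> h \<otimes> k \<otimes> inv h \<in> K" "\<And>k. k \<in> K \<Longrightarrow> inv h \<otimes> k \<otimes> h \<in> K"
    and generates: "\<And>g. g \<in> S \<Longrightarrow> \<exists>i. g \<otimes> inv (h [^] (i::nat)) \<in> K"
    and m: "m > 0" "h [^] m \<in> K" "\<And>i. 0 < i \<Longrightarrow> i < m \<Longrightarrow> h [^] i \<notin> K"
    and V: "fun_vs.subspace V"
    and act_V: "\<And>g v. g \<in> S \<Longrightarrow> v \<in> V \<Longrightarrow> act g v \<in> V"
    and act_plus: "\<And>g u v. g \<in> S \<Longrightarrow> act g (u + v) = act g u + act g v"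
    and act_scale: "\<And>g c v. g \<in> S \<Longrightarrow> act g (\<lambda>b. c * v b) = (\<lambda>b. c * act g v b)"
    and act_one: "\<And>v. v \<in> V \<Longrightarrow> act \<one> v = v"
    and act_mult: "\<And>g g' v. g \<in> S \<Longrightarrow> g' \<in> S \<Longrightarrow> v \<in> V \<Longrightarrow> act (g \<otimes> g') v = act g (act g' v)"
begin

lemma S_carrier [simp]: "g \<in> S \<Longrightarrow> g \<in> carrier G"
  using subgroup.mem_carrier[OF S] .

lemma KS' [simp]: "k \<in> K \<Longrightarrow> k \<in> S" using KS by blast

lemma S_closed [simp]: "g \<in> S \<Longrightarrow> g' \<in> S \<Longrightarrow> g \<otimes> g' \<in> S" "g \<in> S \<Longrightarrow> inv g \<in> S" "\<one> \<in> S"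
  by (rule subgroup.m_closed[OF S] subgroup.m_inv_closed[OF S] subgroup.one_closed[OF S]; assumption)+

lemma K_closed [simp]: "g \<in> K \<Longrightarrow> g' \<in> K \<Longrightarrow> g \<otimes> g' \<in> K" "g \<in> K \<Longrightarrow> inv g \<in> K" "\<one> \<in> K"
  by (rule subgroup.m_closed[OF K] subgroup.m_inv_closed[OF K] subgroup.one_closed[OF K]; assumption)+

lemma hpow [simp]: "h [^] (i::nat) \<in> S"
  by (induction i) (use hS in auto)

lemma normalizes_pow:
  "k \<in> K \<Longrightarrow> h [^] (i::nat) \<otimes> k \<otimes> inv (h [^] i) \<in> K \<and> inv (h [^] i) \<otimes> k \<otimes> h [^] i \<in> K"
proof (induction i arbitrary: k)
  case (Suc i)
  have "h [^] Suc i \<otimes> k \<otimes> inv (h [^] Suc i) = h [^] i \<otimes> (h \<otimes> k \<otimes> inv h) \<otimes> inv (h [^] i)"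
    "inv (h [^] Suc i) \<otimes> k \<otimes> h [^] Suc i = inv h \<otimes> (inv (h [^] i) \<otimes> k \<otimes> h [^] i) \<otimes> h"
    using Suc.prems hS by (simp_all add: group_word_simps)
  then show ?case using Suc normalizes by auto
qed simp

interpretation equivariant_module G act V S
proof
  show "act g (x + y) = act g x + act g y" if "g \<in> S" for g x y using act_plus[OF that] .
  show "0 \<in> V" by (rule fun_vs.subspace_0[OF V])
  show "u - v \<in> V" if "u \<in> V" "v \<in> V" for u v by (rule fun_vs.subspace_diff[OF V that])
qed

definition idx :: "'a \<Rightarrow> nat" where
  "idx g = (LEAST i. g \<otimes> inv (h [^] i) \<in> K)"

lemma idx: "g \<in> S \<Longrightarrow> g \<otimes> inv (h [^] idx g) \<in> K"
  unfolding idx_def using generates by (rule LeastI_ex)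

lemma idx_left: "k \<in> K \<Longrightarrow> g \<in> S \<Longrightarrow> idx (k \<otimes> g) = idx g"
proof -
  assume *: "k \<in> K" "g \<in> S"
  have "k \<otimes> g \<otimes> inv (h [^] i) \<in> K \<longleftrightarrow> g \<otimes> inv (h [^] i) \<in> K" for i :: nat
  proof
    assume "k \<otimes> g \<otimes> inv (h [^] i) \<in> K"
    then have "inv k \<otimes> (k \<otimes> g \<otimes> inv (h [^] i)) \<in> K" using * by simp
    then show "g \<otimes> inv (h [^] i) \<in> K" using * by (simp add: m_assoc)
  qed (use * in \<open>simp add: m_assoc\<close>)
  then show ?thesis by (simp add: idx_def)
qed

lemma idx_K: "k \<in> K \<Longrightarrow> idx k = 0"
  unfolding idx_def by (rule Least_equality) auto

lemma pow_in_K: "h [^] i \<in> K \<longleftrightarrow> m dvd i"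
proof
  have pm: "h [^] (m * j) \<in> K" for j
  proof (induction j)
    case (Suc j)
    have "h [^] (m * Suc j) = h [^] m \<otimes> h [^] (m * j)" using hS by (simp add: nat_pow_mult)
    then show ?case using Suc m by simp
  qed simp
  show "h [^] i \<in> K" if "m dvd i" using that pm by (auto elim: dvdE)
  assume i: "h [^] i \<in> K"
  have "h [^] i = h [^] (m * (i div m)) \<otimes> h [^] (i mod m)"
    using hS by (simp add: nat_pow_mult)
  then have "h [^] (i mod m) = inv (h [^] (m * (i div m))) \<otimes> h [^] i" using hS by simp
  then have "h [^] (i mod m) \<in> K" using pm i by simp
  then show "m dvd i" using m(1) m(3)[of "i mod m"] by (auto simp: mod_eq_0_iff_dvd[symmetric])
qed

definition root_char :: "complex \<Rightarrow> 'a \<Rightarrow> complex" where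
  "root_char \<zeta> g = \<zeta> ^ idx g"

text \<open>Two exponents of \<open>g\<close> modulo K differ by a multiple of the order
  \<open>m\<close>, so any exponent may replace the least one; multiplicativity of
  \<open>root_char\<close> rests on this.\<close>

lemma root_char_eq:
  assumes \<zeta>: "\<zeta> ^ m = 1" and g: "g \<in> S" "g \<otimes> inv (h [^] i) \<in> K"
  shows "root_char \<zeta> g = \<zeta> ^ i"
proof -
  have le: "idx g \<le> i" unfolding idx_def using g(2) by (rule Least_le)
  have "h [^] i = h [^] (i - idx g) \<otimes> h [^] idx g" using le hS by (simp add: nat_pow_mult)
  then have "h [^] (i - idx g) = inv (g \<otimes> inv (h [^] i)) \<otimes> (g \<otimes> inv (h [^] idx g))"
    using hS g(1) by (simp add: group_word_simps)
  then have "m dvd (i - idx g)" using idx[OF g(1)] g(2) by (simp flip: pow_in_K)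
  then obtain j where "i - idx g = m * j" by (auto elim: dvdE)
  then have "i = idx g + m * j" using le by simp
  then show ?thesis using \<zeta> by (simp add: root_char_def power_add power_mult)
qed

lemma root_char_K: "k \<in> K \<Longrightarrow> root_char \<zeta> k = 1"
  by (simp add: root_char_def idx_K)

lemma root_char_h: "\<zeta> ^ m = 1 \<Longrightarrow> root_char \<zeta> h = \<zeta>"
  using root_char_eq[of \<zeta> h 1] hS by simp

lemma root_char_mult:
  assumes "\<zeta> ^ m = 1" "g \<in> S" "g' \<in> S"
  shows "root_char \<zeta> (g \<otimes> g') = root_char \<zeta> g * root_char \<zeta> g'"
proof -
  let ?i = "idx g" and ?j = "idx g'"
  have "h [^] (?i + ?j) = h [^] ?i \<otimes> h [^] ?j" using hS by (simp add: nat_pow_mult)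
  then have "g \<otimes> g' \<otimes> inv (h [^] (?i + ?j)) =
      (g \<otimes> inv (h [^] ?i)) \<otimes> (h [^] ?i \<otimes> (g' \<otimes> inv (h [^] ?j)) \<otimes> inv (h [^] ?i))"
    using assms hS by (simp add: group_word_simps)
  also have "\<dots> \<in> K"
    using idx[OF assms(2)] normalizes_pow[OF idx[OF assms(3)], of ?i] by simp
  finally show ?thesis
    using root_char_eq[OF assms(1)] assms by (simp add: root_char_def power_add)
qed

definition translate :: "nat \<Rightarrow> ('a list \<Rightarrow> 'b \<Rightarrow> complex) \<Rightarrow> 'a list \<Rightarrow> 'b \<Rightarrow> complex" where
  "translate i F xs = act (h [^] i) (F (map ((\<otimes>) (inv (h [^] i))) xs))"

text \<open>The eigenprojection for the operator that sends a cochain to its translate by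
  \<open>h\<close>, of order \<open>m\<close> on cochains equivariant under K. Its eigenvalue is the
  inverse of \<zeta>, so that the result is equivariant for the action twisted by \<zeta>.\<close>

definition component :: "complex \<Rightarrow> ('a list \<Rightarrow> 'b \<Rightarrow> complex) \<Rightarrow> 'a list \<Rightarrow> 'b \<Rightarrow> complex" where
  "component \<zeta> F xs = (\<Sum>i<m. (\<lambda>b. \<zeta> ^ i / of_nat m * translate i F xs b))"

lemma additive_act: "g \<in> S \<Longrightarrow> Modules.additive (act g)"
  by unfold_locales (rule act_plus)

lemma additive_scale: "Modules.additive (\<lambda>(v::'b \<Rightarrow> complex) b. c * v b)"
  by unfold_locales (auto simp: fun_eq_iff distrib_left)

lemma cobd_component: "cobd (component \<zeta> F) xs = component \<zeta> (cobd F) xs"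
proof -
  have "cobd (translate i F) xs = translate i (cobd F) xs" for i
    unfolding translate_def cobd_map by (rule cobd_additive[OF additive_act]) simp
  then have "cobd (\<lambda>ys b. \<zeta> ^ i / of_nat m * translate i F ys b) xs =
      (\<lambda>b. \<zeta> ^ i / of_nat m * translate i (cobd F) xs b)" for i
    using cobd_additive[OF additive_scale[of "\<zeta> ^ i / of_nat m"], of "translate i F" xs] by simp
  then show ?thesis unfolding component_def[abs_def] cobd_sum by simp
qed

lemma lists_of_translate: "g \<in> S \<Longrightarrow> xs \<in> lists_of S q \<Longrightarrow> map ((\<otimes>) g) xs \<in> lists_of S q"
  by (auto simp: lists_of_def)

lemma map_mult_map:
  assumes "g \<in> S" "g' \<in> S" "xs \<in> lists_of S q"
  shows "map ((\<otimes>) g) (map ((\<otimes>) g') xs) = map ((\<otimes>) (g \<otimes> g')) xs"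
  using assms by (auto simp: lists_of_def m_assoc)

text \<open>Equivariance under K survives since powers of \<open>h\<close> normalize K, and
  translation by \<open>h\<close> shifts the summation index, which produces one factor \<zeta>.
  Powers of \<open>h\<close> and K together give all of S.\<close>

lemma component_equivariant:
  assumes F: "equivariant G act V K S q F" and \<zeta>: "\<zeta> ^ m = 1"
  shows "equivariant G (twist (root_char \<zeta>) act) V S S q (component \<zeta> F)"
proof -
  have FV: "F xs \<in> V" for xs using F by (simp add: equivariant_def)
  have tV: "translate i F xs \<in> V" for i xs unfolding translate_def by (intro act_V FV) simp
  have cV: "component \<zeta> F xs \<in> V" for xs
    unfolding component_def by (intro fun_vs.subspace_sum[OF V] fun_vs.subspace_scale[OF V] tV)
  have tr_K: "translate i F (map ((\<otimes>) k) xs) = act k (translate i F xs)"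
    if k: "k \<in> K" and xs: "xs \<in> lists_of S q" for i k xs
  proof -
    let ?k = "inv (h [^] i) \<otimes> k \<otimes> h [^] i"
    have k': "?k \<in> K" using normalizes_pow[OF k] by blast
    let ?ys = "map ((\<otimes>) (inv (h [^] i))) xs"
    have ys: "?ys \<in> lists_of S q" by (rule lists_of_translate[OF _ xs]) simp
    have "map ((\<otimes>) (inv (h [^] i))) (map ((\<otimes>) k) xs) = map ((\<otimes>) ?k) ?ys"
      using xs k by (auto simp: lists_of_def m_assoc)
    then have "translate i F (map ((\<otimes>) k) xs) = act (h [^] i) (act ?k (F ?ys))"
      using F k' ys by (simp add: translate_def equivariant_def del: map_map)
    also have "\<dots> = act (h [^] i \<otimes> ?k) (F ?ys)" using k' FV by (simp add: act_mult)
    also have "h [^] i \<otimes> ?k = k \<otimes> h [^] i" using k by (simp add: m_assoc)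
    also have "act (k \<otimes> h [^] i) (F ?ys) = act k (translate i F xs)"
      using k FV by (simp add: act_mult translate_def)
    finally show ?thesis .
  qed
  have act_comp: "act g (component \<zeta> F xs) = (\<Sum>i<m. (\<lambda>b. \<zeta> ^ i / of_nat m * act g (translate i F xs) b))"
    if "g \<in> S" for g xs
    unfolding component_def Modules.additive.sum[OF additive_act[OF that]] act_scale[OF that] ..
  have comp_K: "component \<zeta> F (map ((\<otimes>) k) xs) = act k (component \<zeta> F xs)"
    if k: "k \<in> K" and xs: "xs \<in> lists_of S q" for k xs
    unfolding act_comp[OF KS'[OF k]] unfolding component_def tr_K[OF k xs] ..
  have tr_h: "translate (Suc i) F (map ((\<otimes>) h) xs) = act h (translate i F xs)"
    if xs: "xs \<in> lists_of S q" for i xs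
  proof -
    have "h [^] Suc i = h \<otimes> h [^] i" using nat_pow_mult[of h 1 i] hS by simp
    then have e: "map ((\<otimes>) (inv (h [^] Suc i))) (map ((\<otimes>) h) xs) = map ((\<otimes>) (inv (h [^] i))) xs"
      "\<And>ys. act (h [^] Suc i) (F ys) = act h (act (h [^] i) (F ys))"
      using xs hS FV by (auto simp: lists_of_def group_word_simps act_mult simp del: nat_pow_Suc)
    show ?thesis unfolding translate_def e ..
  qed
  have tr_m: "translate m F xs = translate 0 F xs" if xs: "xs \<in> lists_of S q" for xs
  proof -
    let ?ys = "map ((\<otimes>) (inv (h [^] m))) xs"
    have "?ys \<in> lists_of S q" by (rule lists_of_translate[OF _ xs]) simp
    then have "translate m F xs = F (map ((\<otimes>) (h [^] m)) ?ys)"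
      using F m(2) by (simp add: translate_def equivariant_def del: map_map)
    also have "map ((\<otimes>) (h [^] m)) ?ys = xs"
      using xs by (auto simp: lists_of_def subset_iff intro!: map_idI)
    also have "F xs = translate 0 F xs"
    proof -
      have "map ((\<otimes>) \<one>) xs = xs" using xs by (auto simp: lists_of_def subset_iff intro!: map_idI)
      then show ?thesis using FV by (simp add: translate_def act_one)
    qed
    finally show ?thesis .
  qed
  have comp_h: "component \<zeta> F (map ((\<otimes>) h) xs) = (\<lambda>b. \<zeta> * act h (component \<zeta> F xs) b)"
    if xs: "xs \<in> lists_of S q" for xs
  proof
    fix b
    let ?u = "\<lambda>i. \<zeta> ^ i / of_nat m * translate i F (map ((\<otimes>) h) xs) b"
    have xs': "map ((\<otimes>) h) xs \<in> lists_of S q" by (rule lists_of_translate[OF hS xs])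
    \<comment> \<open>The shift closes up because \<zeta> is an m-th root of unity and
      \<open>h\<close> to the power \<open>m\<close> lies in K, under which \<open>F\<close> is
      equivariant.\<close>
    have "?u m = ?u 0" using \<zeta> tr_m[OF xs'] by simp
    then have "(\<Sum>i<m. ?u i) = (\<Sum>i<m. ?u (Suc i))"
      by (rule sum_shift_periodic)
    also have "\<dots> = (\<Sum>i<m. \<zeta> * (\<zeta> ^ i / of_nat m * act h (translate i F xs) b))"
      by (intro sum.cong refl) (simp add: tr_h[OF xs] del: list.map)
    finally show "component \<zeta> F (map ((\<otimes>) h) xs) b = \<zeta> * act h (component \<zeta> F xs) b"
      unfolding act_comp[OF hS] unfolding component_def sum_apply sum_distrib_left .
  qed
  have comp_pow: "component \<zeta> F (map ((\<otimes>) (h [^] i)) xs) = (\<lambda>b. \<zeta> ^ i * act (h [^] i) (component \<zeta> F xs) b)"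
    if xs: "xs \<in> lists_of S q" for i xs
  proof (induction i)
    case 0
    have "map ((\<otimes>) \<one>) xs = xs" using xs by (auto simp: lists_of_def subset_iff intro!: map_idI)
    then show ?case using cV by (simp add: act_one)
  next
    case (Suc i)
    have e: "h [^] Suc i = h \<otimes> h [^] i" using nat_pow_mult[of h 1 i] hS by simp
    have "map ((\<otimes>) (h [^] Suc i)) xs = map ((\<otimes>) h) (map ((\<otimes>) (h [^] i)) xs)"
      unfolding e by (rule map_mult_map[symmetric, OF hS _ xs]) simp
    then have "component \<zeta> F (map ((\<otimes>) (h [^] Suc i)) xs) =
        (\<lambda>b. \<zeta> * act h (component \<zeta> F (map ((\<otimes>) (h [^] i)) xs)) b)"
      by (simp only: comp_h[OF lists_of_translate[OF hpow xs]])
    also have "\<dots> = (\<lambda>b. \<zeta> ^ Suc i * act (h [^] Suc i) (component \<zeta> F xs) b)"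
      unfolding Suc act_scale[OF hS] e act_mult[OF hS hpow cV] power_Suc mult.assoc ..
    finally show ?case .
  qed
  show ?thesis unfolding equivariant_def
  proof (intro conjI allI ballI cV)
    fix g xs assume g: "g \<in> S" and xs: "xs \<in> lists_of S q"
    let ?i = "idx g" let ?k = "g \<otimes> inv (h [^] ?i)"
    have k: "?k \<in> K" by (rule idx[OF g])
    have gk: "g = ?k \<otimes> h [^] ?i" using g by (simp add: m_assoc)
    have "map ((\<otimes>) g) xs = map ((\<otimes>) ?k) (map ((\<otimes>) (h [^] ?i)) xs)"
      using map_mult_map[OF _ _ xs, of ?k "h [^] ?i"] k gk by simp
    then have "component \<zeta> F (map ((\<otimes>) g) xs) = act ?k (component \<zeta> F (map ((\<otimes>) (h [^] ?i)) xs))"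
      by (simp only: comp_K[OF k lists_of_translate[OF hpow xs]])
    also have "\<dots> = (\<lambda>b. \<zeta> ^ ?i * act (?k \<otimes> h [^] ?i) (component \<zeta> F xs) b)"
      unfolding comp_pow[OF xs] using k cV by (simp add: act_scale act_mult)
    finally show "component \<zeta> F (map ((\<otimes>) g) xs) = twist (root_char \<zeta>) act g (component \<zeta> F xs)"
      unfolding gk[symmetric] twist_def root_char_def .
  qed
qed

lemma component_one_fixed:
  assumes F: "equivariant G act V S S q F" and xs: "xs \<in> lists_of S q"
  shows "component 1 F xs = F xs"
proof -
  have "translate i F xs = F xs" for i
  proof -
    have "translate i F xs = F (map ((\<otimes>) (h [^] i)) (map ((\<otimes>) (inv (h [^] i))) xs))"
      using F lists_of_translate[OF _ xs, of "inv (h [^] i)"] by (simp add: translate_def equivariant_def del: map_map)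
    also have "map ((\<otimes>) (h [^] i)) (map ((\<otimes>) (inv (h [^] i))) xs) = xs"
      using xs by (auto simp: lists_of_def subset_iff intro!: map_idI)
    finally show ?thesis .
  qed
  then show ?thesis using m(1) by (simp add: component_def fun_eq_iff sum_apply)
qed

text \<open>Orthogonality of roots of unity: summing over \<zeta> annihilates every translate except
  the one with index 0, which is \<open>F\<close>.\<close>

lemma sum_components:
  assumes F: "equivariant G act V K S q F" and xs: "xs \<in> lists_of S q"
  shows "(\<Sum>\<zeta>\<in>{\<zeta>. \<zeta> ^ m = 1}. component \<zeta> F xs) = F xs"
proof
  fix b
  let ?Z = "{\<zeta>::complex. \<zeta> ^ m = 1}"
  have fin: "finite ?Z" and cardZ: "card ?Z = m"
    using m(1) by (auto intro: finite_roots_unity simp: card_roots_unity_eq)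
  have ortho: "(\<Sum>\<zeta>\<in>?Z. \<zeta> ^ i) = 0" if i: "0 < i" "i < m" for i
  proof -
    \<comment> \<open>There are \<open>m\<close> roots of unity, but only \<open>i < m\<close>
      numbers with i-th power 1. Multiplication by such an \<omega> permutes the roots and scales
      the sum by a factor different from 1.\<close>
    have "\<exists>\<omega>\<in>?Z. \<omega> ^ i \<noteq> 1"
    proof (rule ccontr)
      assume "\<not> (\<exists>\<omega>\<in>?Z. \<omega> ^ i \<noteq> 1)"
      then have "?Z \<subseteq> {\<zeta>. \<zeta> ^ i = 1}" by blast
      then have "card ?Z \<le> card {\<zeta>::complex. \<zeta> ^ i = 1}"
        using i by (intro card_mono finite_roots_unity) auto
      also have "\<dots> = i" using i by (intro card_roots_unity_eq)
      finally show False using cardZ i by simp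
    qed
    then obtain \<omega> :: complex where \<omega>: "\<omega> ^ m = 1" "\<omega> ^ i \<noteq> 1" by auto
    then have nz: "\<omega> \<noteq> 0" using m(1) by (metis power_0_left zero_neq_one less_numeral_extra(3))
    have "(\<Sum>\<zeta>\<in>?Z. \<zeta> ^ i) = (\<Sum>\<zeta>\<in>?Z. (\<omega> * \<zeta>) ^ i)"
    proof (rule sum.reindex_bij_witness[of _ "\<lambda>\<zeta>. \<omega> * \<zeta>" "\<lambda>\<zeta>. \<zeta> / \<omega>"])
    qed (use \<omega> nz in \<open>auto simp: power_mult_distrib power_divide\<close>)
    also have "\<dots> = \<omega> ^ i * (\<Sum>\<zeta>\<in>?Z. \<zeta> ^ i)" by (simp add: power_mult_distrib sum_distrib_left)
    finally show ?thesis using \<omega>(2) by simp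
  qed
  have "map ((\<otimes>) \<one>) xs = xs" using xs by (auto simp: lists_of_def subset_iff intro!: map_idI)
  then have tr0: "translate 0 F xs = F xs" using F by (simp add: translate_def act_one equivariant_def)
  have "(\<Sum>\<zeta>\<in>?Z. component \<zeta> F xs) b = (\<Sum>i<m. (\<Sum>\<zeta>\<in>?Z. \<zeta> ^ i) / of_nat m * translate i F xs b)"
    by (simp add: component_def sum_apply sum.swap[of _ ?Z] sum_distrib_right sum_divide_distrib)
  also have "\<dots> = (\<Sum>i<m. if i = 0 then F xs b else 0)"
    using ortho cardZ m(1) tr0 by (intro sum.cong refl) auto
  also have "\<dots> = F xs b" using m(1) by simp
  finally show "(\<Sum>\<zeta>\<in>?Z. component \<zeta> F xs) b = F xs b" .
qed

text \<open>Multiplying away the power of \<open>h\<close> is a left K-equivariant map from S onto K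
  that is the identity on K; it extends cochains of K to lists over S.\<close>

definition retract :: "'a \<Rightarrow> 'a" where
  "retract g = g \<otimes> inv (h [^] idx g)"

lemma retract_K: "g \<in> S \<Longrightarrow> retract g \<in> K"
  unfolding retract_def by (rule idx)

lemma retract_left: "k \<in> K \<Longrightarrow> g \<in> S \<Longrightarrow> retract (k \<otimes> g) = k \<otimes> retract g"
  by (simp add: retract_def idx_left m_assoc)

lemma retract_id: "k \<in> K \<Longrightarrow> retract k = k"
  by (simp add: retract_def idx_K)

lemma map_retract:
  assumes "xs \<in> lists_of S q"
  shows "map retract xs \<in> lists_of K q"
    "k \<in> K \<Longrightarrow> map retract (map ((\<otimes>) k) xs) = map ((\<otimes>) k) (map retract xs)"
  using assms by (auto simp: lists_of_def retract_K retract_left)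

lemma equivariant_retract:
  assumes "equivariant G act V K K q f"
  shows "equivariant G act V K S q (\<lambda>xs. f (map retract xs))"
  using assms map_retract unfolding equivariant_def by (auto simp del: map_map)

lemma map_retract_id: "xs \<in> lists_of K q \<Longrightarrow> map retract xs = xs"
  by (auto simp: lists_of_def retract_id subset_iff intro!: map_idI)

text \<open>
  Cochains of \<open>K\<close> can be computed on lists over \<open>S\<close>: the retraction is homotopic to the identity.
\<close>

lemma bounds_on_S:
  assumes F: "equivariant G act V K S q F" "\<And>xs. xs \<in> lists_of S (Suc q) \<Longrightarrow> cobd F xs = 0"
    and b: "bounds G act V K q F"
  obtains u where "equivariant G act V K S (q - 1) u" "q = 1 \<Longrightarrow> u [] = 0"
    "\<And>xs. xs \<in> lists_of S q \<Longrightarrow> F xs = cobd u xs"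
proof (cases q)
  case 0
  have "[h] \<in> lists_of S (Suc q)" using hS 0 by (simp add: lists_of_def)
  from F(2)[OF this] have "F [] = 0" by simp
  then show thesis
    by (intro that[of "\<lambda>_. 0"] equivariant_zero) (use 0 KS in \<open>auto simp: lists_of_def\<close>)
next
  case (Suc r)
  obtain w where w: "equivariant G act V K K (q - 1) w" "q = 1 \<longrightarrow> w [] = 0"
    "\<forall>xs\<in>lists_of K q. F xs = cobd w xs"
    using b unfolding bounds_def by (elim exE conjE)
  let ?w = "\<lambda>xs. w (map retract xs)"
  have w': "equivariant G act V K S r ?w" using equivariant_retract[OF w(1)] Suc by simp
  let ?F = "\<lambda>xs. F xs - cobd ?w xs"
  have F': "equivariant G act V K S q ?F"
    using equivariant_diff[OF KS F(1)] equivariant_cobd[OF KS w'] Suc by simp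
  have F'_0: "?F (map retract xs) = 0" if xs: "xs \<in> lists_of S q" for xs
  proof -
    have "cobd ?w (map retract xs) = cobd w (map retract xs)"
      by (rule cobd_cong_lists_of[OF map_retract(1)[OF xs]]) (simp add: map_retract_id)
    then show ?thesis using w(3) map_retract(1)[OF xs] by simp
  qed
  let ?p = "prism retract ?F"
  have p: "equivariant G act V K S r ?p"
    unfolding equivariant_def
  proof (intro conjI allI ballI)
    fix xs show "?p xs \<in> V" using F' by (intro V_prism) (auto simp: equivariant_def)
  next
    fix k xs assume k: "k \<in> K" and xs: "xs \<in> lists_of S r"
    show "?p (map ((\<otimes>) k) xs) = act k (?p xs)"
    proof (rule prism_additive_rel[OF additive_act, where r = "\<lambda>x y. x \<in> S \<and> y = k \<otimes> x"])
      show "k \<in> S" using k by simp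
      show "list_all2 (\<lambda>x y. x \<in> S \<and> y = k \<otimes> x) xs (map ((\<otimes>) k) xs)"
        using xs by (simp add: list_all2_map_in_iff lists_of_def)
      show "retract x \<in> S \<and> retract y = k \<otimes> retract x" if "x \<in> S \<and> y = k \<otimes> x" for x y
        using that k retract_K by (simp add: retract_left)
      show "?F vs = act k (?F us)"
        if "list_all2 (\<lambda>x y. x \<in> S \<and> y = k \<otimes> x) us vs" "length us = Suc (length xs)" for us vs
        using that F' k xs Suc unfolding equivariant_def list_all2_map_in_iff
        by (auto simp: lists_of_def)
    qed
  qed
  show thesis
  proof (rule that[of "\<lambda>xs. ?w xs + ?p xs"])
    show "equivariant G act V K S (q - 1) (\<lambda>xs. ?w xs + ?p xs)"
      using equivariant_add[OF KS w' p] Suc by simp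
    show "?w [] + ?p [] = 0" if "q = 1" using w(2) that by simp
    fix xs assume xs: "xs \<in> lists_of S q"
    have "prism retract (cobd ?F) xs = 0"
    proof (rule prism_zero)
      fix us assume "set us \<subseteq> set xs \<union> retract ` set xs" "length us = Suc (length xs)"
      moreover have "set xs \<union> retract ` set xs \<subseteq> S" using xs retract_K by (auto simp: lists_of_def)
      ultimately have "us \<in> lists_of S (Suc q)" using xs unfolding lists_of_def by auto
      then show "cobd ?F us = 0" using F(2) by (simp add: cobd_diff cobd_cobd)
    qed
    then have "cobd ?p xs = ?F xs"
      using prism_homotopy[of retract ?F xs] F'_0[OF xs] by simp
    then show "F xs = cobd (\<lambda>xs. ?w xs + ?p xs) xs" by (simp add: cobd_add)
  qed
qed

text \<open>Surjectivity: a cocycle of K, extended to lists over S, is the sum of its components;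
  the component for 1 is a cocycle of S, and the others are boundaries by \<open>vanish\<close>.
  Injectivity: the component for 1 of a primitive over K is a primitive over S.\<close>

theorem restriction_iso_cyclic:
  assumes vanish: "\<And>\<sigma> q F. (\<And>g g'. g \<in> S \<Longrightarrow> g' \<in> S \<Longrightarrow> \<sigma> (g \<otimes> g') = \<sigma> g * \<sigma> g') \<Longrightarrow>
      (\<And>g. g \<in> S \<Longrightarrow> \<sigma> g ^ m = 1) \<Longrightarrow> (\<exists>g\<in>S. \<sigma> g \<noteq> 1) \<Longrightarrow>
      cocycle G (twist \<sigma> act) V S q F \<Longrightarrow> bounds G (twist \<sigma> act) V S q F"
  shows "restriction_iso G act V S K"
  unfolding restriction_iso_def
proof (intro conjI allI impI)
  fix q f assume f: "cocycle G act V K q f"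
  let ?F = "\<lambda>xs. f (map retract xs)"
  let ?Z = "{\<zeta>::complex. \<zeta> ^ m = 1}"
  have F: "equivariant G act V K S q ?F"
    using f equivariant_retract by (auto simp: cocycle_def)
  have F_closed: "cobd ?F xs = 0" if "xs \<in> lists_of S (Suc q)" for xs
    using f map_retract(1)[OF that] by (simp add: cocycle_def flip: cobd_map)
  have comp: "cocycle G (twist (root_char \<zeta>) act) V S q (component \<zeta> ?F)" if "\<zeta> \<in> ?Z" for \<zeta>
  proof -
    have "component \<zeta> (cobd ?F) xs = 0" if "xs \<in> lists_of S (Suc q)" for xs
    proof -
      have "translate i (cobd ?F) xs = 0" for i
        using F_closed[OF lists_of_translate[OF _ that]] Modules.additive.zero[OF additive_act]
        by (simp add: translate_def)
      then show ?thesis by (simp add: component_def fun_eq_iff sum_apply)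
    qed
    then show ?thesis
      using component_equivariant[OF F] that by (simp add: cocycle_def cobd_component)
  qed
  have bd: "bounds G (twist (root_char \<zeta>) act) V S q (component \<zeta> ?F)" if "\<zeta> \<in> ?Z - {1}" for \<zeta>
  proof (rule vanish)
    show "root_char \<zeta> (g \<otimes> g') = root_char \<zeta> g * root_char \<zeta> g'" if "g \<in> S" "g' \<in> S" for g g'
      using root_char_mult that \<open>\<zeta> \<in> ?Z - {1}\<close> by simp
    show "root_char \<zeta> g ^ m = 1" for g
      using \<open>\<zeta> \<in> ?Z - {1}\<close> by (simp add: root_char_def flip: power_mult) (simp add: mult.commute power_mult)
    show "\<exists>g\<in>S. root_char \<zeta> g \<noteq> 1" using root_char_h hS that by (intro bexI[of _ h]) auto
    show "cocycle G (twist (root_char \<zeta>) act) V S q (component \<zeta> ?F)" using comp that by blast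
  qed
  have triv: "equivariant G act V K K r u" if "equivariant G (twist (root_char \<zeta>) act) V S S r u" for \<zeta> r u
    using equivariant_mono[OF that KS KS] by (auto simp: equivariant_def twist_def root_char_K)
  have one: "cocycle G act V S q (component 1 ?F)"
    using comp[of 1] by (simp add: twist_def[abs_def] root_char_def cocycle_def equivariant_def)
  \<comment> \<open>The twisting character is 1 on K, so a twisted primitive over S is an ordinary
    primitive over K.\<close>
  have bK: "bounds G act V K q (component \<zeta> ?F)" if \<zeta>: "\<zeta> \<in> ?Z - {1}" for \<zeta>
  proof -
    obtain u where u: "equivariant G (twist (root_char \<zeta>) act) V S S (q - 1) u" "q = 1 \<longrightarrow> u [] = 0"
      "\<forall>xs\<in>lists_of S q. component \<zeta> ?F xs = cobd u xs"
      using bd[OF \<zeta>] unfolding bounds_def by (elim exE conjE)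
    show ?thesis unfolding bounds_def
      using triv[OF u(1)] u(2,3) lists_of_mono[OF KS, of q] by (intro exI[of _ u] conjI) auto
  qed
  have "bounds G act V K q (\<lambda>xs. \<Sum>\<zeta>\<in>Y. component \<zeta> ?F xs)" if "finite Y" "Y \<subseteq> ?Z - {1}" for Y
    using that
  proof (induction Y rule: finite_induct)
    case empty
    show ?case unfolding bounds_def
      using equivariant_zero[OF KS] by (intro exI[of _ "\<lambda>_. 0"]) (auto simp: cobd_zero)
  next
    case (insert \<zeta> Y)
    have "(\<lambda>xs. \<Sum>\<zeta>\<in>insert \<zeta> Y. component \<zeta> ?F xs) =
        (\<lambda>xs. component \<zeta> ?F xs + (\<Sum>\<zeta>\<in>Y. component \<zeta> ?F xs))"
      by (rule ext) (simp only: sum.insert[OF insert.hyps])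
    then show ?case using bounds_add[OF KS bK insert.IH, of \<zeta>] insert.prems by simp
  qed
  from this[of "?Z - {1}"] have "bounds G act V K q (\<lambda>xs. \<Sum>\<zeta>\<in>?Z - {1}. component \<zeta> ?F xs)"
    using m(1) by (simp add: finite_roots_unity)
  moreover have "(\<Sum>\<zeta>\<in>?Z - {1}. component \<zeta> ?F xs) = f xs - component 1 ?F xs"
    if xs: "xs \<in> lists_of K q" for xs
  proof -
    have "xs \<in> lists_of S q" using xs lists_of_mono[OF KS] by blast
    from sum_components[OF F this] have "(\<Sum>\<zeta>\<in>?Z. component \<zeta> ?F xs) = f xs"
      using map_retract_id[OF xs] by simp
    then show ?thesis using m(1) by (simp add: sum_diff1 finite_roots_unity)
  qed
  ultimately have "bounds G act V K q (\<lambda>xs. f xs - component 1 ?F xs)"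
    using bounds_cong[of K q "\<lambda>xs. \<Sum>\<zeta>\<in>?Z - {1}. component \<zeta> ?F xs"] by simp
  then show "\<exists>F. cocycle G act V S q F \<and> bounds G act V K q (\<lambda>xs. f xs - F xs)"
    using one by (intro exI[of _ "component 1 ?F"] conjI)
next
  fix q F assume F: "cocycle G act V S q F" "bounds G act V K q F"
  obtain u where u: "equivariant G act V K S (q - 1) u" "q = 1 \<Longrightarrow> u [] = 0"
    "\<And>xs. xs \<in> lists_of S q \<Longrightarrow> F xs = cobd u xs"
  proof (rule bounds_on_S[OF _ _ F(2)])
    show "equivariant G act V K S q F"
      using F(1) equivariant_mono[OF _ KS subset_refl] unfolding cocycle_def by blast
    show "cobd F xs = 0" if "xs \<in> lists_of S (Suc q)" for xs
      using F(1) that unfolding cocycle_def by blast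
  qed blast
  show "bounds G act V S q F" unfolding bounds_def
  proof (intro exI[of _ "component 1 u"] conjI impI ballI)
    show "equivariant G act V S S (q - 1) (component 1 u)"
      using component_equivariant[OF u(1), of 1] by (simp add: twist_def[abs_def] root_char_def)
    show "component 1 u [] = 0" if "q = 1"
    proof -
      have "translate i u [] = 0" for i
        using u(2)[OF that] Modules.additive.zero[OF additive_act[OF hpow]] by (simp add: translate_def)
      then show ?thesis by (simp add: component_def fun_eq_iff sum_apply)
    qed
    fix xs assume xs: "xs \<in> lists_of S q"
    have "translate i (cobd u) xs = translate i F xs" for i
      using u(3)[OF lists_of_translate[OF _ xs]] by (simp add: translate_def)
    then have "component 1 (cobd u) xs = component 1 F xs" by (simp add: component_def)
    also have "\<dots> = F xs" using component_one_fixed[OF _ xs] F(1) by (simp add: cocycle_def)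
    finally show "F xs = cobd (component 1 u) xs" by (simp add: cobd_component)
  qed
qed

end

section \<open>Regular functions and connectedness\<close>

abbreviation regular :: "(complex^'n^'n \<Rightarrow> complex) set" where
  "regular \<equiv> regular_GL UNIV"

lemma regular_const [intro, simp]: "(\<lambda>_. c) \<in> regular"
  unfolding regular_GL_def by (rule alg_gen.const) simp

lemma regular_add [intro]: "f \<in> regular \<Longrightarrow> g \<in> regular \<Longrightarrow> (\<lambda>A. f A + g A) \<in> regular"
  unfolding regular_GL_def by (rule alg_gen.add)

lemma regular_mult [intro]: "f \<in> regular \<Longrightarrow> g \<in> regular \<Longrightarrow> (\<lambda>A. f A * g A) \<in> regular"
  unfolding regular_GL_def by (rule alg_gen.mult)

lemma regular_diff [intro]: "f \<in> regular \<Longrightarrow> g \<in> regular \<Longrightarrow> (\<lambda>A. f A - g A) \<in> regular"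
  using regular_add[OF _ regular_mult[OF regular_const[of "-1"]]] by fastforce

lemma regular_sum [intro]: "(\<And>i. i \<in> I \<Longrightarrow> f i \<in> regular) \<Longrightarrow> (\<lambda>A. \<Sum>i\<in>I. f i A) \<in> regular"
  by (induction I rule: infinite_finite_induct) auto

lemma regular_prod [intro]: "(\<And>i. i \<in> I \<Longrightarrow> f i \<in> regular) \<Longrightarrow> (\<lambda>A. \<Prod>i\<in>I. f i A) \<in> regular"
  by (induction I rule: infinite_finite_induct) auto

lemma regular_entry [intro, simp]: "(\<lambda>A. A $ i $ j) \<in> regular"
  unfolding regular_GL_def by (rule alg_gen.gen) (auto simp: entries_def)

lemma regular_inverse_det [intro, simp]: "(\<lambda>A. inverse (det A)) \<in> regular"
  unfolding regular_GL_def by (rule alg_gen.gen) simp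

lemma regular_GL_mono: "regular_GL K \<subseteq> (regular :: (complex^'n^'n \<Rightarrow> complex) set)"
proof
  fix f :: "complex^'n^'n \<Rightarrow> complex" assume "f \<in> regular_GL K"
  then show "f \<in> regular"
    unfolding regular_GL_def by (induction rule: alg_gen.induct) (auto intro: alg_gen.intros)
qed

lemma regular_det_of:
  assumes "\<And>i j. (\<lambda>A. \<phi> A $ i $ j) \<in> (regular :: (complex^'n^'n \<Rightarrow> complex) set)"
  shows "(\<lambda>A. det (\<phi> A :: complex^'m^'m)) \<in> regular"
  unfolding det_def by (intro regular_sum regular_mult regular_prod assms regular_const)

text \<open>The inverse determinant is a generator of the coordinate ring, so it must be tracked
  along with the entries for regular functions to compose.\<close>

definition regular_map :: "(complex^'n^'n \<Rightarrow> complex^'n^'n) \<Rightarrow> bool" where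
  "regular_map \<phi> \<longleftrightarrow> (\<forall>i j. (\<lambda>A. \<phi> A $ i $ j) \<in> regular) \<and> (\<lambda>A. inverse (det (\<phi> A))) \<in> regular"

lemma regular_compose: "f \<in> regular \<Longrightarrow> regular_map \<phi> \<Longrightarrow> (\<lambda>A. f (\<phi> A)) \<in> regular"
  unfolding regular_GL_def
  by (induction rule: alg_gen.induct)
    (auto simp: regular_map_def regular_GL_def entries_def intro: alg_gen.intros)

lemma regular_map_id [intro, simp]: "regular_map (\<lambda>A. A)"
  by (simp add: regular_map_def)

lemma regular_map_const [intro, simp]: "regular_map (\<lambda>A. c)"
  by (simp add: regular_map_def)

lemma regular_map_mult [intro]:
  assumes "regular_map \<phi>" "regular_map \<theta>"
  shows "regular_map (\<lambda>A. \<phi> A ** \<theta> A)"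
  using assms unfolding regular_map_def det_mul inverse_mult_distrib
  by (auto simp: matrix_matrix_mult_def intro!: regular_sum regular_mult)

text \<open>The inverse given by the adjugate matrix, a regular map; it is 0 on singular matrices.\<close>

definition adj_inv :: "complex^'n^'n \<Rightarrow> complex^'n^'n" where
  "adj_inv A = (\<chi> k j. det (\<chi> i l. if l = k then (if i = j then 1 else 0) else A $ i $ l) * inverse (det A))"

lemma adj_inv_right:
  fixes A :: "complex^'n^'n"
  shows "invertible A \<Longrightarrow> A ** adj_inv A = mat 1"
proof -
  assume "invertible A"
  then have d: "det A \<noteq> 0" by (simp add: invertible_det_nz)
  have "A *v column j (adj_inv A) = axis j 1" for j
  proof -
    have ax: "axis j 1 $ i = (if i = j then 1 else 0 :: complex)" for i by (simp add: axis_def)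
    have "column j (adj_inv A) = (\<chi> k. det (\<chi> i l. if l = k then axis j 1 $ i else A $ i $ l) / det A)"
      unfolding ax by (simp add: adj_inv_def column_def divide_inverse vec_eq_iff)
    then show ?thesis using cramer[OF d, of "column j (adj_inv A)" "axis j 1"] by simp
  qed
  then have "(A ** adj_inv A) $ i $ j = (mat 1 :: complex^'n^'n) $ i $ j" for i j
    by (simp add: matrix_matrix_mult_def matrix_vector_mult_def column_def axis_def mat_def vec_eq_iff)
  then show ?thesis by (simp add: vec_eq_iff)
qed

lemma regular_map_adj_inv [intro]:
  assumes "regular_map (\<phi> :: complex^'n^'n \<Rightarrow> complex^'n^'n)"
  shows "regular_map (\<lambda>A. adj_inv (\<phi> A))"
proof -
  have "(\<lambda>A. adj_inv A $ k $ j) \<in> (regular :: (complex^'n^'n \<Rightarrow> complex) set)" for k j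
  proof -
    have "(\<lambda>A::complex^'n^'n. det (\<chi> i l. if l = k then (if i = j then 1 else 0) else A $ i $ l)) \<in> regular"
    proof (rule regular_det_of)
      fix i l :: 'n
      show "(\<lambda>A::complex^'n^'n. (\<chi> i l. if l = k then (if i = j then 1 else 0) else A $ i $ l) $ i $ l) \<in> regular"
        by (cases "l = k") simp_all
    qed
    then show ?thesis unfolding adj_inv_def by (simp add: regular_mult)
  qed
  moreover have "inverse (det (adj_inv A)) = det A" for A :: "complex^'n^'n"
  proof (cases "invertible A")
    case True
    then have "det A * det (adj_inv A) = 1" using adj_inv_right[OF True] by (metis det_mul det_I)
    then show ?thesis by (metis inverse_inverse_eq inverse_unique mult.commute)
  next
    case False
    then have d: "det A = 0" by (simp add: invertible_det_nz)
    \<comment> \<open>On singular matrices the convention that the inverse of 0 is 0 makes both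
      sides 0, so the identity holds on all matrices and regularity needs no domain.\<close>
    then have "adj_inv A = 0" by (simp add: adj_inv_def vec_eq_iff)
    moreover have "det (0 :: complex^'n^'n) = 0" by (rule det_zero_row(1)[of undefined]) (simp add: row_def vec_eq_iff)
    ultimately show ?thesis using d by simp
  qed
  moreover have "(\<lambda>A. det A) \<in> (regular :: (complex^'n^'n \<Rightarrow> complex) set)" by (rule regular_det_of) simp
  ultimately have "regular_map (adj_inv :: complex^'n^'n \<Rightarrow> complex^'n^'n)"
    unfolding regular_map_def by simp
  from regular_compose[OF _ assms] this show ?thesis unfolding regular_map_def by fast
qed

lemma GL_simps [simp]:
  "carrier GL = {A. invertible A}" "x \<otimes>\<^bsub>GL\<^esub> y = x ** y" "\<one>\<^bsub>GL\<^esub> = mat 1"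
  by (simp_all add: GL_def)

lemma GL_inv: "invertible (A :: complex^'n^'n) \<Longrightarrow> inv\<^bsub>GL\<^esub> A = adj_inv A"
proof -
  assume A: "invertible A"
  have "adj_inv A ** A = mat 1" using adj_inv_right[OF A] by (simp add: matrix_left_right_inverse)
  then have "invertible (adj_inv A)" unfolding invertible_def using adj_inv_right[OF A] by blast
  then show ?thesis
    by (intro group.inv_equality[OF group_GL]) (simp_all add: \<open>adj_inv A ** A = mat 1\<close> A)
qed

text \<open>
  Connectedness in a form that passes to derived groups without speaking about topology.
\<close>

definition reg_connected :: "(complex^'n^'n) set \<Rightarrow> bool" where
  "reg_connected S \<longleftrightarrow> (\<forall>f\<in>regular. finite (f ` S) \<longrightarrow> (\<forall>x\<in>S. \<forall>y\<in>S. f x = f y))"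

lemma reg_connectedD:
  "reg_connected S \<Longrightarrow> f \<in> regular \<Longrightarrow> f ` S \<subseteq> F \<Longrightarrow> finite F \<Longrightarrow> x \<in> S \<Longrightarrow> y \<in> S \<Longrightarrow> f x = f y"
  unfolding reg_connected_def using finite_subset by blast

text \<open>If \<open>f\<close> has finitely many values on the derived group, then x \<mapsto> f(w
  [x, y]) is regular with finitely many values on H, hence constant, and equals f(w) at x = 1. So
  multiplying by a commutator or its inverse does not change \<open>f\<close>, and no closure of the
  derived group is needed.\<close>

lemma reg_connected_derived:
  fixes H :: "(complex^'n^'n) set"
  assumes H: "subgroup H GL" and con: "reg_connected H"
  shows "reg_connected (derived GL H)"
proof -
  let ?D = "derived GL H"
  have Hinv: "invertible x" if "x \<in> H" for x using subgroup.subset[OF H] that by auto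
  have D: "subgroup ?D GL"
    by (rule group.derived_is_subgroup[OF group_GL]) (use Hinv in auto)
  have one: "mat 1 \<in> H" using subgroup.one_closed[OF H] by simp
  have inv1: "invertible (mat 1 :: complex^'n^'n)" by (rule Hinv[OF one])
  have inv': "inv\<^bsub>GL\<^esub> x = adj_inv x" if "x \<in> H" for x using GL_inv Hinv that by blast
  have one': "adj_inv (mat 1 :: complex^'n^'n) = mat 1" using adj_inv_right[OF inv1] by simp
  let ?c = "\<lambda>x y :: complex^'n^'n. x ** y ** adj_inv x ** adj_inv y"
  have c: "?c x y \<in> ?D" if "x \<in> H" "y \<in> H" for x y
  proof -
    have "x \<otimes>\<^bsub>GL\<^esub> y \<otimes>\<^bsub>GL\<^esub> inv\<^bsub>GL\<^esub> x \<otimes>\<^bsub>GL\<^esub> inv\<^bsub>GL\<^esub> y \<in> ?D"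
      unfolding derived_def by (rule generate.incl) (use that in blast)
    then show ?thesis using that inv' by simp
  qed
  have step: "f (w ** z) = f w"
    if f: "f \<in> regular" "finite (f ` ?D)" and z: "z \<in> ?D" and w: "w \<in> ?D" for f z w
    using z w unfolding derived_def
  proof (induction arbitrary: w rule: generate.induct)
    case one
    then show ?case by simp
  next
    case (incl z)
    then obtain x y where xy: "x \<in> H" "y \<in> H" "z = ?c x y" using inv' by auto
    have "(\<lambda>x. f (w ** ?c x y)) ` H \<subseteq> f ` ?D"
      using c[OF _ xy(2)] incl(2) subgroup.m_closed[OF D] by (force simp: derived_def)
    moreover have "(\<lambda>x. f (w ** ?c x y)) \<in> regular"
      by (rule regular_compose[OF f(1)])
        (intro regular_map_mult regular_map_adj_inv regular_map_id regular_map_const)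
    ultimately have "f (w ** ?c x y) = f (w ** ?c (mat 1) y)"
      using f(2) xy one reg_connectedD[OF con] by meson
    also have "?c (mat 1) y = mat 1" using adj_inv_right[OF Hinv[OF xy(2)]] one' by simp
    finally show ?case using xy by simp
  next
    case (inv z)
    then obtain x y where xy: "x \<in> H" "y \<in> H" "z = ?c x y" using inv' by auto
    have ci: "invertible (?c x y)" if "x \<in> H" for x
      using c[OF that xy(2)] subgroup.subset[OF D] by auto
    have "adj_inv (?c x y) \<in> ?D" if "x \<in> H" for x
      using subgroup.m_inv_closed[OF D c[OF that xy(2)]] GL_inv[OF ci[OF that]] by simp
    then have "(\<lambda>x. f (w ** adj_inv (?c x y))) ` H \<subseteq> f ` ?D"
      using inv(2) subgroup.m_closed[OF D] by (force simp: derived_def)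
    moreover have "(\<lambda>x. f (w ** adj_inv (?c x y))) \<in> regular"
      by (rule regular_compose[OF f(1)])
        (intro regular_map_mult regular_map_adj_inv regular_map_id regular_map_const)
    ultimately have "f (w ** adj_inv (?c x y)) = f (w ** adj_inv (?c (mat 1) y))"
      using f(2) xy one reg_connectedD[OF con] by meson
    also have "?c (mat 1) y = mat 1" using adj_inv_right[OF Hinv[OF xy(2)]] one' by simp
    finally show ?case using xy ci[OF xy(1)] one' by (simp add: GL_inv)
  next
    case (eng z1 z2)
    then have "w ** z1 \<in> generate GL (derived_set GL H)" using generate.eng[of w GL _ z1] by simp
    from eng.IH(2)[OF this] eng.IH(1)[OF eng.prems] show ?case by (simp add: matrix_mul_assoc)
  qed
  have "f z = f (mat 1)" if "f \<in> regular" "finite (f ` ?D)" "z \<in> ?D" for f z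
    using step[OF that, of "mat 1"] subgroup.one_closed[OF D] by simp
  then show ?thesis unfolding reg_connected_def by metis
qed

text \<open>On invertible matrices a power of the determinant turns a regular function into a
  polynomial with the same zeros.\<close>

lemma regular_zero_set_closed:
  assumes "f \<in> regular"
  shows "closedin zariski {A :: complex^'n^'n. invertible A \<and> f A = 0}"
proof -
  have det: "(\<lambda>A. det A) \<in> (poly_fun UNIV :: (complex^'n^'n \<Rightarrow> complex) set)"
  proof -
    have sum: "(\<lambda>A. \<Sum>i\<in>I. g i A) \<in> alg_gen UNIV F" if "\<And>i. i \<in> I \<Longrightarrow> g i \<in> alg_gen UNIV F"
      for I :: "'i set" and g and F :: "('x \<Rightarrow> complex) set"
      using that by (induction I rule: infinite_finite_induct) (auto intro: alg_gen.intros)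
    have prod: "(\<lambda>A. \<Prod>i\<in>I. g i A) \<in> alg_gen UNIV F" if "\<And>i. i \<in> I \<Longrightarrow> g i \<in> alg_gen UNIV F"
      for I :: "'i set" and g and F :: "('x \<Rightarrow> complex) set"
      using that by (induction I rule: infinite_finite_induct) (auto intro: alg_gen.intros)
    show ?thesis unfolding det_def poly_fun_def
      by (intro sum alg_gen.mult prod alg_gen.const alg_gen.gen) (auto simp: entries_def)
  qed
  have "\<exists>k. \<exists>p\<in>poly_fun UNIV. \<forall>A::complex^'n^'n. invertible A \<longrightarrow> det A ^ k * f A = p A"
    using assms unfolding regular_GL_def
  proof (induction rule: alg_gen.induct)
    case (const c)
    show ?case
      by (rule exI[of _ 0], rule bexI[of _ "\<lambda>_. c"]) (auto simp: poly_fun_def intro: alg_gen.const)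
  next
    case (gen f)
    then consider "f = (\<lambda>A. inverse (det A))" | "f \<in> entries" by blast
    then show ?case
    proof cases
      case 1
      show ?thesis unfolding 1
        by (rule exI[of _ 1], rule bexI[of _ "\<lambda>_. 1"])
          (auto simp: poly_fun_def invertible_det_nz intro: alg_gen.const)
    next
      case 2
      then show ?thesis by (intro exI[of _ 0] bexI[of _ f]) (auto simp: poly_fun_def intro: alg_gen.gen)
    qed
  next
    case (add f g)
    then obtain k p l q where *: "p \<in> poly_fun UNIV" "q \<in> poly_fun UNIV"
      "\<And>A. invertible A \<Longrightarrow> det A ^ k * f A = p A" "\<And>A. invertible A \<Longrightarrow> det A ^ l * g A = q A" by blast
    have pow: "(\<lambda>A. det A ^ k) \<in> (poly_fun UNIV :: (complex^'n^'n \<Rightarrow> complex) set)" for k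
      using det by (induction k) (auto simp: poly_fun_def intro: alg_gen.intros)
    have "det A ^ (k + l) * (f A + g A) = det A ^ l * p A + det A ^ k * q A" if "invertible A" for A
      unfolding *(3)[OF that, symmetric] *(4)[OF that, symmetric] by (simp add: power_add algebra_simps)
    moreover have "(\<lambda>A. det A ^ l * p A + det A ^ k * q A) \<in> poly_fun UNIV"
      using * pow unfolding poly_fun_def by (auto intro!: alg_gen.add alg_gen.mult)
    ultimately show ?case by (intro exI[of _ "k + l"]) (rule bexI, auto)
  next
    case (mult f g)
    then obtain k p l q where *: "p \<in> poly_fun UNIV" "q \<in> poly_fun UNIV"
      "\<And>A. invertible A \<Longrightarrow> det A ^ k * f A = p A" "\<And>A. invertible A \<Longrightarrow> det A ^ l * g A = q A" by blast
    have "det A ^ (k + l) * (f A * g A) = p A * q A" if "invertible A" for A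
      unfolding *(3)[OF that, symmetric] *(4)[OF that, symmetric] by (simp add: power_add algebra_simps)
    moreover have "(\<lambda>A. p A * q A) \<in> poly_fun UNIV"
      using * unfolding poly_fun_def by (auto intro!: alg_gen.mult)
    ultimately show ?case by (intro exI[of _ "k + l"]) (rule bexI, auto)
  qed
  then obtain k p where p: "p \<in> poly_fun UNIV" "\<And>A. invertible A \<Longrightarrow> det A ^ k * f A = p A" by blast
  have "{A. invertible A \<and> f A = 0} = {A. invertible A \<and> (\<forall>p\<in>{p}. p A = 0)}"
    using p(2)[symmetric] by (auto simp: invertible_det_nz)
  then show ?thesis unfolding closedin_zariski_iff defined_over_def using p(1) by (intro exI[of _ "{p}"]) auto
qed

text \<open>One fibre of a function with finitely many values and the union of its other fibres are
  zero sets of regular functions; two distinct values would split S into two nonempty closed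
  parts.\<close>

lemma connectedin_zariski_imp_reg_connected:
  assumes "connectedin zariski (S :: (complex^'n^'n) set)" "S \<subseteq> {A. invertible A}"
  shows "reg_connected S"
  unfolding reg_connected_def
proof (intro ballI impI, rule ccontr)
  fix f x y assume f: "f \<in> regular" "finite (f ` S)" and xy: "x \<in> S" "y \<in> S" "f x \<noteq> f y"
  let ?g = "\<lambda>A. \<Prod>c\<in>f ` S - {f x}. f A - c"
  let ?E = "{A. invertible A \<and> f A - f x = 0}" and ?E' = "{A. invertible A \<and> ?g A = 0}"
  have g0: "?g A = 0 \<longleftrightarrow> f A \<in> f ` S - {f x}" for A using f(2) by auto
  have "closedin zariski ?E" "closedin zariski ?E'"
    by (rule regular_zero_set_closed, intro regular_prod regular_diff f(1) regular_const)+
  moreover have "S \<subseteq> ?E \<union> ?E'" using assms(2) g0 by auto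
  moreover have "?E \<inter> ?E' \<inter> S = {}" using g0 by auto
  moreover have "?E \<inter> S \<noteq> {}" "?E' \<inter> S \<noteq> {}" using xy assms(2) g0 by auto
  ultimately show False using assms(1) unfolding connectedin_closedin by blast
qed

lemma regular_zero_on_closure:
  assumes "f \<in> regular" "\<And>A. A \<in> S \<Longrightarrow> invertible A \<and> f A = 0" "A \<in> zariski closure_of S"
  shows "f A = 0"
  using closure_of_minimal[OF _ regular_zero_set_closed[OF assms(1)], of S] assms(2,3) by blast

section \<open>Eigenvectors modulo a subspace\<close>

definition poly_op :: "(('b \<Rightarrow> complex) \<Rightarrow> 'b \<Rightarrow> complex) \<Rightarrow> complex poly \<Rightarrow> ('b \<Rightarrow> complex) \<Rightarrow> 'b \<Rightarrow> complex" where
  "poly_op f p v = fold_coeffs (\<lambda>a w. (\<lambda>b. a * v b) + f w) p 0"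

locale fun_operator =
  fixes f :: "('b \<Rightarrow> complex) \<Rightarrow> 'b \<Rightarrow> complex"
  assumes f_add: "f (u + v) = f u + f v" and f_scale: "f (\<lambda>b. c * v b) = (\<lambda>b. c * f v b)"
begin

lemma f_0 [simp]: "f 0 = 0"
  using f_add[of 0 0] by simp

lemma poly_op_0 [simp]: "poly_op f 0 v = 0"
  by (simp add: poly_op_def)

lemma poly_op_pCons [simp]: "poly_op f (pCons a p) v = (\<lambda>b. a * v b) + f (poly_op f p v)"
  by (cases "p = 0"; cases "a = 0") (simp_all add: poly_op_def fun_eq_iff)

lemma poly_op_add: "poly_op f (p + q) v = poly_op f p v + poly_op f q v"
proof (induction p q rule: poly_induct2)
  case 0
  show ?case by simp
next
  case (pCons a p b q)
  show ?case unfolding add_pCons poly_op_pCons pCons f_add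
    by (rule ext) (simp add: distrib_right)
qed

lemma poly_op_smult: "poly_op f (Polynomial.smult c p) v = (\<lambda>b. c * poly_op f p v b)"
proof (induction p)
  case 0
  show ?case by (simp add: zero_fun_def)
next
  case (pCons a p)
  show ?case unfolding smult_pCons poly_op_pCons pCons f_scale
    by (rule ext) (simp only: plus_fun_apply distrib_left mult.assoc)
qed

lemma poly_op_mult: "poly_op f (p * q) v = poly_op f p (poly_op f q v)"
proof (induction p)
  case (pCons a p)
  show ?case unfolding mult_pCons_left poly_op_add poly_op_smult poly_op_pCons pCons
    by (simp add: fun_eq_iff)
qed simp

lemma poly_op_monom: "poly_op f (Polynomial.monom a i) v = (\<lambda>b. a * (f ^^ i) v b)"
proof (induction i)
  case (Suc i)
  show ?case unfolding monom_Suc poly_op_pCons Suc f_scale by (simp add: fun_eq_iff)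
qed (simp add: monom_0 fun_eq_iff)

lemma poly_op_sum: "poly_op f (\<Sum>i\<in>I. p i) v = (\<Sum>i\<in>I. poly_op f (p i) v)"
  by (induction I rule: infinite_finite_induct) (simp_all add: poly_op_add)

lemma poly_op_vec_0 [simp]: "poly_op f p 0 = 0"
proof (induction p)
  case (pCons a p)
  show ?case unfolding poly_op_pCons pCons by (simp add: fun_eq_iff)
qed simp

lemma poly_op_vec_add: "poly_op f p (u + v) = poly_op f p u + poly_op f p v"
proof (induction p)
  case (pCons a p)
  show ?case unfolding poly_op_pCons pCons f_add by (simp add: fun_eq_iff distrib_left)
qed simp

lemma poly_op_vec_scale: "poly_op f p (\<lambda>b. c * v b) = (\<lambda>b. c * poly_op f p v b)"
proof (induction p)
  case (pCons a p)
  show ?case unfolding poly_op_pCons pCons f_scale by (simp add: fun_eq_iff distrib_left)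
qed (simp add: fun_eq_iff)

lemma poly_op_vec_sum: "poly_op f p (\<Sum>i\<in>I. u i) = (\<Sum>i\<in>I. poly_op f p (u i))"
proof (induction I rule: infinite_finite_induct)
  case (insert i I)
  then show ?case unfolding sum.insert[OF insert.hyps] poly_op_vec_add by (simp only:)
qed (simp_all only: sum.infinite sum.empty poly_op_vec_0 simp_thms)

lemma poly_op_subspace:
  assumes "fun_vs.subspace V" "\<And>v. v \<in> V \<Longrightarrow> f v \<in> V" "v \<in> V"
  shows "poly_op f p v \<in> V"
proof (induction p)
  case 0
  show ?case unfolding poly_op_0 by (rule fun_vs.subspace_0[OF assms(1)])
next
  case (pCons a p)
  have "(\<lambda>b. a * v b) \<in> V" by (rule fun_vs.subspace_scale[OF assms(1,3)])
  from fun_vs.subspace_add[OF assms(1) this assms(2)[OF pCons.IH]] show ?case unfolding poly_op_pCons .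
qed

lemma funpow_subspace:
  assumes "\<And>v. v \<in> V \<Longrightarrow> f v \<in> V" "v \<in> V"
  shows "(f ^^ i) v \<in> V"
  by (induction i) (use assms in auto)

text \<open>One more iterate of \<open>v\<close> than the spanning set has elements cannot be
  independent. Coinciding iterates are ruled out separately, since as a set they would count only
  once.\<close>

lemma annihilating_poly:
  assumes V: "\<And>v. v \<in> V \<Longrightarrow> f v \<in> V" "V \<subseteq> fun_vs.span E" "finite E" and v: "v \<in> V"
  shows "\<exists>p. p \<noteq> 0 \<and> poly_op f p v = 0"
proof (rule ccontr)
  assume "\<not> ?thesis"
  then have inj: "p = 0" if "poly_op f p v = 0" for p using that by blast
  let ?u = "\<lambda>i. (f ^^ i) v"
  let ?n = "Suc (card E)"
  have inj_u: "inj_on ?u {..<?n}"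
  proof (rule inj_onI)
    fix i j assume "?u i = ?u j"
    then have "poly_op f (Polynomial.monom 1 i + Polynomial.monom (-1) j) v = 0"
      unfolding poly_op_add poly_op_monom by (simp add: fun_eq_iff)
    from inj[OF this] have "Polynomial.monom 1 i = Polynomial.monom (1::complex) j"
      by (simp add: minus_monom[symmetric])
    then show "i = j" by (metis degree_monom_eq one_neq_zero)
  qed
  have "fun_vs.independent (?u ` {..<?n})"
  proof
    assume "fun_vs.dependent (?u ` {..<?n})"
    then obtain c where c: "\<exists>w\<in>?u ` {..<?n}. c w \<noteq> 0" "(\<Sum>w\<in>?u ` {..<?n}. (\<lambda>b. c w * w b)) = 0"
      using fun_vs.dependent_finite[of "?u ` {..<?n}"] by auto
    let ?p = "\<Sum>i<?n. Polynomial.monom (c (?u i)) i"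
    have "poly_op f ?p v = (\<Sum>i<?n. (\<lambda>b. c (?u i) * ?u i b))"
      unfolding poly_op_sum poly_op_monom ..
    also have "\<dots> = (\<Sum>w\<in>?u ` {..<?n}. (\<lambda>b. c w * w b))"
      by (subst sum.reindex[OF inj_u]) simp
    finally have "?p = 0" using inj c(2) by simp
    then have "c (?u i) = 0" if "i < ?n" for i
    proof -
      have "Polynomial.coeff ?p i = (\<Sum>j<?n. if j = i then c (?u j) else 0)"
        by (simp add: Polynomial.coeff_sum coeff_monom)
      then show ?thesis unfolding \<open>?p = 0\<close> using that by (auto simp: less_Suc_eq split: if_splits)
    qed
    then show False using c(1) by blast
  qed
  moreover have "?u ` {..<?n} \<subseteq> fun_vs.span E" using V funpow_subspace[OF V(1) v] by blast
  ultimately have "card (?u ` {..<?n}) \<le> card E"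
    using fun_vs.independent_span_bound[OF V(3)] by blast
  then show False using card_image[OF inj_u] by simp
qed

text \<open>Take a polynomial of least degree that moves \<open>v\<close> into W and split off a
  linear factor over the complex numbers: the cofactor moves \<open>v\<close> to an eigenvector
  modulo W, which lies outside W by minimality.\<close>

lemma eigenvector_mod_exists:
  assumes V: "fun_vs.subspace V" "\<And>v. v \<in> V \<Longrightarrow> f v \<in> V" "V \<subseteq> fun_vs.span E" "finite E"
    and W: "fun_vs.subspace W" "\<And>v. v \<in> W \<Longrightarrow> f v \<in> W" and v: "v \<in> V" "v \<notin> W"
  shows "\<exists>c u. u \<in> V \<and> u \<notin> W \<and> f u - (\<lambda>b. c * u b) \<in> W"
proof -
  let ?P = "\<lambda>p. p \<noteq> 0 \<and> poly_op f p v \<in> W"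
  have "\<exists>p. ?P p" using annihilating_poly[OF V(2,3,4) v(1)] fun_vs.subspace_0[OF W(1)] by auto
  then obtain p where p: "?P p" and least: "\<And>q. ?P q \<Longrightarrow> Polynomial.degree p \<le> Polynomial.degree q"
    using ex_has_least_nat[of ?P _ Polynomial.degree] by blast
  have "Polynomial.degree p \<noteq> 0"
  proof
    assume "Polynomial.degree p = 0"
    then obtain a where a: "p = [:a:]" by (rule degree_eq_zeroE)
    with p have "a \<noteq> 0" "(\<lambda>b. a * v b) \<in> W" by simp_all
    then have "(\<lambda>b. inverse a * (a * v b)) \<in> W" using fun_vs.subspace_scale[OF W(1)] by fast
    then show False using v(2) \<open>a \<noteq> 0\<close> by simp
  qed
  then obtain c where "poly p c = 0"
    using fundamental_theorem_of_algebra constant_degree by metis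
  then obtain q where q: "p = [:-c, 1:] * q" using poly_eq_0_iff_dvd by (metis dvdE)
  have q0: "q \<noteq> 0" using p q by auto
  have "Polynomial.degree p = Suc (Polynomial.degree q)"
    unfolding q using q0 by (subst degree_mult_eq) auto
  then have qW: "poly_op f q v \<notin> W" using least[of q] q0 by auto
  have "poly_op f p v = f (poly_op f q v) - (\<lambda>b. c * poly_op f q v b)"
    unfolding q poly_op_mult by (simp add: fun_eq_iff)
  then show ?thesis
    using p qW poly_op_subspace[OF V(1,2) v(1)] by (intro exI[of _ c] exI[of _ "poly_op f q v"]) auto
qed

lemma poly_op_mod:
  assumes W: "fun_vs.subspace W" "\<And>v. v \<in> W \<Longrightarrow> f v \<in> W" and v: "f v - (\<lambda>b. c * v b) \<in> W"
  shows "poly_op f p v - (\<lambda>b. poly p c * v b) \<in> W"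
proof (induction p)
  case 0
  then show ?case using fun_vs.subspace_0[OF W(1)] by (simp add: fun_diff_def zero_fun_def)
next
  case (pCons a p)
  have sub: "f (u - w) = f u - f w" for u w
    using f_add[of "u - w" w] by (simp add: algebra_simps)
  have "f (poly_op f p v - (\<lambda>b. poly p c * v b)) \<in> W" by (rule W(2)[OF pCons.IH])
  then have "f (poly_op f p v) - (\<lambda>b. poly p c * f v b) \<in> W" by (simp add: sub f_scale)
  moreover have "(\<lambda>b. poly p c * (f v - (\<lambda>b. c * v b)) b) \<in> W" by (rule fun_vs.subspace_scale[OF W(1) v])
  ultimately have "f (poly_op f p v) - (\<lambda>b. poly p c * f v b) + (\<lambda>b. poly p c * (f v - (\<lambda>b. c * v b)) b) \<in> W"
    by (rule fun_vs.subspace_add[OF W(1)])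
  moreover have "f (poly_op f p v) - (\<lambda>b. poly p c * f v b) + (\<lambda>b. poly p c * (f v - (\<lambda>b. c * v b)) b) =
      poly_op f (pCons a p) v - (\<lambda>b. poly (pCons a p) c * v b)"
    by (rule ext) (simp add: algebra_simps)
  ultimately show ?case by (simp only:)
qed

end

definition supported :: "'b set \<Rightarrow> ('b \<Rightarrow> complex) set" where
  "supported B = {v. \<forall>b. b \<notin> B \<longrightarrow> v b = 0}"

definition unit_fun :: "'b \<Rightarrow> 'b \<Rightarrow> complex" where
  "unit_fun c = (\<lambda>b. if b = c then 1 else 0)"

lemma subspace_supported: "fun_vs.subspace (supported B)"
  by (auto simp: supported_def intro!: fun_vs.subspaceI)

lemma supported_expand_at:
  assumes "finite B" "v \<in> supported B"
  shows "v b = (\<Sum>c\<in>B. v c * unit_fun c b)"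
proof -
  have "(\<Sum>c\<in>B. v c * unit_fun c b) = (\<Sum>c\<in>B. if c = b then v c else 0)"
    by (intro sum.cong) (auto simp: unit_fun_def)
  also have "\<dots> = v b" using assms by (simp add: supported_def)
  finally show ?thesis by simp
qed

lemma supported_expand:
  assumes "finite B" "v \<in> supported B"
  shows "v = (\<Sum>c\<in>B. (\<lambda>b. v c * unit_fun c b))"
  by (rule ext) (simp only: sum_apply flip: supported_expand_at[OF assms])

lemma supported_span:
  assumes "finite B"
  shows "supported B \<subseteq> fun_vs.span (unit_fun ` B)"
proof
  fix v assume v: "v \<in> supported B"
  have "(\<Sum>c\<in>B. (\<lambda>b. v c * unit_fun c b)) \<in> fun_vs.span (unit_fun ` B)"
    by (intro fun_vs.span_sum fun_vs.span_scale fun_vs.span_base imageI)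
  then show "v \<in> fun_vs.span (unit_fun ` B)" using supported_expand[OF assms v] by simp
qed

lemma unit_fun_supported: "c \<in> B \<Longrightarrow> unit_fun c \<in> supported B"
  by (auto simp: supported_def unit_fun_def)

text \<open>The product of annihilating polynomials of the unit vectors kills the whole space, so
  every eigenvalue modulo W is one of its roots.\<close>

lemma (in fun_operator) finite_eigenvalues_mod:
  assumes B: "finite B" "\<And>v. v \<in> supported B \<Longrightarrow> f v \<in> supported B"
    and W: "fun_vs.subspace W" "\<And>v. v \<in> W \<Longrightarrow> f v \<in> W"
  shows "finite {c. \<exists>v. v \<in> supported B \<and> v \<notin> W \<and> f v - (\<lambda>b. c * v b) \<in> W}"
proof -
  have "\<forall>b\<in>B. \<exists>p. p \<noteq> 0 \<and> poly_op f p (unit_fun b) = 0"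
    by (intro ballI annihilating_poly[OF B(2) supported_span[OF B(1)] finite_imageI[OF B(1)]] unit_fun_supported)
  then obtain P where P: "\<And>b. b \<in> B \<Longrightarrow> P b \<noteq> 0" "\<And>b. b \<in> B \<Longrightarrow> poly_op f (P b) (unit_fun b) = 0"
    using bchoice[of B "\<lambda>b p. p \<noteq> 0 \<and> poly_op f p (unit_fun b) = 0"] by blast
  let ?p = "\<Prod>b\<in>B. P b"
  have p0: "?p \<noteq> 0" using P(1) B(1) by simp
  have "poly_op f ?p (unit_fun b) = 0" if "b \<in> B" for b
  proof -
    have "?p = (\<Prod>c\<in>B - {b}. P c) * P b" using that B(1) by (simp add: prod.remove mult.commute)
    then show ?thesis using P(2)[OF that] by (simp add: poly_op_mult)
  qed
  then have kill: "poly_op f ?p v = 0" if "v \<in> supported B" for v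
    by (subst supported_expand[OF B(1) that])
      (simp add: poly_op_vec_sum poly_op_vec_scale zero_fun_def[symmetric])
  have "poly ?p c = 0" if "v \<in> supported B" "v \<notin> W" "f v - (\<lambda>b. c * v b) \<in> W" for c v
  proof (rule ccontr)
    assume nz: "poly ?p c \<noteq> 0"
    have "0 - (\<lambda>b. poly ?p c * v b) \<in> W"
      using poly_op_mod[OF W that(3), of ?p] kill[OF that(1)] by simp
    from fun_vs.subspace_scale[OF W(1) this, of "- inverse (poly ?p c)"] nz
    show False using that(2) by simp
  qed
  then show ?thesis by (intro finite_subset[OF _ poly_roots_finite[OF p0]]) auto
qed

section \<open>The theorem of Lie and Kolchin\<close>

definition matrix_action :: "('g \<Rightarrow> 'b \<Rightarrow> 'b \<Rightarrow> complex) \<Rightarrow> 'b set \<Rightarrow> 'g \<Rightarrow> ('b \<Rightarrow> complex) \<Rightarrow> 'b \<Rightarrow> complex" where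
  "matrix_action R B g v = (\<lambda>b. if b \<in> B then \<Sum>c\<in>B. R g b c * v c else 0)"

locale regular_rep =
  fixes G :: "(complex^'n^'n) set" and B :: "'b set" and R :: "complex^'n^'n \<Rightarrow> 'b \<Rightarrow> 'b \<Rightarrow> complex"
  assumes G: "subgroup G GL" and finite_B: "finite B"
    and R_regular: "b \<in> B \<Longrightarrow> c \<in> B \<Longrightarrow> (\<lambda>g. R g b c) \<in> regular"
    and R_one: "b \<in> B \<Longrightarrow> c \<in> B \<Longrightarrow> R (mat 1) b c = (if b = c then 1 else 0)"
    and R_mult: "g \<in> G \<Longrightarrow> h \<in> G \<Longrightarrow> b \<in> B \<Longrightarrow> c \<in> B \<Longrightarrow> R (g ** h) b c = (\<Sum>d\<in>B. R g b d * R h d c)"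
begin

abbreviation "act \<equiv> matrix_action R B"

sublocale op: fun_operator "act g" for g
  by unfold_locales
    (auto simp: matrix_action_def fun_eq_iff distrib_left sum.distrib sum_distrib_left mult.left_commute)

lemma act_supported: "act g v \<in> supported B"
  by (simp add: matrix_action_def supported_def)

lemma act_diff: "act g (u - v) = act g u - act g v"
  using op.f_add[of g "u - v" v] by (simp add: algebra_simps)

lemma act_one: "v \<in> supported B \<Longrightarrow> act (mat 1) v = v"
proof
  fix b assume v: "v \<in> supported B"
  show "act (mat 1) v b = v b"
  proof (cases "b \<in> B")
    case True
    have "(\<Sum>c\<in>B. R (mat 1) b c * v c) = (\<Sum>c\<in>B. if c = b then v c else 0)"
      by (intro sum.cong) (auto simp: R_one True)
    then show ?thesis using True finite_B by (simp add: matrix_action_def)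
  next
    case False
    then show ?thesis using v by (simp add: matrix_action_def supported_def)
  qed
qed

lemma act_mult: "g \<in> G \<Longrightarrow> h \<in> G \<Longrightarrow> act (g ** h) v = act g (act h v)"
proof
  fix b assume gh: "g \<in> G" "h \<in> G"
  have "(\<Sum>c\<in>B. R (g ** h) b c * v c) = (\<Sum>d\<in>B. R g b d * (\<Sum>c\<in>B. R h d c * v c))" if "b \<in> B"
  proof -
    have "(\<Sum>c\<in>B. R (g ** h) b c * v c) = (\<Sum>c\<in>B. \<Sum>d\<in>B. R g b d * (R h d c * v c))"
      by (intro sum.cong refl) (simp add: R_mult gh that sum_distrib_right mult.assoc)
    also have "\<dots> = (\<Sum>d\<in>B. \<Sum>c\<in>B. R g b d * (R h d c * v c))" by (rule sum.swap)
    finally show ?thesis by (simp add: sum_distrib_left)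
  qed
  then show "act (g ** h) v b = act g (act h v) b"
    by (simp add: matrix_action_def cong: sum.cong)
qed

lemma act_regular: "fun_linear L \<Longrightarrow> (\<lambda>g. L (act g v)) \<in> regular"
proof -
  assume L: "fun_linear L"
  have "L (act g v) = (\<Sum>b\<in>B. (\<Sum>c\<in>B. R g b c * v c) * L (unit_fun b))" for g
  proof -
    have "L (act g v) = L (\<lambda>x. \<Sum>b\<in>B. act g v b * unit_fun b x)"
      by (rule arg_cong[of _ _ L], rule ext, rule supported_expand_at[OF finite_B act_supported])
    also have "\<dots> = (\<Sum>b\<in>B. act g v b * L (unit_fun b))"
      by (simp only: fun_linearD[OF L])
    also have "\<dots> = (\<Sum>b\<in>B. (\<Sum>c\<in>B. R g b c * v c) * L (unit_fun b))"
      by (intro sum.cong refl) (simp add: matrix_action_def)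
    finally show ?thesis .
  qed
  then show ?thesis
    by (simp only:) (intro regular_sum regular_mult regular_const R_regular)
qed

definition stable :: "(complex^'n^'n) set \<Rightarrow> ('b \<Rightarrow> complex) set \<Rightarrow> bool" where
  "stable H W \<longleftrightarrow> fun_vs.subspace W \<and> W \<subseteq> supported B \<and> (\<forall>g\<in>H. \<forall>w\<in>W. act g w \<in> W)"

lemma stableD:
  assumes "stable H W"
  shows "fun_vs.subspace W" "W \<subseteq> supported B" "\<And>g w. g \<in> H \<Longrightarrow> w \<in> W \<Longrightarrow> act g w \<in> W"
    "0 \<in> W" "\<And>u v. u \<in> W \<Longrightarrow> v \<in> W \<Longrightarrow> u + v \<in> W" "\<And>u v. u \<in> W \<Longrightarrow> v \<in> W \<Longrightarrow> u - v \<in> W"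
    "\<And>c v. v \<in> W \<Longrightarrow> (\<lambda>b. c * v b) \<in> W"
  using assms fun_vs.subspace_0 fun_vs.subspace_add fun_vs.subspace_diff fun_vs.subspace_scale
  unfolding stable_def by auto

text \<open>The ambient function space may have infinite dimension; strict monotonicity of
  \<open>dim\<close> is obtained only inside the finite dimensional
  \<open>supported B\<close>.\<close>

lemma dim_less:
  assumes "fun_vs.subspace U" "U \<subseteq> U'" "U \<noteq> U'" "U' \<subseteq> supported B"
  shows "fun_vs.dim U < fun_vs.dim U'"
proof -
  obtain b where b: "b \<subseteq> U" "fun_vs.independent b" "U \<subseteq> fun_vs.span b" "card b = fun_vs.dim U"
    by (rule fun_vs.basis_exists[of U])
  obtain b' where b': "b \<subseteq> b'" "b' \<subseteq> U'" "fun_vs.independent b'" "U' \<subseteq> fun_vs.span b'"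
    by (rule fun_vs.maximal_independent_subset_extend[of b U']) (use b assms in auto)
  have "finite b'"
    using fun_vs.independent_span_bound[OF finite_imageI[OF finite_B, of unit_fun] b'(3)]
      b'(2) assms(4) supported_span[OF finite_B] by blast
  moreover have "b \<noteq> b'"
  proof
    assume "b = b'"
    then have "U' \<subseteq> U" using b'(4) b(1) fun_vs.span_minimal[OF b(1) assms(1)] by blast
    then show False using assms by blast
  qed
  moreover have "card b' = fun_vs.dim U'" by (rule fun_vs.dim_unique[OF b'(2,4,3) refl, symmetric])
  ultimately show ?thesis using b(4) psubset_card_mono[of b' b] b'(1) by auto
qed

lemma act_mod_scalar_mult:
  assumes W: "stable H W" and gh: "g \<in> H" "h \<in> H" "H \<subseteq> G"
    and g: "act g v - (\<lambda>b. c * v b) \<in> W" and h: "act h v - (\<lambda>b. d * v b) \<in> W"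
  shows "act (g ** h) v - (\<lambda>b. c * d * v b) \<in> W"
proof -
  have "act g (act h v - (\<lambda>b. d * v b)) \<in> W" by (rule stableD(3)[OF W gh(1) h])
  then have "act (g ** h) v - (\<lambda>b. d * act g v b) \<in> W"
    using gh by (simp add: act_diff act_mult op.f_scale subset_iff)
  moreover have "(\<lambda>b. d * (act g v - (\<lambda>b. c * v b)) b) \<in> W" by (rule stableD(7)[OF W g])
  ultimately have "(act (g ** h) v - (\<lambda>b. d * act g v b)) + (\<lambda>b. d * (act g v - (\<lambda>b. c * v b)) b) \<in> W"
    by (rule stableD(5)[OF W])
  moreover have "(act (g ** h) v - (\<lambda>b. d * act g v b)) + (\<lambda>b. d * (act g v - (\<lambda>b. c * v b)) b)
      = act (g ** h) v - (\<lambda>b. c * d * v b)"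
  proof (rule ext)
    have "x - d * y + d * (y - c * z) = x - c * d * z" for x y z by (simp add: right_diff_distrib)
    then show "((act (g ** h) v - (\<lambda>b. d * act g v b)) + (\<lambda>b. d * (act g v - (\<lambda>b. c * v b)) b)) b
        = (act (g ** h) v - (\<lambda>b. c * d * v b)) b" for b
      by (simp only: plus_fun_apply minus_apply)
  qed
  ultimately show ?thesis by (simp only:)
qed

lemma act_inv_cancel:
  assumes H: "subgroup H GL" "H \<subseteq> G" and h: "h \<in> H" and v: "v \<in> supported B"
  shows "adj_inv h \<in> H" "act (adj_inv h) (act h v) = v" "act h (act (adj_inv h) v) = v"
proof -
  have inv: "invertible h" using subgroup.mem_carrier[OF H(1) h] by simp
  show a: "adj_inv h \<in> H" using subgroup.m_inv_closed[OF H(1) h] GL_inv[OF inv] by simp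
  have r: "h ** adj_inv h = mat 1" by (rule adj_inv_right[OF inv])
  then have l: "adj_inv h ** h = mat 1" by (simp add: matrix_left_right_inverse)
  have G': "h \<in> G" "adj_inv h \<in> G" using H h a by auto
  show "act (adj_inv h) (act h v) = v" "act h (act (adj_inv h) v) = v"
    using act_mult[OF G'(2,1), of v] act_mult[OF G', of v] act_one[OF v] r l by simp_all
qed

lemma act_notin:
  assumes H: "subgroup H GL" "H \<subseteq> G" and W: "stable H W" and h: "h \<in> H"
    and v: "v \<in> supported B" "v \<notin> W"
  shows "act h v \<notin> W"
proof
  assume "act h v \<in> W"
  then have "act (adj_inv h) (act h v) \<in> W" using stableD(3)[OF W act_inv_cancel(1)[OF H h v(1)]] by blast
  then show False using v act_inv_cancel(2)[OF H h v(1)] by simp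
qed

definition eigenvalues :: "('b \<Rightarrow> complex) set \<Rightarrow> complex^'n^'n \<Rightarrow> complex set" where
  "eigenvalues W g = {c. \<exists>v. v \<in> supported B \<and> v \<notin> W \<and> act g v - (\<lambda>b. c * v b) \<in> W}"

lemma finite_eigenvalues: "stable H W \<Longrightarrow> g \<in> H \<Longrightarrow> finite (eigenvalues W g)"
  unfolding eigenvalues_def
  by (rule op.finite_eigenvalues_mod[OF finite_B]) (use act_supported in \<open>auto dest: stableD\<close>)

text \<open>Commuting modulo W suffices: in a stable space over W of least dimension, an eigenspace
  of \<open>g\<close> modulo W is again stable and larger than W, hence everything. So each
  \<open>g\<close> acts there as a scalar modulo W.\<close>

lemma commuting_eigenvector:
  assumes H: "subgroup H GL" "H \<subseteq> G" and W: "stable H W" and V: "stable H V" "W \<subseteq> V" "W \<noteq> V"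
    and comm: "\<And>g h v. g \<in> H \<Longrightarrow> h \<in> H \<Longrightarrow> v \<in> V \<Longrightarrow> act g (act h v) - act h (act g v) \<in> W"
  shows "\<exists>v. v \<in> V \<and> v \<notin> W \<and> (\<forall>g\<in>H. \<exists>c. act g v - (\<lambda>b. c * v b) \<in> W)"
proof -
  let ?P = "\<lambda>U. stable H U \<and> W \<subseteq> U \<and> W \<noteq> U \<and> U \<subseteq> V"
  have "?P V" using V by simp
  then obtain U where U: "?P U" and least: "\<And>U'. ?P U' \<Longrightarrow> fun_vs.dim U \<le> fun_vs.dim U'"
    using ex_has_least_nat[of ?P V fun_vs.dim] by blast
  note Ud = stableD[OF conjunct1[OF U]] and Wd = stableD[OF W]
  obtain v where v: "v \<in> U" "v \<notin> W" using U by blast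
  have "\<exists>c. act g v - (\<lambda>b. c * v b) \<in> W" if g: "g \<in> H" for g
  proof -
    obtain c u where cu: "u \<in> U" "u \<notin> W" "act g u - (\<lambda>b. c * u b) \<in> W"
      using op.eigenvector_mod_exists[OF Ud(1) Ud(3)[OF g] _ finite_imageI[OF finite_B, of unit_fun] Wd(1) Wd(3)[OF g] v]
        Ud(2) supported_span[OF finite_B] by blast
    let ?E = "{w \<in> U. act g w - (\<lambda>b. c * w b) \<in> W}"
    have E: "fun_vs.subspace ?E"
    proof (rule fun_vs.subspaceI)
      have "act g 0 - (\<lambda>b. c * (0 :: 'b \<Rightarrow> complex) b) = 0" by (simp add: fun_eq_iff)
      then show "0 \<in> ?E" using Ud(4) Wd(4) by (simp only: mem_Collect_eq)
      fix x y assume x: "x \<in> ?E" and y: "y \<in> ?E"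
      have "act g (x + y) - (\<lambda>b. c * (x + y) b) = (act g x - (\<lambda>b. c * x b)) + (act g y - (\<lambda>b. c * y b))"
        by (rule ext) (simp add: op.f_add distrib_left)
      then show "x + y \<in> ?E" using x y Ud(5) Wd(5) by (simp only: mem_Collect_eq)
    next
      fix d x assume x: "x \<in> ?E"
      have "act g (\<lambda>b. d * x b) - (\<lambda>b. c * (d * x b)) = (\<lambda>b. d * (act g x - (\<lambda>b. c * x b)) b)"
        by (rule ext) (simp add: op.f_scale right_diff_distrib mult.left_commute)
      then show "(\<lambda>b. d * x b) \<in> ?E" using x Ud(7) Wd(7) by (simp only: mem_Collect_eq)
    qed
    have "act h w \<in> ?E" if h: "h \<in> H" and w: "w \<in> ?E" for h w
    proof -
      have "act h (act g w - (\<lambda>b. c * w b)) \<in> W" using w Wd(3)[OF h] by blast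
      moreover have "act g (act h w) - act h (act g w) \<in> W" using comm[OF g h] w U by blast
      ultimately have "(act g (act h w) - act h (act g w)) + act h (act g w - (\<lambda>b. c * w b)) \<in> W"
        by (intro Wd(5))
      then have "act g (act h w) - (\<lambda>b. c * act h w b) \<in> W" by (simp add: act_diff op.f_scale)
      then show ?thesis using w Ud(3)[OF h] by simp
    qed
    then have "stable H ?E" using E Ud(2) unfolding stable_def by blast
    moreover have "W \<subseteq> ?E"
    proof
      fix w assume w: "w \<in> W"
      then show "w \<in> ?E" using U Wd(6)[OF Wd(3)[OF g w] Wd(7)[OF w, of c]] by auto
    qed
    moreover have "W \<noteq> ?E" using cu by blast
    ultimately have "?P ?E" using U by blast
    then have "fun_vs.dim U \<le> fun_vs.dim ?E" by (rule least)
    then have "?E = U" using dim_less[OF E _ _ Ud(2)] by force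
    then show ?thesis using v by blast
  qed
  then show ?thesis using v U by blast
qed

text \<open>
  Everything is done modulo a stable subspace \<open>W\<close>, so that flags arise without quotient spaces.
  Connectedness enters twice: eigenvalues form finite sets, hence the weight of an eigenvector of
  the derived group is fixed under conjugation, and it is trivial on commutators.
\<close>

theorem Lie_Kolchin_mod:
  assumes "subgroup H GL" "H \<subseteq> G" "reg_connected H" "(derived GL ^^ n) H = {mat 1}"
    and "stable H W" "stable H V" "W \<subseteq> V" "W \<noteq> V"
  shows "\<exists>v. v \<in> V \<and> v \<notin> W \<and> (\<forall>g\<in>H. \<exists>c. act g v - (\<lambda>b. c * v b) \<in> W)"
  using assms
proof (induction n arbitrary: H W V)
  case 0
  then have H: "H = {mat 1}" by simp
  obtain v where v: "v \<in> V" "v \<notin> W" using 0 by blast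
  have "act (mat 1) v - (\<lambda>b. 1 * v b) = 0"
    using act_one stableD(2)[OF 0(6)] v by (auto simp: fun_eq_iff)
  then have "act (mat 1) v - (\<lambda>b. 1 * v b) \<in> W" using stableD(4)[OF 0(5)] by (simp only:)
  then show ?case using v H by blast
next
  case (Suc n)
  note H = Suc.prems(1,2) and con = Suc.prems(3) and W = Suc.prems(5) and V = Suc.prems(6)
  note Wd = stableD[OF W] and Vd = stableD[OF V]
  interpret HG: subgroup H GL by (rule H(1))
  let ?D = "derived GL H"
  have inv: "invertible x" if "x \<in> H" for x using HG.mem_carrier[OF that] by simp
  have adj: "inv\<^bsub>GL\<^esub> x = adj_inv x" "adj_inv x \<in> H" "x ** adj_inv x = mat 1" "adj_inv x ** x = mat 1" if "x \<in> H" for x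
  proof -
    show a: "inv\<^bsub>GL\<^esub> x = adj_inv x" by (rule GL_inv[OF inv[OF that]])
    show "adj_inv x \<in> H" using HG.m_inv_closed[OF that] a by simp
    show r: "x ** adj_inv x = mat 1" by (rule adj_inv_right[OF inv[OF that]])
    then show "adj_inv x ** x = mat 1" by (simp add: matrix_left_right_inverse)
  qed
  have D: "subgroup ?D GL" by (rule group.derived_is_subgroup[OF group_GL]) (use HG.subset in auto)
  have DH: "?D \<subseteq> H" by (rule group.derived_incl[OF group_GL _ H(1)]) simp
  have comm: "x ** y ** adj_inv x ** adj_inv y \<in> ?D" if "x \<in> H" "y \<in> H" for x y
  proof -
    have "x \<otimes>\<^bsub>GL\<^esub> y \<otimes>\<^bsub>GL\<^esub> inv\<^bsub>GL\<^esub> x \<otimes>\<^bsub>GL\<^esub> inv\<^bsub>GL\<^esub> y \<in> ?D"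
      unfolding derived_def by (rule generate.incl) (use that in blast)
    then show ?thesis using that adj by simp
  qed
  have mclosed: "x ** y \<in> H" if "x \<in> H" "y \<in> H" for x y using HG.m_closed[OF that] by simp
  have one: "mat 1 \<in> H" using HG.one_closed by simp
  have conj: "adj_inv h ** g ** h \<in> ?D" if h: "h \<in> H" and g: "g \<in> ?D" for h g
  proof -
    have gH: "g \<in> H" using g DH by blast
    have ai: "adj_inv (adj_inv h) = h"
      using adj[OF adj(2)[OF h]] adj[OF h] by (metis matrix_mul_assoc matrix_mul_lid matrix_mul_rid)
    have "(adj_inv h ** g ** adj_inv (adj_inv h) ** adj_inv g) \<otimes>\<^bsub>GL\<^esub> g \<in> ?D"
      by (rule subgroup.m_closed[OF D comm[OF adj(2)[OF h] gH] g])
    moreover have "(adj_inv h ** g ** adj_inv (adj_inv h) ** adj_inv g) ** g = adj_inv h ** g ** h"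
      using adj(4)[OF gH] by (simp add: ai flip: matrix_mul_assoc)
    ultimately show ?thesis by simp
  qed
  have D_stable: "stable ?D W" "stable ?D V" using W V DH unfolding stable_def by blast+
  have "(derived GL ^^ n) ?D = {mat 1}" using Suc.prems(4) by (simp add: funpow_swap1)
  then obtain v0 where v0: "v0 \<in> V" "v0 \<notin> W" "\<forall>g\<in>?D. \<exists>c. act g v0 - (\<lambda>b. c * v0 b) \<in> W"
    using Suc.IH[OF D _ reg_connected_derived[OF H(1) con] _ D_stable Suc.prems(7,8)] DH H(2) by blast
  obtain L where L: "fun_linear L" "\<forall>w\<in>W. L w = 0" "L v0 = 1"
    using fun_vs.exists_functional[OF Wd(1) v0(2)] by (elim exE conjE)
  define \<mu> where "\<mu> g = L (act g v0)" for g
  have L_scalar: "l (act g v) = c" if "fun_linear l" "\<forall>w\<in>W. l w = 0" "l v = 1" "act g v - (\<lambda>b. c * v b) \<in> W" for l g v c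
  proof -
    have "l (act g v - (\<lambda>b. c * v b)) = 0" using that by blast
    then have "l (\<lambda>b. act g v b - c * v b) = 0" by (simp add: fun_diff_def)
    then show ?thesis by (simp add: fun_linearD[OF that(1)] that(3))
  qed
  have \<mu>: "act g v0 - (\<lambda>b. \<mu> g * v0 b) \<in> W" if "g \<in> ?D" for g
  proof -
    obtain c where c: "act g v0 - (\<lambda>b. c * v0 b) \<in> W" using v0(3) \<open>g \<in> ?D\<close> by blast
    with L_scalar[OF L c] show ?thesis by (simp add: \<mu>_def)
  qed
  have \<mu>_conj: "\<mu> (adj_inv h ** g ** h) = \<mu> g" if h: "h \<in> H" and g: "g \<in> ?D" for h g
  proof -
    have gH: "g \<in> H" using g DH by blast
    \<comment> \<open>A translate of the weight vector \<open>v0\<close> by \<open>h\<close> is an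
      eigenvector of \<open>g\<close> whose eigenvalue is the weight of the conjugate of
      \<open>g\<close>. These weights thus range over a finite set while depending regularly on
      \<open>h\<close>.\<close>
    have "(\<lambda>h. \<mu> (adj_inv h ** g ** h)) ` H \<subseteq> eigenvalues W g"
    proof (rule image_subsetI)
      fix h assume h: "h \<in> H"
      let ?k = "adj_inv h ** g ** h"
      have v0B: "v0 \<in> supported B" using v0 Vd(2) by blast
      have "act h (act ?k v0 - (\<lambda>b. \<mu> ?k * v0 b)) \<in> W" by (rule Wd(3)[OF h \<mu>[OF conj[OF h g]]])
      moreover have "act h (act ?k v0) = act g (act h v0)"
      proof -
        have "h ** ?k = g ** h" using adj(3)[OF h] by (simp add: matrix_mul_assoc)
        then show ?thesis
          using act_mult[of h ?k v0] act_mult[of g h v0] h gH conj[OF h g] DH H(2) by (metis subsetD)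
      qed
      ultimately have "act g (act h v0) - (\<lambda>b. \<mu> ?k * act h v0 b) \<in> W" by (simp add: act_diff op.f_scale)
      then show "\<mu> ?k \<in> eigenvalues W g"
        unfolding eigenvalues_def using act_supported act_notin[OF H W h v0B v0(2)] by blast
    qed
    moreover have "(\<lambda>h. \<mu> (adj_inv h ** g ** h)) \<in> regular"
      unfolding \<mu>_def
      by (rule regular_compose[OF act_regular[OF L(1)]])
        (intro regular_map_mult regular_map_adj_inv regular_map_id regular_map_const)
    ultimately have "\<mu> (adj_inv h ** g ** h) = \<mu> (adj_inv (mat 1) ** g ** mat 1)"
      using reg_connectedD[OF con _ _ finite_eigenvalues[OF W gH] h one] by blast
    also have "adj_inv (mat 1 :: complex^'n^'n) = mat 1" using adj(3)[OF one] by simp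
    finally show ?thesis by simp
  qed
  \<comment> \<open>The full weight space of \<mu> modulo W; it is stable under H because
    conjugation preserves \<mu>.\<close>
  let ?V = "{v \<in> V. \<forall>g\<in>?D. act g v - (\<lambda>b. \<mu> g * v b) \<in> W}"
  have sub: "fun_vs.subspace ?V"
  proof (rule fun_vs.subspaceI)
    have "act g 0 - (\<lambda>b. \<mu> g * (0 :: 'b \<Rightarrow> complex) b) = 0" for g by (simp add: fun_eq_iff)
    then show "0 \<in> ?V" using Vd(4) Wd(4) by (intro CollectI conjI ballI) (simp_all only:)
    fix x y assume x: "x \<in> ?V" and y: "y \<in> ?V"
    have "act g (x + y) - (\<lambda>b. \<mu> g * (x + y) b) = (act g x - (\<lambda>b. \<mu> g * x b)) + (act g y - (\<lambda>b. \<mu> g * y b))" for g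
      by (rule ext) (simp add: op.f_add distrib_left)
    then show "x + y \<in> ?V" using x y Vd(5) Wd(5) by (simp only: mem_Collect_eq) blast
  next
    fix d x assume x: "x \<in> ?V"
    have "act g (\<lambda>b. d * x b) - (\<lambda>b. \<mu> g * (d * x b)) = (\<lambda>b. d * (act g x - (\<lambda>b. \<mu> g * x b)) b)" for g
      by (rule ext) (simp add: op.f_scale right_diff_distrib mult.left_commute)
    then show "(\<lambda>b. d * x b) \<in> ?V" using x Vd(7) Wd(7) by (simp only: mem_Collect_eq) blast
  qed
  have V_stable: "act h v \<in> ?V" if h: "h \<in> H" and v: "v \<in> ?V" for h v
  proof -
    have "act g (act h v) - (\<lambda>b. \<mu> g * act h v b) \<in> W" if g: "g \<in> ?D" for g
    proof -
      let ?k = "adj_inv h ** g ** h"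
      have gH: "g \<in> H" using g DH by blast
      have "act h (act ?k v - (\<lambda>b. \<mu> ?k * v b)) \<in> W" using v Wd(3)[OF h] conj[OF h g] by blast
      moreover have "act h (act ?k v) = act g (act h v)"
      proof -
        have "h ** ?k = g ** h" using adj(3)[OF h] by (simp add: matrix_mul_assoc)
        then show ?thesis
          using act_mult[of h ?k v] act_mult[of g h v] h gH conj[OF h g] DH H(2) by (metis subsetD)
      qed
      ultimately show ?thesis using \<mu>_conj[OF h g] by (simp add: act_diff op.f_scale)
    qed
    then show ?thesis using v Vd(3)[OF h] by simp
  qed
  have stV: "stable H ?V" using sub Vd(2) V_stable unfolding stable_def by blast
  have WV: "W \<subseteq> ?V"
  proof
    fix w assume w: "w \<in> W"
    have "act g w - (\<lambda>b. \<mu> g * w b) \<in> W" if "g \<in> ?D" for g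
      using Wd(6)[OF Wd(3)[OF _ w] Wd(7)[OF w]] that DH by blast
    then show "w \<in> ?V" using w Suc.prems(7) by blast
  qed
  have WnV: "W \<noteq> ?V" using v0 \<mu> by blast
  have \<mu>_comm: "\<mu> (x ** y ** adj_inv x ** adj_inv y) = 1" if x: "x \<in> H" and y: "y \<in> H" for x y
  proof -
    note VV = stableD[OF stV]
    have "v0 \<in> ?V" using v0 \<mu> by blast
    from op.eigenvector_mod_exists[OF VV(1) VV(3)[OF y] _ finite_imageI[OF finite_B, of unit_fun] Wd(1) Wd(3)[OF y] this v0(2)]
    obtain c v1 where v1: "v1 \<in> ?V" "v1 \<notin> W" "act y v1 - (\<lambda>b. c * v1 b) \<in> W"
      using VV(2) supported_span[OF finite_B] by blast
    have v1B: "v1 \<in> supported B" using v1(1) Vd(2) by blast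
    have c0: "c \<noteq> 0"
    proof
      assume "c = 0"
      then have "act y v1 - 0 \<in> W" using v1(3) by (simp add: zero_fun_def)
      then show False using act_notin[OF H W y v1B v1(2)] by simp
    qed
    let ?k = "\<lambda>x. x ** y ** adj_inv x ** adj_inv y"
    have "(\<lambda>x. \<mu> (?k x)) ` H \<subseteq> (\<lambda>d. d / c) ` eigenvalues W y"
    proof (rule image_subsetI)
      fix x assume x: "x \<in> H"
      let ?v = "act (adj_inv x) v1"
      have kD: "?k x \<in> ?D" by (rule comm[OF x y])
      have kH: "?k x \<in> H" using kD DH by blast
      have "act (?k x) v1 - (\<lambda>b. \<mu> (?k x) * v1 b) \<in> W" using v1(1) kD by blast
      from act_mod_scalar_mult[OF W kH y H(2) this v1(3)]
      have "act (?k x ** y) v1 - (\<lambda>b. \<mu> (?k x) * c * v1 b) \<in> W" .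
      then have "act (adj_inv x) (act (?k x ** y) v1 - (\<lambda>b. \<mu> (?k x) * c * v1 b)) \<in> W"
        by (rule Wd(3)[OF adj(2)[OF x]])
      moreover have "act (adj_inv x) (act (?k x ** y) v1) = act y ?v"
      proof -
        have "adj_inv x ** (?k x ** y) = (adj_inv x ** x) ** y ** adj_inv x ** (adj_inv y ** y)"
          by (simp add: matrix_mul_assoc)
        also have "\<dots> = y ** adj_inv x" using adj(4) x y by simp
        finally show ?thesis
          using act_mult[of "adj_inv x" "?k x ** y" v1] act_mult[of y "adj_inv x" v1] adj(2)[OF x] y
            mclosed[OF kH y] H(2) by (metis subsetD)
      qed
      ultimately have "act y ?v - (\<lambda>b. (\<mu> (?k x) * c) * ?v b) \<in> W" by (simp add: act_diff op.f_scale)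
      then have "\<mu> (?k x) * c \<in> eigenvalues W y"
        unfolding eigenvalues_def using act_supported act_notin[OF H W adj(2)[OF x] v1B v1(2)] by blast
      then show "\<mu> (?k x) \<in> (\<lambda>d. d / c) ` eigenvalues W y" using c0 by (intro image_eqI[of _ _ "\<mu> (?k x) * c"]) auto
    qed
    moreover have "(\<lambda>x. \<mu> (?k x)) \<in> regular"
      unfolding \<mu>_def
      by (rule regular_compose[OF act_regular[OF L(1)]])
        (intro regular_map_mult regular_map_adj_inv regular_map_id regular_map_const)
    ultimately have "\<mu> (?k x) = \<mu> (?k (mat 1))"
      using reg_connectedD[OF con _ _ finite_imageI[OF finite_eigenvalues[OF W y]] x one] by blast
    also have "adj_inv (mat 1 :: complex^'n^'n) = mat 1" using adj(3)[OF one] by simp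
    then have "?k (mat 1) = mat 1" using adj(3)[OF y] by simp
    also have "\<mu> (mat 1) = 1" using act_one v0 Vd(2) L(3) by (auto simp: \<mu>_def)
    finally show ?thesis .
  qed
  have "act g (act h v) - act h (act g v) \<in> W" if g: "g \<in> H" and h: "h \<in> H" and v: "v \<in> ?V" for g h v
  proof -
    let ?k = "g ** h ** adj_inv g ** adj_inv h"
    have kD: "?k \<in> ?D" by (rule comm[OF g h])
    have "act h (act g v) \<in> ?V" using V_stable g h v by blast
    then have "act ?k (act h (act g v)) - (\<lambda>b. \<mu> ?k * act h (act g v) b) \<in> W" using kD by blast
    then have "act ?k (act h (act g v)) - act h (act g v) \<in> W" by (simp add: \<mu>_comm[OF g h])
    moreover have "act ?k (act h (act g v)) = act g (act h v)"
    proof -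
      have "?k ** (h ** g) = g ** h ** adj_inv g ** (adj_inv h ** h) ** g" by (simp add: matrix_mul_assoc)
      also have "\<dots> = g ** h ** (adj_inv g ** g)" using adj(4)[OF h] by (simp add: matrix_mul_assoc[symmetric])
      also have "\<dots> = g ** h" using adj(4)[OF g] by simp
      finally have "?k ** (h ** g) = g ** h" .
      then show ?thesis
        using act_mult[of ?k "h ** g" v] act_mult[of h g v] act_mult[of g h v] g h kD DH mclosed[OF h g] H(2)
        by (metis subsetD)
    qed
    ultimately show ?thesis by simp
  qed
  from commuting_eigenvector[OF H W stV WV WnV this] show ?case by blast
qed

end

section \<open>Vanishing for modules from vanishing for characters\<close>

lemma acyclic_char_cong:
  assumes "\<And>g. g \<in> carrier G \<Longrightarrow> \<psi> g = \<psi>' g"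
  shows "acyclic_char G N \<psi> = acyclic_char G N \<psi>'"
proof -
  have "cochain1 G N \<psi> = cochain1 G N \<psi>'"
    using assms by (intro ext) (simp add: cochain1_def)
  then show ?thesis by (simp add: acyclic_char_def)
qed

text \<open>Modulo N, right translation by \<open>z\<close> agrees with left translation by
  \<open>z\<close>, which acts on cochains as the scalar \<psi> z. Right translation commutes with
  left translations, so its prism is equivariant and 1 - \<psi> z annihilates the
  cohomology.\<close>

lemma (in group) acyclic_abelian:
  assumes N: "N \<lhd> G" and z: "z \<in> carrier G" "\<psi> z \<noteq> 1"
    and comm: "\<And>x. x \<in> carrier G \<Longrightarrow> inv x \<otimes> (inv z \<otimes> (x \<otimes> z)) \<in> N"
  shows "acyclic_char G N \<psi>"
  unfolding acyclic_char_def
proof (intro allI impI)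
  fix q f assume f: "cochain1 G N \<psi> q f" and closed: "\<forall>xs\<in>tuples G (Suc q). cobd f xs = 0"
  have Nc: "n \<in> carrier G" if "n \<in> N" for n
    using subgroup.mem_carrier[OF normal_imp_subgroup[OF N] that] .
  let ?t = "\<lambda>y. y \<otimes> z"
  let ?h = "\<lambda>ys. 1 / (1 - \<psi> z) * prism ?t f ys"
  have f_app: "f ys = \<psi> g * f xs" if "g \<in> carrier G" "length xs = q" "list_all2 (grel G N g) xs ys" for g xs ys
    using f that unfolding cochain1_def by blast
  show "\<exists>h. cochain1 G N \<psi> (q - 1) h \<and> (\<forall>xs\<in>tuples G q. f xs = cobd h xs)"
  proof (cases q)
    case 0
    have "f [] = 0" using bspec[OF closed, of "[\<one>]"] by (simp add: 0)
    then show ?thesis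
      by (intro exI[of _ "\<lambda>_. 0"]) (simp add: 0 cochain1_def)
  next
    case (Suc r)
    have "cochain1 G N \<psi> r ?h"
      unfolding cochain1_def
    proof (intro ballI allI impI)
      fix g xs ys assume g: "g \<in> carrier G" "length xs = r" and xs: "list_all2 (grel G N g) xs ys"
      have "prism ?t f ys = \<psi> g * prism ?t f xs"
      proof (rule prism_additive_rel[OF additive_mult_left xs])
        fix x y assume "grel G N g x y"
        then obtain n where n: "n \<in> N" "y = g \<otimes> x \<otimes> n" "x \<in> carrier G" unfolding grel_def by blast
        have "inv z \<otimes> n \<otimes> z \<in> N" by (rule normal.inv_op_closed1[OF N z(1) n(1)])
        moreover have "inv (x \<otimes> z) \<otimes> (inv g \<otimes> (y \<otimes> z)) = inv z \<otimes> n \<otimes> z"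
          using n g z Nc[OF n(1)] by (simp add: group_word_simps)
        ultimately show "grel G N g (x \<otimes> z) (y \<otimes> z)"
          using n g z Nc[OF n(1)] by (intro grelI) simp_all
      next
        fix us vs assume "list_all2 (grel G N g) us vs" "length us = Suc (length xs)"
        then show "f vs = \<psi> g * f us" using g Suc by (intro f_app) auto
      qed
      then show "?h ys = \<psi> g * ?h xs" by simp
    qed
    moreover have "f xs = cobd ?h xs" if xs: "xs \<in> tuples G q" for xs
    proof -
      have xc: "set xs \<subseteq> carrier G" using xs by (simp add: tuples_def)
      have "list_all2 (grel G N z) xs (map ?t xs)"
        using xc z comm by (auto simp: list_all2_map2 list_all2_same intro!: grelI)
      then have "f (map ?t xs) = \<psi> z * f xs" using xs z by (intro f_app) (auto simp: tuples_def)
      then have "(1 - \<psi> z) * f xs = cobd (prism ?t f) xs + prism ?t (cobd f) xs"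
        unfolding prism_homotopy by (simp add: algebra_simps)
      also have "prism ?t (cobd f) xs = 0"
      proof (rule prism_zero)
        fix us assume "set us \<subseteq> set xs \<union> ?t ` set xs" "length us = Suc (length xs)"
        moreover have "set xs \<union> ?t ` set xs \<subseteq> carrier G" using xc z by auto
        ultimately have "us \<in> tuples G (Suc q)" using xs unfolding tuples_def by auto
        then show "cobd f us = 0" using closed by blast
      qed
      finally have "f xs = 1 / (1 - \<psi> z) * cobd (prism ?t f) xs" using z(2) by (simp add: field_simps)
      then show ?thesis by (simp only: cobd_cmult)
    qed
    ultimately show ?thesis by (intro exI[of _ ?h]) (simp add: Suc)
  qed
qed

definition algebraic_character :: "(complex^'n^'n) set \<Rightarrow> (complex^'n^'n \<Rightarrow> complex) \<Rightarrow> bool" where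
  "algebraic_character G \<theta> \<longleftrightarrow> \<theta> \<in> regular \<and> \<theta> (mat 1) = 1 \<and>
     (\<forall>g\<in>G. \<forall>h\<in>G. \<theta> (g ** h) = \<theta> g * \<theta> h)"

lemma GL_sub_simps [simp]:
  "carrier (GL_sub H) = H" "x \<otimes>\<^bsub>GL_sub H\<^esub> y = x ** y" "\<one>\<^bsub>GL_sub H\<^esub> = mat 1"
  by (simp_all add: GL_def)

lemma cobd_fun_linear: "fun_linear L \<Longrightarrow> L (cobd F xs) = cobd (\<lambda>ys. L (F ys)) xs"
proof -
  assume L: "fun_linear L"
  have "Modules.additive L" by unfold_locales (use fun_linearD(1)[OF L] in \<open>simp add: plus_fun_def\<close>)
  then show ?thesis by (rule cobd_additive[symmetric])
qed

context regular_rep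
begin

lemma equivariant_module_twist:
  assumes W: "stable G W" and H: "H \<subseteq> G"
  shows "equivariant_module (twist \<sigma> act) W H"
proof
  show "twist \<sigma> act g (x + y) = twist \<sigma> act g x + twist \<sigma> act g y" for g x y
    by (rule ext) (simp only: twist_def op.f_add plus_fun_apply distrib_left)
qed (use stableD[OF W] in auto)

text \<open>The long exact sequence of W in W', done by hand: the coefficient of \<open>v\<close> in
  a cocycle is a cocycle for the character \<sigma>\<theta>, its primitive is lifted to W', and what
  remains after subtracting the boundary of the lift has values in W.\<close>

lemma bounds_extend_by_character:
  assumes H: "subgroup H GL" "H \<subseteq> G"
    and \<sigma>: "\<And>g h. g \<in> H \<Longrightarrow> h \<in> H \<Longrightarrow> \<sigma> (g ** h) = \<sigma> g * \<sigma> h" "\<And>g. g \<in> H \<Longrightarrow> \<sigma> g \<noteq> 0"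
    and \<theta>: "\<And>g. g \<in> G \<Longrightarrow> act g v - (\<lambda>b. \<theta> g * v b) \<in> W"
    and ne: "\<exists>g\<in>H. \<sigma> g * \<theta> g \<noteq> 1"
    and acyc: "acyclic_char (GL_sub H) {mat 1} (\<lambda>g. \<sigma> g * \<theta> g)"
    and W: "stable G W" and W': "stable G W'" "W \<subseteq> W'" "v \<in> W'"
    and L: "fun_linear L" "\<And>w. w \<in> W \<Longrightarrow> L w = 0" "L v = 1"
    and W'_L: "\<And>w. w \<in> W' \<Longrightarrow> w - (\<lambda>b. L w * v b) \<in> W"
    and IH: "\<And>q F. cocycle GL (twist \<sigma> act) W H q F \<Longrightarrow> bounds GL (twist \<sigma> act) W H q F"
    and F: "cocycle GL (twist \<sigma> act) W' H q F"
  shows "bounds GL (twist \<sigma> act) W' H q F"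
proof (cases q)
  case 0
  interpret MW: equivariant_module GL "twist \<sigma> act" W' H by (rule equivariant_module_twist[OF W'(1) H(2)])
  have "mat 1 \<in> H" using subgroup.one_closed[OF H(1)] by simp
  then have "[mat 1] \<in> lists_of H (Suc q)" by (simp add: lists_of_def 0)
  then have "cobd F [mat 1] = 0" using F unfolding cocycle_def by blast
  then have "F [] = 0" by simp
  then show ?thesis unfolding bounds_def
    using MW.equivariant_zero[OF subset_refl] by (intro exI[of _ "\<lambda>_. 0"]) (auto simp: 0 lists_of_def)
next
  case (Suc r)
  interpret MW: equivariant_module GL "twist \<sigma> act" W' H by (rule equivariant_module_twist[OF W'(1) H(2)])
  let ?act = "twist \<sigma> act"
  interpret HG: subgroup H GL by (rule H(1))
  have Hinv: "adj_inv h \<in> H" "h ** adj_inv h = mat 1" "adj_inv h ** h = mat 1" if "h \<in> H" for h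
  proof -
    have i: "invertible h" using HG.mem_carrier[OF that] by simp
    show "adj_inv h \<in> H" using HG.m_inv_closed[OF that] GL_inv[OF i] by simp
    show r: "h ** adj_inv h = mat 1" by (rule adj_inv_right[OF i])
    then show "adj_inv h ** h = mat 1" by (simp add: matrix_left_right_inverse)
  qed
  have Hmult: "g ** h \<in> H" if "g \<in> H" "h \<in> H" for g h using HG.m_closed[OF that] by simp
  have L_act: "L (act g w) = \<theta> g * L w" if g: "g \<in> G" and w: "w \<in> W'" for g w
  proof -
    have diff: "L (x - y) = L x - L y" for x y
      using fun_linearD(3)[OF L(1), of x y] by (simp add: fun_diff_def)
    have "L (act g v) = \<theta> g"
      using L(2)[OF \<theta>[OF g]] fun_linearD(2)[OF L(1), of "\<theta> g" v] by (simp add: diff L(3))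
    moreover have "L (act g (w - (\<lambda>b. L w * v b))) = 0" by (rule L(2)[OF stableD(3)[OF W g W'_L[OF w]]])
    then have "L (act g w) - L w * L (act g v) = 0"
      by (simp add: act_diff diff op.f_scale fun_linearD(2)[OF L(1)])
    ultimately show ?thesis by simp
  qed
  have FW': "F xs \<in> W'" for xs using F by (simp add: cocycle_def equivariant_def)
  let ?\<phi> = "\<lambda>xs. L (F xs)"
  have rel: "ys = map ((**) g) xs \<and> xs \<in> lists_of H (length xs)"
    if "list_all2 (grel (GL_sub H) {mat 1} g) xs ys" for g xs ys
  proof -
    have "grel (GL_sub H) {mat 1} g = (\<lambda>x y. x \<in> H \<and> y = g ** x)"
      by (intro ext) (simp add: grel_def)
    then show ?thesis using that by (simp add: list_all2_map_in_iff lists_of_def)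
  qed
  have rel': "list_all2 (grel (GL_sub H) {mat 1} g) xs (map ((**) g) xs)" if "xs \<in> lists_of H p" for g xs p
  proof -
    have "grel (GL_sub H) {mat 1} g = (\<lambda>x y. x \<in> H \<and> y = g ** x)"
      by (intro ext) (simp add: grel_def)
    then show ?thesis using that by (simp add: list_all2_map_in_iff lists_of_def)
  qed
  have tup: "xs \<in> tuples (GL_sub H) p \<longleftrightarrow> xs \<in> lists_of H p" for xs p
    by (auto simp: tuples_def lists_of_def)
  have GLm: "(\<otimes>\<^bsub>GL\<^esub>) g = (**) g" for g :: "complex^'n^'n" by (rule ext) simp
  have L_twist: "L (?act g w) = \<sigma> g * \<theta> g * L w" if "g \<in> H" "w \<in> W'" for g w
    using L_act[of g w] that H(2) by (auto simp: twist_def fun_linearD(2)[OF L(1)])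
  have "cochain1 (GL_sub H) {mat 1} (\<lambda>g. \<sigma> g * \<theta> g) q ?\<phi>"
    unfolding cochain1_def
  proof (intro ballI allI impI)
    fix g xs ys assume g: "g \<in> carrier (GL_sub H)" and xs: "length xs = q" "list_all2 (grel (GL_sub H) {mat 1} g) xs ys"
    have "F ys = ?act g (F xs)"
      using F g rel[OF xs(2)] xs(1) by (simp add: cocycle_def equivariant_def GLm)
    then show "?\<phi> ys = \<sigma> g * \<theta> g * ?\<phi> xs" using L_twist g FW' by simp
  qed
  moreover have "cobd ?\<phi> xs = 0" if "xs \<in> tuples (GL_sub H) (Suc q)" for xs
  proof -
    have "cobd F xs = 0" using F that by (simp add: cocycle_def tup)
    then show ?thesis using cobd_fun_linear[OF L(1), of F xs] fun_linearD(4)[OF L(1)] by (simp add: zero_fun_def)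
  qed
  ultimately obtain h where h: "cochain1 (GL_sub H) {mat 1} (\<lambda>g. \<sigma> g * \<theta> g) r h"
    "\<And>xs. xs \<in> lists_of H q \<Longrightarrow> ?\<phi> xs = cobd h xs"
    using acyc[unfolded acyclic_char_def, rule_format, of q ?\<phi>] by (auto simp: Suc tup)
  have h_eq: "h (map ((**) g) xs) = \<sigma> g * \<theta> g * h xs" if "g \<in> H" "xs \<in> lists_of H r" for g xs
    using h(1) rel'[OF that(2)] that by (simp add: cochain1_def lists_of_def)
  have h_Nil: "h [] = 0" if "r = 0"
  proof -
    obtain g where "g \<in> H" "\<sigma> g * \<theta> g \<noteq> 1" using ne by blast
    then show ?thesis using h_eq[of g "[]"] that by (simp add: lists_of_def)
  qed
  \<comment> \<open>The lift: the list is translated so that its first vertex is the identity,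
    \<open>h\<close> is evaluated and multiplied by \<open>v\<close>, and the result is translated
    back. The value 0 at the empty list is the normalisation that \<open>bounds\<close> demands, and
    agrees with \<open>h_Nil\<close>.\<close>
  define k where "k xs = (case xs of [] \<Rightarrow> 0 | x # us \<Rightarrow>
      if x \<in> H then (\<lambda>b. \<sigma> x * h (map ((**) (adj_inv x)) xs) * act x v b) else 0)" for xs
  have kW': "k xs \<in> W'" for xs
  proof (cases xs)
    case Nil
    then show ?thesis using stableD(4)[OF W'(1)] by (simp add: k_def)
  next
    case (Cons x us)
    have "(\<lambda>b. \<sigma> x * h (map ((**) (adj_inv x)) xs) * act x v b) \<in> W'" if "x \<in> H"
      using that H(2) by (intro stableD(7)[OF W'(1)] stableD(3)[OF W'(1) _ W'(3)]) blast
    then show ?thesis using stableD(4)[OF W'(1)] Cons unfolding k_def by simp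
  qed
  have k: "equivariant GL ?act W' H H r k"
    unfolding equivariant_def
  proof (intro conjI allI ballI kW')
    fix g xs assume g: "g \<in> H" and xs: "xs \<in> lists_of H r"
    show "k (map ((\<otimes>\<^bsub>GL\<^esub>) g) xs) = ?act g (k xs)"
    proof (cases xs)
      case Nil
      then show ?thesis by (simp add: k_def twist_def zero_fun_def[symmetric] fun_eq_iff)
    next
      case (Cons x us)
      have x: "x \<in> H" using xs Cons by (simp add: lists_of_def)
      have gx: "adj_inv (g ** x) ** g = adj_inv x"
      proof -
        have "adj_inv (g ** x) ** g ** (x ** adj_inv x) = adj_inv (g ** x) ** (g ** x) ** adj_inv x"
          by (simp add: matrix_mul_assoc)
        then show ?thesis using Hinv(2)[OF x] Hinv(3)[OF Hmult[OF g x]] by simp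
      qed
      have "map ((**) (adj_inv (g ** x))) (map ((**) g) xs) = map ((**) (adj_inv x)) xs"
        by (simp add: matrix_mul_assoc gx)
      moreover have "k (map ((**) g) xs) =
          (\<lambda>b. \<sigma> (g ** x) * h (map ((**) (adj_inv (g ** x))) (map ((**) g) xs)) * act (g ** x) v b)"
        using Hmult[OF g x] by (simp add: k_def Cons)
      ultimately have "k (map ((**) g) xs) = (\<lambda>b. \<sigma> (g ** x) * h (map ((**) (adj_inv x)) xs) * act (g ** x) v b)"
        by (simp only:)
      also have "\<dots> = (\<lambda>b. \<sigma> g * (\<sigma> x * h (map ((**) (adj_inv x)) xs) * act g (act x v) b))"
        using \<sigma>(1)[OF g x] act_mult[of g x v] g x H(2) by (auto simp: fun_eq_iff)
      also have "\<dots> = ?act g (k xs)"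
        using x by (simp add: k_def Cons twist_def op.f_scale)
      finally show ?thesis by (simp add: GLm)
    qed
  qed
  have Lk: "L (k xs) = h xs" if xs: "xs \<in> lists_of H r" for xs
  proof (cases xs)
    case Nil
    then have "r = 0" using xs by (simp add: lists_of_def)
    then show ?thesis using h_Nil Nil fun_linearD(4)[OF L(1)] by (simp add: k_def zero_fun_def)
  next
    case (Cons x us)
    have x: "x \<in> H" using xs Cons by (simp add: lists_of_def)
    let ?ys = "map ((**) (adj_inv x)) xs"
    have ys: "?ys \<in> lists_of H r" using xs Hmult Hinv(1)[OF x] by (auto simp: lists_of_def)
    have "map ((**) x) ?ys = xs" by (simp add: matrix_mul_assoc Hinv(2)[OF x] map_idI)
    then have "h xs = \<sigma> x * \<theta> x * h ?ys" using h_eq[OF x ys] by simp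
    moreover have "L (k xs) = \<sigma> x * h ?ys * L (act x v)"
      using x fun_linearD(2)[OF L(1)] by (simp add: k_def Cons)
    ultimately show ?thesis using L_act[of x v] x H(2) W'(3) L(3) by auto
  qed
  \<comment> \<open>Cut off to 0 because values in W are required on all lists, while the difference
    lies in W only on lists over H of the right length.\<close>
  define E where "E xs = (if xs \<in> lists_of H q then F xs - cobd k xs else 0)" for xs
  have EW: "E xs \<in> W" for xs
  proof (cases "xs \<in> lists_of H q")
    case True
    have "F xs - cobd k xs \<in> W'" by (intro stableD(6)[OF W'(1)] FW' MW.V_cobd kW')
    then have "F xs - cobd k xs - (\<lambda>b. L (F xs - cobd k xs) * v b) \<in> W" by (rule W'_L)
    moreover have "cobd (\<lambda>ys. L (k ys)) xs = cobd h xs"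
      by (rule cobd_cong_lists_of[OF True]) (simp add: Suc Lk)
    then have "L (F xs - cobd k xs) = 0"
      using h(2)[OF True] fun_linearD(3)[OF L(1), of "F xs" "cobd k xs"] cobd_fun_linear[OF L(1), of k xs]
      by (simp add: fun_diff_def)
    ultimately show ?thesis using True by (simp add: E_def fun_diff_def)
  next
    case False
    then show ?thesis using stableD(4)[OF W] by (simp add: E_def)
  qed
  have dk: "equivariant GL ?act W' H H q (cobd k)"
    using MW.equivariant_cobd[OF subset_refl k] by (simp add: Suc)
  have map_in: "map ((**) g) xs \<in> lists_of H p" if "g \<in> H" "xs \<in> lists_of H p" for g xs p
    using that Hmult by (auto simp: lists_of_def)
  have "cocycle GL ?act W H q E"
    unfolding cocycle_def
  proof (intro conjI ballI)
    have "equivariant GL ?act W' H H q (\<lambda>xs. F xs - cobd k xs)"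
      using F dk by (intro MW.equivariant_diff) (auto simp: cocycle_def)
    then show "equivariant GL ?act W H H q E"
      using EW map_in unfolding equivariant_def by (simp add: E_def GLm)
    fix xs assume xs: "xs \<in> lists_of H (Suc q)"
    have "cobd E xs = cobd (\<lambda>xs. F xs - cobd k xs) xs"
      by (rule cobd_cong_lists_of[OF xs]) (simp add: E_def)
    also have "\<dots> = 0" using F xs by (simp add: cobd_diff cobd_cobd cocycle_def)
    finally show "cobd E xs = 0" .
  qed
  from IH[OF this] obtain u where u: "equivariant GL ?act W H H r u" "q = 1 \<longrightarrow> u [] = 0"
    "\<forall>xs\<in>lists_of H q. E xs = cobd u xs"
    unfolding bounds_def Suc by (elim exE conjE) simp
  have "equivariant GL ?act W' H H r u" using u(1) W'(2) unfolding equivariant_def by blast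
  from MW.equivariant_add[OF subset_refl k this]
  have "equivariant GL ?act W' H H (q - 1) (\<lambda>xs. k xs + u xs)" by (simp add: Suc)
  moreover have "k [] = 0" by (simp add: k_def)
  moreover have "F xs = cobd (\<lambda>xs. k xs + u xs) xs" if "xs \<in> lists_of H q" for xs
    using u(3) that by (simp add: cobd_add E_def diff_eq_eq add.commute)
  ultimately show ?thesis unfolding bounds_def
    using u(2) by (intro exI[of _ "\<lambda>xs. k xs + u xs"]) simp
qed

text \<open>A stable subspace of greatest dimension with vanishing cohomology is everything, since
  otherwise an eigenvector modulo it enlarges it. Stability is required under G rather than H, so
  that the characters that arise are algebraic on the connected group.\<close>

theorem bounds_of_characters:
  assumes con: "reg_connected G" "(derived GL ^^ n) G = {mat 1}"
    and H: "subgroup H GL" "H \<subseteq> G"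
    and \<sigma>: "\<And>g h. g \<in> H \<Longrightarrow> h \<in> H \<Longrightarrow> \<sigma> (g ** h) = \<sigma> g * \<sigma> h" "\<And>g. g \<in> H \<Longrightarrow> \<sigma> g \<noteq> 0"
    and acyc: "\<And>\<theta>. algebraic_character G \<theta> \<Longrightarrow>
      (\<exists>g\<in>H. \<sigma> g * \<theta> g \<noteq> 1) \<and> acyclic_char (GL_sub H) {mat 1} (\<lambda>g. \<sigma> g * \<theta> g)"
    and F: "cocycle GL (twist \<sigma> act) (supported B) H q F"
  shows "bounds GL (twist \<sigma> act) (supported B) H q F"
proof -
  let ?P = "\<lambda>W. stable G W \<and>
    (\<forall>q F. cocycle GL (twist \<sigma> act) W H q F \<longrightarrow> bounds GL (twist \<sigma> act) W H q F)"
  have supp: "stable G (supported B)"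
    unfolding stable_def using subspace_supported act_supported by blast
  have dim_le: "fun_vs.dim W \<le> fun_vs.dim (supported B)" if "stable G W" for W
    using dim_less[of W "supported B"] stableD[OF that] by force
  have zero: "?P {0}"
  proof -
    have "stable G {0}"
      unfolding stable_def using fun_vs.subspace_single_0 subspace_supported fun_vs.subspace_0 by fastforce
    moreover have "bounds GL (twist \<sigma> act) {0} H q F" if "cocycle GL (twist \<sigma> act) {0} H q F" for q F
    proof -
      have "F xs = 0" for xs using that by (simp add: cocycle_def equivariant_def)
      then show ?thesis unfolding bounds_def
        using equivariant_module.equivariant_zero[OF equivariant_module_twist[OF \<open>stable G {0}\<close> H(2)] subset_refl]
        by (intro exI[of _ "\<lambda>_. 0"]) (simp add: cobd_zero)
    qed
    ultimately show ?thesis by blast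
  qed
  have "\<exists>W. ?P W \<and> (\<forall>W'. ?P W' \<longrightarrow> fun_vs.dim W' \<le> fun_vs.dim W)"
  proof (rule ex_has_greatest_nat[of ?P "{0}" fun_vs.dim "Suc (fun_vs.dim (supported B))"])
    show "\<forall>W. ?P W \<longrightarrow> fun_vs.dim W < Suc (fun_vs.dim (supported B))"
      using dim_le by (simp add: less_Suc_eq_le)
  qed (rule zero)
  then obtain W where W: "?P W \<and> (\<forall>W'. ?P W' \<longrightarrow> fun_vs.dim W' \<le> fun_vs.dim W)" ..
  note greatest = mp[OF spec[OF conjunct2[OF W]]]
  have stW: "stable G W" using W by blast
  have "W = supported B"
  proof (rule ccontr)
    assume "W \<noteq> supported B"
    from Lie_Kolchin_mod[OF G subset_refl con stW supp stableD(2)[OF stW] this]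
    obtain v where v: "v \<in> supported B" "v \<notin> W" "\<forall>g\<in>G. \<exists>c. act g v - (\<lambda>b. c * v b) \<in> W"
      by (elim exE conjE)
    obtain L where L: "fun_linear L" "\<forall>w\<in>W. L w = 0" "L v = 1"
      using fun_vs.exists_functional[OF stableD(1)[OF stW] v(2)] by (elim exE conjE)
    have diff: "L (x - y) = L x - L y" for x y
      using fun_linearD(3)[OF L(1), of x y] by (simp add: fun_diff_def)
    define \<theta> where "\<theta> g = L (act g v)" for g
    have \<theta>: "act g v - (\<lambda>b. \<theta> g * v b) \<in> W" if g: "g \<in> G" for g
    proof -
      obtain c where c: "act g v - (\<lambda>b. c * v b) \<in> W" using v(3) g by blast
      then have "L (act g v - (\<lambda>b. c * v b)) = 0" using L(2) by blast
      then have "\<theta> g = c" using fun_linearD(2)[OF L(1), of c v] by (simp add: diff L(3) \<theta>_def)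
      then show ?thesis using c by simp
    qed
    have "algebraic_character G \<theta>"
      unfolding algebraic_character_def
    proof (intro conjI ballI)
      show "\<theta> \<in> regular" unfolding \<theta>_def by (rule act_regular[OF L(1)])
      show "\<theta> (mat 1) = 1" using act_one[OF v(1)] L(3) by (simp add: \<theta>_def)
      fix g h assume gh: "g \<in> G" "h \<in> G"
      have "act (g ** h) v - (\<lambda>b. \<theta> g * \<theta> h * v b) \<in> W"
        by (rule act_mod_scalar_mult[OF stW gh subset_refl \<theta>[OF gh(1)] \<theta>[OF gh(2)]])
      then have "L (act (g ** h) v - (\<lambda>b. \<theta> g * \<theta> h * v b)) = 0" using L(2) by blast
      then show "\<theta> (g ** h) = \<theta> g * \<theta> h"
        using fun_linearD(2)[OF L(1), of "\<theta> g * \<theta> h" v] by (simp add: diff L(3) \<theta>_def)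
    qed
    note ac = acyc[OF this]
    let ?W = "{w \<in> supported B. w - (\<lambda>b. L w * v b) \<in> W}"
    have W'_eq: "w + (\<lambda>b. c * v b) \<in> ?W" if "w \<in> W" for w c
    proof -
      have "L (w + (\<lambda>b. c * v b)) = c"
        using fun_linearD(1)[OF L(1), of w "\<lambda>b. c * v b"] fun_linearD(2)[OF L(1), of c v] L(2,3) that
        by (simp add: plus_fun_def)
      moreover have "w + (\<lambda>b. c * v b) \<in> supported B"
        using that stableD(2)[OF stW] v(1) by (intro stableD(5,7)[OF supp]) auto
      ultimately show ?thesis using that by simp
    qed
    have W'_ex: "\<exists>u c. u \<in> W \<and> w = u + (\<lambda>b. c * v b)" if "w \<in> ?W" for w
      using that by (intro exI[of _ "w - (\<lambda>b. L w * v b)"] exI[of _ "L w"]) simp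
    have "fun_vs.subspace ?W"
    proof (rule fun_vs.subspaceI)
      have "0 + (\<lambda>b. 0 * v b) \<in> ?W" by (rule W'_eq[OF stableD(4)[OF stW]])
      moreover have "0 + (\<lambda>b. 0 * v b) = 0" by (rule ext) simp
      ultimately show "0 \<in> ?W" by (simp only:)
      fix x y assume "x \<in> ?W" "y \<in> ?W"
      then obtain x' y' c d where e: "x' \<in> W" "x = x' + (\<lambda>b. c * v b)" "y' \<in> W" "y = y' + (\<lambda>b. d * v b)"
        using W'_ex by meson
      have "x + y = (x' + y') + (\<lambda>b. (c + d) * v b)" unfolding e by (rule ext) (simp add: distrib_right)
      then show "x + y \<in> ?W" using W'_eq[OF stableD(5)[OF stW e(1,3)]] by (simp only:)
    next
      fix a x assume "x \<in> ?W"
      then obtain x' c where e: "x' \<in> W" "x = x' + (\<lambda>b. c * v b)" using W'_ex by meson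
      have "(\<lambda>b. a * x b) = (\<lambda>b. a * x' b) + (\<lambda>b. (a * c) * v b)" unfolding e by (rule ext) (simp add: distrib_left)
      then show "(\<lambda>b. a * x b) \<in> ?W" using W'_eq[OF stableD(7)[OF stW e(1)]] by (simp only:)
    qed
    moreover have "act g w \<in> ?W" if g: "g \<in> G" and w: "w \<in> ?W" for g w
    proof -
      obtain w' c where e: "w' \<in> W" "w = w' + (\<lambda>b. c * v b)" using W'_ex[OF w] by (elim exE conjE)
      have "act g w = (act g w' + (\<lambda>b. c * (act g v - (\<lambda>b. \<theta> g * v b)) b)) + (\<lambda>b. (c * \<theta> g) * v b)"
        unfolding e op.f_add op.f_scale by (rule ext) (simp add: right_diff_distrib)
      moreover have "act g w' + (\<lambda>b. c * (act g v - (\<lambda>b. \<theta> g * v b)) b) \<in> W"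
        by (intro stableD(5,7)[OF stW] stableD(3)[OF stW g e(1)] \<theta>[OF g])
      ultimately show ?thesis using W'_eq by (simp only:)
    qed
    ultimately have stW': "stable G ?W" unfolding stable_def by blast
    have "W \<subseteq> ?W"
    proof
      fix w assume "w \<in> W"
      moreover have "w + (\<lambda>b. 0 * v b) = w" by (rule ext) simp
      ultimately show "w \<in> ?W" using W'_eq[of w 0] by (simp only:)
    qed
    moreover have vW': "v \<in> ?W"
    proof -
      have "0 + (\<lambda>b. 1 * v b) = v" by (rule ext) simp
      then show ?thesis using W'_eq[OF stableD(4)[OF stW], of 1] by (simp only:)
    qed
    ultimately have less: "fun_vs.dim W < fun_vs.dim ?W"
      using dim_less[OF stableD(1)[OF stW] _ _ stableD(2)[OF stW'], of ] v(2) by blast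
    have "bounds GL (twist \<sigma> act) ?W H q F" if "cocycle GL (twist \<sigma> act) ?W H q F" for q F
      by (rule bounds_extend_by_character[OF H \<sigma> \<theta> conjunct1[OF ac] conjunct2[OF ac] stW stW' \<open>W \<subseteq> ?W\<close> vW' L(1) _ L(3) _ _ that])
        (use L(2) W in auto)
    then have "?P ?W" using stW' by blast
    from greatest[OF this] less show False by linarith
  qed
  then show ?thesis using W F by blast
qed

end

section \<open>Triangular coordinates\<close>

text \<open>The coordinate functionals of a rational basis of the span. They serve to cut the
  complex values of a triangular coordinate on rational matrices into finitely many rational
  ones.\<close>

lemma rat_separating_functionals:
  assumes "finite S"
  obtains Rs :: "(complex \<Rightarrow> rat) set" where "finite Rs"
    and "\<And>r. r \<in> Rs \<Longrightarrow> Vector_Spaces.linear (\<lambda>(q::rat) z. of_rat q * z) (*) r"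
    and "\<And>z. z \<in> rat_vs.span S \<Longrightarrow> (\<And>r. r \<in> Rs \<Longrightarrow> r z = 0) \<Longrightarrow> z = 0"
proof -
  obtain b where b: "b \<subseteq> S" "rat_vs.independent b" "S \<subseteq> rat_vs.span b"
    by (rule rat_vs.maximal_independent_subset[of S])
  have fin: "finite b" using b(1) assms finite_subset by blast
  have "\<forall>x\<in>b. \<exists>r. Vector_Spaces.linear (\<lambda>(q::rat) z. of_rat q * z) (*) r \<and>
      (\<forall>y\<in>rat_vs.span (b - {x}). r y = 0) \<and> r x = 1"
  proof
    fix x assume "x \<in> b"
    then have "x \<notin> rat_vs.span (b - {x})" using b(2) by (auto simp: rat_vs.dependent_def)
    then show "\<exists>r. Vector_Spaces.linear (\<lambda>(q::rat) z. of_rat q * z) (*) r \<and>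
        (\<forall>y\<in>rat_vs.span (b - {x}). r y = 0) \<and> r x = 1"
      by (rule rat_vs.exists_functional[OF rat_vs.subspace_span])
  qed
  from bchoice[OF this] obtain r where
    r: "\<forall>x\<in>b. Vector_Spaces.linear (\<lambda>(q::rat) z. of_rat q * z) (*) (r x) \<and>
      (\<forall>y\<in>rat_vs.span (b - {x}). r x y = 0) \<and> r x x = 1" ..
  show thesis
  proof (rule that[of "r ` b"])
    fix z assume z: "z \<in> rat_vs.span S" and 0: "\<And>\<rho>. \<rho> \<in> r ` b \<Longrightarrow> \<rho> z = 0"
    have "z \<in> rat_vs.span b" using z b(3) rat_vs.span_mono rat_vs.span_span by blast
    then obtain u where u: "z = (\<Sum>x\<in>b. of_rat (u x) * x)"
      using rat_vs.span_finite[OF fin] by auto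
    have "u x = 0" if x: "x \<in> b" for x
    proof -
      interpret L: Vector_Spaces.linear "\<lambda>(q::rat) (z::complex). of_rat q * z" "(*)" "r x" using r x by blast
      have "r x z = (\<Sum>y\<in>b. u y * r x y)" unfolding u L.sum L.scale ..
      also have "\<dots> = (\<Sum>y\<in>b. if y = x then u y else 0)"
        using r x by (intro sum.cong refl) (auto intro: rat_vs.span_base)
      also have "\<dots> = u x" using fin x by simp
      finally show ?thesis using 0[OF imageI[OF x]] by simp
    qed
    then show "z = 0" unfolding u by simp
  qed (use fin r in auto)
qed

text \<open>A longest chain exists by dimension, and an eigenvector modulo its last member would
  lengthen it.\<close>

lemma (in regular_rep) exists_flag:
  assumes con: "reg_connected G" "(derived GL ^^ n) G = {mat 1}"
  shows "\<exists>(N::nat) (vs :: nat \<Rightarrow> 'b \<Rightarrow> complex).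
    (\<forall>j\<le>N. stable G (fun_vs.span (vs ` {..<j}))) \<and>
    (\<forall>j<N. vs j \<notin> fun_vs.span (vs ` {..<j})) \<and> fun_vs.span (vs ` {..<N}) = supported B"
proof -
  let ?P = "\<lambda>k::nat. \<exists>vs :: nat \<Rightarrow> 'b \<Rightarrow> complex. (\<forall>j\<le>k. stable G (fun_vs.span (vs ` {..<j}))) \<and>
    (\<forall>j<k. vs j \<notin> fun_vs.span (vs ` {..<j}))"
  have supp: "stable G (supported B)"
    unfolding stable_def using subspace_supported act_supported by blast
  have dim: "k \<le> fun_vs.dim (fun_vs.span (vs ` {..<k}))"
    if "\<forall>j\<le>k. stable G (fun_vs.span (vs ` {..<j}))" "\<forall>j<k. vs j \<notin> fun_vs.span (vs ` {..<j})" for k :: nat and vs :: "nat \<Rightarrow> 'b \<Rightarrow> complex"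
    using that
  proof (induction k)
    case (Suc k)
    have "fun_vs.dim (fun_vs.span (vs ` {..<k})) < fun_vs.dim (fun_vs.span (vs ` {..<Suc k}))"
    proof (rule dim_less)
      show "fun_vs.span (vs ` {..<k}) \<subseteq> fun_vs.span (vs ` {..<Suc k})" by (rule fun_vs.span_mono) auto
      have "vs k \<in> fun_vs.span (vs ` {..<Suc k})" by (rule fun_vs.span_base) auto
      then show "fun_vs.span (vs ` {..<k}) \<noteq> fun_vs.span (vs ` {..<Suc k})" using Suc.prems(2) by auto
      show "fun_vs.span (vs ` {..<Suc k}) \<subseteq> supported B" using Suc.prems(1) stableD(2) by blast
    qed (rule fun_vs.subspace_span)
    then show ?case using Suc by simp
  qed simp
  have bound: "k < Suc (fun_vs.dim (supported B))" if "?P k" for k :: nat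
  proof -
    obtain vs where vs: "\<forall>j\<le>k. stable G (fun_vs.span (vs ` {..<j}))" "\<forall>j<k. vs j \<notin> fun_vs.span (vs ` {..<j})"
      using \<open>?P k\<close> by (elim exE conjE)
    have st: "stable G (fun_vs.span (vs ` {..<k}))" using vs(1) by blast
    have "fun_vs.dim (fun_vs.span (vs ` {..<k})) \<le> fun_vs.dim (supported B)"
      using dim_less[OF stableD(1)[OF st] stableD(2)[OF st] _ subset_refl]
      by (cases "fun_vs.span (vs ` {..<k}) = supported B") (simp_all add: less_imp_le)
    then show ?thesis using dim[OF vs] by simp
  qed
  have P0: "?P 0"
  proof -
    have "stable G {0}"
      unfolding stable_def using fun_vs.subspace_single_0 subspace_supported fun_vs.subspace_0 by fastforce
    then have "stable G (fun_vs.span ((\<lambda>_. 0) ` {..<0::nat}))"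
      by (simp only: lessThan_0 image_empty fun_vs.span_empty)
    then show ?thesis by (intro exI[of _ "\<lambda>_. 0"] conjI allI impI) (simp_all only: le_zero_eq not_less_zero)
  qed
  have "\<exists>k. ?P k \<and> (\<forall>l. ?P l \<longrightarrow> l \<le> k)"
    by (rule ex_has_greatest_nat[of ?P 0 "\<lambda>k. k" "Suc (fun_vs.dim (supported B))"]) (intro P0 allI impI bound)+
  then obtain N where "?P N \<and> (\<forall>l. ?P l \<longrightarrow> l \<le> N)" ..
  note N = conjunct1[OF this] conjunct2[OF this]
  obtain vs where vs: "\<forall>j\<le>N. stable G (fun_vs.span (vs ` {..<j}))" "\<forall>j<N. vs j \<notin> fun_vs.span (vs ` {..<j})"
    using N(1) by (elim exE conjE)
  let ?W = "fun_vs.span (vs ` {..<N})"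
  have st: "stable G ?W" using vs(1) by blast
  have "?W = supported B"
  proof (rule ccontr)
    assume "?W \<noteq> supported B"
    from Lie_Kolchin_mod[OF G subset_refl con st supp stableD(2)[OF st] this]
    obtain v where v: "v \<in> supported B" "v \<notin> ?W" "\<forall>g\<in>G. \<exists>c. act g v - (\<lambda>b. c * v b) \<in> ?W"
      by (elim exE conjE)
    let ?us = "vs(N := v)"
    have us: "?us ` {..<j} = vs ` {..<j}" if "j \<le> N" for j using that by auto
    have usN: "?us ` {..<Suc N} = insert v (vs ` {..<N})" by (auto simp: lessThan_Suc)
    have "stable G (fun_vs.span (insert v (vs ` {..<N})))"
      unfolding stable_def
    proof (intro conjI ballI)
      show sub: "fun_vs.span (insert v (vs ` {..<N})) \<subseteq> supported B"
        using v(1) stableD(2)[OF st] fun_vs.span_superset[of "vs ` {..<N}"]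
        by (intro fun_vs.span_minimal subspace_supported) auto
      fix g w assume g: "g \<in> G" and w: "w \<in> fun_vs.span (insert v (vs ` {..<N}))"
      have WW: "?W \<subseteq> fun_vs.span (insert v (vs ` {..<N}))" by (rule fun_vs.span_mono) auto
      obtain c where c: "act g v - (\<lambda>b. c * v b) \<in> ?W" using v(3) g by blast
      have "(act g v - (\<lambda>b. c * v b)) + (\<lambda>b. c * v b) \<in> fun_vs.span (insert v (vs ` {..<N}))"
        by (rule fun_vs.span_add[OF subsetD[OF WW c] fun_vs.span_scale[OF fun_vs.span_base]]) simp
      then have gv: "act g v \<in> fun_vs.span (insert v (vs ` {..<N}))" by simp
      obtain d where d: "w - (\<lambda>b. d * v b) \<in> ?W" using w fun_vs.span_breakdown_eq[of w v] by blast
      have "act g (w - (\<lambda>b. d * v b)) \<in> ?W" by (rule stableD(3)[OF st g d])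
      then have "act g (w - (\<lambda>b. d * v b)) + (\<lambda>b. d * act g v b) \<in> fun_vs.span (insert v (vs ` {..<N}))"
        by (intro fun_vs.span_add[OF subsetD[OF WW] fun_vs.span_scale[OF gv]])
      then show "act g w \<in> fun_vs.span (insert v (vs ` {..<N}))" by (simp add: act_diff op.f_scale)
    qed (rule fun_vs.subspace_span)
    then have "\<forall>j\<le>Suc N. stable G (fun_vs.span (?us ` {..<j}))"
      using vs(1) us usN by (metis le_Suc_eq)
    moreover have "\<forall>j<Suc N. ?us j \<notin> fun_vs.span (?us ` {..<j})"
    proof (intro allI impI)
      fix j assume "j < Suc N"
      then consider "j < N" | "j = N" by linarith
      then show "?us j \<notin> fun_vs.span (?us ` {..<j})"
        by cases (use vs(2) v(2) us[of j] in auto)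
    qed
    ultimately have "?P (Suc N)" by (intro exI[of _ ?us] conjI)
    then show False using N(2) by (metis Suc_n_not_le_n)
  qed
  then show ?thesis using vs by (intro exI[of _ N] exI[of _ vs] conjI)
qed

text \<open>\<open>a i j\<close> is the entry of the matrix conjugated into triangular form, and
  \<open>k i j p q\<close> is a product of an entry of the inverse base change and one of the base
  change. All laws but \<open>a_upper\<close> are for arbitrary matrices, since they are applied to
  differences and to weight projections outside G.\<close>

locale triangular_coords =
  fixes G :: "(complex^'n^'n) set" and N :: nat and k :: "nat \<Rightarrow> nat \<Rightarrow> 'n \<Rightarrow> 'n \<Rightarrow> complex"
    and a :: "nat \<Rightarrow> nat \<Rightarrow> complex^'n^'n \<Rightarrow> complex"
  assumes a_def: "a i j Z = (\<Sum>p\<in>UNIV. \<Sum>q\<in>UNIV. k i j p q * Z $ p $ q)"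
    and a_mult: "i < N \<Longrightarrow> j < N \<Longrightarrow> a i j (Z ** Y) = (\<Sum>l<N. a i l Z * a l j Y)"
    and a_one: "i < N \<Longrightarrow> j < N \<Longrightarrow> a i j (mat 1) = (if i = j then 1 else 0)"
    and a_faithful: "(\<And>i j. i < N \<Longrightarrow> j < N \<Longrightarrow> a i j Z = 0) \<Longrightarrow> Z = 0"
    and a_trace: "(\<Sum>p\<in>UNIV. Z $ p $ p) = (\<Sum>i<N. a i i Z)"
    and a_upper: "g \<in> G \<Longrightarrow> j < i \<Longrightarrow> i < N \<Longrightarrow> a i j g = 0"

theorem exists_triangular_coords:
  fixes G :: "(complex^'n^'n) set"
  assumes G: "subgroup G GL" and con: "reg_connected G" "(derived GL ^^ n) G = {mat 1}"
  shows "\<exists>N k a. triangular_coords G N k a"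
proof -
  interpret regular_rep G UNIV "\<lambda>g i j. g $ i $ j"
    by (rule regular_rep.intro[OF G]) (simp_all add: mat_def matrix_matrix_mult_def)
  have suppU: "supported (UNIV :: 'n set) = UNIV" by (simp add: supported_def)
  have act_eq: "act g v = (\<lambda>p. \<Sum>q\<in>UNIV. g $ p $ q * v q)" for g v by (simp add: matrix_action_def)
  have act_mult': "act (Z ** Y) v = act Z (act Y v)" for Z Y v
  proof
    fix p
    have "(\<Sum>q\<in>UNIV. (\<Sum>r\<in>UNIV. Z $ p $ r * Y $ r $ q) * v q) = (\<Sum>r\<in>UNIV. \<Sum>q\<in>UNIV. Z $ p $ r * Y $ r $ q * v q)"
      by (simp add: sum_distrib_right) (rule sum.swap)
    then show "act (Z ** Y) v p = act Z (act Y v) p"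
      by (simp add: act_eq matrix_matrix_mult_def sum_distrib_left mult.assoc)
  qed
  have act_sum: "act Z (\<lambda>b. \<Sum>l<m. u l * v l b) p = (\<Sum>l<m. u l * act Z (v l) p)"
    for Z p m and u :: "nat \<Rightarrow> complex" and v
  proof -
    have "act Z (\<lambda>b. \<Sum>l<m. u l * v l b) p = (\<Sum>q\<in>UNIV. \<Sum>l<m. u l * (Z $ p $ q * v l q))"
      by (simp add: act_eq sum_distrib_left mult.left_commute)
    also have "\<dots> = (\<Sum>l<m. \<Sum>q\<in>UNIV. u l * (Z $ p $ q * v l q))" by (rule sum.swap)
    finally show ?thesis by (simp add: act_eq sum_distrib_left)
  qed
  obtain N :: nat and vs :: "nat \<Rightarrow> 'n \<Rightarrow> complex" where
    vs': "\<forall>j\<le>N. stable G (fun_vs.span (vs ` {..<j}))" "\<forall>j<N. vs j \<notin> fun_vs.span (vs ` {..<j})"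
      "fun_vs.span (vs ` {..<N}) = supported UNIV"
    using exists_flag[OF con] by (elim exE conjE)
  note vs = vs'(1)[rule_format] vs'(2)[rule_format] vs'(3)
  have notin: "vs j \<notin> vs ` {..<j}" if "j < N" for j 
    using vs(2)[OF that] by (rule contrapos_nn) (rule fun_vs.span_base)
  have inj: "inj_on vs {..<N}"
  proof (rule inj_onI)
    fix i j assume *: "i \<in> {..<N}" "j \<in> {..<N}" "vs i = vs j"
    have False if "l < m" "m < N" "vs l = vs m" for l m
      using notin[OF that(2)] that(1) unfolding that(3)[symmetric] by simp
    from this[of i j] this[of j i] * show "i = j" by (cases i j rule: linorder_cases) auto
  qed
  have ind: "fun_vs.independent (vs ` {..<j})" if "j \<le> N" for j
    using that
  proof (induction j)
    case (Suc j)
    then show ?case using vs(2)[of j] by (simp add: lessThan_Suc fun_vs.independent_insert)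
  qed (simp add: fun_vs.independent_empty)
  have "\<forall>i\<in>{..<N}. \<exists>L. fun_linear L \<and> (\<forall>w\<in>fun_vs.span (vs ` ({..<N} - {i})). L w = 0) \<and> L (vs i) = 1"
  proof
    fix i assume i: "i \<in> {..<N}"
    have "vs ` ({..<N} - {i}) = vs ` {..<N} - {vs i}" using inj i by (auto simp: inj_on_def)
    then have "vs i \<notin> fun_vs.span (vs ` ({..<N} - {i}))"
      using ind[of N] i by (auto simp: fun_vs.dependent_def)
    then show "\<exists>L. fun_linear L \<and> (\<forall>w\<in>fun_vs.span (vs ` ({..<N} - {i})). L w = 0) \<and> L (vs i) = 1"
      by (rule fun_vs.exists_functional[OF fun_vs.subspace_span])
  qed
  from bchoice[OF this] obtain c where c: "\<forall>i\<in>{..<N}. fun_linear (c i) \<and>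
      (\<forall>w\<in>fun_vs.span (vs ` ({..<N} - {i})). c i w = 0) \<and> c i (vs i) = 1" ..
  have c_lin: "fun_linear (c i)" if "i < N" for i using c that by blast
  have c_vs: "c i (vs j) = (if i = j then 1 else 0)" if "i < N" "j < N" for i j
  proof (cases "i = j")
    case False
    then have "vs j \<in> fun_vs.span (vs ` ({..<N} - {i}))" using that by (intro fun_vs.span_base) auto
    then show ?thesis using c that False by auto
  qed (use c that in auto)
  have expand: "w x = (\<Sum>i<N. c i w * vs i x)" for w x
  proof -
    have "w \<in> fun_vs.span (vs ` {..<N})" using vs(3) suppU by simp
    then obtain u where u: "w = (\<Sum>v\<in>vs ` {..<N}. (\<lambda>b. u v * v b))"
      using fun_vs.span_finite[of "vs ` {..<N}"] by auto
    have w: "w = (\<lambda>b. \<Sum>j<N. u (vs j) * vs j b)"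
      unfolding u sum.reindex[OF inj] by (simp add: fun_eq_iff sum_apply)
    have "c i w = u (vs i)" if "i < N" for i
    proof -
      have "c i w = (\<Sum>j<N. u (vs j) * c i (vs j))" unfolding w by (simp only: fun_linearD[OF c_lin[OF that]])
      also have "\<dots> = (\<Sum>j<N. if j = i then u (vs j) else 0)" using that by (intro sum.cong) (auto simp: c_vs)
      finally show ?thesis using that by simp
    qed
    then show ?thesis by (subst w) (intro sum.cong, auto)
  qed
  define k where "k i j p q = c i (unit_fun p) * vs j q" for i j :: nat and p q :: 'n
  define a where "a i j Z = (\<Sum>p\<in>UNIV. \<Sum>q\<in>UNIV. k i j p q * Z $ p $ q)" for i j :: nat and Z :: "complex^'n^'n"
  have c_expand: "c i w = (\<Sum>p\<in>UNIV. w p * c i (unit_fun p))" if "i < N" for i w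
  proof -
    have "w = (\<lambda>b. \<Sum>p\<in>UNIV. w p * unit_fun p b)"
      by (rule ext, rule supported_expand_at) (simp_all add: suppU)
    then have "c i w = c i (\<lambda>b. \<Sum>p\<in>UNIV. w p * unit_fun p b)" by (rule arg_cong)
    also have "\<dots> = (\<Sum>p\<in>UNIV. w p * c i (unit_fun p))" by (simp only: fun_linearD[OF c_lin[OF that]])
    finally show ?thesis .
  qed
  have a_act: "a i j Z = c i (act Z (vs j))" if "i < N" for i j Z
  proof -
    have "c i (act Z (vs j)) = (\<Sum>p\<in>UNIV. act Z (vs j) p * c i (unit_fun p))" by (rule c_expand[OF that])
    then show ?thesis by (simp add: a_def k_def act_eq sum_distrib_left sum_distrib_right mult_ac)
  qed
  have "triangular_coords G N k a"
  proof
    show "a i j Z = (\<Sum>p\<in>UNIV. \<Sum>q\<in>UNIV. k i j p q * Z $ p $ q)" for i j Z by (rule a_def)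
    show "a i j (Z ** Y) = (\<Sum>l<N. a i l Z * a l j Y)" if ij: "i < N" "j < N" for i j Z Y
    proof -
      have "act Y (vs j) = (\<lambda>b. \<Sum>l<N. c l (act Y (vs j)) * vs l b)" by (rule ext) (rule expand)
      then have "act Z (act Y (vs j)) = act Z (\<lambda>b. \<Sum>l<N. c l (act Y (vs j)) * vs l b)" by (rule arg_cong)
      also have "\<dots> = (\<lambda>p. \<Sum>l<N. c l (act Y (vs j)) * act Z (vs l) p)"
        by (rule ext) (rule act_sum)
      finally have "c i (act Z (act Y (vs j))) = (\<Sum>l<N. c l (act Y (vs j)) * c i (act Z (vs l)))"
        by (simp only: fun_linearD[OF c_lin[OF ij(1)]])
      also have "\<dots> = (\<Sum>l<N. a i l Z * a l j Y)"
        using ij by (intro sum.cong refl) (simp add: a_act)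
      finally show ?thesis by (simp add: a_act ij act_mult')
    qed
    show "a i j (mat 1) = (if i = j then 1 else 0)" if ij: "i < N" "j < N" for i j
      using act_one[of "vs j"] ij by (simp add: a_act suppU c_vs)
    show "Z = 0" if 0: "\<And>i j. i < N \<Longrightarrow> j < N \<Longrightarrow> a i j Z = 0" for Z
    proof -
      have "act Z (vs j) = 0" if "j < N" for j
      proof
        fix p
        have "act Z (vs j) p = (\<Sum>i<N. c i (act Z (vs j)) * vs i p)" by (rule expand)
        also have "\<dots> = (\<Sum>i<N. a i j Z * vs i p)" by (intro sum.cong refl) (simp add: a_act)
        finally show "act Z (vs j) p = 0 p" using 0 that by simp
      qed
      then have "act Z w p = 0" for w p
      proof -
        have "w = (\<lambda>b. \<Sum>l<N. c l w * vs l b)" by (rule ext) (rule expand)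
        then have "act Z w p = act Z (\<lambda>b. \<Sum>l<N. c l w * vs l b) p" by simp
        also have "\<dots> = (\<Sum>l<N. c l w * act Z (vs l) p)"
          by (rule act_sum)
        also have "\<dots> = 0" using \<open>\<And>j. j < N \<Longrightarrow> act Z (vs j) = 0\<close> by simp
        finally show ?thesis .
      qed
      then have "Z $ p $ q = 0" for p q
      proof -
        have "act Z (unit_fun q) p = (\<Sum>r\<in>UNIV. if r = q then Z $ p $ r else 0)"
          unfolding act_eq by (intro sum.cong) (auto simp: unit_fun_def)
        then show ?thesis using \<open>\<And>w p. act Z w p = 0\<close> by simp
      qed
      then show ?thesis by (simp add: vec_eq_iff)
    qed
    show "(\<Sum>p\<in>UNIV. Z $ p $ p) = (\<Sum>i<N. a i i Z)" for Z
    proof -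
      have "(\<Sum>i<N. a i i Z) = (\<Sum>i<N. \<Sum>p\<in>UNIV. \<Sum>q\<in>UNIV. c i (unit_fun p) * vs i q * Z $ p $ q)"
        by (simp add: a_def k_def)
      also have "\<dots> = (\<Sum>p\<in>UNIV. \<Sum>i<N. \<Sum>q\<in>UNIV. c i (unit_fun p) * vs i q * Z $ p $ q)" by (rule sum.swap)
      also have "\<dots> = (\<Sum>p\<in>UNIV. \<Sum>q\<in>UNIV. (\<Sum>i<N. c i (unit_fun p) * vs i q) * Z $ p $ q)"
        by (intro sum.cong refl) (subst sum.swap, simp add: sum_distrib_right)
      also have "\<dots> = (\<Sum>p\<in>UNIV. \<Sum>q\<in>UNIV. unit_fun p q * Z $ p $ q)"
        by (simp only: expand[symmetric])
      also have "\<dots> = (\<Sum>p\<in>UNIV. \<Sum>q\<in>UNIV. if q = p then Z $ p $ q else 0)"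
        by (intro sum.cong refl) (simp add: unit_fun_def)
      finally show ?thesis by simp
    qed
    show "a i j g = 0" if g: "g \<in> G" and ij: "j < i" "i < N" for g i j
    proof -
      have "vs j \<in> fun_vs.span (vs ` {..<Suc j})" by (rule fun_vs.span_base) auto
      then have "act g (vs j) \<in> fun_vs.span (vs ` {..<Suc j})" using stableD(3)[OF vs(1) g] ij by simp
      moreover have "fun_vs.span (vs ` {..<Suc j}) \<subseteq> fun_vs.span (vs ` ({..<N} - {i}))"
        using ij by (intro fun_vs.span_mono image_mono) auto
      ultimately show ?thesis using c ij by (auto simp: a_act)
    qed
  qed
  then show ?thesis by blast
qed

section \<open>Characters of a Zariski dense group\<close>

context triangular_coords
begin

lemma a_add: "a i j (Y + Z) = a i j Y + a i j Z"
  unfolding a_def by (simp add: distrib_left sum.distrib)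

lemma a_regular: "a i j \<in> regular"
proof -
  have "a i j = (\<lambda>Z. \<Sum>p\<in>UNIV. \<Sum>q\<in>UNIV. k i j p q * Z $ p $ q)" by (rule ext) (rule a_def)
  then show ?thesis by (simp only:) (intro regular_sum regular_mult regular_const regular_entry)
qed

lemma a_mult_upper:
  assumes "g \<in> G" "h \<in> G" "i \<le> j" "j < N"
  shows "a i j (g ** h) = (\<Sum>l\<in>{i..j}. a i l g * a l j h)"
proof -
  have "(\<Sum>l<N. a i l g * a l j h) = (\<Sum>l\<in>{i..j}. a i l g * a l j h)"
  proof (rule sum.mono_neutral_right)
    show "\<forall>l\<in>{..<N} - {i..j}. a i l g * a l j h = 0"
    proof
      fix l assume "l \<in> {..<N} - {i..j}"
      then have "l < i \<or> j < l" "l < N" by auto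
      then show "a i l g * a l j h = 0" using a_upper[OF assms(1), of l i] a_upper[OF assms(2), of j l] assms by auto
    qed
  qed (use assms in auto)
  then show ?thesis using a_mult[of i j g h] assms by simp
qed

lemma diag_mult: "g \<in> G \<Longrightarrow> h \<in> G \<Longrightarrow> i < N \<Longrightarrow> a i i (g ** h) = a i i g * a i i h"
  using a_mult_upper[of g h i i] by simp

lemma diag_character: "i < N \<Longrightarrow> algebraic_character G (a i i)"
  unfolding algebraic_character_def using a_regular diag_mult a_one by simp

text \<open>The filtration of the unipotent part by superdiagonals: \<open>unip H 1\<close> only
  fixes the diagonal, and each further step clears one more superdiagonal.\<close>

definition unip :: "(complex^'n^'n) set \<Rightarrow> nat \<Rightarrow> (complex^'n^'n) set" where
  "unip H d = {n \<in> H. (\<forall>i<N. a i i n = 1) \<and> (\<forall>i j. i < j \<longrightarrow> j < N \<longrightarrow> j < i + d \<longrightarrow> a i j n = 0)}"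

text \<open>At distance at most \<open>d\<close> from the diagonal the entries of \<open>n\<close>
  strictly between vanish, so only the two extreme terms of the product survive.\<close>

lemma a_mult_unip:
  assumes "g \<in> G" "n \<in> unip H d" "H \<subseteq> G" "i < j" "j < N" "j \<le> i + d"
  shows "a i j (g ** n) = a i i g * a i j n + a i j g"
    and "a i j (n ** g) = a i j n * a j j g + a i j g"
proof -
  have n: "n \<in> G" "\<And>i. i < N \<Longrightarrow> a i i n = 1" "\<And>i j. i < j \<Longrightarrow> j < N \<Longrightarrow> j < i + d \<Longrightarrow> a i j n = 0"
    using assms by (auto simp: unip_def)
  have s: "(\<Sum>l\<in>{i..j}. f l) = f i + f j" if "\<And>l. i < l \<Longrightarrow> l < j \<Longrightarrow> f l = 0" for f :: "nat \<Rightarrow> complex"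
  proof -
    have "(\<Sum>l\<in>{i..j}. f l) = (\<Sum>l\<in>{i, j}. f l)"
      by (rule sum.mono_neutral_right) (use assms(4) that in auto)
    then show ?thesis using assms(4) by simp
  qed
  show "a i j (g ** n) = a i i g * a i j n + a i j g"
    using assms n by (subst a_mult_upper) (auto simp: s)
  show "a i j (n ** g) = a i j n * a j j g + a i j g"
    using assms n by (subst a_mult_upper) (auto simp: s)
qed

end

text \<open>Density enters through \<open>nontrivial\<close> alone. It is required for every
  algebraic character because successive extensions divide \<theta> by quotients of diagonal
  characters.\<close>

locale dense_characters = triangular_coords G N k a
  for G :: "(complex^'n^'n) set" and N :: nat and k a +
  fixes H :: "(complex^'n^'n) set" and \<sigma> :: "complex^'n^'n \<Rightarrow> complex"
  assumes G: "subgroup G GL" and H: "subgroup H GL" and HG: "H \<subseteq> G"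
    and H_rat: "g \<in> H \<Longrightarrow> g $ p $ q \<in> \<rat>"
    and diag_rat: "g \<in> H \<Longrightarrow> i < N \<Longrightarrow> a i i g \<in> \<rat>"
    and \<sigma>_mult: "g \<in> H \<Longrightarrow> h \<in> H \<Longrightarrow> \<sigma> (g ** h) = \<sigma> g * \<sigma> h"
    and \<sigma>_nz: "g \<in> H \<Longrightarrow> \<sigma> g \<noteq> 0"
    and nontrivial: "algebraic_character G \<theta> \<Longrightarrow> \<exists>g\<in>H. \<sigma> g * \<theta> g \<noteq> 1"
begin

abbreviation "\<H> \<equiv> GL_sub H"

interpretation Hgrp: group \<H>
  by (rule subgroup.subgroup_is_group[OF H group_GL])

lemma H_closed: "g \<in> H \<Longrightarrow> h \<in> H \<Longrightarrow> g ** h \<in> H" "g \<in> H \<Longrightarrow> g \<in> G" "mat 1 \<in> H"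
  using subgroup.m_closed[OF H, of g h] subgroup.one_closed[OF H] HG by auto

lemma H_inv: "g \<in> H \<Longrightarrow> inv\<^bsub>\<H>\<^esub> g \<in> H" "g \<in> H \<Longrightarrow> g ** inv\<^bsub>\<H>\<^esub> g = mat 1" "g \<in> H \<Longrightarrow> inv\<^bsub>\<H>\<^esub> g ** g = mat 1"
  "g \<in> H \<Longrightarrow> inv\<^bsub>\<H>\<^esub> g = adj_inv g"
proof -
  assume g: "g \<in> H"
  show "inv\<^bsub>\<H>\<^esub> g \<in> H" using Hgrp.inv_closed[of g] g by simp
  show "g ** inv\<^bsub>\<H>\<^esub> g = mat 1" using Hgrp.r_inv[of g] g by simp
  show "inv\<^bsub>\<H>\<^esub> g ** g = mat 1" using Hgrp.l_inv[of g] g by simp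
  have "invertible g" using subgroup.mem_carrier[OF H g] by simp
  then show "inv\<^bsub>\<H>\<^esub> g = adj_inv g" using group.m_inv_consistent[OF group_GL H g] GL_inv by simp
qed

lemma diag_inv: "g \<in> H \<Longrightarrow> i < N \<Longrightarrow> a i i g * a i i (inv\<^bsub>\<H>\<^esub> g) = 1"
  using diag_mult[of g "inv\<^bsub>\<H>\<^esub> g" i] H_inv[of g] H_closed a_one[of i i] by simp

lemma diag_nz: "g \<in> H \<Longrightarrow> i < N \<Longrightarrow> a i i g \<noteq> 0"
  using diag_inv[of g i] by auto

lemma a_conj_unip:
  assumes g: "g \<in> H" and n: "n \<in> unip H d" and ij: "i < j" "j < N" "j \<le> i + d"
  shows "a i j (g ** n ** inv\<^bsub>\<H>\<^esub> g) = a i i g / a j j g * a i j n"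
proof -
  let ?h = "inv\<^bsub>\<H>\<^esub> g"
  have gG: "g \<in> G" "?h \<in> G" "n \<in> H" "n \<in> G" "g ** n \<in> G"
    using g n H_closed H_inv by (auto simp: unip_def)
  have n0: "a i l n = 0" if "i < l" "l < j" for l using n that ij by (auto simp: unip_def)
  have "a i j (g ** n ** ?h) = (\<Sum>l\<in>{i..j}. a i l (g ** n) * a l j ?h)"
    using gG ij by (intro a_mult_upper) auto
  also have "\<dots> = (\<Sum>l\<in>{i..j}. a i l g * a l j ?h + (if l = j then a i i g * a i j n * a j j ?h else 0))"
  proof (intro sum.cong refl)
    fix l assume l: "l \<in> {i..j}"
    show "a i l (g ** n) * a l j ?h = a i l g * a l j ?h + (if l = j then a i i g * a i j n * a j j ?h else 0)"
    proof (cases "l = i")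
      case True
      have "a i i (g ** n) = a i i g" using diag_mult[OF gG(1,4), of i] n ij by (simp add: unip_def)
      then show ?thesis using True ij by simp
    next
      case False
      then have "a i l (g ** n) = a i i g * a i l n + a i l g"
        using l ij by (intro a_mult_unip(1)[OF gG(1) n HG]) auto
      then show ?thesis using n0[of l] l False by (cases "l = j") (auto simp: distrib_right)
    qed
  qed
  also have "\<dots> = (\<Sum>l\<in>{i..j}. a i l g * a l j ?h) + a i i g * a i j n * a j j ?h"
    using ij by (simp add: sum.distrib)
  also have "(\<Sum>l\<in>{i..j}. a i l g * a l j ?h) = a i j (g ** ?h)"
    using gG ij by (intro a_mult_upper[symmetric]) auto
  also have "\<dots> = 0" using H_inv(2)[OF g] a_one[of i j] ij by simp
  also have "a j j ?h = 1 / a j j g" using diag_inv[OF g, of j] diag_nz[OF g, of j] ij by (simp add: field_simps)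
  finally show ?thesis by simp
qed

lemma unip_mem_iff:
  "n \<in> unip H d \<longleftrightarrow> n \<in> H \<and> (\<forall>i<N. a i i n = 1) \<and> (\<forall>i j. i < j \<longrightarrow> j < N \<longrightarrow> j < i + d \<longrightarrow> a i j n = 0)"
  by (simp add: unip_def)

text \<open>Conjugation multiplies an entry on the lowest surviving superdiagonal by a quotient of
  diagonal entries. That quotient is rational by \<open>diag_rat\<close>, so it passes through the
  functional and the kernel is preserved; an arbitrary complex factor would not pass.\<close>

lemma normal_functional_kernel:
  assumes F: "\<And>i r. (i, r) \<in> F \<Longrightarrow> i + d < N \<and> Vector_Spaces.linear (\<lambda>(q::rat) z. of_rat q * z) (*) r"
    and d: "d \<ge> 1"
  shows "{n \<in> unip H d. \<forall>(i, r)\<in>F. r (a i (i + d) n) = 0} \<lhd> \<H>"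
proof -
  let ?K = "{n \<in> unip H d. \<forall>(i, r)\<in>F. r (a i (i + d) n) = 0}"
  have lin: "r (x + y) = r x + r y" "r (of_rat q * x) = q * r x" "r (- x) = - r x" "r 0 = 0"
    if "(i, r) \<in> F" for i r x y q
  proof -
    interpret L: Vector_Spaces.linear "\<lambda>(q::rat) (z::complex). of_rat q * z" "(*)" r using F[OF that] by blast
    show "r (x + y) = r x + r y" "r (of_rat q * x) = q * r x" "r (- x) = - r x" "r 0 = 0"
      by (rule L.add L.scale L.neg L.zero)+
  qed
  have sub: "subgroup ?K \<H>"
  proof (rule Hgrp.subgroupI)
    show "?K \<subseteq> carrier \<H>" by (auto simp: unip_def)
    have "mat 1 \<in> unip H d" using H_closed(3) a_one by (auto simp: unip_def)
    moreover have "r (a i (i + d) (mat 1)) = 0" if "(i, r) \<in> F" for i r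
      using a_one[of i "i + d"] F[OF that] d lin(4)[OF that] by simp
    ultimately have "mat 1 \<in> ?K" by auto
    then show "?K \<noteq> {}" by blast
  next
    fix m assume m: "m \<in> ?K"
    let ?m = "inv\<^bsub>\<H>\<^esub> m"
    have mH: "m \<in> H" "m \<in> unip H d" using m by (auto simp: unip_def)
    have inv: "a i j ?m = - a i j m" if "i < j" "j < N" "j \<le> i + d" for i j
    proof -
      have "a i j (?m ** m) = a i i ?m * a i j m + a i j ?m"
        using mH H_inv H_closed that by (intro a_mult_unip(1)[OF _ _ HG]) auto
      moreover have "a i i ?m = 1" using diag_inv[OF mH(1), of i] mH(2) that by (simp add: unip_def)
      ultimately show ?thesis using H_inv(3)[OF mH(1)] a_one[of i j] that by (simp add: add_eq_0_iff)
    qed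
    have "?m \<in> unip H d"
      unfolding unip_mem_iff using inv mH H_inv(1) diag_inv[OF mH(1)] by (auto simp: unip_def)
    moreover have "r (a i (i + d) ?m) = 0" if "(i, r) \<in> F" for i r
      using inv[of i "i + d"] F[OF that] d m that lin(3)[OF that] by auto
    ultimately show "?m \<in> ?K" by auto
  next
    fix m n assume m: "m \<in> ?K" and n: "n \<in> ?K"
    have mn: "m \<in> unip H d" "n \<in> unip H d" "m \<in> H" "n \<in> H" using m n by (auto simp: unip_def)
    have mult: "a i j (m ** n) = a i j m + a i j n" if "i < j" "j < N" "j \<le> i + d" for i j
    proof -
      have "a i j (m ** n) = a i i m * a i j n + a i j m"
        using mn that H_closed by (intro a_mult_unip(1)[OF _ _ HG]) auto
      then show ?thesis using mn(1) that by (simp add: unip_def)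
    qed
    have "m ** n \<in> unip H d"
      unfolding unip_mem_iff using mult mn H_closed diag_mult by (auto simp: unip_def)
    moreover have "r (a i (i + d) (m ** n)) = 0" if "(i, r) \<in> F" for i r
    proof -
      have "r (a i (i + d) m) = 0" "r (a i (i + d) n) = 0" using m n that by (auto dest!: bspec)
      then show ?thesis using mult[of i "i + d"] F[OF that] d lin(1)[OF that] by simp
    qed
    ultimately show "m \<otimes>\<^bsub>\<H>\<^esub> n \<in> ?K" by auto
  qed
  show ?thesis
  proof (rule Hgrp.normal_invI[OF sub])
    fix g n assume "g \<in> carrier \<H>" and n: "n \<in> ?K"
    then have g: "g \<in> H" and nU: "n \<in> unip H d" "n \<in> H" by (auto simp: unip_def)
    let ?n = "g ** n ** inv\<^bsub>\<H>\<^esub> g"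
    have nH: "?n \<in> H" using g nU H_closed H_inv by auto
    have "a i i ?n = 1" if "i < N" for i
      using that g nU H_closed H_inv diag_inv[OF g that] by (simp add: diag_mult unip_def)
    then have "?n \<in> unip H d"
      unfolding unip_mem_iff using a_conj_unip[OF g nU(1)] nH nU by (auto simp: unip_def)
    moreover have "r (a i (i + d) ?n) = 0" if "(i, r) \<in> F" for i r
    proof -
      have id: "i < i + d" "i + d < N" using F[OF that] d by auto
      have "a i i g / a (i + d) (i + d) g \<in> \<rat>" using diag_rat g id by (intro Rats_divide) auto
      then obtain q where "a i i g / a (i + d) (i + d) g = of_rat q" by (auto elim: Rats_cases)
      then show ?thesis
        using a_conj_unip[OF g nU(1) id order_refl] lin(2)[OF that] n that by auto
    qed
    ultimately show "g \<otimes>\<^bsub>\<H>\<^esub> n \<otimes>\<^bsub>\<H>\<^esub> inv\<^bsub>\<H>\<^esub> g \<in> ?K" by auto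
  qed
qed

text \<open>Only characters trivial on K are characters of H/K, so only these are considered; all
  \<theta> are treated together because the step to a smaller K needs the claim for another
  \<theta>.\<close>

definition good :: "(complex^'n^'n) set \<Rightarrow> bool" where
  "good K \<longleftrightarrow> (\<forall>\<theta>. algebraic_character G \<theta> \<longrightarrow> (\<forall>n\<in>K. \<sigma> n * \<theta> n = 1) \<longrightarrow>
     acyclic_char \<H> K (\<lambda>g. \<sigma> g * \<theta> g))"

lemma character_mult:
  "algebraic_character G \<theta> \<Longrightarrow> algebraic_character G \<theta>' \<Longrightarrow> algebraic_character G (\<lambda>g. \<theta> g * \<theta>' g)"
  unfolding algebraic_character_def by auto

lemma character_inverse:
  assumes "algebraic_character G \<theta>"
  shows "algebraic_character G (\<lambda>g. \<theta> (adj_inv g))" "g \<in> G \<Longrightarrow> \<theta> g * \<theta> (adj_inv g) = 1"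
proof -
  interpret GG: subgroup G GL by (rule G)
  have inv: "adj_inv g \<in> G" "g ** adj_inv g = mat 1" if "g \<in> G" for g
  proof -
    have i: "invertible g" using GG.mem_carrier[OF that] by simp
    show "adj_inv g \<in> G" using GG.m_inv_closed[OF that] GL_inv[OF i] by simp
    show "g ** adj_inv g = mat 1" by (rule adj_inv_right[OF i])
  qed
  have one: "\<theta> g * \<theta> (adj_inv g) = 1" if "g \<in> G" for g
    using assms inv[OF that] that unfolding algebraic_character_def by metis
  then show "g \<in> G \<Longrightarrow> \<theta> g * \<theta> (adj_inv g) = 1" .
  have mult: "\<theta> (adj_inv (g ** h)) = \<theta> (adj_inv g) * \<theta> (adj_inv h)" if "g \<in> G" "h \<in> G" for g h
  proof -
    have "g ** h \<in> G" using GG.m_closed[OF that] by simp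
    then have "(\<theta> g * \<theta> h) * \<theta> (adj_inv (g ** h)) = (\<theta> g * \<theta> (adj_inv g)) * (\<theta> h * \<theta> (adj_inv h))"
      using one[of "g ** h"] one[OF that(1)] one[OF that(2)] assms that unfolding algebraic_character_def by simp
    moreover have "\<theta> g * \<theta> h \<noteq> 0" using one[OF that(1)] one[OF that(2)] by auto
    ultimately show ?thesis by simp
  qed
  have "(\<lambda>g. \<theta> (adj_inv g)) \<in> regular"
    by (rule regular_compose[OF _ regular_map_adj_inv[OF regular_map_id]])
      (use assms in \<open>simp add: algebraic_character_def\<close>)
  moreover have "adj_inv (mat 1 :: complex^'n^'n) = mat 1"
    using inv(2)[of "mat 1"] GG.one_closed by simp
  ultimately show "algebraic_character G (\<lambda>g. \<theta> (adj_inv g))"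
    using assms mult unfolding algebraic_character_def by simp
qed

text \<open>One more functional is one more application of \<open>acyclic_extension\<close>: the
  functional on its entry is \<alpha>, and the quotient of the two diagonal entries is
  \<kappa>.\<close>

lemma good_step:
  assumes F: "\<And>i r. (i, r) \<in> insert (i0, r0) F \<Longrightarrow> i + d < N \<and> Vector_Spaces.linear (\<lambda>(q::rat) z. of_rat q * z) (*) r"
    and d: "d \<ge> 1"
    and good: "good {n \<in> unip H d. \<forall>(i, r)\<in>F. r (a i (i + d) n) = 0}"
  shows "good {n \<in> unip H d. \<forall>(i, r)\<in>insert (i0, r0) F. r (a i (i + d) n) = 0}"
  unfolding good_def
proof (intro allI impI)
  let ?K = "{n \<in> unip H d. \<forall>(i, r)\<in>F. r (a i (i + d) n) = 0}"
  let ?K' = "{n \<in> unip H d. \<forall>(i, r)\<in>insert (i0, r0) F. r (a i (i + d) n) = 0}"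
  let ?j = "i0 + d"
  fix \<theta> assume \<theta>: "algebraic_character G \<theta>" and triv: "\<forall>n\<in>?K'. \<sigma> n * \<theta> n = 1"
  have id: "i0 < ?j" "?j < N" "i0 < N" using F[of i0 r0] d by auto
  interpret L: Vector_Spaces.linear "\<lambda>(q::rat) (z::complex). of_rat q * z" "(*)" r0 using F by blast
  define \<alpha> where "\<alpha> n = r0 (a i0 ?j n)" for n
  define \<kappa> where "\<kappa> g = a i0 i0 g / a ?j ?j g" for g
  have K': "?K' = {n \<in> ?K. \<alpha> n = 0}" by (auto simp: \<alpha>_def)
  have KH: "n \<in> H" "n \<in> unip H d" if "n \<in> ?K" for n using that by (auto simp: unip_def)
  have \<theta>_nz: "\<theta> g \<noteq> 0" if "g \<in> H" for g using character_inverse(2)[OF \<theta>, of g] that H_closed by auto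
  interpret char_extension \<H> ?K \<alpha> \<kappa> "\<lambda>g. \<sigma> g * \<theta> g"
  proof (intro char_extension.intro char_extension_axioms.intro Hgrp.group_axioms)
    show "?K \<lhd> \<H>" by (rule normal_functional_kernel) (use F d in auto)
    show "\<alpha> (m \<otimes>\<^bsub>\<H>\<^esub> n) = \<alpha> m + \<alpha> n" if "m \<in> ?K" "n \<in> ?K" for m n
    proof -
      have "a i0 ?j (m ** n) = a i0 i0 m * a i0 ?j n + a i0 ?j m"
        by (rule a_mult_unip(1)[OF H_closed(2)[OF KH(1)[OF that(1)]] KH(2)[OF that(2)] HG id(1,2) order_refl])
      then have "a i0 ?j (m ** n) = a i0 ?j m + a i0 ?j n" using KH(2)[OF that(1)] id by (simp add: unip_def)
      then show ?thesis by (simp add: \<alpha>_def L.add)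
    qed
    show "of_rat (\<alpha> (g \<otimes>\<^bsub>\<H>\<^esub> n \<otimes>\<^bsub>\<H>\<^esub> inv\<^bsub>\<H>\<^esub> g)) = \<kappa> g * of_rat (\<alpha> n)" if "g \<in> carrier \<H>" "n \<in> ?K" for g n
    proof -
      have g: "g \<in> H" using that by simp
      have "\<kappa> g \<in> \<rat>" unfolding \<kappa>_def using diag_rat g id by (intro Rats_divide) auto
      then obtain q where q: "\<kappa> g = of_rat q" by (auto elim: Rats_cases)
      have "a i0 ?j (g ** n ** inv\<^bsub>\<H>\<^esub> g) = of_rat q * a i0 ?j n"
        using a_conj_unip[OF g KH(2)[OF that(2)] id(1,2) order_refl] unfolding q[symmetric] \<kappa>_def .
      then show ?thesis by (simp add: \<alpha>_def L.scale q of_rat_mult)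
    qed
    show "\<kappa> (g \<otimes>\<^bsub>\<H>\<^esub> h) = \<kappa> g * \<kappa> h" if "g \<in> carrier \<H>" "h \<in> carrier \<H>" for g h
      using that id H_closed by (simp add: \<kappa>_def diag_mult)
    show "\<kappa> g \<noteq> 0" if "g \<in> carrier \<H>" for g using that id diag_nz by (simp add: \<kappa>_def)
    show "\<sigma> (g \<otimes>\<^bsub>\<H>\<^esub> h) * \<theta> (g \<otimes>\<^bsub>\<H>\<^esub> h) = \<sigma> g * \<theta> g * (\<sigma> h * \<theta> h)"
      if "g \<in> carrier \<H>" "h \<in> carrier \<H>" for g h
      using that \<sigma>_mult[of g h] \<theta> H_closed by (simp add: algebraic_character_def)
    show "\<sigma> g * \<theta> g \<noteq> 0" if "g \<in> carrier \<H>" for g using that \<sigma>_nz \<theta>_nz by simp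
    show "\<sigma> n * \<theta> n = 1" if "n \<in> ?K" "\<alpha> n = 0" for n using triv that K' by blast
  qed
  \<comment> \<open>\<theta> divided by \<kappa>, written with \<open>adj_inv\<close> so that it is
    regular on G and again an algebraic character.\<close>
  define \<theta>' where "\<theta>' g = \<theta> g * (a ?j ?j g * a i0 i0 (adj_inv g))" for g
  have \<theta>': "algebraic_character G \<theta>'"
    unfolding \<theta>'_def
    by (rule character_mult[OF \<theta>], rule character_mult[OF diag_character[OF id(2)]],
      rule character_inverse(1)[OF diag_character[OF id(3)]])
  have \<theta>'_eq: "\<sigma> g * \<theta>' g = \<sigma> g * \<theta> g / \<kappa> g" if "g \<in> H" for g
  proof -
    have "a i0 i0 (adj_inv g) = 1 / a i0 i0 g"
      using diag_inv[OF that id(3)] H_inv(4)[OF that] diag_nz[OF that id(3)] by (simp add: field_simps)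
    then show ?thesis by (simp add: \<theta>'_def \<kappa>_def)
  qed
  obtain g0 where g0: "g0 \<in> H" "\<sigma> g0 * \<theta>' g0 \<noteq> 1" using nontrivial[OF \<theta>'] by blast
  have "acyclic_char \<H> {n \<in> ?K. \<alpha> n = 0} (\<lambda>g. \<sigma> g * \<theta> g)"
  proof (rule acyclic_extension)
    assume t: "\<And>n. n \<in> ?K \<Longrightarrow> \<sigma> n * \<theta> n = 1"
    then show "acyclic_char \<H> ?K (\<lambda>g. \<sigma> g * \<theta> g)" using good \<theta> unfolding good_def by blast
    have "\<sigma> n * \<theta>' n = 1" if "n \<in> ?K" for n
    proof -
      have "\<kappa> n = 1" using KH(2)[OF that] id by (simp add: \<kappa>_def unip_def)
      then show ?thesis using \<theta>'_eq[OF KH(1)[OF that]] t[OF that] by simp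
    qed
    then have "acyclic_char \<H> ?K (\<lambda>g. \<sigma> g * \<theta>' g)" using good \<theta>' unfolding good_def by blast
    then show "acyclic_char \<H> ?K (\<lambda>g. \<sigma> g * \<theta> g / \<kappa> g)"
      using acyclic_char_cong[of \<H> "\<lambda>g. \<sigma> g * \<theta>' g" "\<lambda>g. \<sigma> g * \<theta> g / \<kappa> g" ?K] \<theta>'_eq by simp
  next
    show "g0 \<in> carrier \<H>" using g0 by simp
    show "\<sigma> g0 * \<theta> g0 \<noteq> \<kappa> g0"
      using g0 \<theta>'_eq[OF g0(1)] diag_nz[OF g0(1)] id by (auto simp: \<kappa>_def)
  qed
  then show "acyclic_char \<H> ?K' (\<lambda>g. \<sigma> g * \<theta> g)" unfolding K' .
qed

text \<open>At the start the quotient embeds into the diagonal, hence is abelian, and an element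
  with nontrivial character kills everything. Each superdiagonal is then removed by imposing
  separating functionals one at a time.\<close>

lemma good_unip: "good (unip H (Suc d))"
proof (induction d)
  case 0
  show ?case unfolding good_def
  proof (intro allI impI)
    fix \<theta> assume \<theta>: "algebraic_character G \<theta>"
    obtain z where z: "z \<in> H" "\<sigma> z * \<theta> z \<noteq> 1" using nontrivial[OF \<theta>] by blast
    have "unip H (Suc 0) = {n \<in> unip H 1. \<forall>(i, r :: complex \<Rightarrow> rat)\<in>{}. r (a i (i + 1) n) = 0}" by simp
    also have "\<dots> \<lhd> \<H>" by (rule normal_functional_kernel) auto
    finally show "acyclic_char \<H> (unip H (Suc 0)) (\<lambda>g. \<sigma> g * \<theta> g)"
    proof (rule Hgrp.acyclic_abelian[where z = z])
      fix x assume "x \<in> carrier \<H>"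
      then have x: "x \<in> H" by simp
      let ?c = "inv\<^bsub>\<H>\<^esub> x ** (inv\<^bsub>\<H>\<^esub> z ** (x ** z))"
      have "?c \<in> H" using x z H_closed H_inv by simp
      moreover have "a i i ?c = 1" if "i < N" for i
        using that x z H_closed H_inv diag_inv[OF x that] diag_inv[OF z(1) that]
        by (simp add: diag_mult algebra_simps)
      ultimately show "inv\<^bsub>\<H>\<^esub> x \<otimes>\<^bsub>\<H>\<^esub> (inv\<^bsub>\<H>\<^esub> z \<otimes>\<^bsub>\<H>\<^esub> (x \<otimes>\<^bsub>\<H>\<^esub> z)) \<in> unip H (Suc 0)"
        by (auto simp: unip_def)
    qed (use z in auto)
  qed
next
  case (Suc d)
  let ?d = "Suc d"
  \<comment> \<open>Entries of elements of H are rational, so every coordinate on this superdiagonal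
    is a rational combination of these finitely many coefficients.\<close>
  let ?S = "(\<lambda>(i, p, q). k i (i + ?d) p q) ` ({..<N} \<times> UNIV \<times> UNIV)"
  obtain Rs where Rs: "finite Rs" "\<And>r. r \<in> Rs \<Longrightarrow> Vector_Spaces.linear (\<lambda>(q::rat) z. of_rat q * z) (*) r"
    "\<And>z. z \<in> rat_vs.span ?S \<Longrightarrow> (\<And>r. r \<in> Rs \<Longrightarrow> r z = 0) \<Longrightarrow> z = 0"
    using rat_separating_functionals[of ?S] by auto
  let ?F = "{i. i + ?d < N} \<times> Rs"
  have "good {n \<in> unip H ?d. \<forall>(i, r)\<in>F. r (a i (i + ?d) n) = 0}" if "finite F" "F \<subseteq> ?F" for F
    using that
  proof (induction F rule: finite_induct)
    case empty
    then show ?case using Suc by simp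
  next
    case (insert ir F)
    obtain i r where ir: "ir = (i, r)" by force
    show ?case unfolding ir
      by (rule good_step) (use insert ir Rs(2) in auto)
  qed
  moreover have "finite ?F"
  proof -
    have "{i. i + ?d < N} \<subseteq> {..<N}" by auto
    then show ?thesis using Rs(1) finite_subset by blast
  qed
  ultimately have "good {n \<in> unip H ?d. \<forall>(i, r)\<in>?F. r (a i (i + ?d) n) = 0}" by blast
  also have "{n \<in> unip H ?d. \<forall>(i, r)\<in>?F. r (a i (i + ?d) n) = 0} = unip H (Suc ?d)"
  proof (intro equalityI subsetI)
    fix n assume n: "n \<in> {n \<in> unip H ?d. \<forall>(i, r)\<in>?F. r (a i (i + ?d) n) = 0}"
    have "a i (i + ?d) n = 0" if i: "i + ?d < N" for i
    proof (rule Rs(3))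
      have nH: "n \<in> H" using n by (auto simp: unip_def)
      have "k i (i + ?d) p q * n $ p $ q \<in> rat_vs.span ?S" for p q
      proof -
        obtain u where u: "n $ p $ q = of_rat u" using H_rat[OF nH, of p q] by (auto elim: Rats_cases)
        have "k i (i + ?d) p q \<in> ?S" using i by (intro image_eqI[of _ _ "(i, p, q)"]) auto
        then have "of_rat u * k i (i + ?d) p q \<in> rat_vs.span ?S"
          by (intro rat_vs.span_scale rat_vs.span_base)
        then show ?thesis by (simp add: u mult.commute)
      qed
      then show "a i (i + ?d) n \<in> rat_vs.span ?S"
        unfolding a_def by (intro rat_vs.span_sum)
      show "r (a i (i + ?d) n) = 0" if "r \<in> Rs" for r using n that i by blast
    qed
    then have "a i j n = 0" if "j = i + ?d" "j < N" for i j using that by simp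
    then show "n \<in> unip H (Suc ?d)"
      using n unfolding unip_def by (auto simp: less_Suc_eq)
  next
    fix n assume n: "n \<in> unip H (Suc ?d)"
    have "r (a i (i + ?d) n) = 0" if "i + ?d < N" "r \<in> Rs" for i r
    proof -
      interpret L: Vector_Spaces.linear "\<lambda>(q::rat) (z::complex). of_rat q * z" "(*)" r using Rs(2) that by blast
      have "a i (i + ?d) n = 0" using n that(1) by (auto simp: unip_def)
      then show ?thesis using L.zero by simp
    qed
    then show "n \<in> {n \<in> unip H ?d. \<forall>(i, r)\<in>?F. r (a i (i + ?d) n) = 0}"
      using n by (auto simp: unip_def)
  qed
  finally show ?case .
qed

theorem acyclic_character:
  assumes \<theta>: "algebraic_character G \<theta>"
  shows "acyclic_char \<H> {mat 1} (\<lambda>g. \<sigma> g * \<theta> g)"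
proof -
  have "unip H (Suc N) = {mat 1}"
  proof (intro equalityI subsetI)
    fix n assume n: "n \<in> unip H (Suc N)"
    have "a i j n = a i j (mat 1)" if ij: "i < N" "j < N" for i j
    proof -
      consider "i < j" | "i = j" | "j < i" by linarith
      then show ?thesis
        by cases (use n ij a_one a_upper[of n j i] H_closed(2)[of n] in \<open>auto simp: unip_def\<close>)
    qed
    then have "n - mat 1 = 0"
      using a_add[of _ _ "n - mat 1" "mat 1"] by (intro a_faithful) simp
    then show "n \<in> {mat 1}" by simp
  next
    fix n :: "complex^'n^'n" assume "n \<in> {mat 1}"
    then show "n \<in> unip H (Suc N)" using a_one H_closed(3) by (auto simp: unip_def)
  qed
  moreover have "\<sigma> (mat 1) * \<theta> (mat 1) = 1"
    using \<theta> \<sigma>_mult[of "mat 1" "mat 1"] \<sigma>_nz[of "mat 1"] H_closed(3) by (simp add: algebraic_character_def)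
  ultimately show ?thesis using good_unip[of N] \<theta> unfolding good_def by simp
qed

end

section \<open>Rational eigenvalues\<close>

definition torus_points :: "nat \<Rightarrow> (nat \<Rightarrow> complex) set" where
  "torus_points r = carrier (Gm_power r)"

definition torus_mult :: "nat \<Rightarrow> (nat \<Rightarrow> complex) \<Rightarrow> (nat \<Rightarrow> complex) \<Rightarrow> nat \<Rightarrow> complex" where
  "torus_mult r x y = x \<otimes>\<^bsub>Gm_power r\<^esub> y"

text \<open>Characters are 0 off the torus, so that different characters differ at a point of it.\<close>

definition torus_char :: "nat \<Rightarrow> ((nat \<Rightarrow> complex) \<Rightarrow> complex) set" where
  "torus_char r = {\<chi>' . (\<forall>x\<in>torus_points r. \<chi>' x \<noteq> 0) \<and> (\<forall>x. x \<notin> torus_points r \<longrightarrow> \<chi>' x = 0) \<and>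
     (\<forall>x\<in>torus_points r. \<forall>y\<in>torus_points r. \<chi>' (torus_mult r x y) = \<chi>' x * \<chi>' y)}"

lemma torus_points_iff: "x \<in> torus_points r \<longleftrightarrow> (\<forall>i<r. x i \<noteq> 0) \<and> (\<forall>i. \<not> i < r \<longrightarrow> x i = undefined)"
  by (auto simp: torus_points_def Gm_power_def product_group_def Gm_def PiE_iff extensional_def)

lemma torus_mult_apply: "torus_mult r x y i = (if i < r then x i * y i else undefined)"
  by (simp add: torus_mult_def Gm_power_def product_group_def Gm_def)

lemma torus_mult_closed: "x \<in> torus_points r \<Longrightarrow> y \<in> torus_points r \<Longrightarrow> torus_mult r x y \<in> torus_points r"
  by (simp add: torus_points_iff torus_mult_apply)

lemma torus_points_ne: "\<exists>x. x \<in> torus_points r"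
  by (rule exI[of _ "\<lambda>i. if i < r then 1 else undefined"]) (simp add: torus_points_iff)

text \<open>Dedekind's argument: the relation at a product minus a multiple of the relation at one
  factor eliminates a character.\<close>

lemma torus_char_independent:
  assumes "finite F" "F \<subseteq> torus_char r" "\<And>x. x \<in> torus_points r \<Longrightarrow> (\<Sum>\<theta>\<in>F. c \<theta> * \<theta> x) = 0"
  shows "\<forall>\<theta>\<in>F. c \<theta> = 0"
  using assms
proof (induction F arbitrary: c rule: finite_induct)
  case (insert \<theta>0 F)
  have \<theta>0: "\<theta>0 \<in> torus_char r" and F: "F \<subseteq> torus_char r" using insert.prems by auto
  have rel: "c \<theta>0 * \<theta>0 x + (\<Sum>\<theta>\<in>F. c \<theta> * \<theta> x) = 0" if "x \<in> torus_points r" for x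
    using insert.prems(2)[OF that] insert.hyps by simp
  have diff0: "c \<theta> * (\<theta> y - \<theta>0 y) = 0" if y: "y \<in> torus_points r" and "\<theta> \<in> F" for \<theta> y
  proof -
    have "\<forall>\<theta>\<in>F. c \<theta> * (\<theta> y - \<theta>0 y) = 0"
    proof (rule insert.IH[OF F])
      fix x assume x: "x \<in> torus_points r"
      have m: "\<theta> (torus_mult r y x) = \<theta> y * \<theta> x" if "\<theta> \<in> torus_char r" for \<theta>
        using that x y by (simp add: torus_char_def)
      have "(\<Sum>\<theta>\<in>F. c \<theta> * \<theta> (torus_mult r y x)) = (\<Sum>\<theta>\<in>F. c \<theta> * (\<theta> y * \<theta> x))"
        using m F by (intro sum.cong) auto
      then have "c \<theta>0 * (\<theta>0 y * \<theta>0 x) + (\<Sum>\<theta>\<in>F. c \<theta> * (\<theta> y * \<theta> x)) = 0"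
        using rel[OF torus_mult_closed[OF y x]] m[OF \<theta>0] by simp
      moreover have "\<theta>0 y * (c \<theta>0 * \<theta>0 x + (\<Sum>\<theta>\<in>F. c \<theta> * \<theta> x)) = 0" using rel[OF x] by simp
      ultimately have "(\<Sum>\<theta>\<in>F. c \<theta> * (\<theta> y * \<theta> x)) = \<theta>0 y * (\<Sum>\<theta>\<in>F. c \<theta> * \<theta> x)"
        by (simp add: distrib_left mult.left_commute add_eq_0_iff2)
      then show "(\<Sum>\<theta>\<in>F. c \<theta> * (\<theta> y - \<theta>0 y) * \<theta> x) = 0"
        by (simp add: algebra_simps sum_subtractf sum_distrib_left)
    qed
    then show ?thesis using that by blast
  qed
  have cF: "c \<theta> = 0" if "\<theta> \<in> F" for \<theta>
  proof (rule ccontr)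
    assume "c \<theta> \<noteq> 0"
    then have "\<theta> y = \<theta>0 y" if "y \<in> torus_points r" for y using diff0[OF that \<open>\<theta> \<in> F\<close>] by simp
    moreover have "\<theta> y = \<theta>0 y" if "y \<notin> torus_points r" for y
      using that \<theta>0 F \<open>\<theta> \<in> F\<close> by (auto simp: torus_char_def)
    ultimately have "\<theta> = \<theta>0" by (intro ext) blast
    then show False using insert.hyps that by simp
  qed
  obtain x where x: "x \<in> torus_points r" using torus_points_ne by blast
  have "c \<theta>0 * \<theta>0 x = 0" using rel[OF x] cF by simp
  then have "c \<theta>0 = 0" using \<theta>0 x by (auto simp: torus_char_def)
  then show ?case using cF by blast
qed simp

text \<open>A Laurent polynomial is a rational combination of monomials, which are characters. A
  list of terms with repetitions makes sums and products mere concatenation and pairing.\<close>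

lemma regular_Gm_expansion:
  assumes "f \<in> regular_Gm \<rat> r"
  shows "\<exists>L. (\<forall>(c, \<theta>)\<in>set L. c \<in> \<rat> \<and> \<theta> \<in> torus_char r) \<and>
    (\<forall>x\<in>torus_points r. f x = (\<Sum>(c, \<theta>)\<leftarrow>L. c * \<theta> x))"
  using assms unfolding regular_Gm_def
proof (induction rule: alg_gen.induct)
  case (const c)
  have "(\<lambda>x. if x \<in> torus_points r then 1 else 0) \<in> torus_char r"
    by (simp add: torus_char_def torus_mult_closed)
  then show ?case
    using const by (intro exI[of _ "[(c, \<lambda>x. if x \<in> torus_points r then 1 else 0)]"]) simp
next
  case (gen f)
  have "(\<lambda>x. if x \<in> torus_points r then f x else 0) \<in> torus_char r"
    using gen by (auto simp: torus_char_def torus_mult_closed torus_mult_apply torus_points_iff)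
  then show ?case
    by (intro exI[of _ "[(1, \<lambda>x. if x \<in> torus_points r then f x else 0)]"]) simp
next
  case (add f g)
  then obtain L L' where "\<forall>(c, \<theta>)\<in>set L. c \<in> \<rat> \<and> \<theta> \<in> torus_char r"
    "\<forall>x\<in>torus_points r. f x = (\<Sum>(c, \<theta>)\<leftarrow>L. c * \<theta> x)"
    "\<forall>(c, \<theta>)\<in>set L'. c \<in> \<rat> \<and> \<theta> \<in> torus_char r"
    "\<forall>x\<in>torus_points r. g x = (\<Sum>(c, \<theta>)\<leftarrow>L'. c * \<theta> x)" by (elim exE conjE)
  then show ?case by (intro exI[of _ "L @ L'"]) auto
next
  case (mult f g)
  then obtain L L' where L: "\<forall>(c, \<theta>)\<in>set L. c \<in> \<rat> \<and> \<theta> \<in> torus_char r"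
    "\<forall>x\<in>torus_points r. f x = (\<Sum>(c, \<theta>)\<leftarrow>L. c * \<theta> x)"
    "\<forall>(c, \<theta>)\<in>set L'. c \<in> \<rat> \<and> \<theta> \<in> torus_char r"
    "\<forall>x\<in>torus_points r. g x = (\<Sum>(c, \<theta>)\<leftarrow>L'. c * \<theta> x)" by (elim exE conjE)
  let ?M = "map (\<lambda>((c, \<theta>), (d, \<eta>)). (c * d, \<lambda>x. \<theta> x * \<eta> x)) (List.product L L')"
  have one: "(\<Sum>(c, \<theta>)\<leftarrow>map (\<lambda>(d, \<eta>). (c0 * d, \<lambda>x. \<theta>0 x * \<eta> x)) B. c * \<theta> x) =
      c0 * \<theta>0 x * (\<Sum>(c, \<theta>)\<leftarrow>B. c * \<theta> x)"
    for B :: "(complex \<times> ((nat \<Rightarrow> complex) \<Rightarrow> complex)) list" and c0 \<theta>0 x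
  proof (induction B)
    case (Cons p B)
    then show ?case by (simp add: split_beta distrib_left)
  qed simp
  have prod: "(\<Sum>(c, \<theta>)\<leftarrow>map (\<lambda>((c, \<theta>), (d, \<eta>)). (c * d, \<lambda>x. \<theta> x * \<eta> x)) (List.product A B). c * \<theta> x)
      = (\<Sum>(c, \<theta>)\<leftarrow>A. c * \<theta> x) * (\<Sum>(c, \<theta>)\<leftarrow>B. c * \<theta> x)"
    for A B :: "(complex \<times> ((nat \<Rightarrow> complex) \<Rightarrow> complex)) list" and x
  proof (induction A)
    case (Cons p A)
    obtain c \<theta> where p: "p = (c, \<theta>)" by force
    have "map (\<lambda>((c, \<theta>), (d, \<eta>)). (c * d, \<lambda>x. \<theta> x * \<eta> x)) (List.product (p # A) B) =
        map (\<lambda>(d, \<eta>). (c * d, \<lambda>x. \<theta> x * \<eta> x)) B @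
        map (\<lambda>((c, \<theta>), (d, \<eta>)). (c * d, \<lambda>x. \<theta> x * \<eta> x)) (List.product A B)"
      by (simp add: p)
    then show ?case
      by (simp only: map_append sum_list_append one Cons.IH list.map sum_list.Cons p prod.case distrib_right)
  qed simp
  have char_mult: "(\<lambda>x. \<theta> x * \<eta> x) \<in> torus_char r" if "\<theta> \<in> torus_char r" "\<eta> \<in> torus_char r"
    for \<theta> \<eta> :: "(nat \<Rightarrow> complex) \<Rightarrow> complex"
    using that by (simp add: torus_char_def)
  have "fst p \<in> \<rat> \<and> snd p \<in> torus_char r" if "p \<in> set ?M" for p
  proof -
    obtain c \<theta> d \<eta> where p: "p = (c * d, \<lambda>x. \<theta> x * \<eta> x)" "(c, \<theta>) \<in> set L" "(d, \<eta>) \<in> set L'"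
      using \<open>p \<in> set ?M\<close> by auto
    show ?thesis using bspec[OF L(1) p(2)] bspec[OF L(3) p(3)] p(1) char_mult by simp
  qed
  then have M: "\<forall>(c, \<theta>)\<in>set ?M. c \<in> \<rat> \<and> \<theta> \<in> torus_char r" by (simp add: split_beta)
  have "\<forall>x\<in>torus_points r. f x * g x = (\<Sum>(c, \<theta>)\<leftarrow>?M. c * \<theta> x)"
    unfolding prod using L(2,4) by (intro ballI arg_cong2[of _ _ _ _ "(*)"]) (erule bspec, assumption)+
  with M show ?case by (intro exI conjI)
qed

lemma sum_list_group:
  assumes "finite F" "snd ` set L \<subseteq> F"
  shows "(\<Sum>(c, \<theta>)\<leftarrow>L. c * \<theta> x) = (\<Sum>\<eta>\<in>F. (\<Sum>(c, \<theta>)\<leftarrow>L. if \<theta> = \<eta> then c else 0) * (\<eta> x :: complex))"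
  using assms(2)
proof (induction L)
  case (Cons p L)
  obtain c \<theta> where p: "p = (c, \<theta>)" by force
  have "(\<Sum>\<eta>\<in>F. (if \<theta> = \<eta> then c else 0) * \<eta> x) = (\<Sum>\<eta>\<in>F. if \<eta> = \<theta> then c * \<theta> x else 0)"
    by (intro sum.cong) auto
  also have "\<dots> = c * \<theta> x" using assms(1) Cons.prems p by simp
  finally show ?case using Cons by (simp add: p distrib_right sum.distrib)
qed simp

text \<open>The coefficient matrices \<open>P \<theta>\<close> are the projections onto the weight
  spaces of the torus; they are rational because the isomorphism with the split torus is.\<close>

lemma torus_expansion:
  fixes T :: "(complex^'n^'n) set"
  assumes \<phi>: "\<phi> \<in> iso (GL_sub T) (Gm_power r)"
    and reg: "\<And>i j. \<exists>q\<in>regular_Gm \<rat> r. \<forall>x\<in>carrier (Gm_power r). inv_into T \<phi> x $ i $ j = q x"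
  obtains F and P :: "((nat \<Rightarrow> complex) \<Rightarrow> complex) \<Rightarrow> complex^'n^'n"
  where "finite F" "F \<subseteq> torus_char r" "\<And>\<theta> i j. P \<theta> $ i $ j \<in> \<rat>"
    and "\<And>x i j. x \<in> torus_points r \<Longrightarrow> inv_into T \<phi> x $ i $ j = (\<Sum>\<theta>\<in>F. P \<theta> $ i $ j * \<theta> x)"
proof -
  have "\<exists>L. (\<forall>(c, \<theta>)\<in>set L. c \<in> \<rat> \<and> \<theta> \<in> torus_char r) \<and>
      (\<forall>x\<in>torus_points r. inv_into T \<phi> x $ fst ij $ snd ij = (\<Sum>(c, \<theta>)\<leftarrow>L. c * \<theta> x))" for ij
  proof -
    obtain q where q: "q \<in> regular_Gm \<rat> r"
      "\<forall>x\<in>carrier (Gm_power r). inv_into T \<phi> x $ fst ij $ snd ij = q x" using reg by blast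
    from regular_Gm_expansion[OF q(1)] show ?thesis using q(2) by (simp add: torus_points_def)
  qed
  then have "\<forall>ij. \<exists>L. (\<forall>(c, \<theta>)\<in>set L. c \<in> \<rat> \<and> \<theta> \<in> torus_char r) \<and>
      (\<forall>x\<in>torus_points r. inv_into T \<phi> x $ fst ij $ snd ij = (\<Sum>(c, \<theta>)\<leftarrow>L. c * \<theta> x))" ..
  from choice[OF this] obtain L where L: "\<forall>ij. (\<forall>(c, \<theta>)\<in>set (L ij). c \<in> \<rat> \<and> \<theta> \<in> torus_char r) \<and>
      (\<forall>x\<in>torus_points r. inv_into T \<phi> x $ fst ij $ snd ij = (\<Sum>(c, \<theta>)\<leftarrow>L ij. c * \<theta> x))" ..
  let ?F = "\<Union>ij. snd ` set (L ij)"
  let ?P = "\<lambda>\<eta>. \<chi> i j. (\<Sum>(c, \<theta>)\<leftarrow>L (i, j). if \<theta> = \<eta> then c else 0)"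
  have fin: "finite ?F" by simp
  show thesis
  proof (rule that[OF fin])
    show "?F \<subseteq> torus_char r" using L by fastforce
    have "(\<Sum>(c, \<theta>)\<leftarrow>M. if \<theta> = \<eta> then c else 0) \<in> \<rat>"
      if "\<forall>(c, \<theta>)\<in>set M. c \<in> \<rat> \<and> \<theta> \<in> torus_char r" for M and \<eta> :: "(nat \<Rightarrow> complex) \<Rightarrow> complex"
      using that by (induction M) auto
    from this[of "L (i, j)" \<eta> for i j \<eta>] show "?P \<eta> $ i $ j \<in> \<rat>" for \<eta> i j
      using spec[OF L, of "(i, j)"] by simp
    fix x i j assume x: "x \<in> torus_points r"
    have "inv_into T \<phi> x $ i $ j = (\<Sum>(c, \<theta>)\<leftarrow>L (i, j). c * \<theta> x)" using spec[OF L, of "(i, j)"] x by simp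
    also have "\<dots> = (\<Sum>\<eta>\<in>?F. (\<Sum>(c, \<theta>)\<leftarrow>L (i, j). if \<theta> = \<eta> then c else 0) * \<eta> x)"
      by (rule sum_list_group[OF fin]) auto
    finally show "inv_into T \<phi> x $ i $ j = (\<Sum>\<theta>\<in>?F. ?P \<theta> $ i $ j * \<theta> x)" by simp
  qed
qed

context triangular_coords
begin

lemma a_zero: "a i j 0 = 0"
  unfolding a_def by simp

lemma diag_unipotent:
  assumes u: "u \<in> G" "unipotent u" and one: "mat 1 \<in> G" and i: "i < N"
  shows "a i i u = 1"
proof -
  obtain m where m: "(((**) (u - mat 1)) ^^ m) (mat 1) = 0" using u(2) unfolding unipotent_def by blast
  have w: "a i j (u - mat 1) = a i j u - a i j (mat 1)" for i j
    using a_add[of i j "u - mat 1" "mat 1"] by simp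
  have w_upper: "a i j (u - mat 1) = 0" if "j < i" "i < N" for i j
    using w a_upper[OF u(1) that] a_upper[OF one that] by simp
  have pow: "a i i ((((**) (u - mat 1)) ^^ m) (mat 1)) = (a i i u - 1) ^ m \<and>
      (\<forall>j<i. a i j ((((**) (u - mat 1)) ^^ m) (mat 1)) = 0)" if "i < N" for i m
    using that
  proof (induction m arbitrary: i)
    case 0
    then show ?case using a_one by simp
  next
    case (Suc m)
    let ?v = "(((**) (u - mat 1)) ^^ m) (mat 1)"
    have mult: "a i j ((u - mat 1) ** ?v) = (\<Sum>l<N. a i l (u - mat 1) * a l j ?v)" if "j < N" for j
      by (rule a_mult[OF Suc.prems that])
    have summand: "a i l (u - mat 1) * a l j ?v = 0" if "l < N" "l \<noteq> i \<or> j < i" "j \<le> i" for l j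
    proof (cases "l < i")
      case True
      then show ?thesis using w_upper[OF True Suc.prems] by simp
    next
      case False
      then have "j < l" using that by auto
      then show ?thesis using Suc.IH[OF that(1)] by simp
    qed
    have "a i i ((u - mat 1) ** ?v) = (\<Sum>l<N. if l = i then a i i (u - mat 1) * a i i ?v else 0)"
      unfolding mult[OF Suc.prems] by (intro sum.cong refl) (use summand[of _ i] in auto)
    also have "\<dots> = (a i i u - 1) ^ Suc m"
      using Suc.prems Suc.IH[OF Suc.prems] w[of i i] a_one[of i i] by simp
    finally have "a i i ((u - mat 1) ** ?v) = (a i i u - 1) ^ Suc m" .
    moreover have "a i j ((u - mat 1) ** ?v) = 0" if "j < i" for j
      using mult[of j] summand[of _ j] that Suc.prems by simp
    ultimately show ?case by simp
  qed
  from pow[OF i, of m] m show ?thesis by (simp add: a_zero)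
qed

text \<open>The diagonal of g = u t is that of t, namely weights \<mu> evaluated at t, where t
  itself is not assumed rational. The projection for the weight in question is upper triangular with
  diagonal entries 1 and 0, so the trace of its product with \<open>g\<close> is the multiplicity
  times the wanted entry, and that trace is rational.\<close>

theorem diag_rational:
  assumes G: "subgroup G GL"
    and U: "\<And>u. u \<in> U \<Longrightarrow> u \<in> G \<and> unipotent u" and T: "subgroup T GL" "T \<subseteq> G"
    and UT: "\<And>g. g \<in> G \<Longrightarrow> \<exists>u\<in>U. \<exists>t\<in>T. g = u ** t"
    and \<phi>: "\<phi> \<in> iso (GL_sub T) (Gm_power r)"
    and reg: "\<And>i j. \<exists>q\<in>regular_Gm \<rat> r. \<forall>x\<in>carrier (Gm_power r). inv_into T \<phi> x $ i $ j = q x"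
    and g: "g \<in> G" "\<And>p q. g $ p $ q \<in> \<rat>" and i: "i < N"
  shows "a i i g \<in> \<rat>"
proof -
  obtain F and P :: "((nat \<Rightarrow> complex) \<Rightarrow> complex) \<Rightarrow> complex^'n^'n" where
    F: "finite F" "F \<subseteq> torus_char r" and P_rat: "\<And>\<theta> i j. P \<theta> $ i $ j \<in> \<rat>"
    and P: "\<And>x i j. x \<in> torus_points r \<Longrightarrow> inv_into T \<phi> x $ i $ j = (\<Sum>\<theta>\<in>F. P \<theta> $ i $ j * \<theta> x)"
    by (rule torus_expansion[OF \<phi> reg]) (rule that)
  let ?\<psi> = "inv_into T \<phi>"
  have bij: "bij_betw \<phi> T (torus_points r)" using \<phi> by (simp add: iso_def torus_points_def)
  have hom: "\<phi> (s ** t) = torus_mult r (\<phi> s) (\<phi> t)" if "s \<in> T" "t \<in> T" for s t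
    using \<phi> that by (simp add: iso_def hom_def torus_mult_def)
  have \<psi>T: "?\<psi> x \<in> T" "\<phi> (?\<psi> x) = x" if "x \<in> torus_points r" for x
    using bij that by (auto simp: bij_betw_def inv_into_into f_inv_into_f)
  have \<psi>_mult: "?\<psi> (torus_mult r x y) = ?\<psi> x ** ?\<psi> y" if "x \<in> torus_points r" "y \<in> torus_points r" for x y
  proof -
    have "?\<psi> x ** ?\<psi> y \<in> T" using subgroup.m_closed[OF T(1)] \<psi>T that by simp
    moreover have "\<phi> (?\<psi> x ** ?\<psi> y) = torus_mult r x y" using hom \<psi>T that by simp
    ultimately show ?thesis using bij by (metis bij_betw_def inv_into_f_f)
  qed
  have a\<psi>: "a i j (?\<psi> x) = (\<Sum>\<theta>\<in>F. a i j (P \<theta>) * \<theta> x)" if "x \<in> torus_points r" for i j x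
  proof -
    have "a i j (?\<psi> x) = (\<Sum>p\<in>UNIV. \<Sum>q\<in>UNIV. \<Sum>\<theta>\<in>F. k i j p q * (P \<theta> $ p $ q * \<theta> x))"
      unfolding a_def P[OF that] by (simp add: sum_distrib_left)
    also have "\<dots> = (\<Sum>p\<in>UNIV. \<Sum>\<theta>\<in>F. \<Sum>q\<in>UNIV. k i j p q * (P \<theta> $ p $ q * \<theta> x))"
      by (intro sum.cong refl) (rule sum.swap)
    also have "\<dots> = (\<Sum>\<theta>\<in>F. \<Sum>p\<in>UNIV. \<Sum>q\<in>UNIV. k i j p q * (P \<theta> $ p $ q * \<theta> x))" by (rule sum.swap)
    finally show ?thesis by (simp add: a_def sum_distrib_right mult.assoc)
  qed
  have P_upper: "a i j (P \<theta>) = 0" if "j < i" "i < N" "\<theta> \<in> F" for i j \<theta>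
  proof -
    have "(\<Sum>\<theta>\<in>F. a i j (P \<theta>) * \<theta> x) = 0" if x: "x \<in> torus_points r" for x
      using a\<psi>[OF x, of i j] a_upper[of "?\<psi> x" j i] \<psi>T(1)[OF x] T(2) \<open>j < i\<close> \<open>i < N\<close> by auto
    from torus_char_independent[OF F this] show ?thesis using that by blast
  qed
  define \<mu> where "\<mu> i x = (if x \<in> torus_points r then a i i (?\<psi> x) else 0)" for i x
  have one: "mat 1 \<in> G" using subgroup.one_closed[OF G] by simp
  have \<mu>_char: "\<mu> i \<in> torus_char r" if "i < N" for i
  proof -
    have "a i i (?\<psi> x) \<noteq> 0" if x: "x \<in> torus_points r" for x
    proof -
      have t: "?\<psi> x \<in> G" using \<psi>T(1)[OF x] T(2) by blast
      have inv: "invertible (?\<psi> x)" using subgroup.mem_carrier[OF G t] by simp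
      have "adj_inv (?\<psi> x) \<in> G" using subgroup.m_inv_closed[OF G t] GL_inv[OF inv] by simp
      from diag_mult[OF t this \<open>i < N\<close>] adj_inv_right[OF inv] a_one[of i i] \<open>i < N\<close>
      show ?thesis by auto
    qed
    moreover have "a i i (?\<psi> (torus_mult r x y)) = a i i (?\<psi> x) * a i i (?\<psi> y)"
      if "x \<in> torus_points r" "y \<in> torus_points r" for x y
      using diag_mult[of "?\<psi> x" "?\<psi> y" i] \<psi>_mult[OF that] \<psi>T(1) that T(2) \<open>i < N\<close> by auto
    ultimately show ?thesis by (auto simp: torus_char_def \<mu>_def torus_mult_closed)
  qed
  have \<mu>F: "\<mu> i \<in> F" and P_diag: "\<And>\<theta>. \<theta> \<in> F \<Longrightarrow> a i i (P \<theta>) = (if \<theta> = \<mu> i then 1 else 0)" if i: "i < N" for i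
  proof -
    \<comment> \<open>The weight \<mu> i is not yet known to occur in F. Adding it and comparing
      coefficients shows that it occurs and determines the diagonal of every projection.\<close>
    let ?F = "insert (\<mu> i) F"
    let ?c = "\<lambda>\<theta>. (if \<theta> \<in> F then a i i (P \<theta>) else 0) - (if \<theta> = \<mu> i then 1 else 0)"
    have "(\<Sum>\<theta>\<in>?F. ?c \<theta> * \<theta> x) = 0" if x: "x \<in> torus_points r" for x
    proof -
      have "(\<Sum>\<theta>\<in>?F. ?c \<theta> * \<theta> x) =
          (\<Sum>\<theta>\<in>?F. if \<theta> \<in> F then a i i (P \<theta>) * \<theta> x else 0) - (\<Sum>\<theta>\<in>?F. if \<theta> = \<mu> i then \<mu> i x else 0)"
        unfolding sum_subtractf[symmetric] by (intro sum.cong) (auto simp: left_diff_distrib)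
      also have "(\<Sum>\<theta>\<in>?F. if \<theta> = \<mu> i then \<mu> i x else 0) = \<mu> i x" using F(1) by simp
      also have "(\<Sum>\<theta>\<in>?F. if \<theta> \<in> F then a i i (P \<theta>) * \<theta> x else 0) = (\<Sum>\<theta>\<in>F. a i i (P \<theta>) * \<theta> x)"
        using F(1) by (intro sum.mono_neutral_cong_right) auto
      also have "(\<Sum>\<theta>\<in>F. a i i (P \<theta>) * \<theta> x) = \<mu> i x" using a\<psi>[OF x, of i i] x by (simp add: \<mu>_def)
      finally show ?thesis by (simp only: diff_self)
    qed
    then have c: "\<forall>\<theta>\<in>?F. ?c \<theta> = 0"
      using F \<mu>_char[OF i] by (intro torus_char_independent[of ?F r ?c]) auto
    show "\<mu> i \<in> F" using bspec[OF c, of "\<mu> i"] by (auto split: if_splits)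
    show "a i i (P \<theta>) = (if \<theta> = \<mu> i then 1 else 0)" if "\<theta> \<in> F" for \<theta>
      using bspec[OF c, of \<theta>] that by (auto split: if_splits)
  qed
  obtain u t where ut: "u \<in> U" "t \<in> T" "g = u ** t" using UT[OF g(1)] by blast
  let ?x = "\<phi> t"
  have x: "?x \<in> torus_points r" using bij ut(2) by (auto simp: bij_betw_def)
  have \<psi>x: "?\<psi> ?x = t" using bij ut(2) by (auto simp: bij_betw_def)
  have diag_g: "a j j g = \<mu> j ?x" if "j < N" for j
    using diag_mult[of u t j] diag_unipotent[of u j] U[OF ut(1)] ut T(2) one that x \<psi>x by (auto simp: \<mu>_def)
  let ?P = "P (\<mu> i)"
  have "a j j (?P ** g) = (if \<mu> j = \<mu> i then \<mu> i ?x else 0)" if j: "j < N" for j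
  proof -
    have "a j j (?P ** g) = (\<Sum>l<N. a j l ?P * a l j g)" by (rule a_mult[OF j j])
    also have "\<dots> = (\<Sum>l<N. if l = j then a j j ?P * a j j g else 0)"
    proof (intro sum.cong refl)
      fix l assume "l \<in> {..<N}"
      then show "a j l ?P * a l j g = (if l = j then a j j ?P * a j j g else 0)"
        using P_upper[of l j "\<mu> i"] \<mu>F[OF i] a_upper[OF g(1), of j l] j
        by (cases l j rule: linorder_cases) auto
    qed
    also have "\<dots> = a j j ?P * a j j g" using j by simp
    finally show ?thesis using P_diag[OF j \<mu>F[OF i]] diag_g[OF j] by auto
  qed
  then have "(\<Sum>p\<in>UNIV. (?P ** g) $ p $ p) = (\<Sum>j<N. if \<mu> j = \<mu> i then \<mu> i ?x else 0)"
    unfolding a_trace by (intro sum.cong) auto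
  also have "\<dots> = of_nat (card {j \<in> {..<N}. \<mu> j = \<mu> i}) * \<mu> i ?x"
    by (simp add: sum.If_cases Int_def)
  finally have tr: "of_nat (card {j \<in> {..<N}. \<mu> j = \<mu> i}) * \<mu> i ?x = (\<Sum>p\<in>UNIV. (?P ** g) $ p $ p)" by simp
  have "(\<Sum>p\<in>UNIV. (?P ** g) $ p $ p) \<in> \<rat>"
    unfolding matrix_matrix_mult_def by (simp add: P_rat g(2) Rats_sum)
  moreover have "card {j \<in> {..<N}. \<mu> j = \<mu> i} \<noteq> 0" using i by auto
  ultimately have "\<mu> i ?x = (\<Sum>p\<in>UNIV. (?P ** g) $ p $ p) / of_nat (card {j \<in> {..<N}. \<mu> j = \<mu> i})"
    using tr by (simp add: field_simps)
  then show ?thesis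
    using diag_g[OF i] \<open>(\<Sum>p\<in>UNIV. (?P ** g) $ p $ p) \<in> \<rat>\<close> by (simp add: Rats_divide)
qed

end

section \<open>Finite solvable quotients\<close>

context group
begin

text \<open>A subgroup between K and S is normal in S as soon as K contains the commutators of
  S.\<close>

lemma commutator_subgroup_conj:
  assumes K: "subgroup K G" and S: "subgroup S G"
    and comm: "\<forall>a\<in>S. \<forall>b\<in>S. a \<otimes> b \<otimes> inv a \<otimes> inv b \<in> K"
    and S': "subgroup S' G" "K \<subseteq> S'" "S' \<subseteq> S" and g: "g \<in> S" and a: "a \<in> S'"
  shows "g \<otimes> a \<otimes> inv g \<in> S'"
proof -
  have c: "g \<in> carrier G" "a \<in> carrier G" using subgroup.mem_carrier[OF S] g a S'(3) by auto
  have "g \<otimes> a \<otimes> inv g \<otimes> inv a \<in> S'" using comm g a S' by blast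
  then have "g \<otimes> a \<otimes> inv g \<otimes> inv a \<otimes> a \<in> S'" using subgroup.m_closed[OF S'(1)] a by blast
  then show ?thesis using c by (simp add: m_assoc)
qed

text \<open>The subgroup generated by S' and \<open>h\<close>. Products close up because
  \<open>h\<close> normalizes S'; only natural exponents occur, so inverses need a power of
  \<open>h\<close> in S'.\<close>

lemma cyclic_overgroup:
  assumes K: "subgroup K G" and S: "subgroup S G"
    and comm: "\<forall>a\<in>S. \<forall>b\<in>S. a \<otimes> b \<otimes> inv a \<otimes> inv b \<in> K"
    and S': "subgroup S' G" "K \<subseteq> S'" "S' \<subseteq> S" and h: "h \<in> S" and m: "m > 0" "h [^] (m::nat) \<in> S'"
  shows "subgroup {g \<in> S. \<exists>i. g \<otimes> inv (h [^] (i::nat)) \<in> S'} G"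
proof (rule subgroupI)
  let ?H = "{g \<in> S. \<exists>i. g \<otimes> inv (h [^] (i::nat)) \<in> S'}"
  note conj = commutator_subgroup_conj[OF K S comm S']
  have Sc: "g \<in> carrier G" if "g \<in> S" for g using subgroup.mem_carrier[OF S that] .
  have hS: "h [^] (i::nat) \<in> S" for i
    by (induction i) (use h subgroup.m_closed[OF S] subgroup.one_closed[OF S] in auto)
  show "?H \<subseteq> carrier G" using Sc by blast
  have "\<one> \<otimes> inv (h [^] (0::nat)) \<in> S'" using subgroup.one_closed[OF S'(1)] by simp
  then show "?H \<noteq> {}" using subgroup.one_closed[OF S] by blast
  fix g assume "g \<in> ?H"
  then obtain i :: nat where g: "g \<in> S" and i: "g \<otimes> inv (h [^] i) \<in> S'" by blast
  have hic: "h [^] i \<in> carrier G" "g \<in> carrier G" "h \<in> carrier G" using Sc hS g h by auto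
  {
    fix g' assume "g' \<in> ?H"
    then obtain j :: nat where g': "g' \<in> S" and j: "g' \<otimes> inv (h [^] j) \<in> S'" by blast
    have c: "g' \<in> carrier G" "h [^] j \<in> carrier G" using Sc hS g' by auto
    have "g \<otimes> inv (h [^] i) \<otimes> (h [^] i \<otimes> (g' \<otimes> inv (h [^] j)) \<otimes> inv (h [^] i)) \<in> S'"
      using subgroup.m_closed[OF S'(1) i conj[OF hS j]] .
    also have "g \<otimes> inv (h [^] i) \<otimes> (h [^] i \<otimes> (g' \<otimes> inv (h [^] j)) \<otimes> inv (h [^] i)) =
        g \<otimes> g' \<otimes> inv (h [^] (i + j))"
      using c hic by (simp add: group_word_simps flip: nat_pow_mult)
    finally show "g \<otimes> g' \<in> ?H" using subgroup.m_closed[OF S g g'] by blast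
  }
  have "h [^] (m * i) \<in> S'"
    unfolding nat_pow_pow[OF hic(3), symmetric]
    by (induction i) (use m subgroup.m_closed[OF S'(1)] subgroup.one_closed[OF S'(1)] in auto)
  \<comment> \<open>The exponent -i is replaced by the natural number (m - 1) i, which differs from
    it by the multiple m i of m.\<close>
  then have "inv (h [^] i) \<otimes> inv (g \<otimes> inv (h [^] i)) \<otimes> inv (inv (h [^] i)) \<otimes> inv (h [^] (m * i)) \<in> S'"
    by (intro subgroup.m_closed[OF S'(1)] conj subgroup.m_inv_closed[OF S'(1)] subgroup.m_inv_closed[OF S] hS i)
  also have "m * i = (m - 1) * i + i" using m(1) by (cases m) auto
  also have "inv (h [^] i) \<otimes> inv (g \<otimes> inv (h [^] i)) \<otimes> inv (inv (h [^] i)) \<otimes> inv (h [^] ((m - 1) * i + i)) =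
      inv g \<otimes> inv (h [^] ((m - 1) * i))"
    using hic by (simp add: group_word_simps flip: nat_pow_mult)
  finally show "inv g \<in> ?H" using subgroup.m_inv_closed[OF S g] by blast
qed

end

lemma (in group_hom) pow_order_in_kernel: "g \<in> carrier G \<Longrightarrow> g [^] order H \<in> kernel G H h"
  using H.pow_order_eq_1[of "h g"] by (simp add: kernel_def hom_nat_pow)

text \<open>Isolates what the chain argument needs to know about restriction: reflexivity,
  transitivity and cyclic steps above a fixed kernel.\<close>

locale cyclic_step_relation = group_hom G Q \<pi> for G (structure) and Q :: "('q, 'y) monoid_scheme" and \<pi> +
  fixes P :: "'a set \<Rightarrow> 'a set \<Rightarrow> bool"
  assumes finite_Q: "finite (carrier Q)"
    and P_refl: "\<And>S. subgroup S G \<Longrightarrow> P S S"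
    and P_trans: "\<And>S1 S2 S3. subgroup S1 G \<Longrightarrow> subgroup S2 G \<Longrightarrow> subgroup S3 G \<Longrightarrow>
      S2 \<subseteq> S1 \<Longrightarrow> S3 \<subseteq> S2 \<Longrightarrow> P S1 S2 \<Longrightarrow> P S2 S3 \<Longrightarrow> P S1 S3"
    and P_cyclic: "\<And>S K h m. subgroup S G \<Longrightarrow> subgroup K G \<Longrightarrow> K \<subseteq> S \<Longrightarrow> kernel G Q \<pi> \<subseteq> K \<Longrightarrow> h \<in> S \<Longrightarrow>
      (\<And>k. k \<in> K \<Longrightarrow> h \<otimes> k \<otimes> inv h \<in> K) \<Longrightarrow> (\<And>k. k \<in> K \<Longrightarrow> inv h \<otimes> k \<otimes> h \<in> K) \<Longrightarrow>
      (\<And>g. g \<in> S \<Longrightarrow> \<exists>i. g \<otimes> inv (h [^] (i::nat)) \<in> K) \<Longrightarrow>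
      m > 0 \<Longrightarrow> h [^] (m::nat) \<in> K \<Longrightarrow> (\<And>i. 0 < i \<Longrightarrow> i < m \<Longrightarrow> h [^] i \<notin> K) \<Longrightarrow> P S K"
begin

lemma order_Q_pos: "order Q > 0"
  using finite_Q H.order_gt_0_iff_finite by simp

text \<open>Among the subgroups related to K, one with the largest image in the finite quotient is
  everything: adjoining a further element is a cyclic step, and an unchanged image would put that
  element into the subgroup, because the kernel lies in it.\<close>

lemma P_abelian:
  assumes S: "subgroup S G" and K: "subgroup K G" "K \<subseteq> S" "kernel G Q \<pi> \<subseteq> K"
    and comm: "\<forall>a\<in>S. \<forall>b\<in>S. a \<otimes> b \<otimes> inv a \<otimes> inv b \<in> K"
  shows "P S K"
proof -
  let ?good = "\<lambda>S'. subgroup S' G \<and> K \<subseteq> S' \<and> S' \<subseteq> S \<and> P S' K"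
  have sub: "\<pi> ` S' \<subseteq> carrier Q" if "subgroup S' G" for S'
    using subgroup.subset[OF that] by auto
  have "card (\<pi> ` S') < Suc (card (carrier Q))" if "?good S'" for S'
    using card_mono[OF finite_Q sub] that by (simp add: less_Suc_eq_le)
  moreover have "?good K" using K P_refl by simp
  ultimately obtain S' where S': "?good S'" and max: "\<And>S''. ?good S'' \<Longrightarrow> card (\<pi> ` S'') \<le> card (\<pi> ` S')"
    using ex_has_greatest_nat[of ?good K "\<lambda>S'. card (\<pi> ` S')" "Suc (card (carrier Q))"] by (metis nless_le)
  have S'K: "subgroup S' G" "K \<subseteq> S'" "S' \<subseteq> S" "P S' K" using S' by auto
  have "S' = S"
  proof (rule ccontr)
    assume "S' \<noteq> S"
    then obtain h where h: "h \<in> S" "h \<notin> S'" using S'K(3) by blast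
    have Sc: "g \<in> carrier G" if "g \<in> S" for g using subgroup.mem_carrier[OF S that] .
    note conj = G.commutator_subgroup_conj[OF K(1) S comm S'K(1-3)]
    have ex: "0 < order Q \<and> h [^] order Q \<in> S'"
      using pow_order_in_kernel[OF Sc[OF h(1)]] order_Q_pos K(3) S'K(2) by blast
    define m where "m = (LEAST m. 0 < m \<and> h [^] (m::nat) \<in> S')"
    have m: "0 < m" "h [^] m \<in> S'" unfolding m_def using LeastI[of "\<lambda>m. 0 < m \<and> h [^] (m::nat) \<in> S'", OF ex] by auto
    have m_min: "h [^] i \<notin> S'" if "0 < i" "i < m" for i
      using not_less_Least[of i "\<lambda>m. 0 < m \<and> h [^] (m::nat) \<in> S'"] that by (simp add: m_def)
    let ?H = "{g \<in> S. \<exists>i. g \<otimes> inv (h [^] (i::nat)) \<in> S'}"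
    have H: "subgroup ?H G" by (rule G.cyclic_overgroup[OF K(1) S comm S'K(1-3) h(1) m])
    have "g \<otimes> inv (h [^] (0::nat)) \<in> S'" if "g \<in> S'" for g using that Sc S'K(3) by auto
    then have S'H: "S' \<subseteq> ?H" using S'K(3) by blast
    have "h \<otimes> inv (h [^] (1::nat)) \<in> S'" using Sc[OF h(1)] subgroup.one_closed[OF S'K(1)] by simp
    then have hH: "h \<in> ?H" using h(1) by blast
    have "P ?H S'"
    proof (rule P_cyclic[OF H S'K(1) S'H _ hH _ _ _ m m_min])
      show "kernel G Q \<pi> \<subseteq> S'" using K S'K by blast
      show "h \<otimes> k \<otimes> inv h \<in> S'" if "k \<in> S'" for k using conj[OF h(1) that] .
      show "inv h \<otimes> k \<otimes> h \<in> S'" if "k \<in> S'" for k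
        using conj[OF subgroup.m_inv_closed[OF S h(1)] that] Sc[OF h(1)] by simp
    qed auto
    then have "?good ?H" using P_trans[OF H S'K(1) K(1) S'H S'K(2)] H S'K S'H by auto
    then have "card (\<pi> ` ?H) \<le> card (\<pi> ` S')" by (rule max)
    then have "\<pi> ` S' = \<pi> ` ?H"
      using S'H finite_subset[OF sub[OF H] finite_Q] by (intro card_seteq) auto
    then obtain g where g: "g \<in> S'" "\<pi> h = \<pi> g" using hH by (metis (no_types, lifting) imageE imageI)
    have c: "g \<in> carrier G" "h \<in> carrier G" using Sc h S'K(3) g by auto
    then have "\<pi> (h \<otimes> inv g) = \<one>\<^bsub>Q\<^esub>" using g(2) by simp
    then have "h \<otimes> inv g \<in> kernel G Q \<pi>" using c by (simp add: kernel_def)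
    then have "h \<otimes> inv g \<in> S'" using K(3) S'K(2) by blast
    then have "h \<otimes> inv g \<otimes> g \<in> S'" using subgroup.m_closed[OF S'K(1)] g(1) by blast
    then show False using h(2) c by (simp add: G.m_assoc)
  qed
  then show ?thesis using S'K(4) by simp
qed

text \<open>The preimages of the derived series of Q descend from the whole group to the kernel with
  abelian steps.\<close>

theorem P_solvable:
  assumes solv: "(derived Q ^^ n) (carrier Q) = {\<one>\<^bsub>Q\<^esub>}"
  shows "P (carrier G) (kernel G Q \<pi>)"
proof -
  let ?D = "\<lambda>k. (derived Q ^^ k) (carrier Q)"
  let ?K = "\<lambda>k. {g \<in> carrier G. \<pi> g \<in> ?D k}"
  have D: "subgroup (?D k) Q" for k using H.exp_of_derived_is_subgroup[OF H.subgroup_self] .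
  have K: "subgroup (?K k) G" for k
    by (rule G.subgroupI)
      (use subgroup.one_closed[OF D] subgroup.m_closed[OF D] subgroup.m_inv_closed[OF D] G.one_closed in
        \<open>auto intro!: exI[of _ \<one>]\<close>)
  have Dsub: "?D (Suc k) \<subseteq> ?D k" for k using H.derived_incl[OF subset_refl D] by simp
  have ker: "kernel G Q \<pi> \<subseteq> ?K k" for k using subgroup.one_closed[OF D] by (auto simp: kernel_def)
  have step: "P (?K k) (?K (Suc k))" for k
  proof (rule P_abelian[OF K K _ ker])
    show "?K (Suc k) \<subseteq> ?K k" using Dsub[of k] by blast
    show "\<forall>a\<in>?K k. \<forall>b\<in>?K k. a \<otimes> b \<otimes> inv a \<otimes> inv b \<in> ?K (Suc k)"
    proof (intro ballI)
      fix a b assume a: "a \<in> ?K k" and b: "b \<in> ?K k"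
      have "\<pi> a \<otimes>\<^bsub>Q\<^esub> \<pi> b \<otimes>\<^bsub>Q\<^esub> inv\<^bsub>Q\<^esub> \<pi> a \<otimes>\<^bsub>Q\<^esub> inv\<^bsub>Q\<^esub> \<pi> b \<in> derived_set Q (?D k)" using a b by blast
      then have "\<pi> a \<otimes>\<^bsub>Q\<^esub> \<pi> b \<otimes>\<^bsub>Q\<^esub> inv\<^bsub>Q\<^esub> \<pi> a \<otimes>\<^bsub>Q\<^esub> inv\<^bsub>Q\<^esub> \<pi> b \<in> ?D (Suc k)"
        unfolding derived_def funpow.simps o_def by (rule generate.incl)
      then show "a \<otimes> b \<otimes> inv a \<otimes> inv b \<in> ?K (Suc k)" using a b by simp
    qed
  qed
  have "P (carrier G) (?K k)" for k
  proof (induction k)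
    case 0
    have "?K 0 = carrier G" by auto
    then show ?case using P_refl[OF G.subgroup_self] by simp
  next
    case (Suc k)
    show ?case by (rule P_trans[OF G.subgroup_self K K _ _ Suc step]) (use Dsub[of k] in auto)
  qed
  moreover have "?K n = kernel G Q \<pi>" unfolding solv by (auto simp: kernel_def)
  ultimately show ?thesis by metis
qed

end

lemma (in group) exp_of_derived_consistent:
  assumes "subgroup H G"
  shows "(derived (G\<lparr>carrier := H\<rparr>) ^^ n) H = (derived G ^^ n) H"
proof -
  have "(derived (G\<lparr>carrier := H\<rparr>) ^^ n) H = (derived G ^^ n) H \<and> (derived G ^^ n) H \<subseteq> H"
    by (induction n) (use derived_consistent[OF _ assms] derived_incl[OF _ assms] in auto)
  then show ?thesis by simp
qed

lemma (in group) exists_normal_core: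
  assumes D: "subgroup D G" and fin: "finite (rcosets D)"
  shows "\<exists>N. N \<lhd> G \<and> N \<subseteq> D \<and> finite (rcosets N)"
proof -
  let ?N = "{g \<in> carrier G. \<forall>x\<in>carrier G. x \<otimes> g \<otimes> inv x \<in> D}"
  \<comment> \<open>The permutation of the finitely many cosets of D induced by \<open>g\<close>;
    two elements with the same permutation differ by an element of the core, so the core has finite
    index.\<close>
  let ?q = "\<lambda>g. \<lambda>C\<in>rcosets D. C #> g"
  have Dc: "D \<subseteq> carrier G" using subgroup.subset[OF D] .
  have N: "subgroup ?N G"
  proof (rule subgroupI)
    have "\<one> \<in> ?N" using subgroup.one_closed[OF D] by simp
    then show "?N \<noteq> {}" by blast
  next
    fix a assume a: "a \<in> ?N"
    have "x \<otimes> inv a \<otimes> inv x \<in> D" if x: "x \<in> carrier G" for x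
    proof -
      have "inv (x \<otimes> a \<otimes> inv x) \<in> D" using a x subgroup.m_inv_closed[OF D] by blast
      then show ?thesis using a x by (simp add: group_word_simps)
    qed
    then show "inv a \<in> ?N" using a by simp
    fix b assume b: "b \<in> ?N"
    have "x \<otimes> (a \<otimes> b) \<otimes> inv x \<in> D" if x: "x \<in> carrier G" for x
    proof -
      have "x \<otimes> a \<otimes> inv x \<otimes> (x \<otimes> b \<otimes> inv x) \<in> D" using a b x subgroup.m_closed[OF D] by blast
      then show ?thesis using a b x by (simp add: group_word_simps)
    qed
    then show "a \<otimes> b \<in> ?N" using a b by simp
  qed auto
  have "?N \<lhd> G" unfolding normal_inv_iff
  proof (intro conjI ballI N)
    fix y g assume y: "y \<in> carrier G" and g: "g \<in> ?N"
    have "x \<otimes> (y \<otimes> g \<otimes> inv y) \<otimes> inv x \<in> D" if x: "x \<in> carrier G" for x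
    proof -
      have "(x \<otimes> y) \<otimes> g \<otimes> inv (x \<otimes> y) \<in> D" using g x y by blast
      then show ?thesis using g x y by (simp add: group_word_simps)
    qed
    then show "y \<otimes> g \<otimes> inv y \<in> ?N" using y g by simp
  qed
  moreover have "?N \<subseteq> D"
  proof
    fix g assume "g \<in> ?N"
    then have "\<one> \<otimes> g \<otimes> inv \<one> \<in> D" "g \<in> carrier G" by blast+
    then show "g \<in> D" by simp
  qed
  moreover have "finite (rcosets ?N)"
  proof -
    have "?q g \<in> rcosets D \<rightarrow>\<^sub>E rcosets D" if g: "g \<in> carrier G" for g
    proof
      fix C assume "C \<in> rcosets D"
      then obtain x where x: "x \<in> carrier G" "C = D #> x" by (auto simp: RCOSETS_def)
      then have "C #> g = D #> (x \<otimes> g)" using coset_mult_assoc[OF Dc x(1) g] by simp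
      then have "C #> g \<in> rcosets D" using x(1) g rcosetsI[OF Dc, of "x \<otimes> g"] by simp
      then show "?q g C \<in> rcosets D" using \<open>C \<in> rcosets D\<close> by simp
    qed simp
    then have "?q ` carrier G \<subseteq> rcosets D \<rightarrow>\<^sub>E rcosets D" by (rule image_subsetI)
    from finite_subset[OF this finite_PiE[OF fin fin]] have fq: "finite (?q ` carrier G)" .
    have eq: "?N #> g = ?N #> h" if gh: "g \<in> carrier G" "h \<in> carrier G" "?q g = ?q h" for g h
    proof -
      have "x \<otimes> (g \<otimes> inv h) \<otimes> inv x \<in> D" if x: "x \<in> carrier G" for x
      proof -
        have C: "D #> x \<in> rcosets D" using x by (auto simp: RCOSETS_def)
        have "D #> x #> g = D #> x #> h" using fun_cong[OF gh(3), of "D #> x"] C by simp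
        then have "x \<otimes> g \<in> D #> (x \<otimes> h)"
          using coset_mult_assoc[OF Dc x] gh x rcos_self[OF _ D, of "x \<otimes> g"] by simp
        then obtain d where d: "d \<in> D" "x \<otimes> g = d \<otimes> (x \<otimes> h)" by (auto simp: r_coset_def)
        have "x \<otimes> (g \<otimes> inv h) \<otimes> inv x = (x \<otimes> g) \<otimes> inv (x \<otimes> h)"
          using gh x by (simp add: group_word_simps)
        also have "\<dots> = d" unfolding d(2) using d(1) Dc gh x by (auto simp: m_assoc)
        finally show ?thesis using d(1) by simp
      qed
      then have "g \<otimes> inv h \<in> ?N" using gh by simp
      then have "g \<in> ?N #> h" using gh unfolding r_coset_def
        by (intro UN_I[of "g \<otimes> inv h"]) (simp_all add: m_assoc)
      then show ?thesis using repr_independence[OF _ gh(2) N] by blast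
    qed
    \<comment> \<open>Recovers a coset of the core from the permutation, so there are at most as
      many cosets as permutations.\<close>
    define r where "r y = ?N #> (SOME g. g \<in> carrier G \<and> ?q g = y)" for y
    have r: "?N #> g = r (?q g)" if g: "g \<in> carrier G" for g
    proof -
      let ?g = "SOME g'. g' \<in> carrier G \<and> ?q g' = ?q g"
      have g': "?g \<in> carrier G \<and> ?q ?g = ?q g"
        by (rule someI[where x = g]) (rule conjI[OF g refl])
      show ?thesis
        unfolding r_def by (rule eq[OF conjunct1[OF g'] g conjunct2[OF g'], symmetric])
    qed
    have "rcosets ?N \<subseteq> r ` ?q ` carrier G"
    proof
      fix C assume "C \<in> rcosets ?N"
      then obtain g where g: "g \<in> carrier G" "C = ?N #> g" unfolding RCOSETS_def by blast
      show "C \<in> r ` ?q ` carrier G" unfolding g(2) r[OF g(1)] by (intro imageI g(1))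
    qed
    from finite_subset[OF this finite_imageI[OF fq]] show ?thesis .
  qed
  ultimately show ?thesis by blast
qed

lemma coset_map_group_hom: "N \<lhd> G \<Longrightarrow> group_hom G (G Mod N) (\<lambda>a. N #>\<^bsub>G\<^esub> a)"
  by (intro group_hom.intro group_hom_axioms.intro normal.r_coset_hom_Mod normal.factorgroup_is_group normal.axioms(2))

lemma kernel_coset_map: "N \<lhd> G \<Longrightarrow> kernel G (G Mod N) (\<lambda>a. N #>\<^bsub>G\<^esub> a) = N"
proof -
  assume N: "N \<lhd> G"
  interpret normal N G by (rule N)
  show ?thesis
    using coset_join1[OF _ _ subgroup_axioms] coset_join2[OF _ subgroup_axioms] subset
    by (auto simp: kernel_def FactGroup_def)
qed

section \<open>Zariski dense groups of rational matrices\<close>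

locale dense_rational_group = triangular_coords G N k a
  for G :: "(complex^'n^'n) set" and N :: nat and k a +
  fixes \<Gamma> :: "(complex^'n^'n) set" and n :: nat
  assumes G: "subgroup G GL" and con: "reg_connected G" and solv: "(derived GL ^^ n) G = {mat 1}"
    and \<Gamma>: "subgroup \<Gamma> GL" and \<Gamma>G: "\<Gamma> \<subseteq> G" and \<Gamma>_rat: "g \<in> \<Gamma> \<Longrightarrow> g $ p $ q \<in> \<rat>"
    and dense: "G \<subseteq> zariski closure_of \<Gamma>"
    and diag_rat: "g \<in> \<Gamma> \<Longrightarrow> i < N \<Longrightarrow> a i i g \<in> \<rat>"
begin

lemma character_pow:
  assumes \<theta>: "algebraic_character G \<theta>" and g: "g \<in> G"
  shows "g [^]\<^bsub>GL\<^esub> (m::nat) \<in> G \<and> \<theta> (g [^]\<^bsub>GL\<^esub> m) = \<theta> g ^ m"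
  by (induction m)
    (use \<theta> g subgroup.one_closed[OF G] subgroup.m_closed[OF G] in \<open>auto simp: algebraic_character_def nat_pow_def\<close>)

text \<open>The index enters as an exponent \<open>M\<close>: if \<sigma>\<theta> were 1 on S, then
  the m-th power of \<theta> would be 1 on S, and its power with exponent M m would be 1 on all of
  \<Gamma>.\<close>

lemma nontrivial_twist:
  assumes S: "subgroup S GL" "S \<subseteq> \<Gamma>"
    and M: "M > 0" "\<And>g. g \<in> \<Gamma> \<Longrightarrow> g [^]\<^bsub>GL\<^esub> (M::nat) \<in> S"
    and \<sigma>: "m > 0" "\<And>g. g \<in> S \<Longrightarrow> \<sigma> g ^ m = 1" "\<exists>g\<in>S. \<sigma> g \<noteq> (1::complex)"
    and \<theta>: "algebraic_character G \<theta>"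
  shows "\<exists>g\<in>S. \<sigma> g * \<theta> g \<noteq> 1"
proof (rule ccontr)
  assume "\<not> ?thesis"
  then have triv: "\<sigma> g * \<theta> g = 1" if "g \<in> S" for g using that by blast
  have \<theta>S: "\<theta> g ^ m = 1" if "g \<in> S" for g
  proof -
    have "(\<sigma> g * \<theta> g) ^ m = 1" using triv[OF that] by simp
    then show ?thesis using \<sigma>(2)[OF that] by (simp add: power_mult_distrib)
  qed
  have \<theta>\<Gamma>: "\<theta> g ^ (M * m) - 1 = 0" if "g \<in> \<Gamma>" for g
    using \<theta>S[OF M(2)[OF that]] character_pow[OF \<theta>, of g M] \<Gamma>G that by (auto simp: power_mult)
  have "(\<lambda>g. \<theta> g ^ j) \<in> regular" for j
    by (induction j) (use \<theta> in \<open>auto simp: algebraic_character_def intro: regular_mult regular_const\<close>)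
  then have reg: "(\<lambda>g. \<theta> g ^ (M * m) - 1) \<in> regular" by (intro regular_diff regular_const)
  have root: "\<theta> g ^ (M * m) = 1" if "g \<in> G" for g
  proof -
    have "\<theta> g ^ (M * m) - 1 = 0"
      by (rule regular_zero_on_closure[OF reg, of \<Gamma>])
        (use \<theta>\<Gamma> subgroup.mem_carrier[OF \<Gamma>] dense that in \<open>simp_all add: subset_iff\<close>)
    then show ?thesis by simp
  qed
  have "\<theta> g = \<theta> (mat 1)" if "g \<in> G" for g
  proof (rule reg_connectedD[OF con])
    show "\<theta> \<in> regular" using \<theta> by (simp add: algebraic_character_def)
    show "\<theta> ` G \<subseteq> {z. z ^ (M * m) = 1}" using root by blast
    show "finite {z::complex. z ^ (M * m) = 1}" using M(1) \<sigma>(1) by (intro finite_roots_unity) simp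
    show "mat 1 \<in> G" using subgroup.one_closed[OF G] by simp
  qed (rule that)
  then have "\<sigma> g = 1" if "g \<in> S" for g
    using triv[OF that] that S(2) \<Gamma>G \<theta> by (auto simp: algebraic_character_def)
  then show False using \<sigma>(3) by blast
qed

lemma bounds_twist:
  assumes S: "subgroup S GL" "S \<subseteq> \<Gamma>"
    and M: "M > 0" "\<And>g. g \<in> \<Gamma> \<Longrightarrow> g [^]\<^bsub>GL\<^esub> (M::nat) \<in> S"
    and \<sigma>: "\<And>g h. g \<in> S \<Longrightarrow> h \<in> S \<Longrightarrow> \<sigma> (g ** h) = \<sigma> g * \<sigma> h" "m > 0"
      "\<And>g. g \<in> S \<Longrightarrow> \<sigma> g ^ m = 1" "\<exists>g\<in>S. \<sigma> g \<noteq> (1::complex)"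
    and R: "regular_rep G B R"
    and F: "cocycle GL (twist \<sigma> (matrix_action R B)) (supported B) S q F"
  shows "bounds GL (twist \<sigma> (matrix_action R B)) (supported B) S q F"
proof -
  interpret rep: regular_rep G B R by (rule R)
  have \<sigma>0: "\<sigma> g \<noteq> 0" if "g \<in> S" for g using \<sigma>(3)[OF that] \<sigma>(2) by (metis power_eq_0_iff zero_neq_one)
  have "dense_characters G N k a S \<sigma>"
    by (intro dense_characters.intro triangular_coords_axioms dense_characters_axioms.intro)
      (use S G \<Gamma>G \<Gamma>_rat diag_rat \<sigma>(1) \<sigma>0 nontrivial_twist[OF S M \<sigma>(2-4)] in \<open>blast+\<close>)
  then interpret dc: dense_characters G N k a S \<sigma> .
  show ?thesis
  proof (rule rep.bounds_of_characters[OF con solv S(1) _ \<sigma>(1) \<sigma>0 _ F])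
    show "S \<subseteq> G" using S(2) \<Gamma>G by blast
    fix \<theta> assume \<theta>: "algebraic_character G \<theta>"
    then show "(\<exists>g\<in>S. \<sigma> g * \<theta> g \<noteq> 1) \<and> acyclic_char (GL_sub S) {mat 1} (\<lambda>g. \<sigma> g * \<theta> g)"
      using nontrivial_twist[OF S M \<sigma>(2-4)] dc.acyclic_character[OF \<theta>] by simp
  qed
qed

text \<open>S is left open so that the result applies both to \<Gamma> and to its subgroup. The
  exponent refers to K, hence serves every intermediate group of the chain.\<close>

lemma restriction_iso_normal:
  assumes S: "subgroup S GL" "S \<subseteq> \<Gamma>"
    and K: "K \<lhd> GL_sub S" "finite (rcosets\<^bsub>GL_sub S\<^esub> K)"
    and M: "M > 0" "\<And>g. g \<in> \<Gamma> \<Longrightarrow> g [^]\<^bsub>GL\<^esub> (M::nat) \<in> K"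
    and R: "regular_rep G B R"
  shows "restriction_iso GL (matrix_action R B) (supported B) S K"
proof -
  interpret GL: group GL by (rule group_GL)
  interpret rep: regular_rep G B R by (rule R)
  let ?S = "GL_sub S" and ?V = "supported B"
  let ?Q = "?S Mod K" and ?\<pi> = "\<lambda>g. K #>\<^bsub>GL_sub S\<^esub> g"
  let ?P = "restriction_iso GL (matrix_action R B) (supported B)"
  interpret pi: group_hom ?S ?Q ?\<pi> by (rule coset_map_group_hom[OF K(1)])
  have ker: "kernel ?S ?Q ?\<pi> = K" by (rule kernel_coset_map[OF K(1)])
  have SG: "g \<in> G" if "g \<in> S" for g using that S(2) \<Gamma>G by blast
  have sub: "subgroup S' GL" if "subgroup S' ?S" for S' using GL.incl_subgroup[OF S(1) that] .
  have subS: "S' \<subseteq> S" if "subgroup S' ?S" for S' using subgroup.subset[OF that] by simp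
  have inv_S: "inv\<^bsub>?S\<^esub> x = inv\<^bsub>GL\<^esub> x" if "x \<in> S" for x using GL.m_inv_consistent[OF S(1) that] .
  have pow_S: "x [^]\<^bsub>?S\<^esub> (i::nat) = x [^]\<^bsub>GL\<^esub> i" for x i by (rule GL.nat_pow_consistent[symmetric])
  interpret em: equivariant_module GL "matrix_action R B" ?V S
    using fun_vs.subspace_0[OF subspace_supported] fun_vs.subspace_diff[OF subspace_supported] rep.op.f_add
    by unfold_locales auto
  have "cyclic_step_relation ?S ?Q ?\<pi> ?P"
  proof (intro cyclic_step_relation.intro pi.group_hom_axioms cyclic_step_relation_axioms.intro)
    show "finite (carrier ?Q)" using K(2) by (simp add: FactGroup_def)
    show "?P S' S'" if "subgroup S' ?S" for S' using em.restriction_iso_refl[OF subS[OF that]] .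
    show "?P S1 S3" if "subgroup S1 ?S" "S2 \<subseteq> S1" "S3 \<subseteq> S2" "?P S1 S2" "?P S2 S3" for S1 S2 S3
      using em.restriction_iso_trans[OF subS[OF that(1)] that(2-5)] .
    fix S1 K1 h and m :: nat
    assume S1: "subgroup S1 ?S" and K1: "subgroup K1 ?S" and K1S1: "K1 \<subseteq> S1" and kerK: "kernel ?S ?Q ?\<pi> \<subseteq> K1"
      and h: "h \<in> S1"
      and n1: "\<And>k. k \<in> K1 \<Longrightarrow> h \<otimes>\<^bsub>?S\<^esub> k \<otimes>\<^bsub>?S\<^esub> inv\<^bsub>?S\<^esub> h \<in> K1"
      and n2: "\<And>k. k \<in> K1 \<Longrightarrow> inv\<^bsub>?S\<^esub> h \<otimes>\<^bsub>?S\<^esub> k \<otimes>\<^bsub>?S\<^esub> h \<in> K1"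
      and gen: "\<And>g. g \<in> S1 \<Longrightarrow> \<exists>i. g \<otimes>\<^bsub>?S\<^esub> inv\<^bsub>?S\<^esub> (h [^]\<^bsub>?S\<^esub> (i::nat)) \<in> K1"
      and m: "m > 0" "h [^]\<^bsub>?S\<^esub> m \<in> K1" "\<And>i. 0 < i \<Longrightarrow> i < m \<Longrightarrow> h [^]\<^bsub>?S\<^esub> i \<notin> K1"
    have hS: "h \<in> S" using h subS[OF S1] by blast
    have hpow: "h [^]\<^bsub>GL\<^esub> (i::nat) \<in> S" for i using pi.G.nat_pow_closed[of h i] hS by (simp add: pow_S)
    have S1G: "g \<in> G" if "g \<in> S1" for g using that subS[OF S1] SG by blast
    have "cyclic_extension GL (matrix_action R B) ?V S1 K1 h m"
    proof (intro cyclic_extension.intro GL.group_axioms cyclic_extension_axioms.intro sub S1 K1 K1S1 h m(1) subspace_supported)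
      show "h \<otimes>\<^bsub>GL\<^esub> k \<otimes>\<^bsub>GL\<^esub> inv\<^bsub>GL\<^esub> h \<in> K1" "inv\<^bsub>GL\<^esub> h \<otimes>\<^bsub>GL\<^esub> k \<otimes>\<^bsub>GL\<^esub> h \<in> K1" if "k \<in> K1" for k
        using n1[OF that] n2[OF that] by (simp_all add: inv_S[OF hS])
      show "\<exists>i. g \<otimes>\<^bsub>GL\<^esub> inv\<^bsub>GL\<^esub> (h [^]\<^bsub>GL\<^esub> (i::nat)) \<in> K1" if "g \<in> S1" for g
        using gen[OF that] by (simp add: pow_S inv_S[OF hpow])
      show "h [^]\<^bsub>GL\<^esub> m \<in> K1" using m(2) by (simp add: pow_S)
      show "h [^]\<^bsub>GL\<^esub> i \<notin> K1" if "0 < i" "i < m" for i using m(3)[OF that] by (simp add: pow_S)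
      show "matrix_action R B g v \<in> ?V" for g v by (rule rep.act_supported)
      show "matrix_action R B g (u + v) = matrix_action R B g u + matrix_action R B g v" for g u v
        by (rule rep.op.f_add)
      show "matrix_action R B g (\<lambda>b. c * v b) = (\<lambda>b. c * matrix_action R B g v b)" for g c v
        by (rule rep.op.f_scale)
      show "matrix_action R B \<one>\<^bsub>GL\<^esub> v = v" if "v \<in> ?V" for v using rep.act_one[OF that] by simp
      show "matrix_action R B (g \<otimes>\<^bsub>GL\<^esub> g') v = matrix_action R B g (matrix_action R B g' v)"
        if "g \<in> S1" "g' \<in> S1" for g g' v
        using rep.act_mult[OF S1G[OF that(1)] S1G[OF that(2)]] by simp
    qed
    then interpret ce: cyclic_extension GL "matrix_action R B" ?V S1 K1 h m .
    show "?P S1 K1"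
    proof (rule ce.restriction_iso_cyclic)
      fix \<sigma> q F
      assume \<sigma>: "\<And>g g'. g \<in> S1 \<Longrightarrow> g' \<in> S1 \<Longrightarrow> \<sigma> (g \<otimes>\<^bsub>GL\<^esub> g') = \<sigma> g * \<sigma> g'"
        "\<And>g. g \<in> S1 \<Longrightarrow> \<sigma> g ^ m = 1" "\<exists>g\<in>S1. \<sigma> g \<noteq> 1"
        and F: "cocycle GL (twist \<sigma> (matrix_action R B)) ?V S1 q F"
      show "bounds GL (twist \<sigma> (matrix_action R B)) ?V S1 q F"
      proof (rule bounds_twist[OF sub[OF S1] _ M(1) _ _ m(1) \<sigma>(2,3) R F])
        show "S1 \<subseteq> \<Gamma>" using subS[OF S1] S(2) by blast
        show "g [^]\<^bsub>GL\<^esub> M \<in> S1" if "g \<in> \<Gamma>" for g using M(2)[OF that] kerK K1S1 unfolding ker by blast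
        show "\<sigma> (g ** h) = \<sigma> g * \<sigma> h" if "g \<in> S1" "h \<in> S1" for g h using \<sigma>(1)[OF that] by simp
      qed
    qed
  qed
  then interpret cyclic_step_relation ?S ?Q ?\<pi> ?P .
  have "(derived GL ^^ n) S \<subseteq> {mat 1}"
    using GL.mono_exp_of_derived[of S G n] SG unfolding solv by blast
  moreover have "mat 1 \<in> (derived GL ^^ n) S"
    using subgroup.one_closed[OF GL.exp_of_derived_is_subgroup[OF S(1), of n]] by simp
  ultimately have "(derived GL ^^ n) S = {mat 1}" by blast
  have "(derived ?S ^^ n) (carrier ?S) = {mat 1}"
    using GL.exp_of_derived_consistent[OF S(1)] \<open>(derived GL ^^ n) S = {mat 1}\<close> by simp
  moreover have "?\<pi> ` carrier ?S = carrier ?Q" by (auto simp: FactGroup_def RCOSETS_def)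
  ultimately have "(derived ?Q ^^ n) (carrier ?Q) = {\<one>\<^bsub>?Q\<^esub>}"
    using pi.exp_of_derived_img[of "carrier ?S" n] pi.hom_one by simp
  from P_solvable[OF this] show ?thesis unfolding ker by simp
qed

theorem restriction_iso_finite_index:
  assumes \<Delta>: "subgroup \<Delta> (GL_sub \<Gamma>)" "finite (rcosets\<^bsub>GL_sub \<Gamma>\<^esub> \<Delta>)"
    and R: "regular_rep G B R"
  shows "restriction_iso GL (matrix_action R B) (supported B) \<Gamma> \<Delta>"
proof -
  interpret GL: group GL by (rule group_GL)
  interpret rep: regular_rep G B R by (rule R)
  interpret \<Gamma>: group "GL_sub \<Gamma>" by (rule GL.subgroup_imp_group[OF \<Gamma>])
  obtain K where K: "K \<lhd> GL_sub \<Gamma>" "K \<subseteq> \<Delta>" "finite (rcosets\<^bsub>GL_sub \<Gamma>\<^esub> K)"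
    using \<Gamma>.exists_normal_core[OF \<Delta>] by blast
  let ?Q = "GL_sub \<Gamma> Mod K"
  have \<Delta>': "subgroup \<Delta> GL" "\<Delta> \<subseteq> \<Gamma>" using GL.incl_subgroup[OF \<Gamma> \<Delta>(1)] subgroup.subset[OF \<Delta>(1)] by auto
  interpret pi: group_hom "GL_sub \<Gamma>" ?Q "\<lambda>g. K #>\<^bsub>GL_sub \<Gamma>\<^esub> g" by (rule coset_map_group_hom[OF K(1)])
  have fin: "finite (carrier ?Q)" using K(3) by (simp add: FactGroup_def)
  have M: "order ?Q > 0" using fin pi.H.order_gt_0_iff_finite by simp
  have pow: "g [^]\<^bsub>GL\<^esub> order ?Q \<in> K" if "g \<in> \<Gamma>" for g
  proof -
    have "g [^]\<^bsub>GL_sub \<Gamma>\<^esub> order ?Q \<in> kernel (GL_sub \<Gamma>) ?Q (\<lambda>g. K #>\<^bsub>GL_sub \<Gamma>\<^esub> g)"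
      using that by (intro pi.pow_order_in_kernel) simp
    then show ?thesis unfolding kernel_coset_map[OF K(1)] by (simp flip: GL.nat_pow_consistent)
  qed
  have K\<Delta>: "K \<lhd> GL_sub \<Delta>"
  proof -
    have KGL: "subgroup K GL" using GL.incl_subgroup[OF \<Gamma> normal_imp_subgroup[OF K(1)]] .
    interpret \<Delta>: group "GL_sub \<Delta>" by (rule GL.subgroup_imp_group[OF \<Delta>'(1)])
    show ?thesis unfolding \<Delta>.normal_inv_iff
    proof (intro conjI ballI)
      show "subgroup K (GL_sub \<Delta>)" using GL.subgroup_incl[OF KGL \<Delta>'(1) K(2)] .
      fix x h assume x: "x \<in> carrier (GL_sub \<Delta>)" and h: "h \<in> K"
      have "x \<otimes>\<^bsub>GL_sub \<Gamma>\<^esub> h \<otimes>\<^bsub>GL_sub \<Gamma>\<^esub> inv\<^bsub>GL_sub \<Gamma>\<^esub> x \<in> K"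
        using K(1) h x \<Delta>'(2) unfolding \<Gamma>.normal_inv_iff by auto
      moreover have "x \<in> \<Gamma>" "x \<in> \<Delta>" using x \<Delta>'(2) by auto
      ultimately show "x \<otimes>\<^bsub>GL_sub \<Delta>\<^esub> h \<otimes>\<^bsub>GL_sub \<Delta>\<^esub> inv\<^bsub>GL_sub \<Delta>\<^esub> x \<in> K"
        by (simp add: GL.m_inv_consistent[OF \<Gamma>] GL.m_inv_consistent[OF \<Delta>'(1)])
    qed
  qed
  have "rcosets\<^bsub>GL_sub \<Delta>\<^esub> K \<subseteq> rcosets\<^bsub>GL_sub \<Gamma>\<^esub> K" using \<Delta>'(2) by (auto simp: RCOSETS_def r_coset_def)
  then have fin\<Delta>: "finite (rcosets\<^bsub>GL_sub \<Delta>\<^esub> K)" using K(3) finite_subset by blast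
  interpret em: equivariant_module GL "matrix_action R B" "supported B" \<Gamma>
    using fun_vs.subspace_0[OF subspace_supported] fun_vs.subspace_diff[OF subspace_supported] rep.op.f_add
    by unfold_locales auto
  show ?thesis
    by (rule em.restriction_iso_cancel[OF subset_refl \<Delta>'(2) K(2)
          restriction_iso_normal[OF \<Gamma> subset_refl K(1,3) M pow R]
          restriction_iso_normal[OF \<Delta>' K\<Delta> fin\<Delta> M pow R]])
qed

end

lemma cocycle_image:
  assumes A: "Modules.additive A" "\<And>v. v \<in> V \<Longrightarrow> A v \<in> W"
    "\<And>g v. g \<in> S \<Longrightarrow> v \<in> V \<Longrightarrow> A (act g v) = act' g (A v)"
  shows "cocycle G act V S q f \<Longrightarrow> cocycle G act' W S q (\<lambda>xs. A (f xs))"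
  unfolding cocycle_def equivariant_def cobd_additive[OF A(1)]
  using A(2,3) Modules.additive.zero[OF A(1)] by simp

lemma bounds_image:
  assumes A: "Modules.additive A" "\<And>v. v \<in> V \<Longrightarrow> A v \<in> W"
    "\<And>g v. g \<in> S \<Longrightarrow> v \<in> V \<Longrightarrow> A (act g v) = act' g (A v)"
    and f: "bounds G act V S q f"
  shows "bounds G act' W S q (\<lambda>xs. A (f xs))"
proof -
  obtain h where h: "equivariant G act V S S (q - 1) h" "q = 1 \<longrightarrow> h [] = 0"
    "\<forall>xs\<in>lists_of S q. f xs = cobd h xs"
    using f unfolding bounds_def by (elim exE conjE)
  show ?thesis unfolding bounds_def
    using h A Modules.additive.zero[OF A(1)]
    by (intro exI[of _ "\<lambda>xs. A (h xs)"] conjI) (auto simp: cobd_additive equivariant_def)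
qed

text \<open>A retract of an isomorphism is an isomorphism: cocycles and primitives are pushed
  forward by the inclusion and brought back by the retraction.\<close>

lemma restriction_iso_retract:
  assumes \<iota>: "Modules.additive \<iota>" "\<And>m. \<iota> m \<in> V" "\<And>g m. g \<in> S \<Longrightarrow> \<iota> (\<rho> g m) = act g (\<iota> m)"
    and \<pi>: "Modules.additive \<pi>" "\<And>g v. g \<in> S \<Longrightarrow> v \<in> V \<Longrightarrow> \<pi> (act g v) = \<rho> g (\<pi> v)"
    and id: "\<And>m. \<pi> (\<iota> m) = m" and TS: "T \<subseteq> S"
    and iso: "restriction_iso G act V S T"
  shows "restriction_iso G \<rho> UNIV S T"
  unfolding restriction_iso_def
proof (intro conjI allI impI)
  have \<iota>': "\<iota> m \<in> V" "g \<in> T \<Longrightarrow> \<iota> (\<rho> g m) = act g (\<iota> m)" for m g using \<iota> TS by auto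
  have \<pi>': "g \<in> T \<Longrightarrow> v \<in> V \<Longrightarrow> \<pi> (act g v) = \<rho> g (\<pi> v)" for v g using \<pi> TS by auto
  {
    fix q f assume "cocycle G \<rho> UNIV T q f"
    from cocycle_image[OF \<iota>(1) \<iota>' this] obtain F where
      F: "cocycle G act V S q F" "bounds G act V T q (\<lambda>xs. \<iota> (f xs) - F xs)"
      using iso unfolding restriction_iso_def by blast
    have "cocycle G \<rho> UNIV S q (\<lambda>xs. \<pi> (F xs))"
      by (rule cocycle_image[OF \<pi>(1) _ \<pi>(2) F(1)]) auto
    moreover have "bounds G \<rho> UNIV T q (\<lambda>xs. \<pi> (\<iota> (f xs) - F xs))"
      by (rule bounds_image[OF \<pi>(1) _ \<pi>' F(2)]) auto
    ultimately show "\<exists>F. cocycle G \<rho> UNIV S q F \<and> bounds G \<rho> UNIV T q (\<lambda>xs. f xs - F xs)"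
      by (intro exI[of _ "\<lambda>xs. \<pi> (F xs)"]) (simp add: Modules.additive.diff[OF \<pi>(1)] id)
  }
  fix q F assume F: "cocycle G \<rho> UNIV S q F" "bounds G \<rho> UNIV T q F"
  have "bounds G act V S q (\<lambda>xs. \<iota> (F xs))"
    using cocycle_image[OF \<iota> F(1)] bounds_image[OF \<iota>(1) \<iota>' F(2)] iso unfolding restriction_iso_def by simp
  from bounds_image[OF \<pi>(1) _ \<pi>(2) this, of UNIV] show "bounds G \<rho> UNIV S q F" by (simp add: id)
qed

section \<open>Inhomogeneous cochains\<close>

text \<open>The alternating sum over all faces of an inhomogeneous simplex except the first.\<close>

fun faces :: "('g \<Rightarrow> 'g \<Rightarrow> 'g) \<Rightarrow> ('g list \<Rightarrow> 'v::ab_group_add) \<Rightarrow> 'g list \<Rightarrow> 'v" where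
  "faces m f [] = 0"
| "faces m f [g] = f []"
| "faces m f (g # h # gs) = f (m g h # gs) - faces m (\<lambda>l. f (g # l)) (h # gs)"

text \<open>\<open>diffs\<close> and \<open>prods\<close> are the mutually inverse changes between
  the vertices of a simplex and the successive quotients that label it in the bar resolution, with
  the initial vertex kept apart.\<close>

primrec diffs :: "('g, 'x) monoid_scheme \<Rightarrow> 'g \<Rightarrow> 'g list \<Rightarrow> 'g list" where
  "diffs G x [] = []"
| "diffs G x (y # ys) = (inv\<^bsub>G\<^esub> x \<otimes>\<^bsub>G\<^esub> y) # diffs G y ys"

primrec prods :: "('g, 'x) monoid_scheme \<Rightarrow> 'g \<Rightarrow> 'g list \<Rightarrow> 'g list" where
  "prods G x [] = []"
| "prods G x (g # gs) = (x \<otimes>\<^bsub>G\<^esub> g) # prods G (x \<otimes>\<^bsub>G\<^esub> g) gs"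

fun homog :: "('g, 'x) monoid_scheme \<Rightarrow> ('g \<Rightarrow> 'm \<Rightarrow> 'm) \<Rightarrow> ('g list \<Rightarrow> 'm::ab_group_add) \<Rightarrow> 'g list \<Rightarrow> 'm" where
  "homog G \<rho> f [] = 0"
| "homog G \<rho> f (x # xs) = \<rho> x (f (diffs G x xs))"

text \<open>Links the recursive alternating sum to the indexed formula of \<open>coboundary\<close>;
  the signs are opposite, so the differential is the first face minus \<open>faces\<close>.\<close>

lemma faces_sum:
  assumes "vector_space s" "length gs = Suc k"
  shows "faces m f gs = (\<Sum>i<k. s ((-1 :: rat) ^ i) (f (take i gs @ [m (gs ! i) (gs ! Suc i)] @ drop (Suc (Suc i)) gs)))
    + s ((-1) ^ k) (f (butlast gs))"
proof -
  interpret vector_space s by (rule assms)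
  show ?thesis using assms(2)
  proof (induction k arbitrary: gs f)
    case 0
    then obtain g where "gs = [g]" by (metis length_0_conv length_Suc_conv)
    then show ?case by simp
  next
    case (Suc k)
    then obtain g h gs' where gs: "gs = g # h # gs'" by (metis length_Suc_conv)
    have "faces m (\<lambda>l. f (g # l)) (h # gs') = (\<Sum>i<k. s ((-1) ^ i) (f (g # take i (h # gs') @
        [m ((h # gs') ! i) ((h # gs') ! Suc i)] @ drop (Suc (Suc i)) (h # gs')))) + s ((-1) ^ k) (f (g # butlast (h # gs')))"
      using Suc.IH[of "h # gs'" "\<lambda>l. f (g # l)"] Suc.prems gs by simp
    then show ?case unfolding gs sum.lessThan_Suc_shift by (simp add: sum_negf)
  qed
qed

locale cohomology_module = group G + vector_space s
  for G :: "('g, 'x) monoid_scheme" (structure) and s :: "rat \<Rightarrow> 'm \<Rightarrow> 'm::ab_group_add" +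
  fixes \<rho> :: "'g \<Rightarrow> 'm \<Rightarrow> 'm" and S :: "'g set"
  assumes S: "subgroup S G"
    and \<rho>_add: "g \<in> S \<Longrightarrow> \<rho> g (u + v) = \<rho> g u + \<rho> g v"
    and \<rho>_scale: "g \<in> S \<Longrightarrow> \<rho> g (s c v) = s c (\<rho> g v)"
    and \<rho>_one: "\<rho> \<one> v = v"
    and \<rho>_mult: "g \<in> S \<Longrightarrow> h \<in> S \<Longrightarrow> \<rho> (g \<otimes> h) v = \<rho> g (\<rho> h v)"
begin

abbreviation "\<S> \<equiv> G\<lparr>carrier := S\<rparr>"
abbreviation "Z \<equiv> \<lambda>k. carrier (cocycle_group \<S> s \<rho> k)"
abbreviation "B \<equiv> coboundaries \<S> s \<rho>"
abbreviation "\<delta> \<equiv> coboundary \<S> s \<rho>"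
abbreviation "cls \<equiv> coh_class \<S> s \<rho>"

lemma in_carrier [simp]: "g \<in> S \<Longrightarrow> g \<in> carrier G"
  using subgroup.mem_carrier[OF S] .

lemma closed [simp]: "g \<in> S \<Longrightarrow> h \<in> S \<Longrightarrow> g \<otimes> h \<in> S" "g \<in> S \<Longrightarrow> inv g \<in> S" "\<one> \<in> S"
  by (rule subgroup.m_closed[OF S] subgroup.m_inv_closed[OF S] subgroup.one_closed[OF S]; assumption)+

lemma additive_\<rho>: "g \<in> S \<Longrightarrow> Modules.additive (\<rho> g)"
  by unfold_locales (rule \<rho>_add)

sublocale em: equivariant_module G \<rho> UNIV S
  by unfold_locales (use \<rho>_add in auto)

lemma \<rho>_diff: "g \<in> S \<Longrightarrow> \<rho> g (u - v) = \<rho> g u - \<rho> g v"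
  by (rule Modules.additive.diff[OF additive_\<rho>])

lemma \<rho>_zero: "g \<in> S \<Longrightarrow> \<rho> g 0 = 0"
  by (rule Modules.additive.zero[OF additive_\<rho>])

lemma tuples_iff: "xs \<in> tuples \<S> k \<longleftrightarrow> xs \<in> lists_of S k"
  by (auto simp: tuples_def lists_of_def)

lemma cochainsI: "(\<And>xs. xs \<notin> lists_of S k \<Longrightarrow> f xs = 0) \<Longrightarrow> f \<in> cochains \<S> k"
  by (simp add: cochains_def tuples_iff)

lemma cochainsD: "f \<in> cochains \<S> k \<Longrightarrow> xs \<notin> lists_of S k \<Longrightarrow> f xs = 0"
  by (simp add: cochains_def tuples_iff)

lemma diffs_in: "x \<in> S \<Longrightarrow> ys \<in> lists_of S k \<Longrightarrow> diffs G x ys \<in> lists_of S k"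
  by (induction ys arbitrary: x k) (auto simp: lists_of_def)

lemma diffs_map: "g \<in> S \<Longrightarrow> x \<in> S \<Longrightarrow> set ys \<subseteq> S \<Longrightarrow> diffs G (g \<otimes> x) (map ((\<otimes>) g) ys) = diffs G x ys"
proof (induction ys arbitrary: x)
  case (Cons y ys)
  have "inv (g \<otimes> x) \<otimes> (g \<otimes> y) = inv x \<otimes> y" using Cons.prems by (simp add: group_word_simps)
  then show ?case using Cons by simp
qed simp

lemma prods_in: "x \<in> S \<Longrightarrow> gs \<in> lists_of S k \<Longrightarrow> prods G x gs \<in> lists_of S k"
  by (induction gs arbitrary: x k) (auto simp: lists_of_def)

lemma diffs_prods: "x \<in> S \<Longrightarrow> set gs \<subseteq> S \<Longrightarrow> diffs G x (prods G x gs) = gs"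
  by (induction gs arbitrary: x) (auto simp: group_word_simps)

lemma prods_diffs: "x \<in> S \<Longrightarrow> set ys \<subseteq> S \<Longrightarrow> prods G x (diffs G x ys) = ys"
  by (induction ys arbitrary: x) (auto simp: group_word_simps)

lemma map_prods: "g \<in> S \<Longrightarrow> x \<in> S \<Longrightarrow> set gs \<subseteq> S \<Longrightarrow> map ((\<otimes>) g) (prods G x gs) = prods G (g \<otimes> x) gs"
  by (induction gs arbitrary: x) (auto simp: m_assoc)

lemma coboundary_faces:
  assumes "gs \<in> lists_of S (Suc k)"
  shows "\<delta> k f gs = \<rho> (hd gs) (f (tl gs)) - faces (\<otimes>) f gs"
proof -
  have "length gs = Suc k" using assms by (simp add: lists_of_def)
  from faces_sum[OF vector_space_axioms this, of "(\<otimes>)" f] show ?thesis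
    using assms by (simp add: coboundary_def tuples_iff sum_negf)
qed

lemma coboundary_cochains: "\<delta> k f \<in> cochains \<S> (Suc k)"
  by (simp add: coboundary_def cochains_def)

lemma cobd_diffs:
  "x \<in> S \<Longrightarrow> set zs \<subseteq> S \<Longrightarrow> cobd (\<lambda>ws. f (diffs G x ws)) zs = faces (\<otimes>) f (diffs G x zs)"
proof (induction zs arbitrary: x f)
  case (Cons y zs)
  have "cobd (\<lambda>ws. f (diffs G x ws)) (y # zs) =
      f (diffs G x zs) - faces (\<otimes>) (\<lambda>l. f (inv x \<otimes> y # l)) (diffs G y zs)"
    using Cons.IH[of y "\<lambda>l. f (inv x \<otimes> y # l)"] Cons.prems by simp
  also have "\<dots> = faces (\<otimes>) f (diffs G x (y # zs))"
    using Cons.prems by (cases zs) (auto simp: group_word_simps)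
  finally show ?case .
qed simp

text \<open>Degree k corresponds to k + 1 vertices. Dropping the first vertex moves the base point
  from x to y, and the identity \<rho> y = \<rho> x \<rho>(x^-1 y) turns this face into the first
  term of the bar differential.\<close>

lemma cobd_homog:
  assumes "xs \<in> lists_of S (Suc (Suc k))"
  shows "cobd (homog G \<rho> f) xs = homog G \<rho> (\<delta> k f) xs"
proof -
  obtain x y ys where xs: "xs = x # y # ys" "x \<in> S" "y \<in> S" "ys \<in> lists_of S k"
    using assms by (auto simp: lists_of_Suc_iff)
  have ys: "set ys \<subseteq> S" using xs by (simp add: lists_of_def)
  have d: "diffs G x (y # ys) \<in> lists_of S (Suc k)"
    using xs by (intro diffs_in) (auto simp: lists_of_def)
  have "cobd (\<lambda>zs. \<rho> x (f (diffs G x zs))) (y # ys) = \<rho> x (cobd (\<lambda>zs. f (diffs G x zs)) (y # ys))"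
    by (rule cobd_additive[OF additive_\<rho>[OF xs(2)]])
  also have "\<dots> = \<rho> x (faces (\<otimes>) f (diffs G x (y # ys)))"
    using cobd_diffs[of x "y # ys" f] xs ys by simp
  finally have "cobd (homog G \<rho> f) xs = \<rho> y (f (diffs G y ys)) - \<rho> x (faces (\<otimes>) f (diffs G x (y # ys)))"
    by (simp add: xs(1))
  moreover have "\<rho> y (f (diffs G y ys)) = \<rho> x (\<rho> (inv x \<otimes> y) (f (diffs G y ys)))"
    using xs by (simp add: group_word_simps flip: \<rho>_mult)
  ultimately show ?thesis
    using coboundary_faces[OF d, of f] xs(1,2) by (simp add: \<rho>_diff)
qed

lemma equivariant_homog: "equivariant G \<rho> UNIV S S (Suc k) (homog G \<rho> f)"
  unfolding equivariant_def
proof (intro conjI allI ballI)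
  fix g xs assume g: "g \<in> S" and "xs \<in> lists_of S (Suc k)"
  then obtain x ys where "xs = x # ys" "x \<in> S" "ys \<in> lists_of S k" by (auto simp: lists_of_Suc_iff)
  then show "homog G \<rho> f (map ((\<otimes>) g) xs) = \<rho> g (homog G \<rho> f xs)"
    using g diffs_map[of g x ys] by (simp add: \<rho>_mult lists_of_def)
qed simp

text \<open>The value at the simplex based at the identity, which determines an equivariant cochain;
  0 elsewhere because inhomogeneous cochains are normalised.\<close>

definition inhom :: "nat \<Rightarrow> ('g list \<Rightarrow> 'm) \<Rightarrow> 'g list \<Rightarrow> 'm" where
  "inhom k F gs = (if gs \<in> lists_of S k then F (\<one> # prods G \<one> gs) else 0)"

lemma inhom_cochains: "inhom k F \<in> cochains \<S> k"
  by (rule cochainsI) (simp add: inhom_def)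

lemma homog_prods: "gs \<in> lists_of S k \<Longrightarrow> homog G \<rho> f (\<one> # prods G \<one> gs) = f gs"
  by (simp add: \<rho>_one diffs_prods lists_of_def)

lemma one_prods_in: "gs \<in> lists_of S k \<Longrightarrow> \<one> # prods G \<one> gs \<in> lists_of S (Suc k)"
  using prods_in[of \<one> gs k] by (simp add: lists_of_def)

lemma homog_inhom:
  assumes F: "equivariant G \<rho> UNIV S S (Suc k) F" and xs: "xs \<in> lists_of S (Suc k)"
  shows "homog G \<rho> (inhom k F) xs = F xs"
proof -
  obtain x ys where x: "xs = x # ys" "x \<in> S" "ys \<in> lists_of S k"
    using xs by (auto simp: lists_of_Suc_iff)
  have d: "diffs G x ys \<in> lists_of S k" by (rule diffs_in[OF x(2,3)])
  have "homog G \<rho> (inhom k F) xs = \<rho> x (F (\<one> # prods G \<one> (diffs G x ys)))"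
    using d by (simp add: x(1) inhom_def)
  also have "\<dots> = F (map ((\<otimes>) x) (\<one> # prods G \<one> (diffs G x ys)))"
    using F x(2) one_prods_in[OF d] by (simp add: equivariant_def del: list.map)
  also have "map ((\<otimes>) x) (\<one> # prods G \<one> (diffs G x ys)) = xs"
    using x d map_prods[of x \<one> "diffs G x ys"] prods_diffs[of x ys] by (simp add: lists_of_def)
  finally show ?thesis .
qed

lemma cochain_0_iff:
  assumes "f \<in> cochains \<S> k"
  shows "(\<forall>xs\<in>lists_of S (Suc k). homog G \<rho> f xs = 0) \<longleftrightarrow> f = (\<lambda>_. 0)"
proof
  assume H: "\<forall>xs\<in>lists_of S (Suc k). homog G \<rho> f xs = 0"
  show "f = (\<lambda>_. 0)"
  proof
    fix gs show "f gs = 0"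
      using homog_prods[of gs k f] bspec[OF H one_prods_in[of gs k]] cochainsD[OF assms, of gs]
      by (cases "gs \<in> lists_of S k") simp_all
  qed
qed (auto simp: lists_of_Suc_iff \<rho>_zero)

lemma Z_iff: "f \<in> Z k \<longleftrightarrow> f \<in> cochains \<S> k \<and> cocycle G \<rho> UNIV S (Suc k) (homog G \<rho> f)"
proof -
  have "\<delta> k f = (\<lambda>_. 0) \<longleftrightarrow> (\<forall>xs\<in>lists_of S (Suc (Suc k)). cobd (homog G \<rho> f) xs = 0)"
    using cochain_0_iff[OF coboundary_cochains, of k f] cobd_homog[of _ k f] by simp
  then show ?thesis by (auto simp: cocycle_group_def cocycle_def equivariant_homog)
qed

lemma cochains_eqI:
  assumes "f \<in> cochains \<S> k" "g \<in> cochains \<S> k"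
    and "\<And>xs. xs \<in> lists_of S (Suc k) \<Longrightarrow> homog G \<rho> f xs = homog G \<rho> g xs"
  shows "f = g"
proof
  fix gs show "f gs = g gs"
    using assms(3)[OF one_prods_in[of gs k]] homog_prods[of gs k f] homog_prods[of gs k g]
      cochainsD[OF assms(1), of gs] cochainsD[OF assms(2), of gs]
    by (cases "gs \<in> lists_of S k") simp_all
qed

text \<open>In degree 0 the clause of \<open>bounds\<close> about the empty list removes the
  augmentation, in agreement with the zero group of coboundaries there. In higher degrees
  \<open>homog\<close> and \<open>inhom\<close> exchange the primitives.\<close>

lemma B_iff: "f \<in> B k \<longleftrightarrow> f \<in> cochains \<S> k \<and> bounds G \<rho> UNIV S (Suc k) (homog G \<rho> f)"
proof (cases k)
  case 0
  show ?thesis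
  proof
    assume "f \<in> B k"
    then have f: "f = (\<lambda>_. 0)" by (simp add: coboundaries_def 0)
    have "homog G \<rho> f xs = 0" if "xs \<in> lists_of S 1" for xs
      using that f by (auto simp: lists_of_Suc_iff \<rho>_zero)
    then have "bounds G \<rho> UNIV S 1 (homog G \<rho> f)"
      unfolding bounds_def using em.equivariant_zero by (intro exI[of _ "\<lambda>_. 0"]) (simp add: cobd_zero)
    then show "f \<in> cochains \<S> k \<and> bounds G \<rho> UNIV S (Suc k) (homog G \<rho> f)"
      by (simp add: 0 f cochains_def)
  next
    assume f: "f \<in> cochains \<S> k \<and> bounds G \<rho> UNIV S (Suc k) (homog G \<rho> f)"
    then obtain h where h: "h [] = 0" "\<forall>xs\<in>lists_of S 1. homog G \<rho> f xs = cobd h xs"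
      unfolding bounds_def 0 by auto
    have "homog G \<rho> f xs = 0" if "xs \<in> lists_of S (Suc 0)" for xs
    proof -
      obtain x where "xs = [x]"
        using \<open>xs \<in> lists_of S (Suc 0)\<close> by (cases xs) (auto simp: lists_of_def)
      then show ?thesis using bspec[OF h(2), of xs] that h(1) by simp
    qed
    then have "f = (\<lambda>_. 0)" using cochain_0_iff[of f k] f 0 by simp
    then show "f \<in> B k" by (simp add: coboundaries_def 0)
  qed
next
  case (Suc j)
  show ?thesis
  proof
    assume "f \<in> B k"
    then obtain h where h: "h \<in> cochains \<S> j" "f = \<delta> j h" by (auto simp: coboundaries_def Suc)
    have "bounds G \<rho> UNIV S (Suc (Suc j)) (homog G \<rho> f)"
      unfolding bounds_def using equivariant_homog[of j h] cobd_homog[of _ j h]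
      by (intro exI[of _ "homog G \<rho> h"]) (simp add: h(2))
    then show "f \<in> cochains \<S> k \<and> bounds G \<rho> UNIV S (Suc k) (homog G \<rho> f)"
      using coboundary_cochains[of j h] by (simp add: Suc h(2))
  next
    assume f: "f \<in> cochains \<S> k \<and> bounds G \<rho> UNIV S (Suc k) (homog G \<rho> f)"
    then obtain h where h: "equivariant G \<rho> UNIV S S (Suc j) h"
      "\<forall>xs\<in>lists_of S (Suc k). homog G \<rho> f xs = cobd h xs"
      unfolding bounds_def Suc by auto
    have "f = \<delta> j (inhom j h)"
    proof (rule cochains_eqI)
      fix xs assume xs: "xs \<in> lists_of S (Suc (Suc j))"
      have "cobd h xs = cobd (homog G \<rho> (inhom j h)) xs"
        by (rule cobd_cong_lists_of[OF xs]) (simp add: homog_inhom[OF h(1)])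
      then show "homog G \<rho> f xs = homog G \<rho> (\<delta> j (inhom j h)) xs"
        using h(2) xs cobd_homog[OF xs] by (simp add: Suc)
    qed (use f coboundary_cochains in \<open>simp_all add: Suc\<close>)
    then show "f \<in> B k" using inhom_cochains by (auto simp: coboundaries_def Suc)
  qed
qed

lemma B_sub_Z: "f \<in> B k \<Longrightarrow> f \<in> Z k"
proof -
  assume "f \<in> B k"
  then have f: "f \<in> cochains \<S> k" and b: "bounds G \<rho> UNIV S (Suc k) (homog G \<rho> f)" by (simp_all add: B_iff)
  obtain h where h: "\<forall>xs\<in>lists_of S (Suc k). homog G \<rho> f xs = cobd h xs"
    using b unfolding bounds_def by auto
  have "cobd (homog G \<rho> f) xs = 0" if xs: "xs \<in> lists_of S (Suc (Suc k))" for xs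
  proof -
    have "cobd (homog G \<rho> f) xs = cobd (cobd h) xs"
      by (rule cobd_cong_lists_of[OF xs]) (use h in simp)
    then show ?thesis by (simp add: cobd_cobd)
  qed
  then show ?thesis using f by (simp add: Z_iff cocycle_def equivariant_homog)
qed

lemma homog_diff: "xs \<in> lists_of S k \<Longrightarrow> homog G \<rho> (\<lambda>xs. f xs - g xs) xs = homog G \<rho> f xs - homog G \<rho> g xs"
  by (cases xs) (auto simp: lists_of_def \<rho>_diff)

lemma coboundary_zero_iff: "f \<in> Z k \<longleftrightarrow> f \<in> cochains \<S> k \<and> (\<forall>gs\<in>lists_of S (Suc k). \<delta> k f gs = 0)"
  by (auto simp: cocycle_group_def fun_eq_iff coboundary_def tuples_iff)

lemma coboundary_add: "\<delta> k (\<lambda>xs. f xs + g xs) gs = \<delta> k f gs + \<delta> k g gs"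
proof (cases "gs \<in> lists_of S (Suc k)")
  case True
  then have "hd gs \<in> S" by (auto simp: lists_of_Suc_iff)
  moreover have "faces (\<otimes>) (\<lambda>xs. f xs + g xs) gs = faces (\<otimes>) f gs + faces (\<otimes>) g gs"
    by (induction "(\<otimes>)" f gs arbitrary: g rule: faces.induct) auto
  ultimately show ?thesis using True by (simp add: coboundary_faces \<rho>_add)
qed (simp add: coboundary_def tuples_iff)

lemma coboundary_scale: "\<delta> k (\<lambda>xs. s c (f xs)) gs = s c (\<delta> k f gs)"
proof (cases "gs \<in> lists_of S (Suc k)")
  case True
  then have "hd gs \<in> S" by (auto simp: lists_of_Suc_iff)
  moreover have "faces (\<otimes>) (\<lambda>xs. s c (f xs)) gs = s c (faces (\<otimes>) f gs)"
    by (induction "(\<otimes>)" f gs rule: faces.induct) (auto simp: scale_right_diff_distrib)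
  ultimately show ?thesis using True by (simp add: coboundary_faces \<rho>_scale scale_right_diff_distrib)
qed (simp add: coboundary_def tuples_iff)

lemma coboundary_of_zero: "\<delta> k (\<lambda>_. 0) = (\<lambda>_. 0)"
  using coboundary_scale[of k 0 "\<lambda>_. 0"] by (simp add: fun_eq_iff)

lemma cochains_add: "f \<in> cochains \<S> k \<Longrightarrow> g \<in> cochains \<S> k \<Longrightarrow> (\<lambda>xs. f xs + g xs) \<in> cochains \<S> k"
  by (simp add: cochains_def)

lemma cochains_scale: "f \<in> cochains \<S> k \<Longrightarrow> (\<lambda>xs. s c (f xs)) \<in> cochains \<S> k"
  by (simp add: cochains_def)

lemma Z_add: "f \<in> Z k \<Longrightarrow> g \<in> Z k \<Longrightarrow> (\<lambda>xs. f xs + g xs) \<in> Z k"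
  by (simp add: coboundary_zero_iff cochains_add coboundary_add)

lemma Z_scale: "f \<in> Z k \<Longrightarrow> (\<lambda>xs. s c (f xs)) \<in> Z k"
  by (simp add: coboundary_zero_iff cochains_scale coboundary_scale)

lemma B_add: "f \<in> B k \<Longrightarrow> g \<in> B k \<Longrightarrow> (\<lambda>xs. f xs + g xs) \<in> B k"
proof (cases k)
  case (Suc j)
  assume "f \<in> B k" "g \<in> B k"
  then obtain u v where uv: "u \<in> cochains \<S> j" "f = \<delta> j u" "v \<in> cochains \<S> j" "g = \<delta> j v"
    by (auto simp: coboundaries_def Suc)
  have "(\<lambda>xs. f xs + g xs) = \<delta> j (\<lambda>xs. u xs + v xs)"
    by (rule ext) (simp add: uv coboundary_add)
  then show ?thesis using cochains_add[OF uv(1,3)] by (simp add: coboundaries_def Suc)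
qed (simp add: coboundaries_def)

lemma B_scale: "f \<in> B k \<Longrightarrow> (\<lambda>xs. s c (f xs)) \<in> B k"
proof (cases k)
  case (Suc j)
  assume "f \<in> B k"
  then obtain u where u: "u \<in> cochains \<S> j" "f = \<delta> j u" by (auto simp: coboundaries_def Suc)
  have "(\<lambda>xs. s c (f xs)) = \<delta> j (\<lambda>xs. s c (u xs))" by (rule ext) (simp add: u coboundary_scale)
  then show ?thesis using cochains_scale[OF u(1)] by (simp add: coboundaries_def Suc)
qed (simp add: coboundaries_def)

lemma B_zero: "(\<lambda>_. 0) \<in> B k"
  by (cases k) (auto simp: coboundaries_def cochains_def intro!: image_eqI[where x = "\<lambda>_. 0"] coboundary_of_zero[symmetric])

lemma B_uminus: "f \<in> B k \<Longrightarrow> (\<lambda>xs. - f xs) \<in> B k"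
  using B_scale[of f k "- 1"] by simp

lemma B_diff: "f \<in> B k \<Longrightarrow> g \<in> B k \<Longrightarrow> (\<lambda>xs. f xs - g xs) \<in> B k"
  using B_add[of f k "\<lambda>xs. - g xs"] B_uminus by simp

lemma Z_diff: "f \<in> Z k \<Longrightarrow> g \<in> Z k \<Longrightarrow> (\<lambda>xs. f xs - g xs) \<in> Z k"
  using Z_add[of f k "\<lambda>xs. - g xs"] Z_scale[of g k "- 1"] by simp

section \<open>Cohomology classes as cosets of coboundaries\<close>

lemma mem_cls: "g \<in> cls k f \<longleftrightarrow> (\<lambda>xs. g xs - f xs) \<in> B k"
proof -
  have "g \<in> cls k f \<longleftrightarrow> (\<exists>b\<in>B k. g = (\<lambda>xs. b xs + f xs))"
    by (simp add: coh_class_def r_coset_def cocycle_group_def)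
  also have "\<dots> \<longleftrightarrow> (\<lambda>xs. g xs - f xs) \<in> B k"
  proof
    assume "(\<lambda>xs. g xs - f xs) \<in> B k"
    then show "\<exists>b\<in>B k. g = (\<lambda>xs. b xs + f xs)" by (rule bexI[rotated]) simp
  qed auto
  finally show ?thesis .
qed

lemma self_cls: "f \<in> cls k f"
  by (simp add: mem_cls B_zero)

lemma cls_eq_iff: "cls k f = cls k g \<longleftrightarrow> (\<lambda>xs. f xs - g xs) \<in> B k"
proof
  assume "cls k f = cls k g"
  then show "(\<lambda>xs. f xs - g xs) \<in> B k" using self_cls[of f k] by (simp add: mem_cls)
next
  assume fg: "(\<lambda>xs. f xs - g xs) \<in> B k"
  have "(\<lambda>xs. h xs - f xs) \<in> B k \<longleftrightarrow> (\<lambda>xs. h xs - g xs) \<in> B k" for h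
    using B_add[OF _ fg, of "\<lambda>xs. h xs - f xs"] B_diff[OF _ fg, of "\<lambda>xs. h xs - g xs"] by auto
  then show "cls k f = cls k g" by (auto simp: mem_cls)
qed

lemma carrier_cohomology: "carrier (cohomology \<S> s \<rho> k) = cls k ` Z k"
  by (auto simp: cohomology_def FactGroup_def RCOSETS_def coh_class_def)

lemma mult_cohomology: "cls k f \<otimes>\<^bsub>cohomology \<S> s \<rho> k\<^esub> cls k g = cls k (\<lambda>xs. f xs + g xs)"
proof (intro Set.set_eqI)
  fix h
  have "h \<in> cls k f \<otimes>\<^bsub>cohomology \<S> s \<rho> k\<^esub> cls k g \<longleftrightarrow>
      (\<exists>u\<in>cls k f. \<exists>v\<in>cls k g. h = (\<lambda>xs. u xs + v xs))"
    by (simp add: cohomology_def FactGroup_def set_mult_def cocycle_group_def)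
  also have "\<dots> \<longleftrightarrow> (\<lambda>xs. h xs - (f xs + g xs)) \<in> B k"
  proof
    assume "\<exists>u\<in>cls k f. \<exists>v\<in>cls k g. h = (\<lambda>xs. u xs + v xs)"
    then obtain u v where uv: "u \<in> cls k f" "v \<in> cls k g" "h = (\<lambda>xs. u xs + v xs)"
      by (elim bexE)
    show "(\<lambda>xs. h xs - (f xs + g xs)) \<in> B k"
      using B_add[OF uv(1,2)[unfolded mem_cls]] by (simp add: uv(3) add_diff_add)
  next
    assume "(\<lambda>xs. h xs - (f xs + g xs)) \<in> B k"
    then have "(\<lambda>xs. h xs - g xs) \<in> cls k f" by (simp add: mem_cls diff_diff_eq add.commute)
    then show "\<exists>u\<in>cls k f. \<exists>v\<in>cls k g. h = (\<lambda>xs. u xs + v xs)"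
      by (rule bexI[rotated]) (rule bexI[OF _ self_cls], simp)
  qed
  finally show "h \<in> cls k f \<otimes>\<^bsub>cohomology \<S> s \<rho> k\<^esub> cls k g \<longleftrightarrow> h \<in> cls k (\<lambda>xs. f xs + g xs)"
    by (simp add: mem_cls)
qed

lemma scale_cls: "coh_scale \<S> s \<rho> k c (cls k f) = cls k (\<lambda>xs. s c (f xs))"
proof -
  have "cls k (\<lambda>xs. s c (g xs)) = cls k (\<lambda>xs. s c (f xs))" if "g \<in> cls k f" for g
    unfolding cls_eq_iff using B_scale[of "\<lambda>xs. g xs - f xs" k c] that
    by (simp add: mem_cls scale_right_diff_distrib)
  then show ?thesis unfolding coh_scale_def using self_cls[of f k] by blast
qed

end

section \<open>Cup products\<close>

lemma vector_space_rat: "vector_space ((*) :: rat \<Rightarrow> rat \<Rightarrow> rat)"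
  by unfold_locales (simp_all add: algebra_simps)

lemma faces_additive: "Modules.additive A \<Longrightarrow> faces m (\<lambda>l. A (f l)) gs = A (faces m f gs)"
  by (induction m f gs rule: faces.induct) (auto simp: Modules.additive.zero Modules.additive.diff)

context cohomology_module
begin

text \<open>The faces of a product either merge neighbours within the first block followed by
  \<open>v\<close>, or belong to \<open>v\<close> followed by the second block. The subtracted term
  is the last face of the first factor, which is not a face of the product.\<close>

lemma faces_cup:
  "faces m (\<lambda>l. s (a (drop (length us) l)) (f (take (length us) l))) (us @ v # ws) =
    s (a ws) (faces m f (us @ [v]) - s ((-1) ^ length us) (f us)) + s ((-1) ^ length us * faces m a (v # ws)) (f us)"
proof (induction us arbitrary: f)
  case Nil
  have "Modules.additive (\<lambda>c. s c (f []))" by unfold_locales (rule scale_left_distrib)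
  from faces_additive[OF this] show ?case by simp
next
  case (Cons u us)
  show ?case
  proof (cases us)
    case Nil
    have "Modules.additive (\<lambda>c. s c (f [u]))" by unfold_locales (rule scale_left_distrib)
    from faces_additive[OF this] show ?thesis by (simp add: Nil)
  next
    case us: (Cons h us')
    have "faces m (\<lambda>l. s (a (drop (length us) l)) (f (u # take (length us) l))) (us @ v # ws) =
        s (a ws) (faces m (\<lambda>l. f (u # l)) (us @ [v]) - s ((-1) ^ length us) (f (u # us)))
        + s ((-1) ^ length us * faces m a (v # ws)) (f (u # us))"
      by (rule Cons.IH)
    then show ?thesis by (simp add: us scale_right_diff_distrib scale_right_distrib)
  qed
qed

definition cup_cochain :: "nat \<Rightarrow> ('g list \<Rightarrow> 'm) \<Rightarrow> ('g list \<Rightarrow> rat) \<Rightarrow> 'g list \<Rightarrow> 'm" where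
  "cup_cochain i f a = (\<lambda>xs. s (a (drop i xs)) (f (take i xs)))"

lemma trivial_module: "cohomology_module G (*) (trivial_action :: 'g \<Rightarrow> rat \<Rightarrow> rat) S"
  by (intro cohomology_module.intro cohomology_module_axioms.intro group_axioms vector_space_rat S) auto

abbreviation "Z\<^sub>Q \<equiv> \<lambda>k. carrier (cocycle_group \<S> (*) (trivial_action :: 'g \<Rightarrow> rat \<Rightarrow> rat) k)"
abbreviation "B\<^sub>Q \<equiv> coboundaries \<S> (*) (trivial_action :: 'g \<Rightarrow> rat \<Rightarrow> rat)"
abbreviation "\<delta>\<^sub>Q \<equiv> coboundary \<S> (*) (trivial_action :: 'g \<Rightarrow> rat \<Rightarrow> rat)"
abbreviation "cls\<^sub>Q \<equiv> coh_class \<S> (*) (trivial_action :: 'g \<Rightarrow> rat \<Rightarrow> rat)"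

text \<open>The Leibniz rule: the last face of the first factor cancels the first face of the
  second, because the action on the second factor is trivial.\<close>

lemma coboundary_cup:
  assumes gs: "gs \<in> lists_of S (Suc (i + j))"
  shows "\<delta> (i + j) (cup_cochain i f a) gs =
    s (a (drop (Suc i) gs)) (\<delta> i f (take (Suc i) gs)) + s ((-1) ^ i) (s (\<delta>\<^sub>Q j a (drop i gs)) (f (take i gs)))"
proof -
  interpret triv: cohomology_module G "(*)" "trivial_action :: 'g \<Rightarrow> rat \<Rightarrow> rat" S by (rule trivial_module)
  define us v ws where "us = take i gs" and "v = gs ! i" and "ws = drop (Suc i) gs"
  have len: "length gs = Suc (i + j)" "set gs \<subseteq> S" using gs by (auto simp: lists_of_def)
  have dec: "gs = us @ v # ws" unfolding us_def v_def ws_def using len by (intro id_take_nth_drop) simp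
  have lens: "length us = i" "length ws = j" using len by (auto simp: us_def ws_def)
  have t: "take (Suc i) gs = us @ [v]" "drop i gs = v # ws" using dec lens by simp_all
  have inS: "us @ [v] \<in> lists_of S (Suc i)" "v # ws \<in> lists_of S (Suc j)" "hd (us @ [v]) \<in> S"
    using dec len(2) lens by (cases us; auto simp: lists_of_def)+
  have tl: "hd gs = hd (us @ [v])" "take i (tl gs) = tl (us @ [v])" "drop i (tl gs) = ws"
    using dec lens by (cases us; auto)+
  have "\<delta> (i + j) (cup_cochain i f a) gs = \<rho> (hd gs) (cup_cochain i f a (tl gs)) - faces (\<otimes>) (cup_cochain i f a) gs"
    by (rule coboundary_faces[OF gs])
  also have "\<rho> (hd gs) (cup_cochain i f a (tl gs)) = s (a ws) (\<rho> (hd (us @ [v])) (f (tl (us @ [v]))))"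
    using inS(3) unfolding cup_cochain_def tl by (simp add: \<rho>_scale)
  also have "faces (\<otimes>) (cup_cochain i f a) gs =
      s (a ws) (faces (\<otimes>) f (us @ [v]) - s ((-1) ^ i) (f us)) + s ((-1) ^ i * faces (\<otimes>) a (v # ws)) (f us)"
    using faces_cup[of "(\<otimes>)" a us f v ws] unfolding cup_cochain_def by (simp add: lens flip: dec)
  finally show ?thesis
    unfolding t coboundary_faces[OF inS(1)] triv.coboundary_faces[OF inS(2)]
    by (simp add: us_def[symmetric] ws_def[symmetric] scale_right_diff_distrib scale_left_diff_distrib mult.commute
        right_diff_distrib)
qed

lemma cup_cochains:
  assumes "f \<in> cochains \<S> i" "a \<in> cochains \<S> j"
  shows "cup_cochain i f a \<in> cochains \<S> (i + j)"
proof (rule cochainsI)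
  interpret triv: cohomology_module G "(*)" "trivial_action :: 'g \<Rightarrow> rat \<Rightarrow> rat" S by (rule trivial_module)
  fix xs assume xs: "xs \<notin> lists_of S (i + j)"
  have "take i xs \<notin> lists_of S i \<or> drop i xs \<notin> lists_of S j"
  proof (rule ccontr)
    assume "\<not> ?thesis"
    then have "take i xs @ drop i xs \<in> lists_of S (i + j)" unfolding lists_of_def by (auto simp del: append_take_drop_id)
    then show False using xs by simp
  qed
  then show "cup_cochain i f a xs = 0"
    using cochainsD[OF assms(1)] triv.cochainsD[OF assms(2)] unfolding cup_cochain_def by auto
qed

lemma cup_zero: "cup_cochain i (\<lambda>_. 0) a = (\<lambda>_. 0)" "cup_cochain i f (\<lambda>_. 0) = (\<lambda>_. 0)"
  by (simp_all add: cup_cochain_def)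

lemma take_drop_lists_of:
  "gs \<in> lists_of S (i + j) \<Longrightarrow> take i gs \<in> lists_of S i \<and> drop i gs \<in> lists_of S j"
  by (auto simp: lists_of_def dest: in_set_takeD in_set_dropD)

lemma cup_Z:
  assumes f: "f \<in> Z i" and a: "a \<in> Z\<^sub>Q j"
  shows "cup_cochain i f a \<in> Z (i + j)"
proof -
  interpret triv: cohomology_module G "(*)" "trivial_action :: 'g \<Rightarrow> rat \<Rightarrow> rat" S by (rule trivial_module)
  have "\<delta> (i + j) (cup_cochain i f a) gs = 0" if gs: "gs \<in> lists_of S (Suc (i + j))" for gs
    using coboundary_cup[OF gs, of f a] take_drop_lists_of[of gs "Suc i" j] take_drop_lists_of[of gs i "Suc j"]
      gs f a unfolding coboundary_zero_iff triv.coboundary_zero_iff by simp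
  then show ?thesis
    using f a cup_cochains unfolding coboundary_zero_iff triv.coboundary_zero_iff by simp
qed

lemma cup_B_left:
  assumes f: "f \<in> B i" and a: "a \<in> Z\<^sub>Q j"
  shows "cup_cochain i f a \<in> B (i + j)"
proof (cases i)
  case 0
  then have "f = (\<lambda>_. 0)" using f by (simp add: coboundaries_def)
  then show ?thesis using B_zero by (simp add: cup_zero)
next
  case (Suc l)
  interpret triv: cohomology_module G "(*)" "trivial_action :: 'g \<Rightarrow> rat \<Rightarrow> rat" S by (rule trivial_module)
  obtain h where h: "h \<in> cochains \<S> l" "f = \<delta> l h" using f by (auto simp: coboundaries_def Suc)
  have a': "a \<in> cochains \<S> j" "\<And>gs. gs \<in> lists_of S (Suc j) \<Longrightarrow> \<delta>\<^sub>Q j a gs = 0"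
    using a by (simp_all add: triv.coboundary_zero_iff)
  have f': "f \<in> cochains \<S> (Suc l)" using h(2) coboundary_cochains by simp
  have "cup_cochain (Suc l) f a = \<delta> (l + j) (cup_cochain l h a)"
  proof
    fix gs show "cup_cochain (Suc l) f a gs = \<delta> (l + j) (cup_cochain l h a) gs"
    proof (cases "gs \<in> lists_of S (Suc (l + j))")
      case True
      show ?thesis
        using coboundary_cup[OF True, of h a] take_drop_lists_of[of gs l "Suc j"] True a'(2)
        by (simp add: cup_cochain_def h(2))
    next
      case False
      then show ?thesis
        using cochainsD[OF cup_cochains[OF f' a'(1)], of gs] by (simp add: coboundary_def tuples_iff)
    qed
  qed
  then show ?thesis using cup_cochains[OF h(1) a'(1)] by (simp add: coboundaries_def Suc)
qed

lemma cup_B_right: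
  assumes f: "f \<in> Z i" and a: "a \<in> B\<^sub>Q j"
  shows "cup_cochain i f a \<in> B (i + j)"
proof (cases j)
  case 0
  then have "a = (\<lambda>_. 0)" using a by (simp add: coboundaries_def)
  then show ?thesis using B_zero by (simp add: cup_zero)
next
  case (Suc l)
  interpret triv: cohomology_module G "(*)" "trivial_action :: 'g \<Rightarrow> rat \<Rightarrow> rat" S by (rule trivial_module)
  obtain b where b: "b \<in> cochains \<S> l" "a = \<delta>\<^sub>Q l b" using a by (auto simp: coboundaries_def Suc)
  have f': "f \<in> cochains \<S> i" "\<And>gs. gs \<in> lists_of S (Suc i) \<Longrightarrow> \<delta> i f gs = 0"
    using f by (simp_all add: coboundary_zero_iff)
  have a': "a \<in> cochains \<S> (Suc l)" using b(2) triv.coboundary_cochains by simp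
  \<comment> \<open>The sign cancels the one that the Leibniz rule puts in front of the second
    term.\<close>
  let ?u = "\<lambda>xs. s ((-1) ^ i) (cup_cochain i f b xs)"
  have "cup_cochain i f a = \<delta> (i + l) ?u"
  proof
    fix gs show "cup_cochain i f a gs = \<delta> (i + l) ?u gs"
    proof (cases "gs \<in> lists_of S (Suc (i + l))")
      case True
      have "\<delta> (i + l) (cup_cochain i f b) gs = s ((-1) ^ i) (s (\<delta>\<^sub>Q l b (drop i gs)) (f (take i gs)))"
        using coboundary_cup[OF True, of f b] take_drop_lists_of[of gs "Suc i" l] True f'(2) by simp
      moreover have "(-1 :: rat) ^ i * (-1) ^ i = 1" by (simp flip: power_mult_distrib)
      ultimately show ?thesis
        unfolding coboundary_scale by (simp add: cup_cochain_def b(2) mult.assoc[symmetric])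
    next
      case False
      then show ?thesis
        using cochainsD[OF cup_cochains[OF f'(1) a'], of gs] by (simp add: coboundary_def tuples_iff)
    qed
  qed
  then show ?thesis using cochains_scale[OF cup_cochains[OF f'(1) b(1)]] by (simp add: coboundaries_def Suc)
qed

lemma cup_cls:
  assumes f: "f \<in> Z i" and a: "a \<in> Z\<^sub>Q j"
  shows "cup \<S> s \<rho> i j (cls i f) (cls\<^sub>Q j a) = cls (i + j) (cup_cochain i f a)"
proof -
  interpret triv: cohomology_module G "(*)" "trivial_action :: 'g \<Rightarrow> rat \<Rightarrow> rat" S by (rule trivial_module)
  have "cls (i + j) (cup_cochain i g b) = cls (i + j) (cup_cochain i f a)"
    if g: "g \<in> cls i f" and b: "b \<in> cls\<^sub>Q j a" for g b
  proof -
    have gf: "(\<lambda>xs. g xs - f xs) \<in> B i" and ba: "(\<lambda>xs. b xs - a xs) \<in> B\<^sub>Q j"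
      using g b by (simp_all add: mem_cls triv.mem_cls)
    have bZ: "b \<in> Z\<^sub>Q j" using triv.Z_add[OF triv.B_sub_Z[OF ba] a] by simp
    have "(\<lambda>xs. cup_cochain i (\<lambda>xs. g xs - f xs) b xs + cup_cochain i f (\<lambda>xs. b xs - a xs) xs) \<in> B (i + j)"
      by (rule B_add[OF cup_B_left[OF gf bZ] cup_B_right[OF f ba]])
    then show ?thesis
      unfolding cls_eq_iff cup_cochain_def by (simp add: scale_left_diff_distrib scale_right_diff_distrib)
  qed
  then have eq: "coh_class \<S> s \<rho> (i + j) (\<lambda>xs. s (b (drop i xs)) (g (take i xs))) = cls (i + j) (cup_cochain i f a)"
    if "g \<in> cls i f" "b \<in> cls\<^sub>Q j a" for g b
    using that by (simp add: cup_cochain_def)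
  show ?thesis unfolding cup_def
  proof (intro equalityI UN_least subsetI)
    fix h assume "h \<in> cls (i + j) (cup_cochain i f a)"
    then have "h \<in> coh_class \<S> s \<rho> (i + j) (\<lambda>xs. s (a (drop i xs)) (f (take i xs)))"
      using eq[OF self_cls triv.self_cls] by simp
    then show "h \<in> (\<Union>f\<in>cls i f. \<Union>a\<in>cls\<^sub>Q j a. coh_class \<S> s \<rho> (i + j) (\<lambda>xs. s (a (drop i xs)) (f (take i xs))))"
      by (intro UN_I[OF self_cls] UN_I[OF triv.self_cls])
  qed (simp add: eq)
qed

end

section \<open>The cohomology ring of a subgroup\<close>

locale restriction_pair = S: cohomology_module G s \<rho> S + T: cohomology_module G s \<rho> T
  for G :: "('g, 'x) monoid_scheme" (structure) and s :: "rat \<Rightarrow> 'm \<Rightarrow> 'm::ab_group_add" and \<rho> S T +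
  assumes TS: "T \<subseteq> S" and iso: "restriction_iso G \<rho> UNIV S T"
begin

definition res :: "('g list \<Rightarrow> 'm) \<Rightarrow> 'g list \<Rightarrow> 'm" where
  "res f xs = (if set xs \<subseteq> T then f xs else 0)"

lemma homog_res: "xs \<in> lists_of T k \<Longrightarrow> homog G \<rho> (res f) xs = homog G \<rho> f xs"
proof (cases xs)
  case (Cons x ys)
  assume "xs \<in> lists_of T k"
  then have "diffs G x ys \<in> lists_of T (length ys)"
    using Cons by (intro T.diffs_in) (auto simp: lists_of_def)
  then show ?thesis by (simp add: Cons res_def lists_of_def)
qed simp

lemma res_cochains: "f \<in> cochains S.\<S> k \<Longrightarrow> res f \<in> cochains T.\<S> k"
  by (rule T.cochainsI) (use S.cochainsD[of f k] TS in \<open>auto simp: res_def lists_of_def\<close>)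

lemma res_Z: "f \<in> S.Z k \<Longrightarrow> res f \<in> T.Z k"
proof -
  assume f: "f \<in> S.Z k"
  have "cobd (homog G \<rho> (res f)) xs = 0" if xs: "xs \<in> lists_of T (Suc (Suc k))" for xs
  proof -
    have "cobd (homog G \<rho> (res f)) xs = cobd (homog G \<rho> f) xs"
      by (rule cobd_cong_lists_of[OF xs]) (simp add: homog_res)
    also have "\<dots> = 0" using f xs lists_of_mono[OF TS] by (auto simp: S.Z_iff cocycle_def)
    finally show ?thesis .
  qed
  then show ?thesis using f by (simp add: S.Z_iff T.Z_iff res_cochains cocycle_def T.equivariant_homog)
qed

lemma bounds_res_iff:
  "bounds G \<rho> UNIV T (Suc k) (homog G \<rho> (res f)) \<longleftrightarrow> bounds G \<rho> UNIV T (Suc k) (homog G \<rho> f)"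
  by (rule T.em.bounds_cong) (rule homog_res)

lemma res_B: "f \<in> S.B k \<Longrightarrow> res f \<in> T.B k"
  using bounds_mono[OF _ TS, of G \<rho> UNIV "Suc k" "homog G \<rho> f"] by (simp add: S.B_iff T.B_iff res_cochains bounds_res_iff)

lemma res_inj: "f \<in> S.Z k \<Longrightarrow> res f \<in> T.B k \<Longrightarrow> f \<in> S.B k"
  using iso by (simp add: restriction_iso_def S.Z_iff S.B_iff T.B_iff bounds_res_iff)

lemma res_surj:
  assumes g: "g \<in> T.Z k"
  shows "\<exists>f\<in>S.Z k. (\<lambda>xs. g xs - res f xs) \<in> T.B k"
proof -
  have gc: "g \<in> cochains T.\<S> k" "cocycle G \<rho> UNIV T (Suc k) (homog G \<rho> g)" using g by (simp_all add: T.Z_iff)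
  then obtain F where F: "cocycle G \<rho> UNIV S (Suc k) F"
    "bounds G \<rho> UNIV T (Suc k) (\<lambda>xs. homog G \<rho> g xs - F xs)"
    using iso unfolding restriction_iso_def by blast
  let ?f = "S.inhom k F"
  have F_eq: "homog G \<rho> ?f xs = F xs" if "xs \<in> lists_of S (Suc k)" for xs
    by (rule S.homog_inhom[OF conjunct1[OF F(1)[unfolded cocycle_def]] that])
  have "cobd (homog G \<rho> ?f) xs = cobd F xs" if "xs \<in> lists_of S (Suc (Suc k))" for xs
    by (rule cobd_cong_lists_of[OF that]) (simp add: F_eq)
  then have fZ: "?f \<in> S.Z k"
    using F(1) S.inhom_cochains by (simp add: S.Z_iff cocycle_def S.equivariant_homog)
  have "homog G \<rho> (\<lambda>xs. g xs - res ?f xs) xs = homog G \<rho> g xs - F xs" if xs: "xs \<in> lists_of T (Suc k)" for xs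
    using T.homog_diff[OF xs] homog_res[OF xs] F_eq[OF subsetD[OF lists_of_mono[OF TS] xs]] by simp
  then have "bounds G \<rho> UNIV T (Suc k) (\<lambda>xs. homog G \<rho> (\<lambda>xs. g xs - res ?f xs) xs)"
    by (rule iffD2[OF T.em.bounds_cong F(2)])
  moreover have "(\<lambda>xs. g xs - res ?f xs) \<in> cochains T.\<S> k"
    using gc(1) res_cochains[OF S.inhom_cochains] by (simp add: cochains_def)
  ultimately have "(\<lambda>xs. g xs - res ?f xs) \<in> T.B k" by (simp add: T.B_iff)
  then show ?thesis by (rule bexI[OF _ fZ])
qed

text \<open>The inverse of restriction without a choice: all cocycles over S that restrict into the
  class. Surjectivity of restriction makes this set nonempty, injectivity makes it a single
  class.\<close>

definition \<Psi> :: "nat \<Rightarrow> ('g list \<Rightarrow> 'm) set \<Rightarrow> ('g list \<Rightarrow> 'm) set" where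
  "\<Psi> k x = {f \<in> S.Z k. res f \<in> x}"

lemma res_diff: "res (\<lambda>xs. f xs - g xs) = (\<lambda>xs. res f xs - res g xs)"
  by (rule ext) (simp add: res_def)

lemma res_add: "res (\<lambda>xs. f xs + g xs) = (\<lambda>xs. res f xs + res g xs)"
  by (rule ext) (simp add: res_def)

lemma res_scale: "res (\<lambda>xs. s c (f xs)) = (\<lambda>xs. s c (res f xs))"
  by (rule ext) (simp add: res_def)

lemma \<Psi>_cls: "f \<in> S.Z k \<Longrightarrow> \<Psi> k (T.cls k (res f)) = S.cls k f"
proof (intro Set.set_eqI iffI)
  fix g assume f: "f \<in> S.Z k"
  {
    assume "g \<in> \<Psi> k (T.cls k (res f))"
    then have g: "g \<in> S.Z k" "res (\<lambda>xs. g xs - f xs) \<in> T.B k" by (simp_all add: \<Psi>_def T.mem_cls res_diff)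
    show "g \<in> S.cls k f" unfolding S.mem_cls by (rule res_inj[OF S.Z_diff[OF g(1) f] g(2)])
  }
  assume "g \<in> S.cls k f"
  then have gf: "(\<lambda>xs. g xs - f xs) \<in> S.B k" by (simp add: S.mem_cls)
  have "g \<in> S.Z k" using S.Z_add[OF S.B_sub_Z[OF gf] f] by simp
  then show "g \<in> \<Psi> k (T.cls k (res f))" using res_B[OF gf] by (simp add: \<Psi>_def T.mem_cls res_diff)
qed

lemma class_cases:
  assumes "x \<in> carrier (cohomology T.\<S> s \<rho> k)"
  obtains f where "f \<in> S.Z k" "x = T.cls k (res f)"
proof -
  obtain g where g: "g \<in> T.Z k" "x = T.cls k g" using assms unfolding T.carrier_cohomology by blast
  obtain f where f: "f \<in> S.Z k" "(\<lambda>xs. g xs - res f xs) \<in> T.B k" using res_surj[OF g(1)] by blast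
  show thesis by (rule that[OF f(1)]) (use f(2) in \<open>simp add: g(2) T.cls_eq_iff\<close>)
qed

lemma graded_linear_iso: "graded_linear_iso T.\<S> S.\<S> s \<rho> \<rho> \<Psi>"
  unfolding graded_linear_iso_def
proof (intro allI conjI ballI)
  fix k
  have "bij_betw (\<Psi> k) (carrier (cohomology T.\<S> s \<rho> k)) (carrier (cohomology S.\<S> s \<rho> k))"
  proof (rule bij_betw_imageI)
    show "inj_on (\<Psi> k) (carrier (cohomology T.\<S> s \<rho> k))"
    proof (rule inj_onI)
      fix x y
      assume x: "x \<in> carrier (cohomology T.\<S> s \<rho> k)" and y: "y \<in> carrier (cohomology T.\<S> s \<rho> k)"
        and eq: "\<Psi> k x = \<Psi> k y"
      obtain f where f: "f \<in> S.Z k" "x = T.cls k (res f)" using class_cases[OF x] .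
      obtain g where g: "g \<in> S.Z k" "y = T.cls k (res g)" using class_cases[OF y] .
      have "(\<lambda>xs. f xs - g xs) \<in> S.B k" using eq by (simp add: f g \<Psi>_cls S.cls_eq_iff)
      from res_B[OF this] show "x = y" by (simp add: f(2) g(2) T.cls_eq_iff res_diff)
    qed
    show "\<Psi> k ` carrier (cohomology T.\<S> s \<rho> k) = carrier (cohomology S.\<S> s \<rho> k)"
    proof (intro equalityI subsetI)
      fix y assume "y \<in> \<Psi> k ` carrier (cohomology T.\<S> s \<rho> k)"
      then obtain x where x: "x \<in> carrier (cohomology T.\<S> s \<rho> k)" "y = \<Psi> k x" by blast
      obtain f where "f \<in> S.Z k" "x = T.cls k (res f)" using class_cases[OF x(1)] .
      then show "y \<in> carrier (cohomology S.\<S> s \<rho> k)" by (simp add: x(2) \<Psi>_cls S.carrier_cohomology)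
    next
      fix y assume "y \<in> carrier (cohomology S.\<S> s \<rho> k)"
      then obtain f where f: "f \<in> S.Z k" "y = S.cls k f" unfolding S.carrier_cohomology by blast
      have "T.cls k (res f) \<in> carrier (cohomology T.\<S> s \<rho> k)" using res_Z[OF f(1)] by (simp add: T.carrier_cohomology)
      then show "y \<in> \<Psi> k ` carrier (cohomology T.\<S> s \<rho> k)"
        using \<Psi>_cls[OF f(1)] f(2) by (intro image_eqI[where x = "T.cls k (res f)"]) simp_all
    qed
  qed
  moreover have "\<Psi> k (x \<otimes>\<^bsub>cohomology T.\<S> s \<rho> k\<^esub> y) = \<Psi> k x \<otimes>\<^bsub>cohomology S.\<S> s \<rho> k\<^esub> \<Psi> k y"
    if x: "x \<in> carrier (cohomology T.\<S> s \<rho> k)" and y: "y \<in> carrier (cohomology T.\<S> s \<rho> k)" for x y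
  proof -
    obtain f where f: "f \<in> S.Z k" "x = T.cls k (res f)" using class_cases[OF x] .
    obtain g where g: "g \<in> S.Z k" "y = T.cls k (res g)" using class_cases[OF y] .
    show ?thesis
      using \<Psi>_cls[OF S.Z_add[OF f(1) g(1)]] f g
      by (simp add: T.mult_cohomology S.mult_cohomology \<Psi>_cls res_add)
  qed
  ultimately show "\<Psi> k \<in> Group.iso (cohomology T.\<S> s \<rho> k) (cohomology S.\<S> s \<rho> k)"
    by (auto simp: Group.iso_def hom_def bij_betw_def)
  fix c x assume x: "x \<in> carrier (cohomology T.\<S> s \<rho> k)"
  obtain f where f: "f \<in> S.Z k" "x = T.cls k (res f)" using class_cases[OF x] .
  show "\<Psi> k (coh_scale T.\<S> s \<rho> k c x) = coh_scale S.\<S> s \<rho> k c (\<Psi> k x)"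
    using \<Psi>_cls[OF S.Z_scale[OF f(1)]] f by (simp add: T.scale_cls S.scale_cls \<Psi>_cls res_scale)
qed

end

text \<open>Restriction commutes with the cup product already on cochains, including the values 0
  outside T, since a list lies in T exactly when both of its pieces do. The inverse inherits
  this.\<close>

lemma \<Psi>_cup:
  fixes s :: "rat \<Rightarrow> 'm \<Rightarrow> 'm::ab_group_add"
  assumes M: "restriction_pair G s \<rho> S T" and Q: "restriction_pair G (*) trivial_action S T"
    and x: "x \<in> carrier (cohomology (G\<lparr>carrier := T\<rparr>) s \<rho> i)"
    and y: "y \<in> carrier (cohomology (G\<lparr>carrier := T\<rparr>) (*) trivial_action j)"
  shows "restriction_pair.\<Psi> G s \<rho> S T (i + j) (cup (G\<lparr>carrier := T\<rparr>) s \<rho> i j x y) =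
    cup (G\<lparr>carrier := S\<rparr>) s \<rho> i j (restriction_pair.\<Psi> G s \<rho> S T i x)
      (restriction_pair.\<Psi> G (*) trivial_action S T j y)"
proof -
  interpret M: restriction_pair G s \<rho> S T by (rule M)
  interpret Q: restriction_pair G "(*)" "trivial_action :: _ \<Rightarrow> rat \<Rightarrow> rat" S T by (rule Q)
  obtain f where f: "f \<in> M.S.Z i" "x = M.T.cls i (M.res f)" using M.class_cases[OF x] .
  obtain a where a: "a \<in> Q.S.Z j" "y = Q.T.cls j (Q.res a)" using Q.class_cases[OF y] .
  have "M.T.cup_cochain i (M.res f) (Q.res a) = M.res (M.S.cup_cochain i f a)"
  proof
    fix xs
    have "set xs \<subseteq> T \<longleftrightarrow> set (take i xs) \<subseteq> T \<and> set (drop i xs) \<subseteq> T"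
      by (metis Un_subset_iff append_take_drop_id set_append)
    then show "M.T.cup_cochain i (M.res f) (Q.res a) xs = M.res (M.S.cup_cochain i f a) xs"
      by (auto simp: M.T.cup_cochain_def M.S.cup_cochain_def M.res_def Q.res_def)
  qed
  then show ?thesis
    using M.T.cup_cls[OF M.res_Z[OF f(1)] Q.res_Z[OF a(1)]] M.S.cup_cls[OF f(1) a(1)]
      M.\<Psi>_cls[OF M.S.cup_Z[OF f(1) a(1)]] M.\<Psi>_cls[OF f(1)] Q.\<Psi>_cls[OF a(1)]
    by (simp add: f(2) a(2))
qed

theorem isomorphic_as_cohomology_rings_of_restriction:
  fixes s :: "rat \<Rightarrow> 'm \<Rightarrow> 'm::ab_group_add"
  assumes M: "restriction_pair G s \<rho> S T" and Q: "restriction_pair G (*) trivial_action S T"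
  shows "isomorphic_as_cohomology_rings (G\<lparr>carrier := T\<rparr>) (G\<lparr>carrier := S\<rparr>) s \<rho> \<rho>"
proof -
  interpret M: restriction_pair G s \<rho> S T by (rule M)
  interpret Q: restriction_pair G "(*)" "trivial_action :: _ \<Rightarrow> rat \<Rightarrow> rat" S T by (rule Q)
  let ?u = "\<lambda>xs :: 'a list. if xs = [] then 1 else 0 :: rat"
  have "?u \<in> cochains Q.S.\<S> 0" by (rule Q.S.cochainsI) (auto simp: lists_of_def)
  moreover have "Q.S.\<delta> 0 ?u gs = 0" if "gs \<in> lists_of S (Suc 0)" for gs
    using Q.S.coboundary_faces[OF that, of ?u] that by (cases gs) (auto simp: lists_of_def)
  ultimately have "?u \<in> Q.S.Z 0" unfolding Q.S.coboundary_zero_iff by blast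
  moreover have "Q.res ?u = ?u" by (rule ext) (simp add: Q.res_def)
  ultimately have "Q.\<Psi> 0 (coh_unit (G\<lparr>carrier := T\<rparr>)) = coh_unit (G\<lparr>carrier := S\<rparr>)"
    using Q.\<Psi>_cls[of ?u 0] by (simp add: coh_unit_def)
  then show ?thesis
    unfolding isomorphic_as_cohomology_rings_def
    using M.graded_linear_iso Q.graded_linear_iso \<Psi>_cup[OF M Q] \<Psi>_cup[OF Q Q]
    by (intro exI[of _ M.\<Psi>] exI[of _ Q.\<Psi>] conjI ballI allI)
qed

section \<open>Rational modules\<close>

text \<open>Any rational functional with value 1 at 1. It is not multiplicative, but it commutes
  with rational scalars, which is all that rational matrices require.\<close>

lemma exists_rational_retraction:
  "\<exists>L. Vector_Spaces.linear (\<lambda>(q::rat) (z::complex). of_rat q * z) (*) L \<and> (\<forall>q. L (of_rat q) = q)"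
proof -
  have "rat_vs.subspace {0 :: complex}" by (rule rat_vs.subspace_single_0)
  from rat_vs.exists_functional[OF this, of 1]
  obtain L :: "complex \<Rightarrow> rat" where L: "Vector_Spaces.linear (\<lambda>q z. of_rat q * z) (*) L" "L 1 = 1"
    by auto
  interpret L: Vector_Spaces.linear "\<lambda>(q::rat) (z::complex). of_rat q * z" "(*)" L by (rule L(1))
  have "L (of_rat q) = q" for q using L.scale[of q 1] L(2) by simp
  with L(1) show ?thesis by (intro exI conjI allI)
qed

text \<open>Makes the coefficient ring an instance of the module case, so one theorem supplies both
  isomorphisms.\<close>

lemma rational_module_trivial: "rational_module G (*) (trivial_action :: complex^'n^'n \<Rightarrow> rat \<Rightarrow> rat)"
proof -
  have ind: "\<not> vector_space_over_itself.dependent {1 :: rat}" using vector_space_over_itself.dependent_single[of 1] by simp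
  have span: "vector_space_over_itself.span {1 :: rat} = UNIV"
    using vector_space_over_itself.span_singleton[of 1] by auto
  have fd: "finite_dimensional_vector_space (*) {1 :: rat}"
    by (intro finite_dimensional_vector_space.intro vector_space_rat
        finite_dimensional_vector_space_axioms.intro ind span) simp
  have rep: "vector_space_over_itself.representation {1 :: rat} 1 1 = 1"
    using vector_space_over_itself.representation_basis[OF ind, of 1] by simp
  have lin: "Vector_Spaces.linear (*) (*) (\<lambda>q::rat. q)" by (rule vector_space_over_itself.linear_ident)
  have one: "(\<lambda>g :: complex^'n^'n. 1 :: complex) \<in> regular_GL \<rat>"
    unfolding regular_GL_def by (rule alg_gen.const) simp
  show ?thesis unfolding rational_module_def
    by (intro exI[of _ "{1}"] exI[of _ "\<lambda>_ _ _. 1"] conjI fd) (use one rep lin in simp_all)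
qed

context dense_rational_group
begin

theorem restriction_pair_rational_module:
  fixes s :: "rat \<Rightarrow> 'm \<Rightarrow> 'm::ab_group_add"
  assumes M: "rational_module G s \<rho>"
    and \<Delta>: "subgroup \<Delta> (GL_sub \<Gamma>)" "finite (rcosets\<^bsub>GL_sub \<Gamma>\<^esub> \<Delta>)"
  shows "restriction_pair GL s \<rho> \<Gamma> \<Delta>"
proof -
  obtain B R where fd: "finite_dimensional_vector_space s B"
    and R: "\<forall>b\<in>B. \<forall>c\<in>B. (\<lambda>g. R g b c) \<in> regular_GL \<rat>"
      "\<forall>b\<in>B. \<forall>c\<in>B. R (mat 1) b c = (if b = c then 1 else 0)"
      "\<forall>g\<in>G. \<forall>h\<in>G. \<forall>b\<in>B. \<forall>c\<in>B. R (g ** h) b c = (\<Sum>d\<in>B. R g b d * R h d c)"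
    and \<rho>: "\<forall>g\<in>rational_points G. Vector_Spaces.linear s s (\<rho> g) \<and>
      (\<forall>b\<in>B. \<forall>c\<in>B. R g b c = of_rat (module.representation s B (\<rho> g c) b))"
    using M unfolding rational_module_def by (elim exE conjE)
  interpret fd: finite_dimensional_vector_space s B by (rule fd)
  interpret rep: regular_rep G B R
  proof (rule regular_rep.intro[OF G fd.finite_Basis])
    show "(\<lambda>g. R g b c) \<in> regular" if "b \<in> B" "c \<in> B" for b c
      by (rule subsetD[OF regular_GL_mono]) (use R(1) that in blast)
  qed (use R in auto)
  have rat: "g \<in> rational_points G" if "g \<in> \<Gamma>" for g
    using that \<Gamma>G \<Gamma>_rat by (auto simp: rational_points_def)
  have lin: "Vector_Spaces.linear s s (\<rho> g)" if "g \<in> \<Gamma>" for g using \<rho> rat[OF that] by blast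
  let ?rep = "fd.representation B"
  have R_rep: "R g b c = of_rat (?rep (\<rho> g c) b)" if "g \<in> \<Gamma>" "b \<in> B" "c \<in> B" for g b c
    using \<rho> rat[OF that(1)] that by blast
  have rep_add: "?rep (u + v) b = ?rep u b + ?rep v b" for u v b
    by (simp add: fd.representation_add[OF fd.independent_Basis] fd.span_Basis)
  have rep_scale: "?rep (s c v) b = c * ?rep v b" for c v b
    by (simp add: fd.representation_scale[OF fd.independent_Basis] fd.span_Basis)
  have rep_lin: "Vector_Spaces.linear s (*) (\<lambda>v. ?rep v b)" for b
    by unfold_locales (simp_all add: rep_add rep_scale algebra_simps)
  have expand: "(\<Sum>b\<in>B. s (?rep m b) b) = m" for m
    using fd.sum_representation_eq[OF fd.independent_Basis, of m B] fd.finite_Basis by (simp add: fd.span_Basis)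
  have \<rho>_expand: "\<rho> g m = (\<Sum>c\<in>B. s (?rep m c) (\<rho> g c))" if g: "g \<in> \<Gamma>" for g m
  proof -
    interpret l: Vector_Spaces.linear s s "\<rho> g" by (rule lin[OF g])
    have "\<rho> g m = \<rho> g (\<Sum>c\<in>B. s (?rep m c) c)" by (simp only: expand)
    then show ?thesis by (simp add: l.sum l.scale)
  qed
  obtain L :: "complex \<Rightarrow> rat" where L: "Vector_Spaces.linear (\<lambda>(q::rat) (z::complex). of_rat q * z) (*) L"
    "\<forall>q. L (of_rat q) = q" using exists_rational_retraction by blast
  interpret L: Vector_Spaces.linear "\<lambda>(q::rat) (z::complex). of_rat q * z" "(*)" L by (rule L(1))
  \<comment> \<open>Coordinates embed the rational module into the complex one, and the retraction
    applied to each coordinate leads back; both maps commute with \<Gamma> because its matrices in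
    this basis are rational.\<close>
  define \<iota> where "\<iota> m b = (if b \<in> B then of_rat (?rep m b) else 0 :: complex)" for m b
  define \<pi> where "\<pi> v = (\<Sum>b\<in>B. s (L (v b)) b)" for v
  have \<iota>_add: "Modules.additive \<iota>"
    by unfold_locales (auto simp: \<iota>_def fun_eq_iff rep_add of_rat_add)
  have \<iota>_supp: "\<iota> m \<in> supported B" for m by (simp add: supported_def \<iota>_def)
  have \<pi>_add: "Modules.additive \<pi>"
    by unfold_locales (simp add: \<pi>_def L.add fd.scale_left_distrib sum.distrib)
  have \<pi>\<iota>: "\<pi> (\<iota> m) = m" for m
  proof -
    have "\<pi> (\<iota> m) = (\<Sum>b\<in>B. s (?rep m b) b)" unfolding \<pi>_def \<iota>_def using L(2) by (intro sum.cong) auto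
    then show ?thesis by (simp only: expand)
  qed
  have \<iota>\<rho>: "\<iota> (\<rho> g m) = rep.act g (\<iota> m)" if g: "g \<in> \<Gamma>" for g m
  proof
    fix b
    interpret r: Vector_Spaces.linear s "(*)" "\<lambda>v. ?rep v b" by (rule rep_lin)
    have "?rep (\<rho> g m) b = (\<Sum>c\<in>B. ?rep m c * ?rep (\<rho> g c) b)"
      unfolding \<rho>_expand[OF g, of m] by (simp add: r.sum r.scale)
    then show "\<iota> (\<rho> g m) b = rep.act g (\<iota> m) b"
      by (simp add: \<iota>_def matrix_action_def of_rat_sum of_rat_mult R_rep[OF g] mult.commute)
  qed
  have \<pi>\<rho>: "\<pi> (rep.act g v) = \<rho> g (\<pi> v)" if g: "g \<in> \<Gamma>" for g v
  proof -
    interpret l: Vector_Spaces.linear s s "\<rho> g" by (rule lin[OF g])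
    have "\<pi> (rep.act g v) = (\<Sum>b\<in>B. s (\<Sum>c\<in>B. ?rep (\<rho> g c) b * L (v c)) b)"
      unfolding \<pi>_def matrix_action_def by (intro sum.cong refl) (simp add: R_rep[OF g] L.sum L.scale)
    also have "\<dots> = (\<Sum>b\<in>B. \<Sum>c\<in>B. s (L (v c)) (s (?rep (\<rho> g c) b) b))"
      by (simp add: fd.scale_sum_left mult.commute)
    also have "\<dots> = (\<Sum>c\<in>B. \<Sum>b\<in>B. s (L (v c)) (s (?rep (\<rho> g c) b) b))" by (rule sum.swap)
    also have "\<dots> = (\<Sum>c\<in>B. s (L (v c)) (\<rho> g c))"
      by (simp only: expand flip: fd.scale_sum_right)
    also have "\<dots> = \<rho> g (\<pi> v)" by (simp add: \<pi>_def l.sum l.scale)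
    finally show ?thesis .
  qed
  \<comment> \<open>The module laws of \<rho> are transported through this injection from the matrix
    coefficients, where the homomorphism property is given.\<close>
  have \<iota>_inj: "\<iota> u = \<iota> v \<Longrightarrow> u = v" for u v using \<pi>\<iota> by metis
  have closed: "mat 1 \<in> \<Gamma>" "\<And>g h. g \<in> \<Gamma> \<Longrightarrow> h \<in> \<Gamma> \<Longrightarrow> g ** h \<in> \<Gamma>"
    using subgroup.one_closed[OF \<Gamma>] subgroup.m_closed[OF \<Gamma>] by auto
  have \<rho>_one: "\<rho> (mat 1) m = m" for m
    by (rule \<iota>_inj) (simp add: \<iota>\<rho>[OF closed(1)] rep.act_one[OF \<iota>_supp])
  have \<rho>_mult: "\<rho> (g ** h) m = \<rho> g (\<rho> h m)" if "g \<in> \<Gamma>" "h \<in> \<Gamma>" for g h m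
    by (rule \<iota>_inj) (use that \<Gamma>G closed in \<open>simp add: \<iota>\<rho> rep.act_mult subset_iff\<close>)
  have module: "cohomology_module GL s \<rho> S" if "subgroup S GL" "S \<subseteq> \<Gamma>" for S
  proof (intro cohomology_module.intro group_GL fd.vector_space_axioms cohomology_module_axioms.intro that(1))
    fix g u v c assume "g \<in> S"
    then have g: "g \<in> \<Gamma>" using that by blast
    interpret l: Vector_Spaces.linear s s "\<rho> g" by (rule lin[OF g])
    show "\<rho> g (u + v) = \<rho> g u + \<rho> g v" by (rule l.add)
    show "\<rho> g (s c v) = s c (\<rho> g v)" by (rule l.scale)
    show "\<rho> (g \<otimes>\<^bsub>GL\<^esub> h) v = \<rho> g (\<rho> h v)" if "h \<in> S" for h
      using \<rho>_mult[OF g, of h] that \<open>S \<subseteq> \<Gamma>\<close> by auto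
  qed (simp add: \<rho>_one)
  have \<Delta>': "subgroup \<Delta> GL" "\<Delta> \<subseteq> \<Gamma>"
    using group.incl_subgroup[OF group_GL \<Gamma> \<Delta>(1)] subgroup.subset[OF \<Delta>(1)] by auto
  show ?thesis
  proof (intro restriction_pair.intro module \<Gamma> subset_refl \<Delta>' restriction_pair_axioms.intro)
    show "restriction_iso GL \<rho> UNIV \<Gamma> \<Delta>"
      by (rule restriction_iso_retract[OF \<iota>_add \<iota>_supp \<iota>\<rho> \<pi>_add \<pi>\<rho> \<pi>\<iota> \<Delta>'(2)
            restriction_iso_finite_index[OF \<Delta> rep.regular_rep_axioms]])
  qed
qed

end

theorem corollary1p3:
  fixes G U T \<Gamma> \<Delta> :: "(complex^'n^'n) set"
    and s :: "rat \<Rightarrow> 'm \<Rightarrow> 'm::ab_group_add"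
    and \<rho> :: "complex^'n^'n \<Rightarrow> 'm \<Rightarrow> 'm"
  assumes "algebraic_group \<rat> G" and "connectedin zariski G" and "solvable (GL_sub G)"
    and "unipotent_radical U G" and "defined_over \<rat> U"
    and "maximal_torus T G" and "split_torus \<rat> T"
    and "U <#>\<^bsub>GL\<^esub> T = G" and "U \<inter> T = {mat 1}"
    and "subgroup \<Gamma> GL" and "\<Gamma> \<subseteq> rational_points G" and "zariski closure_of \<Gamma> = G"
    and "discrete (\<Gamma> \<inter> rational_points T)"
    and "rational_module G s \<rho>"
    and "subgroup \<Delta> (GL_sub \<Gamma>)" and "finite (rcosets\<^bsub>GL_sub \<Gamma>\<^esub> \<Delta>)"
  shows "isomorphic_as_cohomology_rings (GL_sub \<Delta>) (GL_sub \<Gamma>) s \<rho> \<rho>"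
proof -
  interpret GL: group GL by (rule group_GL)
  have G: "subgroup G GL" using assms(1) by (simp add: algebraic_group_def)
  have con: "reg_connected G"
    by (rule connectedin_zariski_imp_reg_connected[OF assms(2)]) (use subgroup.mem_carrier[OF G] in auto)
  have "\<exists>n. (derived GL ^^ n) G = {mat 1}"
    using group.solvable_imp_trivial_derived_seq[OF GL.subgroup_imp_group[OF G], of G] assms(3)
      GL.exp_of_derived_consistent[OF G] by (simp add: solvable_def)
  then obtain n where solv: "(derived GL ^^ n) G = {mat 1}" ..
  have "\<exists>N k a. triangular_coords G N k a" by (rule exists_triangular_coords[OF G con solv])
  then obtain N k a where tc: "triangular_coords G N k a" by (elim exE)
  have U: "u \<in> G \<and> unipotent u" if "u \<in> U" for u
    using assms(4) that subgroup.mem_carrier[OF normal_imp_subgroup, of U "GL_sub G" u]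
    by (auto simp: unipotent_radical_def connected_normal_unipotent_def)
  have T: "subgroup T GL" "T \<subseteq> G"
    using assms(6,7) by (auto simp: split_torus_def algebraic_group_def maximal_torus_def)
  have UT: "\<exists>u\<in>U. \<exists>t\<in>T. g = u ** t" if "g \<in> G" for g
    using that assms(8) by (auto simp: set_mult_def)
  obtain r \<phi> where \<phi>: "\<phi> \<in> iso (GL_sub T) (Gm_power r)"
    and "\<forall>i j. \<exists>q\<in>regular_Gm \<rat> r. \<forall>x\<in>carrier (Gm_power r). inv_into T \<phi> x $ i $ j = q x"
    using assms(7) unfolding split_torus_def by blast
  then have reg: "\<exists>q\<in>regular_Gm \<rat> r. \<forall>x\<in>carrier (Gm_power r). inv_into T \<phi> x $ i $ j = q x" for i j
    by blast
  have rat: "g \<in> G" "g $ p $ q \<in> \<rat>" if "g \<in> \<Gamma>" for g p q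
    using assms(11) that by (auto simp: rational_points_def)
  \<comment> \<open>Splitness over the rationals enters through \<open>reg\<close>: the inverse
    parametrisation of the torus has rational Laurent polynomials as entries.\<close>
  have diag: "a i i g \<in> \<rat>" if "g \<in> \<Gamma>" "i < N" for g i
    using triangular_coords.diag_rational[OF tc G U T UT \<phi> reg rat(1)[OF that(1)] rat(2)[OF that(1)] that(2)] .
  have "dense_rational_group G N k a \<Gamma> n"
    by (intro dense_rational_group.intro tc dense_rational_group_axioms.intro G con solv assms(10) rat(2) diag)
      (use rat(1) assms(12) in auto)
  then interpret dense_rational_group G N k a \<Gamma> n .
  show ?thesis
    by (rule isomorphic_as_cohomology_rings_of_restriction)
      (rule restriction_pair_rational_module assms(14-16) rational_module_trivial)+
qed

end
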